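(* Let $G$ be a compact Lie group. Suppose that for every real separable Hilbert space $H$ (of finite or infinite dimension) equipped with an orthogonal action of $G$ we are given a map $$\mu=\mu_H\colon \Omega\bigl(\mathcal{FS}(H)^G,\operatorname{GL}(H)\cap\mathcal{FS}(H)^G\bigr)\to \mathrm{RO}(G).$$ Assume that this family of maps satisfies the following four properties, for all such $H$: $(\mathcal{Z}_G)$ If $L=\{L_\lambda\}_{\lambda\in I}$ is a path with $L_\lambda\in\operatorname{GL}(H)\cap\mathcal{FS}(H)^G$ for all $\lambda\in I$, then $\mu(L)=0\in\mathrm{RO}(G)$. $(\mathcal{A}_G)$ If $H=H_1\oplus H_2$ (orthogonal direct sum of closed subspaces) with $H_1,H_2$ $G$-invariant, and $L=\{L_\lambda\}_{\lambda\in I}$ is a path in $\mathcal{FS}(H)^G$ with invertible endpoints such that $L_\lambda(H_i)\subset H_i$ for $i=1,2$ and all $\lambda\in I$, then $\mu(L)=\mu(L|_{H_1})+\mu(L|_{H_2})\in\mathrm{RO}(G)$. $(\mathcal{H}_G)$ If $h\colon I\times I\to\mathcal{FS}(H)^G$ is continuous and $h(s,0)$, $h(s,1)$ are invertible for all $s\in I$, then $\mu(h(0,\cdot))=\mu(h(1,\cdot))\in\mathrm{RO}(G)$. $(\mathcal{M}_G)$ If $\dim H<\infty$ and $L=\{L_\lambda\}_{\lambda\in I}$ is a path in $\mathcal{FS}(H)^G$ with invertible endpoints, then $\mu(L)=[E^-(L_0)]-[E^-(L_1)]\in\mathrm{RO}(G)$, where $E^-(T)$ denotes the direct sum of the eigenspaces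 of the selfadjoint operator $T$ for negative eigenvalues. Then $\mu=\mathrm{sf}_G$, i.e. $\mu_H(L)=\mathrm{sf}_G(L)$ for every such $H$ and every $L\in\Omega\bigl(\mathcal{FS}(H)^G,\operatorname{GL}(H)\cap\mathcal{FS}(H)^G\bigr)$.
   Context: Notation. $I=[0,1]$. For a real separable Hilbert space $H$ with an orthogonal action of the compact Lie group $G$ (continuous in the usual sense: $(g,u)\mapsto gu$ is continuous), $\mathcal{L}(H)$ is the space of bounded operators with the norm topology, $\operatorname{GL}(H)$ the invertible ones, and $\mathcal{FS}(H)$ the set of bounded selfadjoint Fredholm operators (finite-dimensional kernel and closed range). $\mathcal{FS}(H)^G$ is the subset of $G$-equivariant operators, $T(gu)=g(Tu)$ for all $u\in H$, $g\in G$. For a pair of topological spaces $(X,Y)$ with $Y\subset X$, $\Omega(X,Y)$ denotes the set of all continuous paths $I\to X$ with both endpoints in $Y$. $\mathrm{RO}(G)$ is the real representation ring, i.e. the Grothendieck group of the commutative monoid (under direct sum) of isomorphism classes of finite-dimensional real representations of $G$; its elements are formal differences $[U]-[V]$ modulo the relation generated by $[U]-[V]\sim[U\oplus W]-[V\oplus W]$. The $G$-equivariant spectral flow. Let $L=\{L_\lambda\}_{\lambda\in I}$ be a continuous path in $\mathcal{FS}(H)^G$. There are a partition $0=\lambda_0<\dots<\lambda_N=1$ and numbers $a_i>0$, $i=1,\dots,N$, such that for each $i$ the map $[\lambda_{i-1},\lambda_i]\ni\lambda\mapsto\chi_{[-a_i,a_i]}(L_\lambda)\in\mathcal{L}(H)$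 is a continuous family of finite rank projections, where $\chi_{[a,b]}(T)$ is the spectral projection of the selfadjoint operator $T$ for the interval $[a,b]$. Put $E(T,[0,a]):=\operatorname{im}\chi_{[0,a]}(T)$, which for $T=L_\lambda$, $\lambda\in[\lambda_{i-1},\lambda_i]$, $a=a_i$ is a finite-dimensional $G$-representation. Then $$\mathrm{sf}_G(L)=\sum_{i=1}^N\bigl([E(L_{\lambda_i},[0,a_i])]-[E(L_{\lambda_{i-1}},[0,a_i])]\bigr)\in\mathrm{RO}(G),$$ which is known not to depend on the choice of the partition and of the numbers $a_i$. *)

theory Defs
  imports "HOL-Analysis.Analysis" "HOL-Algebra.Ring" "Jordan_Normal_Form.Matrix"
begin

no_notation scalar_prod (infix "\<bullet>" 70)

section \<open>Compact Lie groups\<close>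

text \<open>
  The model space \<open>Euclidean_space n\<close> is the set of all \<open>x :: nat \<Rightarrow> real\<close> with \<open>x i = 0\<close> for \<open>i \<ge> n\<close>,
  so that the dimension \<open>n\<close> is a value and \<open>n = 0\<close> (finite groups) is allowed.
  \<open>C_k n k S f\<close>: all iterated partial derivatives of order at most \<open>k\<close> exist and are continuous on
  the open subset \<open>S\<close> of \<open>Euclidean_space n\<close>.
\<close>

fun C_k :: "nat \<Rightarrow> nat \<Rightarrow> (nat \<Rightarrow> real) set \<Rightarrow> ((nat \<Rightarrow> real) \<Rightarrow> real) \<Rightarrow> bool" where
  "C_k n 0 S f \<longleftrightarrow> continuous_map (subtopology (Euclidean_space n) S) euclideanreal f"
| "C_k n (Suc k) S f \<longleftrightarrow>
     continuous_map (subtopology (Euclidean_space n) S) euclideanreal f \<and>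
     (\<forall>i<n. (\<forall>x\<in>S. (\<lambda>t. f (x(i := t))) differentiable (at (x i))) \<and>
            C_k n k S (\<lambda>x. deriv (\<lambda>t. f (x(i := t))) (x i)))"

definition smooth_map ::
  "nat \<Rightarrow> nat \<Rightarrow> (nat \<Rightarrow> real) set \<Rightarrow> ((nat \<Rightarrow> real) \<Rightarrow> (nat \<Rightarrow> real)) \<Rightarrow> bool" where
  "smooth_map m n S f \<longleftrightarrow> (\<forall>j<n. \<forall>k. C_k m k S (\<lambda>x. f x j))"

type_synonym 'g chart = "'g set \<times> ('g \<Rightarrow> nat \<Rightarrow> real)"

definition is_chart :: "'g topology \<Rightarrow> nat \<Rightarrow> 'g chart \<Rightarrow> bool" where
  "is_chart X n = (\<lambda>(U, \<phi>). openin X U \<and> openin (Euclidean_space n) (\<phi> ` U) \<and>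
     homeomorphic_map (subtopology X U) (subtopology (Euclidean_space n) (\<phi> ` U)) \<phi>)"

definition smooth_atlas :: "'g topology \<Rightarrow> nat \<Rightarrow> 'g chart set \<Rightarrow> bool" where
  "smooth_atlas X n \<A> \<longleftrightarrow> (\<forall>c\<in>\<A>. is_chart X n c) \<and> (\<Union>(U, \<phi>)\<in>\<A>. U) = topspace X \<and>
     (\<forall>(U, \<phi>)\<in>\<A>. \<forall>(V, \<psi>)\<in>\<A>.
        smooth_map n n (\<phi> ` (U \<inter> V)) (\<lambda>x. \<psi> (inv_into U \<phi> x)))"

text \<open>The two components of a point of \<open>\<real>\<^sup>2\<^sup>n = \<real>\<^sup>n \<times> \<real>\<^sup>n\<close>.\<close>

definition fst_half :: "nat \<Rightarrow> (nat \<Rightarrow> real) \<Rightarrow> (nat \<Rightarrow> real)" where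
  "fst_half n z = (\<lambda>i. if i < n then z i else 0)"

definition snd_half :: "nat \<Rightarrow> (nat \<Rightarrow> real) \<Rightarrow> (nat \<Rightarrow> real)" where
  "snd_half n z = (\<lambda>i. if i < n then z (n + i) else 0)"

text \<open>A Lie group of dimension \<open>n\<close>: a topological group (\<open>G\<close> with topology \<open>X\<close>) with a smooth
  atlas \<open>\<A>\<close> in which multiplication and inversion are smooth.\<close>

definition Lie_group ::
  "('g, 'm) monoid_scheme \<Rightarrow> 'g topology \<Rightarrow> nat \<Rightarrow> 'g chart set \<Rightarrow> bool" where
  "Lie_group G X n \<A> \<longleftrightarrow>
     group G \<and> topspace X = carrier G \<and> Hausdorff_space X \<and> second_countable X \<and>
     smooth_atlas X n \<A> \<and>
     continuous_map (prod_topology X X) X (\<lambda>(x, y). x \<otimes>\<^bsub>G\<^esub> y) \<and>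
     continuous_map X X (\<lambda>x. inv\<^bsub>G\<^esub> x) \<and>
     (\<forall>(U, \<phi>)\<in>\<A>. \<forall>(V, \<psi>)\<in>\<A>. \<forall>(W, \<theta>)\<in>\<A>.
        smooth_map (n + n) n
          {z \<in> topspace (Euclidean_space (n + n)).
             fst_half n z \<in> \<phi> ` U \<and> snd_half n z \<in> \<psi> ` V \<and>
             inv_into U \<phi> (fst_half n z) \<otimes>\<^bsub>G\<^esub> inv_into V \<psi> (snd_half n z) \<in> W}
          (\<lambda>z. \<theta> (inv_into U \<phi> (fst_half n z) \<otimes>\<^bsub>G\<^esub> inv_into V \<psi> (snd_half n z)))) \<and>
     (\<forall>(U, \<phi>)\<in>\<A>. \<forall>(V, \<psi>)\<in>\<A>.
        smooth_map n n {x \<in> \<phi> ` U. inv\<^bsub>G\<^esub> (inv_into U \<phi> x) \<in> V}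
          (\<lambda>x. \<psi> (inv\<^bsub>G\<^esub> (inv_into U \<phi> x))))"

definition compact_Lie_group ::
  "('g, 'm) monoid_scheme \<Rightarrow> 'g topology \<Rightarrow> nat \<Rightarrow> 'g chart set \<Rightarrow> bool" where
  "compact_Lie_group G X n \<A> \<longleftrightarrow> Lie_group G X n \<A> \<and> compact_space X"


section \<open>The real representation ring\<close>

text \<open>A finite-dimensional real representation is given in matrix form; every such representation
  is isomorphic to one of this kind.  The values outside \<open>carrier G\<close> play no role: they are ignored by
  \<open>rep_iso\<close> and hence by the classes in \<open>RO\<close>.\<close>

type_synonym 'g rep = "'g \<Rightarrow> real mat"

definition is_rep :: "('g, 'm) monoid_scheme \<Rightarrow> 'g topology \<Rightarrow> nat \<Rightarrow> 'g rep \<Rightarrow> bool" where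
  "is_rep G X n R \<longleftrightarrow>
     (\<forall>g\<in>carrier G. R g \<in> carrier_mat n n) \<and>
     R \<one>\<^bsub>G\<^esub> = 1\<^sub>m n \<and>
     (\<forall>g\<in>carrier G. \<forall>h\<in>carrier G. R (g \<otimes>\<^bsub>G\<^esub> h) = R g * R h) \<and>
     (\<forall>i<n. \<forall>j<n. continuous_map X euclideanreal (\<lambda>g. R g $$ (i, j)))"

definition reps :: "('g, 'm) monoid_scheme \<Rightarrow> 'g topology \<Rightarrow> 'g rep set" where
  "reps G X = {R. \<exists>n. is_rep G X n R}"

definition rep_iso ::
  "('g, 'm) monoid_scheme \<Rightarrow> 'g topology \<Rightarrow> 'g rep \<Rightarrow> 'g rep \<Rightarrow> bool" where
  "rep_iso G X U V \<longleftrightarrow>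
     (\<exists>n P. is_rep G X n U \<and> is_rep G X n V \<and> P \<in> carrier_mat n n \<and> invertible_mat P \<and>
        (\<forall>g\<in>carrier G. P * U g = V g * P))"

definition mat_sum :: "real mat \<Rightarrow> real mat \<Rightarrow> real mat" where
  "mat_sum A B = four_block_mat A (0\<^sub>m (dim_row A) (dim_col B)) (0\<^sub>m (dim_row B) (dim_col A)) B"

definition mat_tensor :: "real mat \<Rightarrow> real mat \<Rightarrow> real mat" where
  "mat_tensor A B = mat (dim_row A * dim_row B) (dim_col A * dim_col B)
     (\<lambda>(i, j). A $$ (i div dim_row B, j div dim_col B) * B $$ (i mod dim_row B, j mod dim_col B))"

definition rep_sum :: "'g rep \<Rightarrow> 'g rep \<Rightarrow> 'g rep" where
  "rep_sum U V = (\<lambda>g. mat_sum (U g) (V g))"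

definition rep_tensor :: "'g rep \<Rightarrow> 'g rep \<Rightarrow> 'g rep" where
  "rep_tensor U V = (\<lambda>g. mat_tensor (U g) (V g))"

definition trivial_rep :: "nat \<Rightarrow> 'g rep" where
  "trivial_rep n = (\<lambda>g. 1\<^sub>m n)"

text \<open>A pair \<open>(U, V)\<close> stands for the formal difference \<open>[U] - [V]\<close>.\<close>

inductive RO_eq ::
  "('g, 'm) monoid_scheme \<Rightarrow> 'g topology \<Rightarrow> 'g rep \<times> 'g rep \<Rightarrow> 'g rep \<times> 'g rep \<Rightarrow> bool"
  for G X where
  iso: "rep_iso G X U U' \<Longrightarrow> rep_iso G X V V' \<Longrightarrow> RO_eq G X (U, V) (U', V')"
| stab: "U \<in> reps G X \<Longrightarrow> V \<in> reps G X \<Longrightarrow> W \<in> reps G X \<Longrightarrow>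
    RO_eq G X (U, V) (rep_sum U W, rep_sum V W)"
| sym: "RO_eq G X p q \<Longrightarrow> RO_eq G X q p"
| trans: "RO_eq G X p q \<Longrightarrow> RO_eq G X q r \<Longrightarrow> RO_eq G X p r"

definition RO_rel ::
  "('g, 'm) monoid_scheme \<Rightarrow> 'g topology \<Rightarrow> (('g rep \<times> 'g rep) \<times> ('g rep \<times> 'g rep)) set" where
  "RO_rel G X = {(p, q). RO_eq G X p q}"

definition RO ::
  "('g, 'm) monoid_scheme \<Rightarrow> 'g topology \<Rightarrow> ('g rep \<times> 'g rep) set ring" where
  "RO G X =
    \<lparr>carrier = (reps G X \<times> reps G X) // RO_rel G X,
     mult = (\<lambda>x y. RO_rel G X `` {(rep_sum (rep_tensor U U') (rep_tensor V V'),
                                   rep_sum (rep_tensor U V') (rep_tensor V U')) |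
                                  U V U' V'. (U, V) \<in> x \<and> (U', V') \<in> y}),
     one = RO_rel G X `` {(trivial_rep 1, trivial_rep 0)},
     zero = RO_rel G X `` {(trivial_rep 0, trivial_rep 0)},
     add = (\<lambda>x y. RO_rel G X `` {(rep_sum U U', rep_sum V V') |
                                  U V U' V'. (U, V) \<in> x \<and> (U', V') \<in> y})\<rparr>"


section \<open>Hilbert spaces with an orthogonal action\<close>

text \<open>
  Since one cannot quantify over types inside a formula, a separable Hilbert space is represented as
  a closed separable subspace \<open>H\<close> (with the induced inner product) of a Hilbert space given by a
  type \<open>'h\<close>, where \<open>'h\<close> is arbitrary.  Every real separable Hilbert space arises in this way up to
  isometry as soon as \<open>'h\<close> is infinite-dimensional, and exactly, as \<open>UNIV\<close>, for suitable \<open>'h\<close>.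
\<close>

definition hilbert :: "'h::{real_inner, complete_space} set \<Rightarrow> bool" where
  "hilbert H \<longleftrightarrow> subspace H \<and> closed H \<and> (\<exists>D. countable D \<and> D \<subseteq> H \<and> H \<subseteq> closure D)"

text \<open>
  \<open>ops H\<close> is the space of bounded operators on \<open>H\<close>.  An operator on \<open>H\<close> is represented by its extension
  by zero on the orthogonal complement of \<open>H\<close>; this is a bijection which preserves the operator norm,
  so the norm topology is the one inherited from the type of bounded operators on \<open>'h\<close>.
\<close>

definition ops :: "'h::{real_inner, complete_space} set \<Rightarrow> ('h \<Rightarrow>\<^sub>L 'h) set" where
  "ops H = {T :: 'h \<Rightarrow>\<^sub>L 'h. (\<forall>u\<in>H. T u \<in> H) \<and> (\<forall>u. (\<forall>v\<in>H. u \<bullet> v = 0) \<longrightarrow> T u = 0)}"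

text \<open>The restriction of \<open>T\<close> to an invariant closed subspace \<open>K\<close>, as an element of \<open>ops K\<close>.\<close>

definition restr_op ::
  "'h::{real_inner, complete_space} set \<Rightarrow> ('h \<Rightarrow>\<^sub>L 'h) \<Rightarrow> ('h \<Rightarrow>\<^sub>L 'h)" where
  "restr_op K T = (THE R :: 'h \<Rightarrow>\<^sub>L 'h. R \<in> ops K \<and> (\<forall>u\<in>K. R u = T u))"

definition orthogonal_action ::
  "('g, 'm) monoid_scheme \<Rightarrow> 'g topology \<Rightarrow> 'h::{real_inner, complete_space} set \<Rightarrow>
     ('g \<Rightarrow> 'h \<Rightarrow>\<^sub>L 'h) \<Rightarrow> bool" where
  "orthogonal_action G X H \<rho> \<longleftrightarrow>
     \<rho> \<in> carrier G \<rightarrow>\<^sub>E ops H \<and>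
     (\<forall>u\<in>H. \<rho> \<one>\<^bsub>G\<^esub> u = u) \<and>
     (\<forall>g\<in>carrier G. \<forall>h\<in>carrier G. \<forall>u\<in>H. \<rho> (g \<otimes>\<^bsub>G\<^esub> h) u = \<rho> g (\<rho> h u)) \<and>
     (\<forall>g\<in>carrier G. \<forall>u\<in>H. \<forall>v\<in>H. \<rho> g u \<bullet> \<rho> g v = u \<bullet> v) \<and>
     continuous_map (prod_topology X (top_of_set H)) euclidean (\<lambda>(g, u). \<rho> g u)"

definition hilbert_rep ::
  "('g, 'm) monoid_scheme \<Rightarrow> 'g topology \<Rightarrow> 'h::{real_inner, complete_space} set \<Rightarrow>
     ('g \<Rightarrow> 'h \<Rightarrow>\<^sub>L 'h) \<Rightarrow> bool" where
  "hilbert_rep G X H \<rho> \<longleftrightarrow> hilbert H \<and> orthogonal_action G X H \<rho>"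

definition invariant ::
  "('g, 'm) monoid_scheme \<Rightarrow> ('g \<Rightarrow> 'h::{real_inner, complete_space} \<Rightarrow>\<^sub>L 'h) \<Rightarrow> 'h set \<Rightarrow> bool" where
  "invariant G \<rho> V \<longleftrightarrow> (\<forall>g\<in>carrier G. \<forall>u\<in>V. \<rho> g u \<in> V)"

definition restr_action ::
  "('g, 'm) monoid_scheme \<Rightarrow> 'h::{real_inner, complete_space} set \<Rightarrow>
     ('g \<Rightarrow> 'h \<Rightarrow>\<^sub>L 'h) \<Rightarrow> ('g \<Rightarrow> 'h \<Rightarrow>\<^sub>L 'h)" where
  "restr_action G K \<rho> = (\<lambda>g\<in>carrier G. restr_op K (\<rho> g))"

definition finite_dim :: "'h::real_vector set \<Rightarrow> bool" where
  "finite_dim V \<longleftrightarrow> (\<exists>B. finite B \<and> V \<subseteq> span B)"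

text \<open>\<open>R\<close> is the matrix form of the representation \<open>\<rho>\<close> on \<open>V\<close> with respect to some basis of \<open>V\<close>.\<close>

definition matrix_form ::
  "('g, 'm) monoid_scheme \<Rightarrow> 'g topology \<Rightarrow> ('g \<Rightarrow> 'h::{real_inner, complete_space} \<Rightarrow>\<^sub>L 'h) \<Rightarrow>
     'h set \<Rightarrow> 'g rep \<Rightarrow> bool" where
  "matrix_form G X \<rho> V R \<longleftrightarrow>
     (\<exists>n (b :: nat \<Rightarrow> 'h). is_rep G X n R \<and> inj_on b {..<n} \<and> independent (b ` {..<n}) \<and>
        span (b ` {..<n}) = V \<and>
        (\<forall>g\<in>carrier G. \<forall>j<n. \<rho> g (b j) = (\<Sum>i<n. R g $$ (i, j) *\<^sub>R b i)))"

text \<open>The element \<open>[V] - [W]\<close> of \<open>RO G X\<close>, for finite-dimensional invariant subspaces \<open>V\<close> and \<open>W\<close>.\<close>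

definition RO_diff ::
  "('g, 'm) monoid_scheme \<Rightarrow> 'g topology \<Rightarrow> ('g \<Rightarrow> 'h::{real_inner, complete_space} \<Rightarrow>\<^sub>L 'h) \<Rightarrow>
     'h set \<Rightarrow> 'h set \<Rightarrow> ('g rep \<times> 'g rep) set" where
  "RO_diff G X \<rho> V W =
     RO_rel G X `` {(R, S). matrix_form G X \<rho> V R \<and> matrix_form G X \<rho> W S}"


section \<open>Selfadjoint Fredholm operators and paths\<close>

definition selfadjoint :: "'h::{real_inner, complete_space} set \<Rightarrow> ('h \<Rightarrow>\<^sub>L 'h) \<Rightarrow> bool" where
  "selfadjoint H T \<longleftrightarrow> (\<forall>u\<in>H. \<forall>v\<in>H. T u \<bullet> v = u \<bullet> T v)"

definition FS :: "'h::{real_inner, complete_space} set \<Rightarrow> ('h \<Rightarrow>\<^sub>L 'h) set" where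
  "FS H = {T \<in> ops H. selfadjoint H T \<and> finite_dim {u \<in> H. T u = 0} \<and> closed (blinfun_apply T ` H)}"

definition FS_G ::
  "('g, 'm) monoid_scheme \<Rightarrow> 'h::{real_inner, complete_space} set \<Rightarrow> ('g \<Rightarrow> 'h \<Rightarrow>\<^sub>L 'h) \<Rightarrow>
     ('h \<Rightarrow>\<^sub>L 'h) set" where
  "FS_G G H \<rho> = {T \<in> FS H. \<forall>g\<in>carrier G. \<forall>u\<in>H. T (\<rho> g u) = \<rho> g (T u)}"

definition GL :: "'h::{real_inner, complete_space} set \<Rightarrow> ('h \<Rightarrow>\<^sub>L 'h) set" where
  "GL H = {T \<in> ops H. \<exists>R\<in>ops H. \<forall>u\<in>H. R (T u) = u \<and> T (R u) = u}"

text \<open>Paths are functions on \<open>{0..1}\<close>, normalised to be \<open>undefined\<close> elsewhere.\<close>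

definition \<Omega> :: "'a::topological_space set \<Rightarrow> 'a set \<Rightarrow> (real \<Rightarrow> 'a) set" where
  "\<Omega> X Y = {L \<in> {0..1} \<rightarrow>\<^sub>E X. continuous_on {0..1} L \<and> L 0 \<in> Y \<and> L 1 \<in> Y}"

definition restr_path ::
  "'h::{real_inner, complete_space} set \<Rightarrow> (real \<Rightarrow> 'h \<Rightarrow>\<^sub>L 'h) \<Rightarrow> (real \<Rightarrow> 'h \<Rightarrow>\<^sub>L 'h)" where
  "restr_path K L = (\<lambda>l\<in>{0..1}. restr_op K (L l))"

text \<open>The direct sum of the eigenspaces for negative eigenvalues.\<close>

definition E_neg :: "'h::{real_inner, complete_space} set \<Rightarrow> ('h \<Rightarrow>\<^sub>L 'h) \<Rightarrow> 'h set" where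
  "E_neg H T = span (\<Union>c\<in>{..<0}. {u \<in> H. T u = c *\<^sub>R u})"


section \<open>Spectral projections\<close>

text \<open>\<open>E\<close> is the spectral family (resolution of the identity, continuous from the right) of the bounded
  selfadjoint operator \<open>T\<close> on \<open>H\<close>, i.e. \<open>T = \<integral>t dE\<^sub>t\<close>.  The integral is expressed by Lebesgue-Stieltjes
  integrals against the functions \<open>t \<mapsto> \<langle>E\<^sub>t u, u\<rangle>\<close>.\<close>

definition spectral_family ::
  "'h::{real_inner, complete_space} set \<Rightarrow> ('h \<Rightarrow>\<^sub>L 'h) \<Rightarrow> (real \<Rightarrow> 'h \<Rightarrow>\<^sub>L 'h) \<Rightarrow> bool" where
  "spectral_family H T E \<longleftrightarrow>
     (\<forall>t. E t \<in> ops H \<and> selfadjoint H (E t)) \<and>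
     (\<forall>s t. \<forall>u\<in>H. E s (E t u) = E (min s t) u) \<and>
     (\<forall>t. \<forall>u\<in>H. ((\<lambda>s. E s u) \<longlongrightarrow> E t u) (at_right t)) \<and>
     (\<exists>r. (\<forall>t. t < - r \<longrightarrow> (\<forall>u\<in>H. E t u = 0)) \<and> (\<forall>t\<ge>r. \<forall>u\<in>H. E t u = u)) \<and>
     (\<forall>u\<in>H. T u \<bullet> u = (LINT t|interval_measure (\<lambda>t. E t u \<bullet> u). t))"

text \<open>\<open>\<chi>\<^bsub>[a,b]\<^esub>(T)\<close> is \<open>E\<^sub>b\<close> minus the strong limit of \<open>E\<^sub>s\<close> as \<open>s\<close> tends to \<open>a\<close> from the left.\<close>

definition spectral_proj ::
  "'h::{real_inner, complete_space} set \<Rightarrow> real \<Rightarrow> real \<Rightarrow> ('h \<Rightarrow>\<^sub>L 'h) \<Rightarrow> ('h \<Rightarrow>\<^sub>L 'h)" where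
  "spectral_proj H a b T =
     (THE P :: 'h \<Rightarrow>\<^sub>L 'h. P \<in> ops H \<and> (\<exists>E. spectral_family H T E \<and>
        (\<forall>u\<in>H. ((\<lambda>s. E b u - E s u) \<longlongrightarrow> P u) (at_left a))))"

definition spectral_space ::
  "'h::{real_inner, complete_space} set \<Rightarrow> ('h \<Rightarrow>\<^sub>L 'h) \<Rightarrow> real \<Rightarrow> real \<Rightarrow> 'h set" where
  "spectral_space H T a b = blinfun_apply (spectral_proj H a b T) ` H"


section \<open>The equivariant spectral flow\<close>

definition sf_data ::
  "'h::{real_inner, complete_space} set \<Rightarrow> (real \<Rightarrow> 'h \<Rightarrow>\<^sub>L 'h) \<Rightarrow>
     nat \<Rightarrow> (nat \<Rightarrow> real) \<Rightarrow> (nat \<Rightarrow> real) \<Rightarrow> bool" where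
  "sf_data H L N l a \<longleftrightarrow>
     l 0 = 0 \<and> l N = 1 \<and> (\<forall>i<N. l i < l (Suc i)) \<and>
     (\<forall>i\<in>{1..N}. a i > 0 \<and>
        continuous_on {l (i - 1)..l i} (\<lambda>s. spectral_proj H (- a i) (a i) (L s)) \<and>
        (\<forall>s\<in>{l (i - 1)..l i}. finite_dim (spectral_space H (L s) (- a i) (a i))))"

text \<open>The value does not depend on the choice of the partition \<open>l\<close> and of the numbers \<open>a\<close>.\<close>

definition sf ::
  "('g, 'm) monoid_scheme \<Rightarrow> 'g topology \<Rightarrow> 'h::{real_inner, complete_space} set \<Rightarrow>
     ('g \<Rightarrow> 'h \<Rightarrow>\<^sub>L 'h) \<Rightarrow> (real \<Rightarrow> 'h \<Rightarrow>\<^sub>L 'h) \<Rightarrow> ('g rep \<times> 'g rep) set" where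
  "sf G X H \<rho> L = (THE x. \<exists>N l a. sf_data H L N l a \<and>
     x = (\<Oplus>\<^bsub>RO G X\<^esub>i\<in>{1..N}. RO_diff G X \<rho> (spectral_space H (L (l i)) 0 (a i))
                                        (spectral_space H (L (l (i - 1))) 0 (a i))))"

end

theory Submission
  imports Defs
begin

text \<open>
  A congruence \<open>S\<^sup>* L S\<close> by a path of equivariant invertible operators starting at the identity does
  not change \<open>\<mu>(L)\<close>, by homotopy invariance.  On a piece of the partition the operators
  \<open>L\<^sub>\<lambda> + 2a \<chi>\<^bsub>[-a,a]\<^esub>(L\<^sub>\<lambda>)\<close> are invertible, hence congruent to the one at the left end, and \<open>L\<^sub>0\<close> is congruent
  to an involution \<open>J\<close>.  So \<open>L\<close> may be replaced by \<open>J + K\<close> with \<open>K\<close> of finite rank, and, deforming \<open>K\<close>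
  to \<open>Q K Q\<close>, by a path which is constant and invertible on the complement of an invariant subspace \<open>F\<close> of
  finite dimension (\<open>Q\<close> is the projection onto \<open>F\<close>).  Additivity leaves the difference of the negative
  eigenspaces on \<open>F\<close>, which telescopes over the partition; the equivariant law of inertia identifies
  each term with that of \<open>sf\<^sub>G\<close>.  As this works for every partition, it also shows that \<open>sf\<^sub>G\<close> is well defined.
\<close>

section \<open>Bounded operators on a Hilbert space\<close>

text \<open>Congruence is the right operation because \<open>S' T S\<close> stays selfadjoint,
  Fredholm and equivariant, and because a path of transporters is at once a homotopy of paths. The
  shift 2a matches the two bounds at hand: on the range of the projection the operator is at least
  -a, off it its modulus is at least a, so the shifted operator is bounded below by a. No F can be
  expected to absorb the whole path: each K has finite rank, but the ranges move with \<lambda> and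
  may together span an infinite-dimensional space. So F collects only the ranges at the finitely
  many partition points; the compression to F then leaves those points, in particular both ends,
  unchanged. Over one piece all shifted operators are carried to a single one, whose negative space
  cancels in the difference. What remains is the negative part of the spectral space for [-a,a]; as
  that space has constant class along the piece, a loss of negative part is a gain of the part for
  [0,a]. Since a spectral projection is a definite description over all spectral families, existence
  and uniqueness of the family must be settled before it can be computed.\<close>

lemma blinfun_Cauchy_convergent:
  fixes X :: "nat \<Rightarrow> 'a::real_normed_vector \<Rightarrow>\<^sub>L 'b::{real_normed_vector, complete_space}"
  assumes X: "Cauchy X"
  obtains A where "X \<longlonglongrightarrow> A"
proof -
  have "\<exists>y. (\<lambda>n. X n x) \<longlonglongrightarrow> y" for x
    using bounded_linear.Cauchy[OF blinfun.bounded_linear_left X, of x] Cauchy_convergent_iff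
    by (metis convergent_def)
  then obtain v where v: "\<And>x. (\<lambda>n. X n x) \<longlonglongrightarrow> v x" by metis
  obtain K where K: "\<And>n. norm (X n) \<le> K"
    using Cauchy_Bseq[OF X] by (meson BseqE)
  have "bounded_linear v"
  proof (rule bounded_linear_intro[where K=K])
    show "v (x + y) = v x + v y" for x y
      using tendsto_add[OF v[of x] v[of y]] v[of "x + y"]
      by (simp add: blinfun.bilinear_simps LIMSEQ_unique)
    show "v (r *\<^sub>R x) = r *\<^sub>R v x" for r x
      using tendsto_scaleR[OF tendsto_const[of r] v[of x]] v[of "r *\<^sub>R x"]
      by (simp add: blinfun.bilinear_simps LIMSEQ_unique)
    show "norm (v x) \<le> norm x * K" for x
    proof (rule LIMSEQ_le_const2[OF tendsto_norm[OF v]])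
      show "\<exists>N. \<forall>n\<ge>N. norm (X n x) \<le> norm x * K"
        using K by (metis mult.commute mult_right_mono norm_blinfun norm_ge_zero order_trans)
    qed
  qed
  then obtain A where A: "v = blinfun_apply A" by (metis bounded_linear_Blinfun_apply)
  have "X \<longlonglongrightarrow> A"
  proof (rule LIMSEQ_I)
    fix r :: real assume "r > 0"
    then obtain N where N: "\<And>m n. m \<ge> N \<Longrightarrow> n \<ge> N \<Longrightarrow> norm (X m - X n) < r / 2"
      using CauchyD[OF X, of "r / 2"] by auto
    have "norm (X n - A) < r" if n: "n \<ge> N" for n
    proof -
      have "norm ((X n - A) x) \<le> r / 2 * norm x" for x
      proof -
        have "(\<lambda>m. norm ((X n - X m) x)) \<longlonglongrightarrow> norm (X n x - A x)"
          unfolding blinfun.diff_left A[symmetric] by (intro tendsto_intros v)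
        moreover have "norm ((X n - X m) x) \<le> r / 2 * norm x" if "m \<ge> N" for m
          using norm_blinfun[of "X n - X m" x] N[OF n that]
          by (meson less_imp_le mult_right_mono norm_ge_zero order_trans)
        ultimately show ?thesis
          unfolding blinfun.diff_left by (blast intro: LIMSEQ_le_const2)
      qed
      then have "norm (X n - A) \<le> r / 2"
        using \<open>r > 0\<close> by (intro norm_blinfun_bound) auto
      then show ?thesis using \<open>r > 0\<close> by simp
    qed
    then show "\<exists>N. \<forall>n\<ge>N. norm (X n - A) < r" by blast
  qed
  then show ?thesis by (rule that)
qed

text \<open>Adjointness is a relation: every operator below is given together with its adjoint.
  \<open>adj A A\<close> is selfadjointness on the whole space \<open>'h\<close>.\<close>

definition adj :: "('h::real_inner \<Rightarrow>\<^sub>L 'h) \<Rightarrow> ('h \<Rightarrow>\<^sub>L 'h) \<Rightarrow> bool" where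
  "adj A B \<longleftrightarrow> (\<forall>u v. A u \<bullet> v = u \<bullet> B v)"

definition comm :: "('h::real_normed_vector \<Rightarrow>\<^sub>L 'h) \<Rightarrow> ('h \<Rightarrow>\<^sub>L 'h) \<Rightarrow> bool" where
  "comm A B \<longleftrightarrow> A o\<^sub>L B = B o\<^sub>L A"

definition is_proj :: "('h::real_inner \<Rightarrow>\<^sub>L 'h) \<Rightarrow> bool" where
  "is_proj P \<longleftrightarrow> adj P P \<and> P o\<^sub>L P = P"

lemmas bl = blinfun.bilinear_simps

lemma adjD: "adj A B \<Longrightarrow> A u \<bullet> v = u \<bullet> B v"
  by (simp add: adj_def)

lemma adj_sym: "adj A B \<Longrightarrow> adj B A"
  by (metis adj_def inner_commute)

lemma adj_id [simp]: "adj id_blinfun id_blinfun"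
  by (simp add: adj_def)

lemma adj_zero [simp]: "adj 0 0"
  by (simp add: adj_def)

lemma adj_add: "adj A A' \<Longrightarrow> adj B B' \<Longrightarrow> adj (A + B) (A' + B')"
  by (simp add: adj_def bl inner_simps)

lemma adj_diff: "adj A A' \<Longrightarrow> adj B B' \<Longrightarrow> adj (A - B) (A' - B')"
  by (simp add: adj_def bl inner_simps)

lemma adj_minus: "adj A A' \<Longrightarrow> adj (- A) (- A')"
  by (simp add: adj_def bl inner_simps)

lemma adj_scaleR: "adj A A' \<Longrightarrow> adj (c *\<^sub>R A) (c *\<^sub>R A')"
  by (simp add: adj_def bl inner_simps)

lemma adj_compose: "adj A A' \<Longrightarrow> adj B B' \<Longrightarrow> adj (A o\<^sub>L B) (B' o\<^sub>L A')"
  by (simp add: adj_def)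

lemmas adj_intros = adj_add adj_diff adj_minus adj_scaleR adj_compose adj_id adj_zero

lemma adj_unique: "adj A B \<Longrightarrow> adj A C \<Longrightarrow> B = C"
proof (rule blinfun_eqI)
  fix u assume *: "adj A B" "adj A C"
  have "\<forall>v. v \<bullet> B u = v \<bullet> C u" using adjD[OF *(1), of _ u] adjD[OF *(2), of _ u] by simp
  then show "B u = C u" by (simp add: vector_eq_ldot)
qed

lemma adj_norm_le:
  assumes "adj A B" shows "norm B \<le> norm A"
proof (rule norm_blinfun_bound)
  fix u
  have "norm (B u) * norm (B u) = A (B u) \<bullet> u"
    using assms by (simp add: adj_def flip: power2_eq_square power2_norm_eq_inner)
  also have "\<dots> \<le> norm A * norm (B u) * norm u"
    by (meson norm_blinfun mult_right_mono norm_cauchy_schwarz norm_ge_zero order_trans)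
  finally show "norm (B u) \<le> norm A * norm u"
    by (cases "B u = 0") (auto simp: mult.commute mult.left_commute)
qed simp

lemma comm_sym: "comm A B \<Longrightarrow> comm B A"
  by (simp add: comm_def)

lemma commD: "comm A B \<Longrightarrow> blinfun_apply A (blinfun_apply B u) = B (A u)"
  by (metis blinfun_apply_blinfun_compose comm_def)

lemma commI: "(\<And>u. blinfun_apply A (blinfun_apply B u) = B (A u)) \<Longrightarrow> comm A B"
  unfolding comm_def by (rule blinfun_eqI) simp

lemma comm_id [simp]: "comm id_blinfun A" "comm A id_blinfun"
  by (auto intro: commI)

lemma comm_zero [simp]: "comm 0 A" "comm A 0"
  by (auto intro: commI)

lemma comm_refl [simp]: "comm A A"
  by (simp add: comm_def)

lemma comm_add: "comm A B \<Longrightarrow> comm A C \<Longrightarrow> comm A (B + C)"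
  unfolding comm_def by (simp add: bounded_bilinear.add_left[OF bounded_bilinear_blinfun_compose]
      bounded_bilinear.add_right[OF bounded_bilinear_blinfun_compose])

lemma comm_diff: "comm A B \<Longrightarrow> comm A C \<Longrightarrow> comm A (B - C)"
  unfolding comm_def by (simp add: bounded_bilinear.diff_left[OF bounded_bilinear_blinfun_compose]
      bounded_bilinear.diff_right[OF bounded_bilinear_blinfun_compose])

lemma comm_minus: "comm A B \<Longrightarrow> comm A (- B)"
  unfolding comm_def by (simp add: bounded_bilinear.minus_left[OF bounded_bilinear_blinfun_compose]
      bounded_bilinear.minus_right[OF bounded_bilinear_blinfun_compose])

lemma comm_scaleR: "comm A B \<Longrightarrow> comm A (c *\<^sub>R B)"
  unfolding comm_def by (simp add: bounded_bilinear.scaleR_left[OF bounded_bilinear_blinfun_compose]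
      bounded_bilinear.scaleR_right[OF bounded_bilinear_blinfun_compose])

lemma comm_compose: "comm A B \<Longrightarrow> comm A C \<Longrightarrow> comm A (B o\<^sub>L C)"
  by (intro commI) (metis blinfun_apply_blinfun_compose commD)

lemmas comm_intros = comm_add comm_diff comm_minus comm_scaleR comm_compose comm_id comm_zero

lemma tendsto_blinfun_compose:
  "(f \<longlongrightarrow> A) F \<Longrightarrow> (g \<longlongrightarrow> B) F \<Longrightarrow> ((\<lambda>x. f x o\<^sub>L g x) \<longlongrightarrow> (A o\<^sub>L B)) F"
  by (rule bounded_bilinear.tendsto[OF bounded_bilinear_blinfun_compose])

lemma continuous_on_blinfun_compose:
  "continuous_on S f \<Longrightarrow> continuous_on S g \<Longrightarrow> continuous_on S (\<lambda>x. f x o\<^sub>L g x)"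
  by (rule bounded_bilinear.continuous_on[OF bounded_bilinear_blinfun_compose])

lemma comm_limit:
  assumes "X \<longlonglongrightarrow> A" and "\<And>n. comm C (X n)" shows "comm C A"
  unfolding comm_def
proof (rule LIMSEQ_unique)
  show "(\<lambda>n. C o\<^sub>L X n) \<longlonglongrightarrow> (C o\<^sub>L A)"
    by (intro tendsto_blinfun_compose tendsto_const assms)
  show "(\<lambda>n. C o\<^sub>L X n) \<longlonglongrightarrow> (A o\<^sub>L C)"
    unfolding assms(2)[unfolded comm_def] by (intro tendsto_blinfun_compose tendsto_const assms)
qed

lemma adj_limit:
  assumes "X \<longlonglongrightarrow> A" "Y \<longlonglongrightarrow> B" and "\<And>n. adj (X n) (Y n)" shows "adj A B"
  unfolding adj_def
proof (intro allI)
  fix u v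
  show "A u \<bullet> v = u \<bullet> B v"
  proof (rule LIMSEQ_unique)
    show "(\<lambda>n. X n u \<bullet> v) \<longlonglongrightarrow> A u \<bullet> v"
      by (intro tendsto_intros assms)
    show "(\<lambda>n. X n u \<bullet> v) \<longlonglongrightarrow> u \<bullet> B v"
      unfolding adjD[OF assms(3)] by (intro tendsto_intros assms)
  qed
qed

subsection \<open>Orthogonal projections\<close>

text \<open>A minimising sequence for the distance to \<open>V\<close> is Cauchy by the
  parallelogram identity, since midpoints stay in \<open>V\<close>. Closedness puts its limit in
  \<open>V\<close>, and a minimiser cannot be improved in any direction \<open>v\<close>, which is
  orthogonality.\<close>

lemma orthogonal_decomposition:
  fixes V :: "'h::{real_inner, complete_space} set"
  assumes V: "subspace V" "closed V"
  shows "\<exists>p\<in>V. \<forall>v\<in>V. (u - p) \<bullet> v = 0"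
proof -
  define D where "D = (\<lambda>v. (norm (u - v))\<^sup>2) ` V"
  define d where "d = Inf D"
  have D0: "D \<noteq> {}" "bdd_below D"
    using subspace_0[OF V(1)] by (auto simp: D_def intro!: bdd_belowI[of _ 0])
  have dle: "d \<le> (norm (u - v))\<^sup>2" if "v \<in> V" for v
    unfolding d_def using that D0 by (intro cInf_lower) (auto simp: D_def)
  have "\<exists>v\<in>V. (norm (u - v))\<^sup>2 < d + 1 / Suc n" for n
    using cInf_lessD[OF D0(1), of "d + 1 / Suc n"] by (auto simp: D_def d_def)
  then obtain x where x: "\<And>n. x n \<in> V" "\<And>n. (norm (u - x n))\<^sup>2 < d + 1 / Suc n" by metis
  have par: "(norm (a - b))\<^sup>2 \<le> 2 * ((norm (u - a))\<^sup>2 - d) + 2 * ((norm (u - b))\<^sup>2 - d)"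
    if "a \<in> V" "b \<in> V" for a b
  proof -
    have "(1/2) *\<^sub>R (a + b) \<in> V" using that V(1) by (simp add: subspace_add subspace_scale)
    then have "d \<le> (norm (u - (1/2) *\<^sub>R (a + b)))\<^sup>2" by (rule dle)
    moreover have "(norm (a - b))\<^sup>2 = 2 * (norm (u - a))\<^sup>2 + 2 * (norm (u - b))\<^sup>2
       - 4 * (norm (u - (1/2) *\<^sub>R (a + b)))\<^sup>2"
      by (simp add: power2_norm_eq_inner inner_simps inner_commute algebra_simps)
    ultimately show ?thesis by simp
  qed
  have "Cauchy x"
  proof (rule CauchyI)
    fix e :: real assume "e > 0"
    then obtain N where N: "1 / real (Suc N) < e\<^sup>2 / 4"
      using reals_Archimedean[of "e\<^sup>2 / 4"] by (auto simp: inverse_eq_divide)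
    have "norm (x m - x n) < e" if "m \<ge> N" "n \<ge> N" for m n
    proof -
      have "(norm (u - x k))\<^sup>2 - d < e\<^sup>2 / 4" if "k \<ge> N" for k
      proof -
        have "1 / real (Suc k) \<le> 1 / real (Suc N)"
          using that by (intro divide_left_mono) auto
        then show ?thesis using x(2)[of k] N by linarith
      qed
      from this[OF that(1)] this[OF that(2)] have "(norm (x m - x n))\<^sup>2 < e\<^sup>2"
        using par[OF x(1)[of m] x(1)[of n]] by argo
      then show ?thesis using \<open>e > 0\<close> by (simp add: power_less_imp_less_base)
    qed
    then show "\<exists>M. \<forall>m\<ge>M. \<forall>n\<ge>M. norm (x m - x n) < e" by blast
  qed
  then obtain p where p: "x \<longlonglongrightarrow> p" by (metis Cauchy_convergent_iff convergent_def)
  have pV: "p \<in> V" using closed_sequentially[OF V(2)] x(1) p by blast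
  have "(norm (u - p))\<^sup>2 \<le> d"
  proof (rule LIMSEQ_le)
    show "(\<lambda>n. (norm (u - x n))\<^sup>2) \<longlonglongrightarrow> (norm (u - p))\<^sup>2" by (intro tendsto_intros p)
    show "(\<lambda>n. d + 1 / Suc n) \<longlonglongrightarrow> d"
      using tendsto_add[OF tendsto_const[of d] LIMSEQ_inverse_real_of_nat]
      by (simp add: inverse_eq_divide)
    show "\<exists>N. \<forall>n\<ge>N. (norm (u - x n))\<^sup>2 \<le> d + 1 / Suc n" using x(2) less_imp_le by blast
  qed
  note pd = this
  have "(u - p) \<bullet> v = 0" if v: "v \<in> V" for v
  proof (cases "v = 0")
    case False
    define c where "c = (u - p) \<bullet> v"
    \<comment> \<open>The minimum point of the quadratic in \<open>t\<close>; moving there would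
      lower the squared distance by \<open>c * c / (v \<bullet> v)\<close>.\<close>
    define t where "t = c / (v \<bullet> v)"
    have vv: "v \<bullet> v > 0" using False by simp
    have "p + t *\<^sub>R v \<in> V" using pV v V(1) by (simp add: subspace_add subspace_scale)
    from order_trans[OF pd dle[OF this]]
    have "(norm (u - p))\<^sup>2 \<le> (norm (u - (p + t *\<^sub>R v)))\<^sup>2" .
    also have "\<dots> = (norm (u - p))\<^sup>2 - 2 * t * c + t * t * (v \<bullet> v)"
      by (simp add: power2_norm_eq_inner inner_simps inner_commute algebra_simps c_def)
    also have "\<dots> = (norm (u - p))\<^sup>2 - c * c / (v \<bullet> v)"
      using vv by (simp add: t_def field_simps)
    finally have "c * c / (v \<bullet> v) \<le> 0" by simp
    then show ?thesis using vv by (simp add: divide_le_0_iff c_def mult_le_0_iff) linarith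
  qed simp
  then show ?thesis using pV by blast
qed

definition proj :: "'h::{real_inner, complete_space} set \<Rightarrow> 'h \<Rightarrow>\<^sub>L 'h" where
  "proj V = (SOME P. \<forall>u. blinfun_apply P u \<in> V \<and> (\<forall>v\<in>V. (u - P u) \<bullet> v = 0))"

context
  fixes V :: "'h::{real_inner, complete_space} set"
  assumes V: "subspace V" "closed V"
begin

lemma proj_spec: "proj V u \<in> V \<and> (\<forall>v\<in>V. (u - proj V u) \<bullet> v = 0)"
proof -
  obtain p where p: "\<And>u. p u \<in> V" "\<And>u v. v \<in> V \<Longrightarrow> (u - p u) \<bullet> v = 0"
    using orthogonal_decomposition[OF V] by metis
  have uniq: "q = p u" if q: "q \<in> V" "\<And>v. v \<in> V \<Longrightarrow> (u - q) \<bullet> v = 0" for q u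
  proof -
    have "q - p u \<in> V" using q p V(1) by (simp add: subspace_diff)
    then have "(u - p u) \<bullet> (q - p u) - (u - q) \<bullet> (q - p u) = 0" using q(2) p(2) by simp
    then have "(q - p u) \<bullet> (q - p u) = 0" by (simp add: inner_simps)
    then show ?thesis by simp
  qed
  have "bounded_linear p"
  proof (rule bounded_linear_intro[where K=1])
    show "p (x + y) = p x + p y" for x y
      using p(2)[of _ x] p(2)[of _ y] p(1) V(1)
      by (intro uniq[symmetric]) (auto simp: subspace_add inner_simps algebra_simps)
    show "p (r *\<^sub>R x) = r *\<^sub>R p x" for r x
      using p(2)[of _ x] p(1) V(1)
      by (intro uniq[symmetric]) (auto simp: subspace_scale inner_simps algebra_simps)
    show "norm (p x) \<le> norm x * 1" for x
    proof -
      have "p x \<bullet> p x = x \<bullet> p x" using p(2)[OF p(1), of x x] by (simp add: inner_simps)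
      then have "norm (p x) * norm (p x) \<le> norm x * norm (p x)"
        by (metis norm_cauchy_schwarz power2_eq_square power2_norm_eq_inner)
      then show ?thesis by (cases "p x = 0") auto
    qed
  qed
  then have "\<forall>u. blinfun_apply (Blinfun p) u \<in> V \<and> (\<forall>v\<in>V. (u - Blinfun p u) \<bullet> v = 0)"
    using p by (simp add: bounded_linear_Blinfun_apply)
  then show ?thesis unfolding proj_def by (rule someI2) blast
qed

lemma proj_in: "proj V u \<in> V"
  using proj_spec by blast

lemma proj_orth: "v \<in> V \<Longrightarrow> (u - proj V u) \<bullet> v = 0"
  using proj_spec by blast

lemma proj_eqI: 
  assumes "p \<in> V" "\<And>v. v \<in> V \<Longrightarrow> (u - p) \<bullet> v = 0" shows "proj V u = p"
proof -
  have d: "proj V u - p \<in> V" using assms(1) proj_in V(1) by (simp add: subspace_diff)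
  have "(u - p) \<bullet> (proj V u - p) - (u - proj V u) \<bullet> (proj V u - p) = 0"
    using assms(2)[OF d] proj_orth[OF d] by simp
  then have "(proj V u - p) \<bullet> (proj V u - p) = 0" by (simp add: inner_simps)
  then show ?thesis by simp
qed

lemma proj_ident: "u \<in> V \<Longrightarrow> proj V u = u"
  by (rule proj_eqI) auto

lemma proj_fix_iff: "proj V u = u \<longleftrightarrow> u \<in> V"
  using proj_ident proj_in by metis

lemma proj_0_iff: "proj V u = 0 \<longleftrightarrow> (\<forall>v\<in>V. u \<bullet> v = 0)"
proof
  assume "proj V u = 0" then show "\<forall>v\<in>V. u \<bullet> v = 0" using proj_orth[of _ u] by auto
next
  assume "\<forall>v\<in>V. u \<bullet> v = 0" then show "proj V u = 0" using subspace_0[OF V(1)] by (intro proj_eqI) auto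
qed

lemma is_proj_proj: "is_proj (proj V)"
proof -
  have "proj V u \<bullet> v = u \<bullet> proj V v" for u v
    using proj_orth[OF proj_in, of u v] proj_orth[OF proj_in, of v u]
    by (simp add: inner_simps inner_commute)
  then show ?thesis
    unfolding is_proj_def adj_def by (auto intro!: blinfun_eqI simp: proj_ident proj_in)
qed

text \<open>Invariance under \<open>C\<close> puts \<open>C (proj V u)\<close> in \<open>V\<close>;
  invariance under the adjoint makes the remainder orthogonal to \<open>V\<close>.\<close>

lemma proj_comm:
  assumes "adj C C'" and "\<And>u. u \<in> V \<Longrightarrow> C u \<in> V" and "\<And>u. u \<in> V \<Longrightarrow> C' u \<in> V"
  shows "comm C (proj V)"
proof (rule commI)
  fix u
  have "proj V (C u) = C (proj V u)"
  proof (rule proj_eqI)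
    show "C (proj V u) \<in> V" using assms proj_in by blast
    show "(C u - C (proj V u)) \<bullet> v = 0" if "v \<in> V" for v
      using proj_orth[of "C' v" u] assms(3)[OF that] adjD[OF assms(1), of "u - proj V u" v]
      by (simp add: bl)
  qed
  then show "C (proj V u) = proj V (C u)" by simp
qed

end

lemma is_projD:
  assumes "is_proj P"
  shows "adj P P" "P (P u) = P u" "P u \<bullet> v = u \<bullet> P v" "P u \<bullet> P v = P u \<bullet> v" "P u \<bullet> u = P u \<bullet> P u"
proof -
  show 1: "adj P P" using assms is_proj_def by blast
  show 2: "P (P u) = P u" for u using assms by (metis blinfun_apply_blinfun_compose is_proj_def)
  show 3: "P u \<bullet> v = u \<bullet> P v" for u v using 1 by (rule adjD)
  show "P u \<bullet> P v = P u \<bullet> v" for u v by (metis 2 3)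
  then show "P u \<bullet> u = P u \<bullet> P u" by simp
qed

lemma is_proj_pyth:
  assumes "is_proj P" shows "(norm u)\<^sup>2 = (norm (P u))\<^sup>2 + (norm (u - P u))\<^sup>2"
  using is_projD(4)[OF assms, of u u]
  by (simp add: power2_norm_eq_inner inner_simps inner_commute)

lemma is_proj_le: "is_proj P \<Longrightarrow> norm (P u) \<le> norm u"
  using is_proj_pyth[of P u] by (metis le_add_same_cancel1 power2_le_imp_le norm_ge_zero zero_le_power2)

lemma is_proj_compl:
  assumes "is_proj P" shows "is_proj (id_blinfun - P)"
  unfolding is_proj_def
  using assms by (auto simp: bl is_projD intro!: adj_intros blinfun_eqI)

lemma is_proj_compose:
  assumes "is_proj P" "is_proj Q" "comm P Q" shows "is_proj (P o\<^sub>L Q)"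
proof -
  have "adj (P o\<^sub>L Q) (P o\<^sub>L Q)"
    using adj_compose[OF is_projD(1)[OF assms(1)] is_projD(1)[OF assms(2)]] assms(3)
    by (simp add: comm_def)
  moreover have "P (Q (P (Q u))) = P (Q u)" for u
    using assms by (metis commD is_projD(2))
  ultimately show ?thesis unfolding is_proj_def by (auto intro: blinfun_eqI)
qed

lemma subspace_kernel: "subspace {u. blinfun_apply K u = 0}"
  by (auto simp: subspace_def bl)

lemma closed_kernel: "closed {u. blinfun_apply K u = 0}"
  by (intro closed_Collect_eq continuous_intros)

lemma subspace_range: "subspace S \<Longrightarrow> subspace (blinfun_apply K ` S)"
  by (rule linear_subspace_image) (auto intro: bounded_linear.linear blinfun.bounded_linear_right)

lemma is_proj_range:
  assumes "is_proj P" shows "range (blinfun_apply P) = {u. P u = u}" "closed (range (blinfun_apply P))"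
    "subspace (range (blinfun_apply P))"
proof -
  show *: "range (blinfun_apply P) = {u. P u = u}"
    using is_projD(2)[OF assms] by (auto, metis rangeI)
  show "closed (range (blinfun_apply P))"
    unfolding * by (intro closed_Collect_eq continuous_intros)
  show "subspace (range (blinfun_apply P))"
    by (rule subspace_range) simp
qed

text \<open>Equal fixed spaces give \<open>P o\<^sub>L Q = Q\<close> and
  \<open>Q o\<^sub>L P = P\<close>. The two products are adjoint to each other, so \<open>P\<close>
  is the adjoint of \<open>Q\<close>, that is \<open>Q\<close> itself.\<close>

lemma is_proj_eqI:
  assumes "is_proj P" "is_proj Q" "\<And>u. P u = u \<longleftrightarrow> Q u = u"
  shows "P = Q"
proof -
  have "P (Q u) = Q u" "Q (P u) = P u" for u using assms by (metis is_projD(2))+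
  then have "P o\<^sub>L Q = Q" "Q o\<^sub>L P = P" by (auto intro: blinfun_eqI)
  moreover have "adj (P o\<^sub>L Q) (Q o\<^sub>L P)" using assms by (intro adj_compose is_projD(1))
  ultimately show ?thesis
    by (metis adj_unique assms(2) is_projD(1))
qed

lemma comm_proj_kernel:
  fixes K :: "'h::{real_inner, complete_space} \<Rightarrow>\<^sub>L 'h"
  assumes "adj C C'" "comm C K" "comm C' K"
  shows "comm C (proj {u. K u = 0})"
proof (rule proj_comm[OF subspace_kernel closed_kernel assms(1)])
  show "C u \<in> {u. K u = 0}" if "u \<in> {u. K u = 0}" for u
    using commD[OF assms(2), of u] that by (simp add: bl)
  show "C' u \<in> {u. K u = 0}" if "u \<in> {u. K u = 0}" for u
    using commD[OF assms(3), of u] that by (simp add: bl)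
qed

subsection \<open>Square roots\<close>

text \<open>The iteration \<open>Z \<mapsto> (X + Z\<^sup>2)/2\<close> for the solution of \<open>(1 - Z)\<^sup>2 = 1 - X\<close> is dominated by the
  scalar iteration for \<open>X = 1\<close>, whose limit is \<open>1\<close>; hence it converges uniformly on the unit ball.\<close>

primrec sqrt_iter :: "('h::real_normed_vector \<Rightarrow>\<^sub>L 'h) \<Rightarrow> nat \<Rightarrow> ('h \<Rightarrow>\<^sub>L 'h)" where
  "sqrt_iter X 0 = 0"
| "sqrt_iter X (Suc n) = (1/2) *\<^sub>R (X + (sqrt_iter X n o\<^sub>L sqrt_iter X n))"

primrec sqrt_bound :: "nat \<Rightarrow> real" where
  "sqrt_bound 0 = 0"
| "sqrt_bound (Suc n) = (1 + sqrt_bound n * sqrt_bound n) / 2"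

lemma sqrt_bound_range: "0 \<le> sqrt_bound n \<and> sqrt_bound n \<le> 1"
proof (induction n)
  case (Suc n)
  then have "sqrt_bound n * sqrt_bound n \<le> 1" by (simp add: mult_le_one)
  then show ?case using Suc by simp
qed simp

lemma sqrt_bound_mono: "sqrt_bound n \<le> sqrt_bound (Suc n)"
proof -
  have "0 \<le> (1 - sqrt_bound n)\<^sup>2" by simp
  then show ?thesis by (simp add: power2_eq_square algebra_simps)
qed

lemma sqrt_bound_lim: "sqrt_bound \<longlonglongrightarrow> 1"
proof -
  have "incseq sqrt_bound" using sqrt_bound_mono by (rule incseq_SucI)
  then obtain l where l: "sqrt_bound \<longlonglongrightarrow> l"
    using incseq_convergent sqrt_bound_range by metis
  have "(\<lambda>n. sqrt_bound (Suc n)) \<longlonglongrightarrow> (1 + l * l) / 2"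
    unfolding sqrt_bound.simps by (intro tendsto_intros l) simp
  then have "l = (1 + l * l) / 2" using LIMSEQ_Suc[OF l] LIMSEQ_unique by blast
  then have "(l - 1)\<^sup>2 = 0" by (simp add: power2_eq_square algebra_simps)
  then show ?thesis using l by simp
qed

text \<open>The difference of two squares is \<open>(Z' - Z) Z' + Z (Z' - Z)\<close>, so norm and
  increment have to be bounded together; with the scalar bounds inserted this is exactly the
  increment of the scalar iteration.\<close>

lemma sqrt_iter_bounds:
  assumes X: "norm X \<le> 1"
  shows "norm (sqrt_iter X n) \<le> sqrt_bound n \<and>
    norm (sqrt_iter X (Suc n) - sqrt_iter X n) \<le> sqrt_bound (Suc n) - sqrt_bound n"
proof (induction n)
  case 0
  then show ?case using X by simp
next
  case (Suc n)
  let ?Z = "sqrt_iter X n" and ?Z' = "sqrt_iter X (Suc n)"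
  let ?z = "sqrt_bound n" and ?z' = "sqrt_bound (Suc n)"
  have n1: "norm ?Z' \<le> ?z'"
    using Suc norm_triangle_ineq[of ?Z "?Z' - ?Z"] by (simp del: sqrt_iter.simps sqrt_bound.simps)
  have "sqrt_iter X (Suc (Suc n)) - ?Z' =
      (1/2) *\<^sub>R (((?Z' - ?Z) o\<^sub>L ?Z') + (?Z o\<^sub>L (?Z' - ?Z)))"
    by (rule blinfun_eqI) (simp add: bl algebra_simps)
  also have "norm \<dots> \<le> (1/2) * (norm (?Z' - ?Z) * norm ?Z' + norm ?Z * norm (?Z' - ?Z))"
    using norm_blinfun_compose[of "?Z' - ?Z" ?Z'] norm_blinfun_compose[of ?Z "?Z' - ?Z"]
      norm_triangle_ineq[of "(?Z' - ?Z) o\<^sub>L ?Z'" "?Z o\<^sub>L (?Z' - ?Z)"]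
    unfolding norm_scaleR by (auto simp del: sqrt_iter.simps)
  also have "\<dots> \<le> (1/2) * ((?z' - ?z) * ?z' + ?z * (?z' - ?z))"
    using Suc n1 sqrt_bound_range[of n] sqrt_bound_mono[of n]
    by (intro mult_left_mono add_mono mult_mono) (auto simp del: sqrt_iter.simps sqrt_bound.simps)
  also have "\<dots> = sqrt_bound (Suc (Suc n)) - ?z'" by (simp add: field_simps)
  finally show ?case using n1 by blast
qed

lemma sqrt_iter_diff:
  assumes X: "norm X \<le> 1"
  shows "norm (sqrt_iter X (n + k) - sqrt_iter X n) \<le> sqrt_bound (n + k) - sqrt_bound n"
proof (induction k)
  case (Suc k)
  then show ?case
    using sqrt_iter_bounds[OF X, of "n + k"]
      norm_triangle_ineq[of "sqrt_iter X (n + Suc k) - sqrt_iter X (n + k)" "sqrt_iter X (n + k) - sqrt_iter X n"]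
    by (simp del: sqrt_iter.simps sqrt_bound.simps)
qed simp

definition sqrt_lim :: "('h::{real_inner, complete_space} \<Rightarrow>\<^sub>L 'h) \<Rightarrow> ('h \<Rightarrow>\<^sub>L 'h)" where
  "sqrt_lim X = lim (sqrt_iter X)"

lemma sqrt_iter_tendsto:
  assumes X: "norm X \<le> 1"
  shows "sqrt_iter X \<longlonglongrightarrow> sqrt_lim X"
proof -
  have "Cauchy (sqrt_iter X)"
  proof (rule CauchyI')
    fix e :: real assume "e > 0"
    obtain N where N: "\<And>m n. m \<ge> N \<Longrightarrow> n \<ge> N \<Longrightarrow> norm (sqrt_bound m - sqrt_bound n) < e"
      using CauchyD[OF LIMSEQ_imp_Cauchy[OF sqrt_bound_lim] \<open>e > 0\<close>] by blast
    show "\<exists>M. \<forall>m\<ge>M. \<forall>n>m. dist (sqrt_iter X m) (sqrt_iter X n) < e"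
    proof (intro exI[of _ N] allI impI)
      fix m n assume "m \<ge> N" "n > m"
      then show "dist (sqrt_iter X m) (sqrt_iter X n) < e"
        using sqrt_iter_diff[OF X, of m "n - m"] N[of n m] by (simp add: dist_norm norm_minus_commute)
    qed
  qed
  then show ?thesis
    unfolding sqrt_lim_def using blinfun_Cauchy_convergent convergent_LIMSEQ_iff convergent_def by metis
qed

lemma sqrt_lim_bound:
  assumes X: "norm X \<le> 1" shows "norm (sqrt_lim X - sqrt_iter X n) \<le> 1 - sqrt_bound n"
proof (rule LIMSEQ_le)
  show "(\<lambda>k. norm (sqrt_iter X (n + k) - sqrt_iter X n)) \<longlonglongrightarrow> norm (sqrt_lim X - sqrt_iter X n)"
    using LIMSEQ_ignore_initial_segment[OF sqrt_iter_tendsto[OF X], of n]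
    by (intro tendsto_intros) (simp add: add.commute)
  show "(\<lambda>k. sqrt_bound (n + k) - sqrt_bound n) \<longlonglongrightarrow> 1 - sqrt_bound n"
    using LIMSEQ_ignore_initial_segment[OF sqrt_bound_lim, of n]
    by (intro tendsto_intros) (simp add: add.commute)
qed (use sqrt_iter_diff[OF X] in blast)

lemma norm_sqrt_lim: "norm X \<le> 1 \<Longrightarrow> norm (sqrt_lim X) \<le> 1"
  using sqrt_lim_bound[of X 0] by simp

lemma sqrt_lim_square:
  assumes X: "norm X \<le> 1"
  shows "(id_blinfun - sqrt_lim X) o\<^sub>L (id_blinfun - sqrt_lim X) = id_blinfun - X"
proof -
  have "(\<lambda>n. sqrt_iter X (Suc n)) \<longlonglongrightarrow> (1/2) *\<^sub>R (X + (sqrt_lim X o\<^sub>L sqrt_lim X))"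
    unfolding sqrt_iter.simps
    by (intro tendsto_intros tendsto_blinfun_compose sqrt_iter_tendsto X)
  then have "sqrt_lim X = (1/2) *\<^sub>R (X + (sqrt_lim X o\<^sub>L sqrt_lim X))"
    using LIMSEQ_Suc[OF sqrt_iter_tendsto[OF X]] LIMSEQ_unique by blast
  then have e: "2 *\<^sub>R sqrt_lim X = X + (sqrt_lim X o\<^sub>L sqrt_lim X)" by (metis scaleR_half_double scaleR_scaleR mult_2 mult.right_neutral scaleR_2 scaleR_add_right)
  show ?thesis
  proof (rule blinfun_eqI)
    fix u
    have "2 *\<^sub>R sqrt_lim X u = X u + sqrt_lim X (sqrt_lim X u)"
      using arg_cong[OF e, of "\<lambda>A. blinfun_apply A u"] by (simp add: bl)
    then show "((id_blinfun - sqrt_lim X) o\<^sub>L (id_blinfun - sqrt_lim X)) u = (id_blinfun - X) u"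
      by (simp add: bl scaleR_2 algebra_simps)
  qed
qed

lemma comm_sqrt_iter: "comm C X \<Longrightarrow> comm C (sqrt_iter X n)"
  by (induction n) (auto intro!: comm_intros)

lemma comm_sqrt_lim: "norm X \<le> 1 \<Longrightarrow> comm C X \<Longrightarrow> comm C (sqrt_lim X)"
  using comm_limit[OF sqrt_iter_tendsto] comm_sqrt_iter by blast

lemma adj_sqrt_iter: "adj X Y \<Longrightarrow> adj (sqrt_iter X n) (sqrt_iter Y n)"
  by (induction n) (auto intro!: adj_intros)

lemma adj_sqrt_lim: "norm X \<le> 1 \<Longrightarrow> adj X Y \<Longrightarrow> adj (sqrt_lim X) (sqrt_lim Y)"
  using adj_limit[OF sqrt_iter_tendsto sqrt_iter_tendsto adj_sqrt_iter] adj_norm_le[of X Y] by fastforce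

lemma sqrt_iter_intertwine:
  assumes "B o\<^sub>L X = Y o\<^sub>L B" shows "B o\<^sub>L sqrt_iter X n = sqrt_iter Y n o\<^sub>L B"
proof (induction n)
  case (Suc n)
  have 1: "B (X u) = Y (B u)" for u using assms by (metis blinfun_apply_blinfun_compose)
  have 2: "B (sqrt_iter X n u) = sqrt_iter Y n (B u)" for u using Suc by (metis blinfun_apply_blinfun_compose)
  show ?case by (rule blinfun_eqI) (simp add: bl 1 2)
qed simp

text \<open>Each iterate is intertwined, hence so is the limit. It serves to move a square root
  across the operator that is being transported by a congruence.\<close>

lemma sqrt_lim_intertwine:
  assumes "B o\<^sub>L X = Y o\<^sub>L B" "norm X \<le> 1" "norm Y \<le> 1"
  shows "B o\<^sub>L sqrt_lim X = sqrt_lim Y o\<^sub>L B"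
proof (rule LIMSEQ_unique)
  show "(\<lambda>n. B o\<^sub>L sqrt_iter X n) \<longlonglongrightarrow> (B o\<^sub>L sqrt_lim X)"
    by (intro tendsto_blinfun_compose tendsto_const sqrt_iter_tendsto assms)
  show "(\<lambda>n. B o\<^sub>L sqrt_iter X n) \<longlonglongrightarrow> (sqrt_lim Y o\<^sub>L B)"
    unfolding sqrt_iter_intertwine[OF assms(1)]
    by (intro tendsto_blinfun_compose tendsto_const sqrt_iter_tendsto assms)
qed

lemma continuous_on_sqrt_lim: "continuous_on (cball 0 1) sqrt_lim"
proof (rule uniform_limit_theorem)
  show "\<forall>\<^sub>F n in sequentially. continuous_on (cball 0 1) (\<lambda>X. sqrt_iter X n)"
  proof (intro always_eventually allI)
    show "continuous_on (cball 0 1) (\<lambda>X. sqrt_iter X n)" for n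
      by (induction n) (auto intro!: continuous_intros continuous_on_blinfun_compose)
  qed
  show "uniform_limit (cball 0 1) (\<lambda>n X. sqrt_iter X n) sqrt_lim sequentially"
  proof (rule uniform_limitI)
    fix e :: real assume "e > 0"
    then have "\<forall>\<^sub>F n in sequentially. dist (sqrt_bound n) 1 < e"
      using sqrt_bound_lim tendstoD by blast
    then show "\<forall>\<^sub>F n in sequentially. \<forall>X\<in>cball 0 1. dist (sqrt_iter X n) (sqrt_lim X) < e"
    proof eventually_elim
      case (elim n)
      then show ?case
        using sqrt_lim_bound[of _ n] by (fastforce simp: dist_norm norm_minus_commute)
    qed
  qed
qed simp

text \<open>Polarisation with \<open>v\<close> in the direction of \<open>X u\<close> and of the
  norm of \<open>u\<close>: the values of the form at \<open>u + v\<close> and \<open>u - v\<close>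
  recover \<open>X u \<bullet> v\<close>, and the parallelogram law sums their bounds.\<close>

lemma sa_norm_le:
  assumes X: "adj X X" and b: "\<And>u. \<bar>X u \<bullet> u\<bar> \<le> c * (norm u)\<^sup>2"
  shows "norm (X u) \<le> c * norm u"
proof (cases "X u = 0 \<or> u = 0")
  case True
  have "0 \<le> c" if "u \<noteq> 0"
    using b[of u] that by (metis abs_ge_zero order_trans zero_le_mult_iff zero_less_norm_iff zero_less_power not_less)
  then show ?thesis using True by (cases "u = 0") auto
next
  case False
  define v where "v = (norm u / norm (X u)) *\<^sub>R X u"
  have nv: "norm v = norm u" using False by (simp add: v_def)
  have "4 * (X u \<bullet> v) = X (u + v) \<bullet> (u + v) - X (u - v) \<bullet> (u - v)"
    using adjD[OF X, of v u] by (simp add: bl inner_simps inner_commute)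
  also have "\<dots> \<le> c * (norm (u + v))\<^sup>2 + c * (norm (u - v))\<^sup>2"
    using b[of "u + v"] b[of "u - v"] by linarith
  also have "\<dots> = c * (2 * (norm u)\<^sup>2 + 2 * (norm v)\<^sup>2)"
    by (simp add: power2_norm_eq_inner inner_simps inner_commute algebra_simps)
  finally have "X u \<bullet> v \<le> c * (norm u * norm u)" by (simp add: nv power2_eq_square)
  moreover have "X u \<bullet> v = norm u * norm (X u)"
    using False by (simp add: v_def power2_norm_eq_inner[symmetric] power2_eq_square)
  ultimately have "norm u * norm (X u) \<le> norm u * (c * norm u)" by (simp add: mult_ac)
  then show ?thesis using False by simp
qed

text \<open>Rescaled to \<open>1 - A / c\<close>, the operator has a quadratic form between 0 and
  the squared norm, so its norm is at most 1 and \<open>sqrt_lim\<close> applies. The root is a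
  limit of polynomials in \<open>A\<close>, which gives the commutation property.\<close>

lemma pos_sqrt_exists:
  fixes A :: "'h::{real_inner, complete_space} \<Rightarrow>\<^sub>L 'h"
  assumes A: "adj A A" "\<And>u. 0 \<le> A u \<bullet> u"
  obtains B where "adj B B" "\<And>u. 0 \<le> B u \<bullet> u" "B o\<^sub>L B = A" "\<And>C. comm C A \<Longrightarrow> comm C B"
proof -
  \<comment> \<open>Adding 1 secures \<open>c > 0\<close> also when \<open>A = 0\<close>.\<close>
  define c where "c = norm A + 1"
  have c: "c > 0" by (simp add: c_def add_nonneg_pos)
  define X where "X = id_blinfun - (1/c) *\<^sub>R A"
  have adjX: "adj X X" unfolding X_def by (intro adj_intros A)
  have "\<bar>X u \<bullet> u\<bar> \<le> 1 * (norm u)\<^sup>2" for u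
  proof -
    have "A u \<bullet> u \<le> norm A * norm u * norm u"
      by (meson mult_right_mono norm_blinfun norm_cauchy_schwarz norm_ge_zero order_trans)
    also have "\<dots> \<le> c * (norm u)\<^sup>2" by (simp add: c_def power2_eq_square algebra_simps)
    finally have "A u \<bullet> u / c \<le> (norm u)\<^sup>2" using c by (simp add: field_simps)
    moreover have "A u \<bullet> u / c \<ge> 0" using A c by simp
    ultimately show ?thesis by (simp add: X_def bl inner_simps power2_norm_eq_inner)
  qed
  then have X1: "norm X \<le> 1" by (intro norm_blinfun_bound sa_norm_le[OF adjX]) auto
  define Y where "Y = id_blinfun - sqrt_lim X"
  define B where "B = sqrt c *\<^sub>R Y"
  have "adj B B" unfolding B_def Y_def by (intro adj_intros adj_sqrt_lim X1 adjX)
  moreover have "0 \<le> B u \<bullet> u" for u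
  proof -
    have "sqrt_lim X u \<bullet> u \<le> norm (sqrt_lim X u) * norm u" by (rule norm_cauchy_schwarz)
    also have "\<dots> \<le> 1 * norm u * norm u"
      by (intro mult_right_mono order_trans[OF norm_blinfun] norm_sqrt_lim X1) auto
    finally have "0 \<le> Y u \<bullet> u"
      by (simp add: Y_def bl inner_simps power2_norm_eq_inner[symmetric] power2_eq_square)
    then show ?thesis using c by (simp add: B_def bl)
  qed
  moreover have "B o\<^sub>L B = A"
  proof -
    have "B o\<^sub>L B = c *\<^sub>R (Y o\<^sub>L Y)"
      using c by (intro blinfun_eqI) (simp add: B_def bl)
    also have "\<dots> = A" unfolding Y_def sqrt_lim_square[OF X1]
      using c by (simp add: X_def)
    finally show ?thesis .
  qed
  moreover have "comm C B" if "comm C A" for C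
    unfolding B_def Y_def by (intro comm_intros comm_sqrt_lim X1) (simp add: X_def comm_intros that)
  ultimately show ?thesis by (rule that)
qed

section \<open>The spectral theorem\<close>

text \<open>With \<open>A = B o\<^sub>L B\<close>, the number \<open>A u \<bullet> u\<close> is the
  squared norm of \<open>B u\<close>.\<close>

lemma pos_null:
  fixes A :: "'h::{real_inner, complete_space} \<Rightarrow>\<^sub>L 'h"
  assumes "adj A A" "\<And>u. 0 \<le> A u \<bullet> u" "A u \<bullet> u = 0" shows "A u = 0"
proof -
  obtain B where B: "adj B B" "B o\<^sub>L B = A" using pos_sqrt_exists[OF assms(1,2)] by metis
  have AB: "A u = B (B u)" using B(2) by auto
  then have "B u \<bullet> B u = 0" using assms(3) adjD[OF B(1)] by simp
  then show ?thesis by (simp add: AB)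
qed

text \<open>A positive root of the square of \<open>A\<close>. Its commutation property is part of
  the choice because it carries equivariance, and the invariance of \<open>H\<close>, over to the
  spectral projections.\<close>

definition op_abs :: "('h::{real_inner, complete_space} \<Rightarrow>\<^sub>L 'h) \<Rightarrow> ('h \<Rightarrow>\<^sub>L 'h)" where
  "op_abs A = (SOME B. adj B B \<and> (\<forall>u. 0 \<le> blinfun_apply B u \<bullet> u) \<and> B o\<^sub>L B = A o\<^sub>L A \<and>
     (\<forall>C. comm C (A o\<^sub>L A) \<longrightarrow> comm C B))"

lemma op_abs:
  assumes A: "adj A A"
  shows "adj (op_abs A) (op_abs A)" "0 \<le> op_abs A u \<bullet> u" "op_abs A o\<^sub>L op_abs A = A o\<^sub>L A"
    "comm C A \<Longrightarrow> comm C (op_abs A)"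
proof -
  have "adj (A o\<^sub>L A) (A o\<^sub>L A)" by (intro adj_intros A)
  moreover have "0 \<le> (A o\<^sub>L A) v \<bullet> v" for v using adjD[OF A, of "A v" v] by simp
  ultimately obtain B where "adj B B \<and> (\<forall>u. 0 \<le> blinfun_apply B u \<bullet> u) \<and> B o\<^sub>L B = A o\<^sub>L A \<and>
     (\<forall>C. comm C (A o\<^sub>L A) \<longrightarrow> comm C B)"
    using pos_sqrt_exists by metis
  then have *: "adj (op_abs A) (op_abs A) \<and> (\<forall>u. 0 \<le> op_abs A u \<bullet> u) \<and>
     op_abs A o\<^sub>L op_abs A = A o\<^sub>L A \<and> (\<forall>C. comm C (A o\<^sub>L A) \<longrightarrow> comm C (op_abs A))"
    unfolding op_abs_def by (rule someI)
  then show "adj (op_abs A) (op_abs A)" "0 \<le> op_abs A u \<bullet> u" "op_abs A o\<^sub>L op_abs A = A o\<^sub>L A"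
    by auto
  show "comm C A \<Longrightarrow> comm C (op_abs A)" using * by (auto intro: comm_compose)
qed

text \<open>\<open>sle T t\<close> and \<open>slt T t\<close> are the spectral projections of \<open>T\<close> for \<open>(-\<infinity>, t]\<close> and \<open>(-\<infinity>, t)\<close>.
  The kernel of the positive part of \<open>T - t\<close> is the range of the former.\<close>

definition sle :: "('h::{real_inner, complete_space} \<Rightarrow>\<^sub>L 'h) \<Rightarrow> real \<Rightarrow> ('h \<Rightarrow>\<^sub>L 'h)" where
  "sle T t = proj {u. (op_abs (T - t *\<^sub>R id_blinfun) + (T - t *\<^sub>R id_blinfun)) u = 0}"

definition slt :: "('h::{real_inner, complete_space} \<Rightarrow>\<^sub>L 'h) \<Rightarrow> real \<Rightarrow> ('h \<Rightarrow>\<^sub>L 'h)" where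
  "slt T t = id_blinfun - sle (- T) (- t)"

lemma is_proj_sle: "is_proj (sle T t)"
  unfolding sle_def by (rule is_proj_proj[OF subspace_kernel closed_kernel])

lemma is_proj_slt: "is_proj (slt T t)"
  unfolding slt_def by (intro is_proj_compl is_proj_sle)

lemma comm_sle:
  assumes "adj T T" "adj C C'" "comm C T" "comm C' T" shows "comm C (sle T t)"
proof -
  have a: "adj (T - t *\<^sub>R id_blinfun) (T - t *\<^sub>R id_blinfun)" by (intro adj_intros assms)
  have "comm C (T - t *\<^sub>R id_blinfun)" "comm C' (T - t *\<^sub>R id_blinfun)" by (intro comm_intros assms)+
  then show ?thesis
    unfolding sle_def by (intro comm_proj_kernel[OF assms(2)] comm_add op_abs(4)[OF a]) auto
qed

lemma comm_slt:
  assumes "adj T T" "adj C C'" "comm C T" "comm C' T" shows "comm C (slt T t)"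
  unfolding slt_def using assms by (intro comm_intros comm_sle[of _ _ C']) (auto intro: adj_minus comm_minus)

text \<open>On the kernel of \<open>D + A\<close>, with \<open>A = T - t\<close> and
  \<open>D\<close> its absolute value, \<open>A u = - D u\<close> and \<open>D\<close> is
  positive.\<close>

lemma sle_range:
  assumes T: "adj T T" and u: "sle T t u = u" shows "T u \<bullet> u \<le> t * (u \<bullet> u)"
proof -
  let ?A = "T - t *\<^sub>R id_blinfun"
  have a: "adj ?A ?A" by (intro adj_intros T)
  have "u \<in> {u. (op_abs ?A + ?A) u = 0}"
    using u proj_fix_iff[OF subspace_kernel closed_kernel] unfolding sle_def by blast
  then have "?A u = - op_abs ?A u" by (simp add: bl eq_neg_iff_add_eq_0 add.commute)
  then have "?A u \<bullet> u = - (op_abs ?A u \<bullet> u)" by simp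
  then have "?A u \<bullet> u \<le> 0" using op_abs(2)[OF a, of u] by linarith
  then show ?thesis by (simp add: bl inner_simps)
qed

text \<open>From \<open>(D + A) (D - A) = D^2 - A^2 = 0\<close> the range of \<open>D - A\<close>
  lies in the kernel of \<open>D + A\<close>, to which \<open>u\<close> is orthogonal; hence
  \<open>(D - A) u\<close> has norm 0 and \<open>D u = A u\<close>. If the form vanished at
  \<open>u\<close>, \<open>pos_null\<close> would give \<open>D u = 0\<close> and place
  \<open>u\<close> itself in that kernel.\<close>

lemma sle_kernel:
  assumes T: "adj T T" and u: "sle T t u = 0" "u \<noteq> 0" shows "t * (u \<bullet> u) < T u \<bullet> u"
proof -
  let ?A = "T - t *\<^sub>R id_blinfun"
  let ?D = "op_abs ?A"
  let ?K = "{u. (?D + ?A) u = 0}"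
  have a: "adj ?A ?A" by (intro adj_intros T)
  have orth: "u \<bullet> v = 0" if "v \<in> ?K" for v
    using u that proj_0_iff[OF subspace_kernel closed_kernel] unfolding sle_def by blast
  have c: "?A (?D v) = ?D (?A v)" for v using op_abs(4)[OF a comm_refl] by (rule commD)
  have d: "?D (?D v) = ?A (?A v)" for v
    using op_abs(3)[OF a] by (metis blinfun_apply_blinfun_compose)
  have K: "(?D - ?A) v \<in> ?K" for v
    using c[of v] d[of v] unfolding mem_Collect_eq by (simp only: blinfun.add_left blinfun.diff_left blinfun.diff_right) simp
  have "adj (?D - ?A) (?D - ?A)" by (intro adj_diff op_abs(1) a)
  then have "(?D - ?A) u \<bullet> (?D - ?A) u = u \<bullet> (?D - ?A) ((?D - ?A) u)" by (rule adjD)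
  also have "\<dots> = 0" by (intro orth K)
  finally have "(?D - ?A) u = 0" by simp
  then have DA: "?D u = ?A u" by (simp add: blinfun.diff_left)
  have "?A u \<bullet> u \<noteq> 0"
  proof
    assume "?A u \<bullet> u = 0"
    then have "?D u = 0" using pos_null[OF op_abs(1,2)[OF a], of u] DA by simp
    then have "u \<in> ?K" using DA by (simp add: blinfun.add_left)
    then show False using orth[of u] u(2) by simp
  qed
  moreover have "?A u \<bullet> u \<ge> 0" using op_abs(2)[OF a, of u] DA by simp
  ultimately show ?thesis by (simp add: bl inner_simps)
qed

lemma sle_kernel_le:
  assumes "adj T T" "sle T t u = 0" shows "t * (u \<bullet> u) \<le> T u \<bullet> u"
  using sle_kernel[OF assms] by (cases "u = 0") auto

lemma slt_range:
  assumes "adj T T" "slt T t u = u" "u \<noteq> 0" shows "T u \<bullet> u < t * (u \<bullet> u)"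
  using sle_kernel[of "- T" "- t" u] assms by (simp add: slt_def bl adj_minus)

lemma slt_range_le:
  assumes "adj T T" "slt T t u = u" shows "T u \<bullet> u \<le> t * (u \<bullet> u)"
  using slt_range[OF assms] by (cases "u = 0") auto

lemma slt_kernel:
  assumes "adj T T" "slt T t u = 0" shows "t * (u \<bullet> u) \<le> T u \<bullet> u"
  using sle_range[of "- T" "- t" u] assms by (simp add: slt_def bl adj_minus)

text \<open>Since \<open>(t - T)P\<close> is positive and commutes with \<open>R\<^sup>* R\<close> for \<open>R = QP\<close>, the inequality
  \<open>T \<le> t\<close> passes from the range of \<open>P\<close> to the range of \<open>R\<close>.\<close>

lemma intertwine_zero:
  fixes T :: "'h::{real_inner, complete_space} \<Rightarrow>\<^sub>L 'h"
  assumes T: "adj T T" and P: "is_proj P" "comm P T" and Q: "adj Q Q" "comm Q T"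
    and le: "\<And>u. P u = u \<Longrightarrow> T u \<bullet> u \<le> t * (u \<bullet> u)"
    and gt: "\<And>u. Q u \<noteq> 0 \<Longrightarrow> t * (Q u \<bullet> Q u) < T (Q u) \<bullet> Q u"
  shows "Q (P u) = 0"
proof -
  define A where "A = (t *\<^sub>R id_blinfun - T) o\<^sub>L P"
  have cTP: "comm (t *\<^sub>R id_blinfun - T) P" using P by (intro comm_sym[OF comm_diff] comm_intros)
  have PP: "adj P P" using P is_projD by blast
  have "adj (t *\<^sub>R id_blinfun - T) (t *\<^sub>R id_blinfun - T)" by (intro adj_intros T)
  from adj_compose[OF this PP] have A1: "adj A A" using cTP unfolding A_def comm_def by simp
  have TP: "P (T v) = T (P v)" for v using P(2) by (rule commD)
  have TQ: "Q (T v) = T (Q v)" for v using Q(2) by (rule commD)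
  have A2: "0 \<le> A v \<bullet> v" for v
  proof -
    have "A v \<bullet> v = P (t *\<^sub>R P v - T (P v)) \<bullet> v"
      by (simp add: A_def bl is_projD(2)[OF P(1)] TP)
    also have "\<dots> = (t *\<^sub>R P v - T (P v)) \<bullet> P v" by (rule is_projD(3)[OF P(1)])
    also have "\<dots> = t * (P v \<bullet> P v) - T (P v) \<bullet> P v" by (simp add: inner_simps)
    finally show ?thesis using le[of "P v"] is_projD(2)[OF P(1)] by simp
  qed
  obtain B where B: "adj B B" "B o\<^sub>L B = A" "\<And>C. comm C A \<Longrightarrow> comm C B"
    using pos_sqrt_exists[OF A1 A2] by metis
  define C where "C = P o\<^sub>L Q o\<^sub>L Q o\<^sub>L P"
  have Cv: "C v = P (Q (Q (P v)))" for v by (simp add: C_def)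
  have "comm C A"
    by (rule commI) (simp add: A_def Cv bl TP TQ is_projD(2)[OF P(1)])
  then have CB: "C (B v) = B (C v)" for v using B(3) commD by blast
  have BB: "A v = B (B v)" for v using B(2) by auto
  have "0 \<le> Q (P (B u)) \<bullet> Q (P (B u))" by simp
  also have "\<dots> = C (B u) \<bullet> B u"
    by (simp add: Cv is_projD(3)[OF P(1)] adjD[OF Q(1)])
  also have "\<dots> = A (C u) \<bullet> u" by (simp add: CB BB adjD[OF B(1)])
  also have "\<dots> = t * (C u \<bullet> u) - T (C u) \<bullet> u"
    by (simp add: A_def bl inner_simps Cv is_projD(2)[OF P(1)])
  also have "C u \<bullet> u = Q (P u) \<bullet> Q (P u)"
    by (simp add: Cv is_projD(3)[OF P(1)] adjD[OF Q(1)])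
  also have "T (C u) \<bullet> u = T (Q (P u)) \<bullet> Q (P u)"
    by (simp add: Cv TP[symmetric] TQ[symmetric] is_projD(3)[OF P(1)] adjD[OF Q(1)])
  finally show ?thesis using gt[of "P u"] by fastforce
qed

lemma comm_sle_self: "adj T T \<Longrightarrow> comm (sle T t) T"
  by (rule comm_sym, rule comm_sle) auto

lemma comm_slt_self: "adj T T \<Longrightarrow> comm (slt T t) T"
  by (rule comm_sym, rule comm_slt) auto

text \<open>The form of \<open>T\<close> is at most \<open>t\<close> on the range of
  \<open>P\<close> and above \<open>t\<close> on the kernel of \<open>Q\<close>, so
  \<open>(1 - Q) P = 0\<close> by \<open>intertwine_zero\<close>; the second equation is the adjoint
  of the first. This criterion is the source of the order relations between \<open>sle\<close> and
  \<open>slt\<close>.\<close>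

lemma proj_leI:
  fixes T :: "'h::{real_inner, complete_space} \<Rightarrow>\<^sub>L 'h"
  assumes T: "adj T T" and P: "is_proj P" "comm P T" and Q: "is_proj Q" "comm Q T"
    and le: "\<And>u. P u = u \<Longrightarrow> T u \<bullet> u \<le> t * (u \<bullet> u)"
    and gt: "\<And>u. Q u = 0 \<Longrightarrow> u \<noteq> 0 \<Longrightarrow> t * (u \<bullet> u) < T u \<bullet> u"
  shows "Q (P u) = P u" "P (Q u) = P u"
proof -
  have 1: "Q (P u) = P u" for u
  proof -
    have "comm (id_blinfun - Q) T" using Q by (intro comm_sym[OF comm_diff] comm_intros) (auto simp: comm_sym)
    then have "(id_blinfun - Q) (P u) = 0"
    proof (rule intertwine_zero[OF T P is_projD(1)[OF is_proj_compl[OF Q(1)]] _ le])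
      fix u assume "(id_blinfun - Q) u \<noteq> 0"
      then show "t * ((id_blinfun - Q) u \<bullet> (id_blinfun - Q) u) < T ((id_blinfun - Q) u) \<bullet> (id_blinfun - Q) u"
        using is_projD(2)[OF Q(1)] by (intro gt) (auto simp: bl)
    qed
    then show ?thesis by (simp add: bl)
  qed
  then have "Q o\<^sub>L P = P" by (auto intro: blinfun_eqI)
  moreover have "adj (Q o\<^sub>L P) (P o\<^sub>L Q)" by (intro adj_compose is_projD P Q)
  ultimately have "P o\<^sub>L Q = P" using P(1) adj_unique is_projD(1) by metis
  then show "P (Q u) = P u" by (metis blinfun_apply_blinfun_compose)
  show "Q (P u) = P u" by (rule 1)
qed

lemma sle_mono:
  assumes T: "adj T T" and "s \<le> t"
  shows "sle T t (sle T s u) = sle T s u" "sle T s (sle T t u) = sle T s u"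
proof -
  have *: "T u \<bullet> u \<le> t * (u \<bullet> u)" if "sle T s u = u" for u
    using sle_range[OF T that] mult_right_mono[OF assms(2), of "u \<bullet> u"] by simp
  note 1 = proj_leI[OF T is_proj_sle comm_sle_self[OF T] is_proj_sle comm_sle_self[OF T] * sle_kernel[OF T], simplified]
  show "sle T t (sle T s u) = sle T s u" "sle T s (sle T t u) = sle T s u" by (rule 1; simp)+
qed

lemma sle_min:
  assumes T: "adj T T" shows "sle T s (sle T t u) = sle T (min s t) u"
  using sle_mono[OF T] by (cases "s \<le> t") (auto simp: min_def)

lemma slt_le_sle:
  assumes T: "adj T T" and "s \<le> t"
  shows "sle T t (slt T s u) = slt T s u" "slt T s (sle T t u) = slt T s u"
proof -
  have *: "T u \<bullet> u \<le> t * (u \<bullet> u)" if "slt T s u = u" for u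
    using slt_range_le[OF T that] mult_right_mono[OF assms(2), of "u \<bullet> u"] by simp
  note 1 = proj_leI[OF T is_proj_slt comm_slt_self[OF T] is_proj_sle comm_sle_self[OF T] * sle_kernel[OF T], simplified]
  show "sle T t (slt T s u) = slt T s u" "slt T s (sle T t u) = slt T s u" by (rule 1; simp)+
qed

lemma sle_le_slt:
  assumes T: "adj T T" and "s < t"
  shows "slt T t (sle T s u) = sle T s u" "sle T s (slt T t u) = sle T s u"
proof -
  have *: "s * (u \<bullet> u) < T u \<bullet> u" if "slt T t u = 0" "u \<noteq> 0" for u
  proof -
    have "s * (u \<bullet> u) < t * (u \<bullet> u)" using that(2) assms(2) by simp
    then show ?thesis using slt_kernel[OF T that(1)] by simp
  qed
  note 1 = proj_leI[OF T is_proj_sle comm_sle_self[OF T] is_proj_slt comm_slt_self[OF T] sle_range[OF T] *, simplified]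
  show "slt T t (sle T s u) = sle T s u" "sle T s (slt T t u) = sle T s u" by (rule 1; simp)+
qed

lemma slt_mono:
  assumes T: "adj T T" and "s \<le> t"
  shows "slt T t (slt T s u) = slt T s u" "slt T s (slt T t u) = slt T s u"
  using sle_mono[of "- T" "- t" "- s" u] assms by (simp_all add: slt_def bl adj_minus)

lemma sle_top:
  assumes T: "adj T T" and "norm T \<le> t" shows "sle T t u = u"
proof (rule ccontr)
  define v where "v = u - sle T t u"
  assume "sle T t u \<noteq> u"
  then have v: "v \<noteq> 0" "sle T t v = 0" by (auto simp: v_def bl is_projD(2)[OF is_proj_sle])
  have "T v \<bullet> v \<le> norm T * norm v * norm v"
    by (meson mult_right_mono norm_blinfun norm_cauchy_schwarz norm_ge_zero order_trans)
  also have "\<dots> = norm T * (v \<bullet> v)" by (simp add: power2_norm_eq_inner[symmetric] power2_eq_square)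
  also have "\<dots> \<le> t * (v \<bullet> v)" by (intro mult_right_mono assms) simp
  finally show False using sle_kernel[OF T v(2,1)] by simp
qed

lemma sle_bot:
  assumes T: "adj T T" and "t < - norm T" shows "sle T t u = 0"
proof (rule ccontr)
  define v where "v = sle T t u"
  assume "sle T t u \<noteq> 0"
  then have v: "v \<noteq> 0" "sle T t v = v" by (auto simp: v_def is_projD(2)[OF is_proj_sle])
  have "(- T) v \<bullet> v \<le> norm (- T) * norm v * norm v"
    by (meson mult_right_mono norm_blinfun norm_cauchy_schwarz norm_ge_zero order_trans)
  also have "\<dots> = norm T * (v \<bullet> v)" by (simp add: power2_norm_eq_inner[symmetric] power2_eq_square)
  also have "\<dots> < - t * (v \<bullet> v)" using assms v(1) by (intro mult_strict_right_mono) auto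
  finally show False using sle_range[OF T v(2)] by (simp add: bl)
qed

text \<open>Along \<open>t + 1 / (n + 1)\<close> the vectors \<open>v\<close> have decreasing norms
  and satisfy Pythagoras, hence form a Cauchy sequence. Its limit is fixed by every
  \<open>sle T (x m)\<close> and killed by \<open>sle T t\<close>; unless it is 0, the form would be
  both at most and strictly above the level \<open>t\<close>.\<close>

lemma sle_right_continuous:
  assumes T: "adj T T"
  shows "((\<lambda>s. sle T s u) \<longlongrightarrow> sle T t u) (at_right t)"
proof -
  define v where "v s = sle T s u - sle T t u" for s
  have v_t: "sle T t (v s) = 0" if "t \<le> s" for s
    using that by (simp add: v_def bl sle_min[OF T] min_def)
  have v_diff: "v r = sle T r (v s)" if "t \<le> r" "r \<le> s" for r s
    using that sle_mono[OF T, of r s] sle_mono[OF T, of t r]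
    by (simp add: v_def bl)
  have pyth: "(norm (v s - v r))\<^sup>2 = (norm (v s))\<^sup>2 - (norm (v r))\<^sup>2" if "t \<le> r" "r \<le> s" for r s
    using is_proj_pyth[OF is_proj_sle[of T r], of "v s"] v_diff[OF that] by simp
  have mono: "norm (v r) \<le> norm (v s)" if "t \<le> r" "r \<le> s" for r s
    using is_proj_le[OF is_proj_sle] v_diff[OF that] by metis
  define x where "x n = t + 1 / Suc n" for n :: nat
  have xt: "t < x n" for n by (simp add: x_def)
  have xdec: "x n \<le> x m" if "m \<le> n" for m n
    using that by (auto simp: x_def intro!: divide_left_mono)
  have xlim: "x \<longlonglongrightarrow> t"
    using tendsto_add[OF tendsto_const[of t] LIMSEQ_inverse_real_of_nat]
    by (simp add: x_def[abs_def] inverse_eq_divide)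
  define q where "q n = (norm (v (x n)))\<^sup>2" for n
  have "decseq q"
    unfolding decseq_def q_def using less_imp_le[OF xt] by (auto intro!: power_mono mono xdec)
  then obtain l where "q \<longlonglongrightarrow> l"
    using decseq_convergent[of q 0] by (auto simp: q_def)
  then have qC: "Cauchy q" by (rule LIMSEQ_imp_Cauchy)
  have "Cauchy (\<lambda>n. v (x n))"
  proof (rule CauchyI')
    fix e :: real assume "e > 0"
    then obtain N where N: "\<And>m n. m \<ge> N \<Longrightarrow> n \<ge> N \<Longrightarrow> norm (q m - q n) < e\<^sup>2"
      using CauchyD[OF qC, of "e\<^sup>2"] by auto
    have "dist (v (x m)) (v (x n)) < e" if "m \<ge> N" "m < n" for m n
    proof -
      have "(norm (v (x m) - v (x n)))\<^sup>2 = q m - q n"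
        unfolding q_def using that xdec[of m n] xt[of n] by (intro pyth) auto
      also have "\<dots> < e\<^sup>2" using N[of m n] that by auto
      finally show ?thesis using \<open>e > 0\<close> by (simp add: dist_norm power_less_imp_less_base)
    qed
    then show "\<exists>M. \<forall>m\<ge>M. \<forall>n>m. dist (v (x m)) (v (x n)) < e" by blast
  qed
  then obtain w where w: "(\<lambda>n. v (x n)) \<longlonglongrightarrow> w" by (metis Cauchy_convergent_iff convergent_def)
  have w_t: "sle T t w = 0"
  proof (rule LIMSEQ_unique)
    show "(\<lambda>n. sle T t (v (x n))) \<longlonglongrightarrow> sle T t w" by (intro tendsto_intros w)
    show "(\<lambda>n. sle T t (v (x n))) \<longlonglongrightarrow> 0" using v_t xt by (simp add: less_imp_le)
  qed
  have w_m: "sle T (x m) w = w" for m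
  proof (rule LIMSEQ_unique)
    show "(\<lambda>n. sle T (x m) (v (x n))) \<longlonglongrightarrow> sle T (x m) w" by (intro tendsto_intros w)
    have "sle T (x m) (v (x n)) = v (x n)" if "n \<ge> m" for n
      using sle_mono(1)[OF T xdec[OF that]] sle_mono(1)[OF T less_imp_le[OF xt]] by (simp add: v_def bl)
    then show "(\<lambda>n. sle T (x m) (v (x n))) \<longlonglongrightarrow> w"
      by (intro Lim_transform_eventually[OF w]) (auto simp: eventually_sequentially intro!: exI[of _ m])
  qed
  have "T w \<bullet> w \<le> t * (w \<bullet> w)"
  proof (rule LIMSEQ_le_const)
    show "(\<lambda>m. x m * (w \<bullet> w)) \<longlonglongrightarrow> t * (w \<bullet> w)" by (intro tendsto_intros xlim)
    show "\<exists>N. \<forall>n\<ge>N. T w \<bullet> w \<le> x n * (w \<bullet> w)" using sle_range[OF T w_m] by blast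
  qed
  then have "w = 0" using sle_kernel[OF T w_t] by fastforce
  then have vlim: "(\<lambda>n. norm (v (x n))) \<longlonglongrightarrow> 0" using tendsto_norm[OF w] by simp
  have "((\<lambda>s. v s) \<longlongrightarrow> 0) (at_right t)"
  proof (rule tendstoI)
    fix e :: real assume "e > 0"
    then obtain n where n: "norm (v (x n)) < e"
      using order_tendstoD(2)[OF vlim, of e] by (auto simp: eventually_sequentially)
    have "dist (v s) 0 < e" if "t < s" "s < x n" for s
      using mono[of s "x n"] that n by simp
    then show "\<forall>\<^sub>F s in at_right t. dist (v s) 0 < e"
      using xt[of n] eventually_at_right_less by (auto simp: eventually_at_right[of t "x n"])
  qed
  then show ?thesis unfolding v_def by (simp add: LIM_zero_iff)
qed

text \<open>Right continuity for \<open>- T\<close> is left continuity of \<open>slt T\<close>. For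
  \<open>s < t\<close> the vector \<open>slt T t u - sle T s u\<close> is a projection of
  \<open>slt T t u - slt T s u\<close>, hence no longer than it.\<close>

lemma sle_left_limit:
  assumes T: "adj T T"
  shows "((\<lambda>s. sle T s u) \<longlongrightarrow> slt T t u) (at_left t)"
proof -
  have "((\<lambda>s. sle (- T) s u) \<longlongrightarrow> sle (- T) (- t) u) (at_right (- t))"
    by (intro sle_right_continuous adj_minus T)
  then have "((\<lambda>s. sle (- T) (- s) u) \<longlongrightarrow> sle (- T) (- t) u) (at_left t)"
    by (simp add: at_left_minus filterlim_filtermap)
  from tendsto_diff[OF tendsto_const[of u] this]
  have "((\<lambda>s. u - sle (- T) (- s) u) \<longlongrightarrow> u - sle (- T) (- t) u) (at_left t)" .
  moreover have "slt T s u = u - sle (- T) (- s) u" for s by (simp add: slt_def bl)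
  ultimately have "((\<lambda>s. slt T s u) \<longlongrightarrow> slt T t u) (at_left t)" by simp
  from tendsto_diff[OF tendsto_const[of "slt T t u"] this]
  have lim: "((\<lambda>s. slt T t u - slt T s u) \<longlongrightarrow> 0) (at_left t)" by simp
  have "((\<lambda>s. slt T t u - sle T s u) \<longlongrightarrow> 0) (at_left t)"
  proof (rule Lim_null_comparison[OF _ tendsto_norm_zero[OF lim]])
    have "norm (slt T t u - sle T s u) \<le> norm (slt T t u - slt T s u)" if "s < t" for s
    proof -
      have "slt T t u - sle T s u = (id_blinfun - sle T s) (slt T t u - slt T s u)"
        using sle_le_slt[OF T that] slt_le_sle[OF T order_refl, of s] by (simp add: bl)
      then show ?thesis using is_proj_le[OF is_proj_compl[OF is_proj_sle]] by metis
    qed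
    then show "\<forall>\<^sub>F s in at_left t. norm (slt T t u - sle T s u) \<le> norm (slt T t u - slt T s u)"
      by (auto simp: eventually_at_filter)
  qed
  from tendsto_diff[OF tendsto_const[of "slt T t u"] this] show ?thesis by simp
qed

subsection \<open>Stieltjes integrals\<close>

text \<open>Cutting the interval into \<open>n + 1\<close> equal parts bounds the change of
  \<open>D\<close> by \<open>(b - a) * (F b - F a) / (n + 1)\<close>, because the increments of
  \<open>F\<close> telescope.\<close>

lemma quadratic_variation_zero:
  fixes D F :: "real \<Rightarrow> real"
  assumes "a \<le> b" and D: "\<And>s t. s \<le> t \<Longrightarrow> \<bar>D t - D s\<bar> \<le> (t - s) * (F t - F s)"
  shows "D b = D a"
proof -
  have *: "\<bar>D b - D a\<bar> \<le> (b - a) * (F b - F a) / Suc n" for n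
  proof -
    define h where "h = (b - a) / Suc n"
    have h0: "h \<ge> 0" using assms by (simp add: h_def)
    have "\<bar>D (a + k * h) - D a\<bar> \<le> h * (F (a + k * h) - F a)" for k :: nat
    proof (induction k)
      case (Suc k)
      have "\<bar>D (a + Suc k * h) - D (a + k * h)\<bar> \<le> h * (F (a + Suc k * h) - F (a + k * h))"
        using D[of "a + k * h" "a + Suc k * h"] h0 by (simp add: algebra_simps)
      then show ?case using Suc unfolding right_diff_distrib by linarith
    qed simp
    from this[of "Suc n"] show ?thesis by (simp add: h_def)
  qed
  have "(\<lambda>n. (b - a) * (F b - F a) / Suc n) \<longlonglongrightarrow> 0"
    using tendsto_mult[OF tendsto_const[of "(b - a) * (F b - F a)"] LIMSEQ_inverse_real_of_nat]
    by (simp add: field_simps)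
  then have "\<bar>D b - D a\<bar> \<le> 0" by (rule LIMSEQ_le_const) (use * in blast)
  then show ?thesis by simp
qed

context
  fixes F :: "real \<Rightarrow> real" and r c :: real
  assumes mono: "\<And>s t. s \<le> t \<Longrightarrow> F s \<le> F t" and rc: "\<And>t. continuous (at_right t) F"
    and bot: "\<And>t. t < - r \<Longrightarrow> F t = 0" and top: "\<And>t. r \<le> t \<Longrightarrow> F t = c"
begin

lemma stieltjes_Ioc: "s \<le> t \<Longrightarrow> emeasure (interval_measure F) {s<..t} = F t - F s"
  using mono rc by (intro emeasure_interval_measure_Ioc) auto

lemma stieltjes_AE_le:
  assumes "\<And>t. x \<le> t \<Longrightarrow> F t = F x" shows "AE t in interval_measure F. t \<le> x"
proof -
  have "{x<..x + n} \<in> null_sets (interval_measure F)" for n :: nat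
    using stieltjes_Ioc[of x "x + n"] assms[of "x + n"] by (intro null_setsI) auto
  then have N: "(\<Union>n::nat. {x<..x + n}) \<in> null_sets (interval_measure F)" by (rule null_sets_UN)
  have S: "{x<..} \<subseteq> (\<Union>n::nat. {x<..x + n})"
  proof
    fix y assume "y \<in> {x<..}"
    moreover obtain n :: nat where "y - x < n" using reals_Archimedean2 by blast
    ultimately show "y \<in> (\<Union>n::nat. {x<..x + n})" by (intro UN_I[of n]) auto
  qed
  have "{x<..} \<in> null_sets (interval_measure F)" by (rule null_sets_subset[OF N _ S]) simp
  then show ?thesis by (rule AE_I') auto
qed

lemma stieltjes_AE_gt:
  assumes "\<And>t. t \<le> x \<Longrightarrow> F t = F x" shows "AE t in interval_measure F. x < t"
proof -
  have "{x - n<..x} \<in> null_sets (interval_measure F)" for n :: nat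
    using stieltjes_Ioc[of "x - n" x] assms[of "x - n"] by (intro null_setsI) auto
  then have N: "(\<Union>n::nat. {x - n<..x}) \<in> null_sets (interval_measure F)" by (rule null_sets_UN)
  have S: "{..x} \<subseteq> (\<Union>n::nat. {x - n<..x})"
  proof
    fix y assume "y \<in> {..x}"
    moreover obtain n :: nat where "x - y < n" using reals_Archimedean2 by blast
    ultimately show "y \<in> (\<Union>n::nat. {x - n<..x})" by (intro UN_I[of n]) auto
  qed
  have "{..x} \<in> null_sets (interval_measure F)" by (rule null_sets_subset[OF N _ S]) simp
  then show ?thesis by (rule AE_I') auto
qed

text \<open>\<open>F\<close> is known to vanish only for \<open>t < - r\<close>, so there may be
  mass at \<open>- r\<close>; the extra 1 on the left includes it, and \<open>\<bar>r\<bar>\<close>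
  makes the interval nonempty for either sign of \<open>r\<close>.\<close>

lemma stieltjes_support: "AE t in interval_measure F. - \<bar>r\<bar> - 1 < t \<and> t \<le> \<bar>r\<bar>"
proof -
  have "AE t in interval_measure F. - \<bar>r\<bar> - 1 < t" by (intro stieltjes_AE_gt) (auto simp: bot)
  moreover have "AE t in interval_measure F. t \<le> \<bar>r\<bar>" by (intro stieltjes_AE_le) (auto simp: top)
  ultimately show ?thesis by eventually_elim simp
qed

lemma stieltjes_total: "emeasure (interval_measure F) UNIV = c"
proof -
  have "emeasure (interval_measure F) UNIV = emeasure (interval_measure F) {- \<bar>r\<bar> - 1<..\<bar>r\<bar>}"
    using stieltjes_support by (intro emeasure_eq_AE) auto
  also have "\<dots> = c" by (simp add: stieltjes_Ioc bot top)
  finally show ?thesis .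
qed

lemma stieltjes_c: "0 \<le> c"
  using mono[of "- \<bar>r\<bar> - 1" "\<bar>r\<bar>"] bot[of "- \<bar>r\<bar> - 1"] top[of "\<bar>r\<bar>"] by simp

lemma stieltjes_finite: "finite_measure (interval_measure F)"
  by (rule finite_measureI) (simp add: stieltjes_total)

lemma stieltjes_measure: "measure (interval_measure F) UNIV = c"
  using stieltjes_total stieltjes_c by (simp add: measure_def)

lemma stieltjes_measure_Ioc: "s \<le> t \<Longrightarrow> measure (interval_measure F) {s<..t} = F t - F s"
  using stieltjes_Ioc mono[of s t] by (simp add: measure_def)

lemma stieltjes_integrable: "integrable (interval_measure F) (\<lambda>t. t)"
proof (rule finite_measure.integrable_const_bound[OF stieltjes_finite])
  show "AE x in interval_measure F. norm x \<le> \<bar>r\<bar> + 1"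
    using stieltjes_support by (rule eventually_mono) auto
qed simp

lemma stieltjes_Ioc_bounds:
  assumes "s \<le> t"
  shows "s * (F t - F s) \<le> (LINT x|interval_measure F. indicator {s<..t} x * x)"
    "(LINT x|interval_measure F. indicator {s<..t} x * x) \<le> t * (F t - F s)"
proof -
  interpret finite_measure "interval_measure F" by (rule stieltjes_finite)
  have i: "integrable (interval_measure F) (\<lambda>x. indicator {s<..t} x * x)"
    using integrable_mult_indicator[OF _ stieltjes_integrable, of "{s<..t}"] by simp
  have j: "integrable (interval_measure F) (\<lambda>x. indicator {s<..t} x * d)" for d :: real
    by (intro integrable_mult_left integrable_real_indicator) (auto simp: emeasure_eq_measure)
  have k: "(LINT x|interval_measure F. indicator {s<..t} x * d) = d * (F t - F s)" for d :: real
    using stieltjes_measure_Ioc[OF assms] by simp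
  show "s * (F t - F s) \<le> (LINT x|interval_measure F. indicator {s<..t} x * x)"
    unfolding k[symmetric] by (intro integral_mono i j) (auto simp: indicator_def)
  show "(LINT x|interval_measure F. indicator {s<..t} x * x) \<le> t * (F t - F s)"
    unfolding k[symmetric] by (intro integral_mono i j) (auto simp: indicator_def)
qed

text \<open>The partial integral \<open>\<psi>\<close> of the identity has increments between
  \<open>s\<close> and \<open>t\<close> times those of \<open>F\<close>, just as \<phi> has; the
  difference of the two therefore satisfies \<open>quadratic_variation_zero\<close> and is
  constant.\<close>

lemma stieltjes_characterization:
  assumes \<phi>: "\<And>s t. s \<le> t \<Longrightarrow> s * (F t - F s) \<le> \<phi> t - \<phi> s \<and> \<phi> t - \<phi> s \<le> t * (F t - F s)"
    and bot': "\<And>t. t < - r \<Longrightarrow> \<phi> t = 0" and top': "\<And>t. r \<le> t \<Longrightarrow> \<phi> t = d"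
  shows "(LINT t|interval_measure F. t) = d"
proof -
  define \<psi> where "\<psi> x = (LINT t|interval_measure F. indicator {..x} t * t)" for x :: real
  have i: "integrable (interval_measure F) (\<lambda>x. indicator A x * x)" if "A \<in> sets borel" for A
    using integrable_mult_indicator[OF _ stieltjes_integrable, of A] that by simp
  have diff: "\<psi> t - \<psi> s = (LINT x|interval_measure F. indicator {s<..t} x * x)" if "s \<le> t" for s t
  proof -
    have "\<psi> t - \<psi> s = (LINT x|interval_measure F. indicator {..t} x * x - indicator {..s} x * x)"
      unfolding \<psi>_def by (rule Bochner_Integration.integral_diff[symmetric]; rule i; simp)
    also have "\<dots> = (LINT x|interval_measure F. indicator {s<..t} x * x)"
      using that by (intro Bochner_Integration.integral_cong) (auto simp: indicator_def)
    finally show ?thesis .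
  qed
  define D where "D t = \<phi> t - \<psi> t" for t
  have "\<bar>D t - D s\<bar> \<le> (t - s) * (F t - F s)" if "s \<le> t" for s t
  proof -
    have "D t - D s = (\<phi> t - \<phi> s) - (\<psi> t - \<psi> s)" by (simp add: D_def)
    then show ?thesis
      using \<phi>[OF that] stieltjes_Ioc_bounds[OF that] unfolding diff[OF that] left_diff_distrib by linarith
  qed
  then have "D \<bar>r\<bar> = D (- \<bar>r\<bar> - 1)" by (intro quadratic_variation_zero[of _ _ D F]) auto
  moreover have "\<psi> \<bar>r\<bar> = (LINT t|interval_measure F. t)"
    unfolding \<psi>_def
    by (intro integral_cong_AE) (simp_all, rule eventually_mono[OF stieltjes_support], simp)
  moreover have "\<psi> (- \<bar>r\<bar> - 1) = (LINT t|interval_measure F. 0)"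
    unfolding \<psi>_def
    by (intro integral_cong_AE) (simp_all, rule eventually_mono[OF stieltjes_support], simp)
  ultimately show ?thesis using bot'[of "- \<bar>r\<bar> - 1"] top'[of "\<bar>r\<bar>"] by (simp add: D_def)
qed

end

subsection \<open>The spectral family\<close>

lemma hilbertD: "hilbert H \<Longrightarrow> subspace H" "hilbert H \<Longrightarrow> closed H"
  by (auto simp: hilbert_def)

lemma opsD:
  assumes "subspace H" "closed H" "T \<in> ops H"
  shows "T (proj H u) = T u" "proj H (T u) = T u" "T u \<in> H"
proof -
  have "\<forall>v\<in>H. (u - proj H u) \<bullet> v = 0" using proj_orth[OF assms(1,2)] by blast
  then have "T (u - proj H u) = 0" using assms(3) unfolding ops_def by blast
  then show 1: "T (proj H u) = T u" by (simp add: bl)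
  have "T (proj H u) \<in> H" using assms proj_in by (auto simp: ops_def)
  then show 2: "T u \<in> H" using 1 by simp
  then show "proj H (T u) = T u" using assms proj_ident by blast
qed

lemma opsI:
  assumes "subspace H" "closed H" "\<And>u. blinfun_apply T u \<in> H" "\<And>u. blinfun_apply T (proj H u) = T u"
  shows "T \<in> ops H"
  unfolding ops_def using assms proj_0_iff[OF assms(1,2)] by (auto simp: bl) (metis blinfun.zero_right)

lemma ops_eqI:
  assumes "subspace H" "closed H" "S \<in> ops H" "T \<in> ops H" "\<And>u. u \<in> H \<Longrightarrow> blinfun_apply S u = T u"
  shows "S = T"
  by (rule blinfun_eqI) (metis assms opsD(1) proj_in)

lemma ops_comm: "subspace H \<Longrightarrow> closed H \<Longrightarrow> T \<in> ops H \<Longrightarrow> comm (proj H) T"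
  by (rule commI) (simp add: opsD)

lemma selfadjoint_adj:
  assumes "subspace H" "closed H" "T \<in> ops H"
  shows "selfadjoint H T \<longleftrightarrow> adj T T"
proof
  assume s: "selfadjoint H T"
  show "adj T T" unfolding adj_def
  proof (intro allI)
    fix u v
    have "T u \<bullet> v = T (proj H u) \<bullet> proj H v"
      using is_projD(3)[OF is_proj_proj[OF assms(1,2)], of "T u" v] opsD[OF assms] by simp
    also have "\<dots> = proj H u \<bullet> T (proj H v)"
      using s proj_in[OF assms(1,2)] by (simp add: selfadjoint_def)
    also have "\<dots> = u \<bullet> T v"
      using is_projD(3)[OF is_proj_proj[OF assms(1,2)], of u "T v"] opsD[OF assms] by simp
    finally show "T u \<bullet> v = u \<bullet> T v" .
  qed
qed (simp add: selfadjoint_def adjD)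

context
  fixes H :: "'h::{real_inner, complete_space} set" and T :: "'h \<Rightarrow>\<^sub>L 'h"
  assumes H: "subspace H" "closed H" and TH: "T \<in> ops H" and T: "adj T T"
begin

lemma comm_proj_sle: "comm (proj H) (sle T t)"
  using ops_comm[OF H TH] by (intro comm_sle[OF T is_projD(1)[OF is_proj_proj[OF H]]])

lemma comm_proj_slt: "comm (proj H) (slt T t)"
  using ops_comm[OF H TH] by (intro comm_slt[OF T is_projD(1)[OF is_proj_proj[OF H]]])

lemma sle_in: "u \<in> H \<Longrightarrow> sle T t u \<in> H"
  using commD[OF comm_proj_sle, of t u] proj_in[OF H, of "sle T t u"] proj_ident[OF H, of u] by simp

lemma slt_in: "u \<in> H \<Longrightarrow> slt T t u \<in> H"
  using commD[OF comm_proj_slt, of t u] proj_in[OF H, of "slt T t u"] proj_ident[OF H, of u] by simp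

text \<open>The integral is evaluated by \<open>stieltjes_characterization\<close>. Composing with
  \<open>proj H\<close> turns the projections of the whole space into elements of
  \<open>ops H\<close>.\<close>

lemma spectral_family_sle: "spectral_family H T (\<lambda>t. sle T t o\<^sub>L proj H)"
  unfolding spectral_family_def
proof (intro conjI allI ballI)
  have P: "is_proj (proj H)" by (rule is_proj_proj[OF H])
  have on_H: "(sle T t o\<^sub>L proj H) u = sle T t u" if "u \<in> H" for u t
    using that proj_ident[OF H] by simp
  show o: "sle T t o\<^sub>L proj H \<in> ops H" for t
    using sle_in proj_in[OF H] by (intro opsI[OF H]) (auto simp: is_projD(2)[OF P])
  show "selfadjoint H (sle T t o\<^sub>L proj H)" for t
    by (auto simp: selfadjoint_def proj_ident[OF H] is_projD(3)[OF is_proj_sle])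
  show "(sle T s o\<^sub>L proj H) ((sle T t o\<^sub>L proj H) u) = (sle T (min s t) o\<^sub>L proj H) u"
    if "u \<in> H" for s t u
    using that on_H sle_in sle_min[OF T] by simp
  show "((\<lambda>s. (sle T s o\<^sub>L proj H) u) \<longlongrightarrow> (sle T t o\<^sub>L proj H) u) (at_right t)" if "u \<in> H" for t u
    using sle_right_continuous[OF T] by simp
  show "\<exists>r. (\<forall>t. t < - r \<longrightarrow> (\<forall>u\<in>H. (sle T t o\<^sub>L proj H) u = 0)) \<and> (\<forall>t\<ge>r. \<forall>u\<in>H. (sle T t o\<^sub>L proj H) u = u)"
    using on_H proj_ident[OF H] sle_top[OF T] sle_bot[OF T] by (intro exI[of _ "norm T"]) auto
  fix u assume u: "u \<in> H"
  define F where "F t = (norm (sle T t u))\<^sup>2" for t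
  have F: "(sle T t o\<^sub>L proj H) u \<bullet> u = F t" for t
    using on_H[OF u] is_projD(5)[OF is_proj_sle] by (simp add: F_def power2_norm_eq_inner)
  have F_diff: "F t - F s = (norm (sle T t u - sle T s u))\<^sup>2" if "s \<le> t" for s t
    using is_proj_pyth[OF is_proj_sle[of T s], of "sle T t u"] sle_mono[OF T that] by (simp add: F_def)
  \<comment> \<open>The energy of the part of \<open>u\<close> below the level \<open>t\<close>. As
    \<open>sle T s\<close> commutes with \<open>T\<close>, cross terms vanish and an increment is
    the energy of the spectral slice \<open>w\<close> between \<open>s\<close> and
    \<open>t\<close>.\<close>
  define \<phi> where "\<phi> t = T (sle T t u) \<bullet> sle T t u" for t
  have \<phi>_diff: "s * (F t - F s) \<le> \<phi> t - \<phi> s \<and> \<phi> t - \<phi> s \<le> t * (F t - F s)" if "s \<le> t" for s t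
  proof -
    define v where "v = sle T s u"
    define w where "w = sle T t u - sle T s u"
    have w: "sle T t w = w" "sle T s w = 0" "sle T s v = v" "sle T t u = v + w"
      using sle_mono[OF T that] by (simp_all add: w_def v_def bl is_projD(2)[OF is_proj_sle])
    have "T v \<bullet> w = T (sle T s v) \<bullet> w" by (simp add: w)
    also have "\<dots> = sle T s (T v) \<bullet> w" by (simp add: commD[OF comm_sle_self[OF T]])
    also have "\<dots> = 0" using w by (simp add: is_projD(3)[OF is_proj_sle])
    finally have vw: "T v \<bullet> w = 0" .
    have "T w \<bullet> v = 0" using vw adjD[OF T, of w v] by (simp add: inner_commute)
    then have "\<phi> t - \<phi> s = T w \<bullet> w"
      using vw w by (simp add: \<phi>_def v_def[symmetric] bl inner_simps)
    moreover have "F t - F s = w \<bullet> w" using F_diff[OF that] by (simp add: w_def power2_norm_eq_inner)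
    ultimately show ?thesis using sle_range[OF T w(1)] sle_kernel_le[OF T w(2)] by simp
  qed
  have "(LINT t|interval_measure F. t) = T u \<bullet> u"
  proof (rule stieltjes_characterization[where r="norm T" and c="u \<bullet> u" and \<phi>=\<phi>])
    show "F s \<le> F t" if "s \<le> t" for s t using F_diff[OF that] by (metis diff_ge_0_iff_ge zero_le_power2)
    show "continuous (at_right t) F" for t
      unfolding continuous_within F_def by (intro tendsto_intros sle_right_continuous T)
  qed (use \<phi>_diff in \<open>auto simp: F_def \<phi>_def sle_top[OF T] sle_bot[OF T] power2_norm_eq_inner\<close>)
  then show "T u \<bullet> u = (LINT t|interval_measure (\<lambda>t. (sle T t o\<^sub>L proj H) u \<bullet> u). t)"
    unfolding F by simp
qed

section \<open>Uniqueness of the spectral family\<close>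

context
  fixes E
  assumes E: "spectral_family H T E"
begin

lemma spectral_family_ops: "E t \<in> ops H"
  using E by (auto simp: spectral_family_def)

lemma spectral_family_min: "u \<in> H \<Longrightarrow> E s (E t u) = E (min s t) u"
  using E by (auto simp: spectral_family_def)

lemma spectral_family_adj: "adj (E t) (E t)"
  using E selfadjoint_adj[OF H spectral_family_ops] by (auto simp: spectral_family_def)

lemma spectral_family_is_proj: "is_proj (E t)"
  unfolding is_proj_def
proof (intro conjI spectral_family_adj blinfun_eqI)
  fix u
  have "E t (E t (proj H u)) = E t (proj H u)" using spectral_family_min[OF proj_in[OF H]] by simp
  then show "(E t o\<^sub>L E t) u = E t u" using opsD(1)[OF H spectral_family_ops] by simp
qed

lemma spectral_family_form: "E t u \<bullet> u = (norm (E t u))\<^sup>2"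
  using is_projD(5)[OF spectral_family_is_proj] by (simp add: power2_norm_eq_inner)

text \<open>The function \<open>E t u \<bullet> u\<close> of \<open>t\<close> is the squared norm of
  \<open>E t u\<close>, hence monotone, and it is constant outside a bounded interval, so the facts
  on Stieltjes measures apply.\<close>

lemma spectral_family_measure:
  assumes u: "u \<in> H"
  shows "(\<And>t. t \<ge> x \<Longrightarrow> E t u = E x u) \<Longrightarrow> AE t in interval_measure (\<lambda>t. E t u \<bullet> u). t \<le> x"
    and "(\<And>t. t \<le> x \<Longrightarrow> E t u = 0) \<Longrightarrow> AE t in interval_measure (\<lambda>t. E t u \<bullet> u). x < t"
    and "integrable (interval_measure (\<lambda>t. E t u \<bullet> u)) (\<lambda>t. t)"
    and "finite_measure (interval_measure (\<lambda>t. E t u \<bullet> u))"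
    and "measure (interval_measure (\<lambda>t. E t u \<bullet> u)) UNIV = u \<bullet> u"
proof -
  let ?F = "\<lambda>t. E t u \<bullet> u"
  have "\<exists>r. (\<forall>t. t < - r \<longrightarrow> (\<forall>u\<in>H. E t u = 0)) \<and> (\<forall>t\<ge>r. \<forall>u\<in>H. E t u = u)"
    using E unfolding spectral_family_def by blast
  then obtain r where r: "\<And>t. t < - r \<Longrightarrow> E t u = 0" "\<And>t. r \<le> t \<Longrightarrow> E t u = u"
    using u by blast
  have mono: "?F s \<le> ?F t" if "s \<le> t" for s t
  proof -
    have "norm (E s u) \<le> norm (E t u)"
      using is_proj_le[OF spectral_family_is_proj, of s "E t u"] spectral_family_min[OF u, of s t] that
      by (simp add: min_def)
    then show ?thesis unfolding spectral_family_form by (intro power_mono) auto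
  qed
  have rc: "continuous (at_right t) ?F" for t
    unfolding continuous_within using E u by (auto simp: spectral_family_def intro!: tendsto_inner tendsto_const)
  have b: "?F t = 0" if "t < - r" for t using r(1)[OF that] by simp
  have t: "?F t = u \<bullet> u" if "r \<le> t" for t using r(2)[OF that] by simp
  note st = mono rc b t
  show "AE t in interval_measure ?F. t \<le> x" if *: "\<And>t. t \<ge> x \<Longrightarrow> E t u = E x u"
  proof (rule stieltjes_AE_le[OF st])
    show "E t u \<bullet> u = E x u \<bullet> u" if "x \<le> t" for t by (simp only: *[OF that])
  qed
  show "AE t in interval_measure ?F. x < t" if "\<And>t. t \<le> x \<Longrightarrow> E t u = 0"
    by (rule stieltjes_AE_gt[OF st]) (use that that[of x] in auto)
  show "integrable (interval_measure ?F) (\<lambda>t. t)" by (rule stieltjes_integrable[OF st])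
  show "finite_measure (interval_measure ?F)" by (rule stieltjes_finite[OF st])
  show "measure (interval_measure ?F) UNIV = u \<bullet> u" by (rule stieltjes_measure[OF st])
qed

text \<open>The family is tied to \<open>T\<close> only through quadratic forms. For
  \<open>x\<close> in the range of \<open>E t\<close> and \<open>y\<close> in its kernel within
  \<open>H\<close>, the forms of \<open>E s\<close> at \<open>x + y\<close> and \<open>x - y\<close>
  coincide for all \<open>s\<close>, so the two integrals agree and polarisation gives
  \<open>T x \<bullet> y = 0\<close>. Thus the range of \<open>E t\<close> is invariant under
  \<open>T\<close>, and taking adjoints gives commutation.\<close>

lemma spectral_family_comm: "comm (E t) T"
proof -
  have q: "T u \<bullet> u = (LINT t|interval_measure (\<lambda>t. E t u \<bullet> u). t)" if "u \<in> H" for u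
    using E that by (auto simp: spectral_family_def)
  have EH: "E s u \<in> H" for s u using opsD(3)[OF H spectral_family_ops] .
  have TH': "T u \<in> H" for u using opsD(3)[OF H TH] .
  have orth: "T (E t u) \<bullet> (v - E t v) = 0" if uv: "u \<in> H" "v \<in> H" for u v
  proof -
    define x where "x = E t u"
    define y where "y = v - E t v"
    have xy: "x \<in> H" "y \<in> H" using uv EH H(1) by (auto simp: x_def y_def subspace_diff)
    have "E s x \<bullet> y = 0" for s
    proof -
      have "E s x \<bullet> y = E (min s t) u \<bullet> v - E (min s t) u \<bullet> E t v"
        using spectral_family_min[OF uv(1)] by (simp add: x_def y_def inner_simps)
      also have "E (min s t) u \<bullet> E t v = E t (E (min s t) u) \<bullet> v"
        by (simp add: is_projD(3)[OF spectral_family_is_proj])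
      also have "\<dots> = E (min s t) u \<bullet> v"
        using spectral_family_min[OF uv(1)] by (simp add: min.commute min.left_commute)
      finally show ?thesis by simp
    qed
    then have "E s (x + y) \<bullet> (x + y) = E s (x - y) \<bullet> (x - y)" for s
      using adjD[OF spectral_family_adj, of s y x] by (simp add: bl inner_simps inner_commute)
    then have "T (x + y) \<bullet> (x + y) = T (x - y) \<bullet> (x - y)"
      using q xy H(1) by (simp add: subspace_add subspace_diff)
    then show ?thesis
      using adjD[OF T, of y x] by (simp add: bl inner_simps inner_commute x_def[symmetric] y_def[symmetric])
  qed
  have inv: "E t (T (E t u)) = T (E t u)" for u
  proof -
    let ?u = "proj H u" and ?v = "T (E t u) - E t (T (E t u))"
    have "E t u = E t ?u" using opsD(1)[OF H spectral_family_ops] by simp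
    then have o: "T (E t u) \<bullet> (v - E t v) = 0" if "v \<in> H" for v
      using orth[OF proj_in[OF H, of u] that] by simp
    have "?v \<bullet> ?v = T (E t u) \<bullet> (?v - E t ?v)"
      using is_projD[OF spectral_family_is_proj] by (simp add: bl inner_simps)
    also have "\<dots> = 0" using EH TH' H(1) by (intro o subspace_diff)
    finally show ?thesis by simp
  qed
  have "E t o\<^sub>L (T o\<^sub>L E t) = T o\<^sub>L E t" by (rule blinfun_eqI) (simp add: inv)
  moreover have "adj (E t o\<^sub>L (T o\<^sub>L E t)) (E t o\<^sub>L T o\<^sub>L E t)" "adj (T o\<^sub>L E t) (E t o\<^sub>L T)"
    by (intro adj_intros T spectral_family_adj)+
  ultimately have "E t o\<^sub>L T o\<^sub>L E t = E t o\<^sub>L T" by (metis adj_unique)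
  moreover have "E t o\<^sub>L T o\<^sub>L E t = T o\<^sub>L E t" by (rule blinfun_eqI) (simp add: inv)
  ultimately show ?thesis by (simp add: comm_def)
qed

lemma spectral_family_range:
  assumes "E t u = u" shows "T u \<bullet> u \<le> t * (u \<bullet> u)"
proof -
  have u: "u \<in> H" using opsD(3)[OF H spectral_family_ops, of t u] assms by simp
  let ?M = "interval_measure (\<lambda>t. E t u \<bullet> u)"
  interpret finite_measure ?M by (rule spectral_family_measure[OF u])
  have "E s u = E t u" if "t \<le> s" for s
  proof -
    have "E s (E t u) = E t u" using spectral_family_min[OF u, of s t] that by (simp add: min_absorb2)
    then show ?thesis by (simp add: assms)
  qed
  then have "AE s in ?M. s \<le> t" by (rule spectral_family_measure[OF u])
  then have "(LINT s|?M. s) \<le> (LINT s|?M. t)"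
    by (intro integral_mono_AE spectral_family_measure(3)[OF u]) auto
  also have "\<dots> = t * (u \<bullet> u)" using spectral_family_measure(5)[OF u] by simp
  finally show ?thesis using E u by (auto simp: spectral_family_def)
qed

text \<open>The measure lives on \<open>t < s\<close>. If the integral of \<open>s - t\<close> were
  0, the measure would vanish, against its total mass \<open>u \<bullet> u > 0\<close>.\<close>

lemma spectral_family_kernel:
  assumes u: "u \<in> H" "E t u = 0" "u \<noteq> 0" shows "t * (u \<bullet> u) < T u \<bullet> u"
proof -
  let ?M = "interval_measure (\<lambda>t. E t u \<bullet> u)"
  interpret finite_measure ?M by (rule spectral_family_measure[OF u(1)])
  have "E s u = 0" if "s \<le> t" for s
    using spectral_family_min[OF u(1), of s t] that assms by (simp add: min_def split: if_splits)
  then have AE: "AE s in ?M. t < s" by (rule spectral_family_measure[OF u(1)])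
  have i: "integrable ?M (\<lambda>s. s - t)"
    by (intro Bochner_Integration.integrable_diff spectral_family_measure[OF u(1)]) simp
  have pos: "0 \<le> (LINT s|?M. s - t)"
    using AE by (intro integral_nonneg_AE) (auto elim!: eventually_mono)
  have "(LINT s|?M. s - t) \<noteq> 0"
  proof
    assume "(LINT s|?M. s - t) = 0"
    moreover have "AE s in ?M. 0 \<le> s - t" using AE by (auto elim!: eventually_mono)
    ultimately have "AE s in ?M. s - t = 0" using integral_nonneg_eq_0_iff_AE[OF i] by simp
    then have "AE s in ?M. False" using AE by eventually_elim simp
    then have "measure ?M UNIV = 0" using AE_iff_measurable[of UNIV ?M "\<lambda>_. False"] by (simp add: measure_def)
    then show False using spectral_family_measure(5)[OF u(1)] u(3) by simp
  qed
  moreover have "(LINT s|?M. s - t) = (LINT s|?M. s) - t * (u \<bullet> u)"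
    using spectral_family_measure(5)[OF u(1)]
    by (subst Bochner_Integration.integral_diff) (auto intro: spectral_family_measure[OF u(1)])
  moreover have "T u \<bullet> u = (LINT s|?M. s)" using E u by (auto simp: spectral_family_def)
  ultimately show ?thesis using pos by simp
qed

text \<open>Both families obey the same bounds for the form of \<open>T\<close> on range and kernel,
  so \<open>intertwine_zero\<close>, used in both directions, shows that the two projections fix the
  same vectors.\<close>

lemma spectral_family_unique: "E t = sle T t o\<^sub>L proj H"
proof (rule is_proj_eqI)
  let ?P = "proj H"
  have P: "is_proj ?P" by (rule is_proj_proj[OF H])
  show "is_proj (E t)" by (rule spectral_family_is_proj)
  show "is_proj (sle T t o\<^sub>L ?P)" by (intro is_proj_compose is_proj_sle P comm_sym[OF comm_proj_sle])
  have EH: "E t u \<in> H" for u using opsD(3)[OF H spectral_family_ops] .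
  have 1: "(id_blinfun - sle T t) (E t u) = 0" for u
  proof (rule intertwine_zero[OF T spectral_family_is_proj spectral_family_comm _ _ spectral_family_range])
    show "adj (id_blinfun - sle T t) (id_blinfun - sle T t)"
      by (intro is_projD(1) is_proj_compl is_proj_sle)
    show "comm (id_blinfun - sle T t) T"
      by (intro comm_sym[OF comm_diff] comm_intros comm_sym[OF comm_sle_self] T)
    show "t * ((id_blinfun - sle T t) u \<bullet> (id_blinfun - sle T t) u)
        < T ((id_blinfun - sle T t) u) \<bullet> (id_blinfun - sle T t) u"
      if "(id_blinfun - sle T t) u \<noteq> 0" for u
      using that by (intro sle_kernel[OF T]) (auto simp: bl is_projD(2)[OF is_proj_sle])
  qed
  have 2: "(?P - E t) (sle T t u) = 0" for u
  proof (rule intertwine_zero[OF T is_proj_sle comm_sle_self[OF T] _ _ sle_range[OF T]])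
    show "adj (?P - E t) (?P - E t)"
      by (intro adj_diff spectral_family_adj is_projD(1)[OF P])
    show "comm (?P - E t) T"
      by (intro comm_sym[OF comm_diff] comm_sym[OF spectral_family_comm] comm_sym[OF ops_comm] H TH)
    show "t * ((?P - E t) u \<bullet> (?P - E t) u) < T ((?P - E t) u) \<bullet> (?P - E t) u"
      if "(?P - E t) u \<noteq> 0" for u
      using that EH proj_in[OF H] opsD(1)[OF H spectral_family_ops] is_projD(2)[OF spectral_family_is_proj]
      by (intro spectral_family_kernel) (auto simp: bl subspace_diff[OF H(1)])
  qed
  show "E t u = u \<longleftrightarrow> (sle T t o\<^sub>L ?P) u = u" for u
  proof
    assume e: "E t u = u"
    then have "u \<in> H" using EH[of u] by simp
    moreover have "sle T t u = u" using 1[of u] e by (simp add: bl)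
    ultimately show "(sle T t o\<^sub>L ?P) u = u" by (simp add: proj_ident[OF H])
  next
    assume "(sle T t o\<^sub>L ?P) u = u"
    then have e: "sle T t (?P u) = u" by simp
    then have u: "u \<in> H" using sle_in[OF proj_in[OF H, of u]] by metis
    then have "sle T t u = u" using e by (simp add: proj_ident[OF H])
    then show "E t u = u" using 2[of u] u by (simp add: bl proj_ident[OF H])
  qed
qed

end

text \<open>Discharges the definite description: the projection is determined by the family, the
  family is unique, and its strong limit from the left is \<open>slt T a\<close>. Later facts on
  \<open>spectral_proj\<close> start from this formula.\<close>

lemma spectral_proj_eq: "spectral_proj H a b T = (sle T b - slt T a) o\<^sub>L proj H"
  unfolding spectral_proj_def
proof (rule the_equality)
  let ?P = "(sle T b - slt T a) o\<^sub>L proj H"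
  have o: "?P \<in> ops H"
    using sle_in slt_in proj_in[OF H] is_projD(2)[OF is_proj_proj[OF H]]
    by (intro opsI[OF H]) (auto simp: bl subspace_diff[OF H(1)])
  have lim: "((\<lambda>s. (sle T b o\<^sub>L proj H) u - (sle T s o\<^sub>L proj H) u) \<longlongrightarrow> ?P u) (at_left a)" for u
    using tendsto_diff[OF tendsto_const sle_left_limit[OF T]] by (simp add: bl)
  show "?P \<in> ops H \<and> (\<exists>E. spectral_family H T E \<and>
        (\<forall>u\<in>H. ((\<lambda>s. E b u - E s u) \<longlongrightarrow> ?P u) (at_left a)))"
    using o lim spectral_family_sle by blast
  fix Q
  assume "Q \<in> ops H \<and> (\<exists>E. spectral_family H T E \<and>
        (\<forall>u\<in>H. ((\<lambda>s. E b u - E s u) \<longlongrightarrow> blinfun_apply Q u) (at_left a)))"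
  then obtain E where Q: "Q \<in> ops H" "spectral_family H T E"
    "\<And>u. u \<in> H \<Longrightarrow> ((\<lambda>s. E b u - E s u) \<longlongrightarrow> Q u) (at_left a)" by blast
  show "Q = ?P"
  proof (rule ops_eqI[OF H Q(1) o])
    fix u assume "u \<in> H"
    show "Q u = ?P u"
      by (rule tendsto_unique[OF _ Q(3)[OF \<open>u \<in> H\<close>]])
        (use lim spectral_family_unique[OF Q(2)] in auto)
  qed
qed

lemma spectral_proj_ops: "spectral_proj H a b T \<in> ops H"
  unfolding spectral_proj_eq
  using sle_in slt_in proj_in[OF H] is_projD(2)[OF is_proj_proj[OF H]]
  by (intro opsI[OF H]) (auto simp: bl subspace_diff[OF H(1)])

lemma spectral_proj_comm:
  assumes "adj C C'" "comm C T" "comm C' T" "comm C (proj H)"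
  shows "comm C (spectral_proj H a b T)"
  unfolding spectral_proj_eq
  using assms by (intro comm_intros comm_sle[OF T assms(1)] comm_slt[OF T assms(1)])

lemma spectral_proj_comm_self: "comm (spectral_proj H a b T) T"
  by (intro comm_sym[OF spectral_proj_comm[OF T]] comm_refl comm_sym[OF ops_comm] H TH)

lemma is_proj_spectral_proj:
  assumes "a \<le> b" shows "is_proj (spectral_proj H a b T)"
proof -
  have P: "is_proj (proj H)" by (rule is_proj_proj[OF H])
  have "is_proj (sle T b - slt T a)"
    unfolding is_proj_def
    by (auto intro!: blinfun_eqI adj_diff is_projD(1)[OF is_proj_sle] is_projD(1)[OF is_proj_slt]
        simp: bl slt_le_sle[OF T assms] is_projD(2)[OF is_proj_sle] is_projD(2)[OF is_proj_slt])
  then show ?thesis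
    unfolding spectral_proj_eq
    by (intro is_proj_compose P comm_sym[OF comm_diff] comm_proj_sle comm_proj_slt)
qed

lemma spectral_proj_on: "u \<in> H \<Longrightarrow> spectral_proj H a b T u = sle T b u - slt T a u"
  unfolding spectral_proj_eq by (simp add: bl proj_ident[OF H])

lemma spectral_proj_fix_iff:
  assumes "a \<le> b"
  shows "spectral_proj H a b T u = u \<longleftrightarrow> u \<in> H \<and> sle T b u = u \<and> slt T a u = 0"
proof
  assume *: "spectral_proj H a b T u = u"
  then have u: "u \<in> H" using opsD(3)[OF H spectral_proj_ops] by metis
  then have e: "sle T b u - slt T a u = u" using * spectral_proj_on by simp
  have "sle T b u = sle T b (sle T b u - slt T a u)" by (simp add: e)
  also have "\<dots> = sle T b u - slt T a u"
    by (simp add: blinfun.diff_right slt_le_sle[OF T assms] is_projD(2)[OF is_proj_sle])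
  also note e
  finally show "u \<in> H \<and> sle T b u = u \<and> slt T a u = 0" using u e by simp
qed (simp add: spectral_proj_on)

lemma spectral_proj_range_ge:
  assumes "a \<le> b" "spectral_proj H a b T u = u" shows "a * (u \<bullet> u) \<le> T u \<bullet> u"
  using assms slt_kernel[OF T] by (simp add: spectral_proj_fix_iff)

lemma spectral_proj_range_le:
  assumes "a \<le> b" "spectral_proj H a b T u = u" shows "T u \<bullet> u \<le> b * (u \<bullet> u)"
  using assms sle_range[OF T] by (simp add: spectral_proj_fix_iff)

text \<open>On the range the form of \<open>T - c\<close> is bounded by \<open>h\<close>; composed
  with the commuting projection it becomes a selfadjoint operator to which \<open>sa_norm_le\<close>
  applies. The centre \<open>c\<close> is left free for gaps around nonzero levels.\<close>

lemma spectral_proj_norm_range_center: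
  assumes "0 \<le> h" "spectral_proj H (c - h) (c + h) T u = u" shows "norm (T u - c *\<^sub>R u) \<le> h * norm u"
proof -
  let ?P = "spectral_proj H (c - h) (c + h) T" and ?S = "T - c *\<^sub>R id_blinfun"
  have le: "c - h \<le> c + h" using assms by simp
  have P: "is_proj ?P" using le by (rule is_proj_spectral_proj)
  have c: "comm ?P ?S" by (intro comm_diff comm_scaleR comm_id spectral_proj_comm_self)
  have "adj (?S o\<^sub>L ?P) (?P o\<^sub>L ?S)" by (intro adj_intros T is_projD(1)[OF P])
  then have a: "adj (?S o\<^sub>L ?P) (?S o\<^sub>L ?P)" using c by (simp add: comm_def)
  have "\<bar>(?S o\<^sub>L ?P) v \<bullet> v\<bar> \<le> h * (norm v)\<^sup>2" for v
  proof -
    have "(?S o\<^sub>L ?P) v \<bullet> v = ?S (?P (?P v)) \<bullet> v" by (simp add: is_projD(2)[OF P])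
    also have "\<dots> = ?P (?S (?P v)) \<bullet> v" by (simp only: commD[OF c])
    also have "\<dots> = ?S (?P v) \<bullet> ?P v" by (rule is_projD(3)[OF P])
    finally have e: "(?S o\<^sub>L ?P) v \<bullet> v = ?S (?P v) \<bullet> ?P v" .
    have "\<bar>?S (?P v) \<bullet> ?P v\<bar> \<le> h * (norm (?P v))\<^sup>2"
      using spectral_proj_range_ge[OF le, of "?P v"] spectral_proj_range_le[OF le, of "?P v"]
      by (simp add: is_projD(2)[OF P] power2_norm_eq_inner abs_le_iff bl inner_simps algebra_simps)
    also have "\<dots> \<le> h * (norm v)\<^sup>2"
      using assms(1) is_proj_le[OF P] by (intro mult_left_mono power_mono) auto
    finally show ?thesis unfolding e .
  qed
  from sa_norm_le[OF a this, of u] show ?thesis using assms(2) by (simp add: bl)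
qed

lemma spectral_proj_norm_range:
  assumes "0 \<le> a" "spectral_proj H (- a) a T u = u" shows "norm (T u) \<le> a * norm u"
  using spectral_proj_norm_range_center[of a 0 u] assms by simp

text \<open>Such \<open>u\<close> splits into \<open>x\<close>, where the form is at most
  \<open>- a\<close>, and \<open>y\<close>, where it is at least \<open>a\<close>; the two are
  orthogonal, also for the form of \<open>T\<close>. Pairing \<open>T u\<close> with
  \<open>y - x\<close>, which has the norm of \<open>u\<close>, adds both contributions.\<close>

lemma spectral_proj_norm_kernel:
  assumes "0 \<le> a" "spectral_proj H (- a) a T u = 0" "u \<in> H" shows "a * norm u \<le> norm (T u)"
proof -
  define x where "x = slt T (- a) u"
  define y where "y = u - sle T a u"
  have le: "- a \<le> a" using assms by simp
  have "sle T a u = slt T (- a) u" using assms spectral_proj_on by simp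
  then have u: "u = x + y" by (simp add: x_def y_def)
  have x: "slt T (- a) x = x" by (simp add: x_def is_projD(2)[OF is_proj_slt])
  have y: "sle T a y = 0" by (simp add: y_def bl is_projD(2)[OF is_proj_sle])
  have y': "slt T (- a) y = 0" using slt_le_sle(2)[OF T le] by (simp add: y_def bl)
  have xy: "x \<bullet> y = 0"
    using x y' is_projD(3)[OF is_proj_slt, of T "- a" x y] by simp
  have "T x \<bullet> y = slt T (- a) (T x) \<bullet> y" using commD[OF comm_slt_self[OF T], of "- a" x] x by simp
  also have "\<dots> = 0" using y' by (simp add: is_projD(3)[OF is_proj_slt])
  finally have Txy: "T x \<bullet> y = 0" .
  then have Tyx: "T y \<bullet> x = 0" using adjD[OF T, of y x] by (simp add: inner_commute)
  have "norm u = norm (y - x)"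
    unfolding u norm_eq_sqrt_inner using xy by (simp add: inner_simps inner_commute)
  moreover have "a * (u \<bullet> u) \<le> T u \<bullet> (y - x)"
    using slt_range_le[OF T x] sle_kernel_le[OF T y] xy Txy Tyx
    unfolding u by (simp add: bl inner_simps inner_commute algebra_simps)
  moreover have "T u \<bullet> (y - x) \<le> norm (T u) * norm (y - x)" by (rule norm_cauchy_schwarz)
  ultimately have "norm u * (a * norm u) \<le> norm u * norm (T u)"
    by (simp add: power2_norm_eq_inner[symmetric] power2_eq_square mult_ac)
  then show ?thesis by (cases "u = 0") auto
qed

lemma spectral_proj_nonneg_part:
  assumes "0 \<le> a" "spectral_proj H 0 a T u = u"
  shows "spectral_proj H (- a) a T u = u" "0 \<le> T u \<bullet> u"
proof -
  have u: "u \<in> H" "sle T a u = u" "slt T 0 u = 0" using assms by (auto simp: spectral_proj_fix_iff)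
  have "slt T (- a) u = 0" using slt_mono(2)[OF T, of "- a" 0 u] assms(1) u by simp
  then show "spectral_proj H (- a) a T u = u" using u assms(1) by (subst spectral_proj_fix_iff) auto
  show "0 \<le> T u \<bullet> u" using spectral_proj_range_ge[OF assms] by simp
qed

lemma spectral_proj_neg_part:
  assumes "0 \<le> a" "spectral_proj H (- a) a T u = u" "spectral_proj H 0 a T u = 0" "u \<noteq> 0"
  shows "T u \<bullet> u < 0"
proof -
  have u: "u \<in> H" "sle T a u = u" using assms by (auto simp: spectral_proj_fix_iff)
  then have "slt T 0 u = u" using assms spectral_proj_on by simp
  then show ?thesis using slt_range[OF T _ assms(4)] by fastforce
qed

end

section \<open>Finite-dimensional subspaces\<close>

lemma finite_dim_subset: "finite_dim W \<Longrightarrow> V \<subseteq> W \<Longrightarrow> finite_dim V"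
  by (auto simp: finite_dim_def)

lemma finite_dim_basis:
  fixes V :: "'h::real_vector set"
  assumes "subspace V" "finite_dim V"
  obtains B where "finite B" "independent B" "span B = V" "B \<subseteq> V"
proof -
  obtain B where B: "B \<subseteq> V" "independent B" "V \<subseteq> span B" by (meson maximal_independent_subset)
  obtain C where C: "finite C" "V \<subseteq> span C" using assms by (auto simp: finite_dim_def)
  have "finite B" using independent_span_bound[OF C(1) B(2)] B(1) C(2) by auto
  moreover have "span B = V" using B assms(1) span_minimal by blast
  ultimately show ?thesis using B that by blast
qed

lemma finite_dim_orthonormal_basis:
  fixes V :: "'h::real_inner set"
  assumes "subspace V" "finite_dim V"
  obtains b n where "inj_on b {..<n::nat}" "independent (b ` {..<n})" "span (b ` {..<n}) = V"
    "\<And>i j. i < n \<Longrightarrow> j < n \<Longrightarrow> b i \<bullet> b j = (if i = j then 1 else 0)"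
proof -
  obtain B where B: "finite B" "independent B" "span B = V" using finite_dim_basis[OF assms] by metis
  obtain C where C: "finite C" "card C \<le> card B" "span C = V" "pairwise Linear_Algebra.orthogonal C"
    using basis_orthogonal[OF B(1)] B(3) by metis
  define D where "D = (\<lambda>x. x /\<^sub>R norm x) ` (C - {0})"
  have D: "finite D" "0 \<notin> D" using C by (auto simp: D_def)
  have Do: "pairwise Linear_Algebra.orthogonal D"
    using C(4) by (auto simp: D_def pairwise_def Linear_Algebra.orthogonal_def)
  have Di: "independent D" using Do D(2) by (simp add: pairwise_orthogonal_independent)
  have "span D = V"
  proof
    show "span D \<subseteq> V"
      using assms(1) C(3) by (intro span_minimal) (auto simp: D_def subspace_scale span_base)
    have "x \<in> span D" if "x \<in> C" for x
    proof (cases "x = 0")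
      case False
      then have "x /\<^sub>R norm x \<in> span D" using that by (auto simp: D_def intro: span_base)
      from span_scale[OF this, of "norm x"] False show ?thesis by simp
    qed (simp add: span_zero)
    then show "V \<subseteq> span D" unfolding C(3)[symmetric] by (intro span_minimal) auto
  qed
  moreover obtain b where b: "bij_betw b {..<card D} D"
    using ex_bij_betw_nat_finite[OF D(1)] by (auto simp: atLeast0LessThan)
  moreover have "b i \<bullet> b j = (if i = j then 1 else 0)" if "i < card D" "j < card D" for i j
  proof (cases "i = j")
    case True
    have "b i \<in> D" using b that by (auto simp: bij_betw_def)
    then have "norm (b i) = 1" by (auto simp: D_def) (metis left_inverse norm_eq_zero)
    then show ?thesis using True by (simp add: norm_eq_1)
  next
    case False
    then have "b i \<noteq> b j" "b i \<in> D" "b j \<in> D" using b that by (auto simp: bij_betw_def inj_on_def)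
    then have "b i \<bullet> b j = 0" using Do by (auto simp: pairwise_def Linear_Algebra.orthogonal_def)
    then show ?thesis using False by simp
  qed
  ultimately show ?thesis
    using Di by (intro that[of b "card D"]) (auto simp: bij_betw_def)
qed

lemma finite_dim_closed:
  fixes V :: "'h::real_inner set"
  assumes V: "subspace V" "finite_dim V"
  shows "closed V"
proof -
  obtain b n where b: "span (b ` {..<n::nat}) = V"
    "\<And>i j. i < n \<Longrightarrow> j < n \<Longrightarrow> b i \<bullet> b j = (if i = j then 1 else 0)"
    using finite_dim_orthonormal_basis[OF V] by metis
  define p where "p u = (\<Sum>i<n. (u \<bullet> b i) *\<^sub>R b i)" for u
  have pV: "p u = u" if "u \<in> V" for u
    using that unfolding b(1)[symmetric]
  proof (induction rule: span_induct_alt)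
    case base then show ?case by (simp add: p_def)
  next
    case (step c x y)
    then obtain j where j: "j < n" "x = b j" by auto
    have "p x = (\<Sum>i<n. if i = j then b i else 0)"
      unfolding p_def j(2) using j(1) b(2) by (intro sum.cong) auto
    also have "\<dots> = x" using j by simp
    finally have "p x = x" .
    moreover have "p (c *\<^sub>R x + y) = c *\<^sub>R p x + p y"
      by (simp add: p_def inner_simps scaleR_add_left sum.distrib scaleR_sum_right)
    ultimately show ?case using step by simp
  qed
  have pin: "p u \<in> V" for u
    unfolding p_def b(1)[symmetric] by (intro span_sum span_scale span_base) auto
  have "V = {u. p u = u}" by (auto simp: pV) (metis pin)
  also have "closed \<dots>" unfolding p_def by (intro closed_Collect_eq continuous_intros)
  finally show ?thesis .
qed

lemma finite_dim_image:
  assumes "linear f" "finite_dim V" shows "finite_dim (f ` V)"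
proof -
  obtain B where B: "finite B" "V \<subseteq> span B" using assms(2) by (auto simp: finite_dim_def)
  have "f ` V \<subseteq> span (f ` B)" using B(2) linear_span_image[OF assms(1), of B] by auto
  then show ?thesis using B(1) by (auto simp: finite_dim_def)
qed

lemma finite_dim_inj:
  fixes V :: "'h::real_vector set"
  assumes "linear f" "subspace V" "inj_on f V" "finite_dim (f ` V)" shows "finite_dim V"
proof -
  obtain B where B: "B \<subseteq> V" "independent B" "V \<subseteq> span B" by (meson maximal_independent_subset)
  obtain C where C: "finite C" "f ` V \<subseteq> span C" using assms by (auto simp: finite_dim_def)
  have sB: "span B = V" using B assms(2) span_minimal by blast
  have "independent (f ` B)"
    using assms B(2) sB by (intro linear_independent_injective_image) auto
  then have "finite (f ` B)" using independent_span_bound[OF C(1), of "f ` B"] B(1) C(2) by auto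
  then have "finite B" using assms(3) B(1) by (metis finite_imageD inj_on_subset)
  then show ?thesis using sB by (auto simp: finite_dim_def)
qed

lemma finite_dim_sum:
  assumes "finite_dim V" "finite_dim W" shows "finite_dim {v + w | v w. v \<in> V \<and> w \<in> W}"
proof -
  obtain B C where B: "finite B" "V \<subseteq> span B" and C: "finite C" "W \<subseteq> span C"
    using assms by (auto simp: finite_dim_def)
  have "{v + w | v w. v \<in> V \<and> w \<in> W} \<subseteq> span (B \<union> C)"
    using B(2) C(2) by (auto simp: span_Un)
  then show ?thesis using B(1) C(1) unfolding finite_dim_def by blast
qed

lemma linear_blinfun [simp]: "linear (blinfun_apply A)"
  by (simp add: blinfun.bounded_linear_right bounded_linear.linear)

section \<open>Existence of spectral flow data\<close>

text \<open>The gliding hump argument: each step of size \<open>3\<^sup>-\<^sup>k\<close> towards \<open>\<plusminus>z k\<close> makes the pairing with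
  \<open>z k\<close> large, and the later steps cannot undo this.\<close>

lemma uniform_boundedness:
  fixes x :: "nat \<Rightarrow> 'h::{real_inner, complete_space}"
  assumes bd: "\<And>y. \<exists>C. \<forall>k. \<bar>x k \<bullet> y\<bar> \<le> C"
  shows "\<exists>K. \<forall>k. norm (x k) \<le> K"
proof (rule ccontr)
  assume "\<not> ?thesis"
  \<comment> \<open>The growth rate 4 has to beat the step ratio 3: step \<open>k\<close> yields a
    pairing with \<open>z k\<close> of size at least \<open>(1/3) ^ k * norm (z k)\<close>, which
    exceeds \<open>(4/3) ^ k\<close>.\<close>
  then have "\<exists>n. norm (x n) > 4 ^ k" for k :: nat by (meson not_le)
  then obtain m where m: "\<And>k. norm (x (m k)) > 4 ^ k" by metis
  define z where "z k = x (m k)" for k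
  have zn: "norm (z k) > 4 ^ k" for k using m by (simp add: z_def)
  have z0: "norm (z k) > 0" for k using zn[of k] by (meson less_trans zero_less_numeral zero_less_power)
  define y where "y = rec_nat 0 (\<lambda>k v. v + (if z k \<bullet> v \<ge> 0 then 1 else - 1) *\<^sub>R ((1/3) ^ k) *\<^sub>R (z k /\<^sub>R norm (z k)))"
  have y_Suc: "y (Suc k) = y k + (if z k \<bullet> y k \<ge> 0 then 1 else - 1) *\<^sub>R ((1/3) ^ k) *\<^sub>R (z k /\<^sub>R norm (z k))" for k
    by (simp add: y_def)
  have step: "norm (y (Suc k) - y k) = (1/3) ^ k" for k
    using z0[of k] by (simp add: y_Suc)
  have big: "(1/3) ^ k * norm (z k) \<le> \<bar>z k \<bullet> y (Suc k)\<bar>" for k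
  proof -
    define e where "e = (1/3) ^ k *\<^sub>R (z k /\<^sub>R norm (z k))"
    have ze: "z k \<bullet> e = (1/3) ^ k * norm (z k)"
      using z0[of k] by (simp add: e_def power2_norm_eq_inner[symmetric] power2_eq_square)
    have "0 \<le> (1/3) ^ k * norm (z k)" by simp
    moreover have "z k \<bullet> y (Suc k) = z k \<bullet> y k + (if z k \<bullet> y k \<ge> 0 then 1 else - 1) * (z k \<bullet> e)"
      unfolding y_Suc e_def[symmetric] by (simp add: inner_add_right)
    ultimately show ?thesis unfolding ze by (cases "z k \<bullet> y k \<ge> 0"; simp; linarith)
  qed
  \<comment> \<open>The steps after the \<open>k\<close>-th have total length at most the geometric
    sum \<open>(1/2) * (1/3) ^ k\<close>, half the length of the \<open>k\<close>-th step, so at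
    least half of the gain is kept.\<close>
  have tail: "norm (y (Suc k + n) - y (Suc k)) \<le> (1/2) * (1/3) ^ k * (1 - (1/3) ^ n)" for k n
  proof (induction n)
    case (Suc n)
    have "norm (y (Suc k + Suc n) - y (Suc k)) \<le> norm (y (Suc (Suc k + n)) - y (Suc k + n)) + norm (y (Suc k + n) - y (Suc k))"
      using norm_triangle_ineq[of "y (Suc (Suc k + n)) - y (Suc k + n)" "y (Suc k + n) - y (Suc k)"] by simp
    also have "\<dots> \<le> (1/3) ^ (Suc k + n) + (1/2) * (1/3) ^ k * (1 - (1/3) ^ n)"
      using Suc step by (intro add_mono) auto
    also have "\<dots> = (1/2) * (1/3) ^ k * (1 - (1/3) ^ Suc n)"
      by (simp add: power_add field_simps)
    finally show ?case .
  qed simp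
  have tail': "norm (y (Suc k + n) - y (Suc k)) \<le> (1/2) * (1/3) ^ k" for k n
  proof -
    have "(1/2) * (1/3) ^ k * (1 - (1/3) ^ n) \<le> (1/2) * (1/3) ^ k * (1 :: real)"
      by (intro mult_left_mono) auto
    from order_trans[OF tail this] show ?thesis by simp
  qed
  have "Cauchy y"
  proof (rule CauchyI)
    fix e :: real assume "e > 0"
    then obtain k where k: "(1/3) ^ k < e" using real_arch_pow_inv[of e "1/3"] by auto
    have "norm (y i - y j) < e" if "i \<ge> Suc k" "j \<ge> Suc k" for i j
    proof -
      have "norm (y i - y (Suc k)) \<le> (1/2) * (1/3) ^ k" "norm (y j - y (Suc k)) \<le> (1/2) * (1/3) ^ k"
        using tail'[of k "i - Suc k"] tail'[of k "j - Suc k"] that by auto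
      then show ?thesis
        using norm_triangle_ineq4[of "y i - y (Suc k)" "y j - y (Suc k)"] k by simp
    qed
    then show "\<exists>M. \<forall>m\<ge>M. \<forall>n\<ge>M. norm (y m - y n) < e" by blast
  qed
  then obtain w where w: "y \<longlonglongrightarrow> w" by (metis Cauchy_convergent_iff convergent_def)
  have wk: "norm (w - y (Suc k)) \<le> (1/2) * (1/3) ^ k" for k
  proof (rule LIMSEQ_le_const2)
    show "(\<lambda>n. norm (y n - y (Suc k))) \<longlonglongrightarrow> norm (w - y (Suc k))" by (intro tendsto_intros w)
    show "\<exists>N. \<forall>n\<ge>N. norm (y n - y (Suc k)) \<le> (1/2) * (1/3) ^ k"
      using tail'[of k] by (metis le_add_diff_inverse)
  qed
  have large: "(1/2) * (4/3) ^ k \<le> \<bar>z k \<bullet> w\<bar>" for k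
  proof -
    have "\<bar>z k \<bullet> (w - y (Suc k))\<bar> \<le> norm (z k) * norm (w - y (Suc k))" by (rule Cauchy_Schwarz_ineq2)
    also have "\<dots> \<le> norm (z k) * ((1/2) * (1/3) ^ k)" by (intro mult_left_mono wk) simp
    finally have "\<bar>z k \<bullet> w\<bar> \<ge> (1/2) * ((1/3) ^ k * norm (z k))"
      using big[of k] unfolding inner_diff_right by argo
    moreover have "(1/3) ^ k * 4 ^ k \<le> (1/3) ^ k * norm (z k)"
      using zn[of k] by (intro mult_left_mono) auto
    moreover have "(1/3) ^ k * 4 ^ k = (4/3 :: real) ^ k" by (simp add: power_mult_distrib[symmetric])
    ultimately show ?thesis by argo
  qed
  obtain C where C: "\<And>k. \<bar>x k \<bullet> w\<bar> \<le> C" using bd by metis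
  obtain k where "2 * C < (4/3 :: real) ^ k" using real_arch_pow[of "4/3" "2 * C"] by auto
  then show False using large[of k] C[of "m k"] by (simp add: z_def)
qed

lemma FS_D:
  assumes "hilbert H" "T \<in> FS H"
  shows "T \<in> ops H" "adj T T" "finite_dim {u \<in> H. T u = 0}" "closed (blinfun_apply T ` H)"
  using assms selfadjoint_adj[OF hilbertD[OF assms(1)]] by (auto simp: FS_def)

text \<open>Otherwise there are \<open>x k\<close> orthogonal to the kernel with norm
  \<open>k\<close> and images of norm at most 1. Closedness of the range splits every vector of
  \<open>H\<close> as \<open>T z\<close> plus an element of the kernel, so
  \<open>x k \<bullet> y = T (x k) \<bullet> z\<close> is bounded for each \<open>y\<close>, against
  \<open>uniform_boundedness\<close>.\<close>

lemma fredholm_bounded_below: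
  assumes H: "hilbert H" and T: "T \<in> FS H"
  obtains \<delta> where "\<delta> > 0"
    "\<And>u. u \<in> H \<Longrightarrow> (\<And>v. v \<in> H \<Longrightarrow> T v = 0 \<Longrightarrow> u \<bullet> v = 0) \<Longrightarrow> \<delta> * norm u \<le> norm (T u)"
proof -
  note Hs = hilbertD[OF H] and Td = FS_D[OF H T]
  define K where "K = {u \<in> H. \<forall>v\<in>H. T v = 0 \<longrightarrow> u \<bullet> v = 0}"
  have Kscale: "c *\<^sub>R u \<in> K" if "u \<in> K" for c u
    using that Hs(1) by (auto simp: K_def subspace_scale)
  have "\<exists>\<delta>>0. \<forall>u\<in>K. \<delta> * norm u \<le> norm (T u)"
  proof (rule ccontr)
    assume n: "\<not> ?thesis"
    have "\<exists>x\<in>K. norm x = real k \<and> norm (T x) \<le> 1" for k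
    proof -
      have "1 / (real k + 1) > 0" by simp
      then obtain u where u: "u \<in> K" "1 / (real k + 1) * norm u > norm (T u)" using n by (meson not_le)
      then have "0 < 1 / (real k + 1) * norm u" using norm_ge_zero[of "T u"] by linarith
      then have u0: "norm u > 0" by (simp add: zero_less_divide_iff)
      let ?x = "(real k / norm u) *\<^sub>R u"
      have "norm (T ?x) = real k / norm u * norm (T u)" by (simp add: bl)
      also have "\<dots> \<le> real k / norm u * (1 / (real k + 1) * norm u)"
        using u by (intro mult_left_mono) auto
      also have "\<dots> \<le> 1" using u0 by (simp add: field_simps)
      finally show ?thesis using Kscale[OF u(1)] u0 by (intro bexI[of _ ?x]) auto
    qed
    then obtain x where x: "\<And>k. x k \<in> K" "\<And>k. norm (x k) = real k" "\<And>k. norm (T (x k)) \<le> 1" by metis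
    let ?R = "blinfun_apply T ` H"
    have R: "subspace ?R" "closed ?R" using subspace_range[OF Hs(1)] Td by auto
    have "\<exists>C. \<forall>k. \<bar>x k \<bullet> y\<bar> \<le> C" for y
    proof -
      define y' where "y' = proj H y"
      define p where "p = proj ?R y'"
      have y': "y' \<in> H" using proj_in[OF Hs] by (simp add: y'_def)
      obtain z where z: "z \<in> H" "p = T z" using proj_in[OF R] by (auto simp: p_def)
      have pH: "p \<in> H" using z opsD[OF Hs Td(1)] by simp
      \<comment> \<open>The part of \<open>y'\<close> orthogonal to the range is killed by
        \<open>T\<close>, since \<open>T (T (y' - p))\<close> lies in the range.\<close>
      have "T (y' - p) \<bullet> T (y' - p) = (y' - p) \<bullet> T (T (y' - p))" by (rule adjD[OF Td(2)])
      also have "\<dots> = 0"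
        unfolding p_def using opsD(3)[OF Hs Td(1)] by (intro proj_orth[OF R]) auto
      finally have "T (y' - p) = 0" by simp
      then have o: "x k \<bullet> (y' - p) = 0" for k
        using x(1)[of k] y' pH Hs(1) by (auto simp: K_def subspace_diff)
      have "\<bar>x k \<bullet> y\<bar> \<le> norm z" for k
      proof -
        have "x k \<bullet> (y - y') = 0"
          using proj_orth[OF Hs, of "x k" y] x(1)[of k] by (simp add: y'_def K_def inner_commute)
        then have "x k \<bullet> y = x k \<bullet> T z" using o[of k] z by (simp add: inner_diff_right)
        also have "\<dots> = T (x k) \<bullet> z" by (simp add: adjD[OF Td(2)])
        also have "\<bar>\<dots>\<bar> \<le> norm (T (x k)) * norm z" by (rule Cauchy_Schwarz_ineq2)
        also have "\<dots> \<le> 1 * norm z" by (intro mult_right_mono x) simp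
        finally show ?thesis by simp
      qed
      then show ?thesis by blast
    qed
    then obtain C where "\<And>k. norm (x k) \<le> C" using uniform_boundedness by metis
    then show False using x(2) reals_Archimedean2[of C] by (metis not_le)
  qed
  then show ?thesis using that by (auto simp: K_def)
qed

section \<open>Spectral gap and stability of spectral projections near a Fredholm operator\<close>

context
  fixes H :: "'h::{real_inner, complete_space} set" and T :: "'h \<Rightarrow>\<^sub>L 'h" and \<delta> :: real
  assumes H: "hilbert H" and T: "T \<in> FS H" and \<delta>: "\<delta> > 0"
    and below: "\<And>u. u \<in> H \<Longrightarrow> (\<And>v. v \<in> H \<Longrightarrow> T v = 0 \<Longrightarrow> u \<bullet> v = 0) \<Longrightarrow> \<delta> * norm u \<le> norm (T u)"
begin

private lemma Hs: "subspace H" "closed H" using hilbertD[OF H] by auto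
private lemma To: "T \<in> ops H" and Ta: "adj T T" using FS_D[OF H T] by auto

definition kern :: "'h set" where "kern = {u \<in> H. T u = 0}"

private lemma kern: "subspace kern" "closed kern"
proof -
  have "kern = H \<inter> {u. T u = 0}" by (auto simp: kern_def)
  then show "subspace kern" "closed kern"
    using Hs subspace_kernel[of T] closed_kernel[of T] by (auto simp: subspace_inter closed_Int)
qed

private lemma below': "u \<in> H \<Longrightarrow> proj kern u = 0 \<Longrightarrow> \<delta> * norm u \<le> norm (T u)"
  using proj_0_iff[OF kern] by (intro below) (auto simp: kern_def)

text \<open>\<open>T - t\<close> splits along kernel and complement: it has size
  \<open>\<delta> / 2\<close> on the kernel and at least \<open>\<delta> - \<delta> / 2\<close> on
  the complement. So the levels \<open>\<plusminus>\<delta> / 2\<close> keep the distance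
  \<open>\<delta> / 2\<close> from the spectrum of \<open>T\<close>.\<close>

private lemma resolvent_bound:
  assumes "\<bar>t\<bar> = \<delta> / 2" "u \<in> H" shows "\<delta> / 2 * norm u \<le> norm (T u - t *\<^sub>R u)"
proof -
  define k where "k = proj kern u"
  define m where "m = u - k"
  have k: "T k = 0" "k \<in> H" using proj_in[OF kern, of u] by (auto simp: k_def kern_def)
  have m: "m \<in> H" "proj kern m = 0"
    using assms(2) k(2) Hs(1) is_projD(2)[OF is_proj_proj[OF kern], of u]
    by (auto simp: m_def k_def subspace_diff bl)
  have u: "u = k + m" by (simp add: m_def)
  have km: "k \<bullet> m = 0" using proj_orth[OF kern proj_in[OF kern], of u u] by (simp add: k_def m_def inner_commute)
  have kTm: "k \<bullet> T m = 0" using adjD[OF Ta, of k m] k by simp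
  have "\<delta> * norm m \<le> norm (T m)" by (rule below'[OF m])
  also have "\<dots> \<le> norm (T m - t *\<^sub>R m) + norm (t *\<^sub>R m)"
    using norm_triangle_sub[of "T m" "t *\<^sub>R m"] by (simp add: add.commute)
  finally have "\<delta> / 2 * norm m \<le> norm (T m - t *\<^sub>R m)" using assms(1) by simp
  then have "(\<delta> / 2 * norm m)\<^sup>2 \<le> (norm (T m - t *\<^sub>R m))\<^sup>2" using \<delta> by (intro power_mono) auto
  moreover have "(norm (t *\<^sub>R k))\<^sup>2 = (\<delta> / 2 * norm k)\<^sup>2" using assms(1) by simp
  moreover have "(norm (T u - t *\<^sub>R u))\<^sup>2 = (norm (t *\<^sub>R k))\<^sup>2 + (norm (T m - t *\<^sub>R m))\<^sup>2"
    unfolding u power2_norm_eq_inner using km kTm k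
    by (simp add: bl inner_simps inner_commute algebra_simps)
  moreover
  have "(norm u)\<^sup>2 = (norm k)\<^sup>2 + (norm m)\<^sup>2"
    unfolding u power2_norm_eq_inner using km by (simp add: inner_simps inner_commute)
  then have "(\<delta> / 2 * norm u)\<^sup>2 = (\<delta> / 2 * norm k)\<^sup>2 + (\<delta> / 2 * norm m)\<^sup>2"
    unfolding power_mult_distrib by (simp add: distrib_left)
  ultimately have "(\<delta> / 2 * norm u)\<^sup>2 \<le> (norm (T u - t *\<^sub>R u))\<^sup>2" by linarith
  then show ?thesis by (rule power2_le_imp_le) simp
qed

private lemma perturbed_bound:
  assumes "norm (S - T) \<le> \<delta> / 8" shows "norm (S u - T u) \<le> \<delta> / 8 * norm u"
  using norm_blinfun[of "S - T" u] mult_right_mono[OF assms, of "norm u"] by (simp add: bl)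

text \<open>A nonzero vector in the spectral range of \<open>S\<close> for the interval of radius
  \<open>\<delta> / 4\<close> about \<open>\<plusminus>\<delta> / 2\<close> would violate
  \<open>resolvent_bound\<close>, because \<open>\<delta> / 4 + \<delta> / 8 < \<delta> / 2\<close>.
  Hence \<open>S\<close> has no spectrum at distance between \<open>\<delta> / 4\<close> and
  \<open>3 * \<delta> / 4\<close> from 0, and every cutoff in that range selects the same
  projection.\<close>

lemma spectral_gap:
  assumes S: "S \<in> ops H" "adj S S" "norm (S - T) \<le> \<delta> / 8"
  shows "spectral_proj H (- (3 * \<delta> / 4)) (3 * \<delta> / 4) S = spectral_proj H (- (\<delta> / 2)) (\<delta> / 2) S"
    "spectral_proj H (- (\<delta> / 4)) (\<delta> / 4) S = spectral_proj H (- (\<delta> / 2)) (\<delta> / 2) S"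
proof -
  note SH = Hs S(1,2)
  have gap: "sle S (t + \<delta> / 4) u = slt S (t - \<delta> / 4) u" if t: "\<bar>t\<bar> = \<delta> / 2" and u: "u \<in> H" for t u
  proof -
    let ?P = "spectral_proj H (t - \<delta> / 4) (t + \<delta> / 4) S"
    have P: "is_proj ?P" using \<delta> by (intro is_proj_spectral_proj[OF SH]) auto
    define v where "v = ?P u"
    have v: "?P v = v" by (simp add: v_def is_projD(2)[OF P])
    have vH: "v \<in> H" using opsD(3)[OF Hs spectral_proj_ops[OF SH]] by (simp add: v_def)
    have "\<delta> / 2 * norm v \<le> norm (T v - t *\<^sub>R v)" by (rule resolvent_bound[OF t vH])
    also have "\<dots> \<le> norm (S v - t *\<^sub>R v) + norm (S v - T v)"
      using norm_triangle_ineq4[of "S v - t *\<^sub>R v" "S v - T v"] by simp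
    also have "\<dots> \<le> \<delta> / 4 * norm v + \<delta> / 8 * norm v"
      using \<delta> v by (intro add_mono spectral_proj_norm_range_center[OF SH] perturbed_bound S(3)) auto
    finally have "\<delta> / 8 * norm v \<le> 0" by simp
    then have "v = 0" using \<delta> by (simp add: mult_le_0_iff)
    then show ?thesis using spectral_proj_on[OF SH u] by (simp add: v_def)
  qed
  have g1: "sle S (3 * \<delta> / 4) u = slt S (\<delta> / 4) u" if "u \<in> H" for u
    using gap[of "\<delta> / 2" u] that \<delta> by (simp add: field_simps)
  have g2: "sle S (- (\<delta> / 4)) u = slt S (- (3 * \<delta> / 4)) u" if "u \<in> H" for u
    using gap[of "- (\<delta> / 2)" u] that \<delta> by (simp add: field_simps)
  have h1: "sle S s u = slt S (\<delta> / 4) u" if "u \<in> H" "\<delta> / 4 \<le> s" "s \<le> 3 * \<delta> / 4" for u s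
  proof -
    have "sle S s u = sle S s (sle S (3 * \<delta> / 4) u)" by (simp only: sle_mono(2)[OF S(2) that(3)])
    also have "\<dots> = sle S s (slt S (\<delta> / 4) u)" by (simp only: g1[OF that(1)])
    also have "\<dots> = slt S (\<delta> / 4) u" by (rule slt_le_sle(1)[OF S(2) that(2)])
    finally show ?thesis .
  qed
  have h2: "slt S s u = slt S (- (3 * \<delta> / 4)) u" if "u \<in> H" "- (3 * \<delta> / 4) \<le> s" "s \<le> - (\<delta> / 4)" for u s
  proof -
    have "slt S s u = slt S s (sle S (- (\<delta> / 4)) u)" by (simp only: slt_le_sle(2)[OF S(2) that(3)])
    also have "\<dots> = slt S s (slt S (- (3 * \<delta> / 4)) u)" by (simp only: g2[OF that(1)])
    also have "\<dots> = slt S (- (3 * \<delta> / 4)) u" by (rule slt_mono(1)[OF S(2) that(2)])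
    finally show ?thesis .
  qed
  have e: "spectral_proj H (- s) s S u = slt S (\<delta> / 4) u - slt S (- (3 * \<delta> / 4)) u"
    if "u \<in> H" "\<delta> / 4 \<le> s" "s \<le> 3 * \<delta> / 4" for u s
    using that by (simp only: spectral_proj_on[OF SH that(1)] h1 h2[of u "- s"] neg_le_iff_le)
  show "spectral_proj H (- (3 * \<delta> / 4)) (3 * \<delta> / 4) S = spectral_proj H (- (\<delta> / 2)) (\<delta> / 2) S"
  proof (rule ops_eqI[OF Hs spectral_proj_ops[OF SH] spectral_proj_ops[OF SH]])
    fix u assume u: "u \<in> H"
    show "spectral_proj H (- (3 * \<delta> / 4)) (3 * \<delta> / 4) S u = spectral_proj H (- (\<delta> / 2)) (\<delta> / 2) S u"
      using e[OF u, of "(3 * \<delta> / 4)"] e[OF u, of "\<delta> / 2"] \<delta> by simp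
  qed
  show "spectral_proj H (- (\<delta> / 4)) (\<delta> / 4) S = spectral_proj H (- (\<delta> / 2)) (\<delta> / 2) S"
  proof (rule ops_eqI[OF Hs spectral_proj_ops[OF SH] spectral_proj_ops[OF SH]])
    fix u assume u: "u \<in> H"
    show "spectral_proj H (- (\<delta> / 4)) (\<delta> / 4) S u = spectral_proj H (- (\<delta> / 2)) (\<delta> / 2) S u"
      using e[OF u, of "(\<delta> / 4)"] e[OF u, of "\<delta> / 2"] \<delta> by simp
  qed
qed

lemma gap_range:
  assumes S: "S \<in> ops H" "adj S S" "norm (S - T) \<le> \<delta> / 8" and u: "spectral_proj H (- (\<delta> / 2)) (\<delta> / 2) S u = u"
  shows "norm (S u) \<le> \<delta> / 4 * norm u"
  using spectral_proj_norm_range[OF Hs S(1,2), of "\<delta> / 4" u] spectral_gap(2)[OF S] u \<delta> by simp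

lemma gap_kernel:
  assumes S: "S \<in> ops H" "adj S S" "norm (S - T) \<le> \<delta> / 8"
    and u: "spectral_proj H (- (\<delta> / 2)) (\<delta> / 2) S u = 0" "u \<in> H"
  shows "3 * \<delta> / 4 * norm u \<le> norm (S u)"
  using spectral_proj_norm_kernel[OF Hs S(1,2), of "3 * \<delta> / 4" u] spectral_gap(1)[OF S] u \<delta> by simp

text \<open>Projecting to the kernel of \<open>T\<close> is injective on the spectral space: a
  vector \<open>u\<close> sent to 0 satisfies \<open>\<delta> * norm u \<le> norm (T u)\<close>,
  while \<open>gap_range\<close> and the perturbation allow only \<open>3 / 8\<close> of
  that.\<close>

lemma gap_finite_dim:
  assumes S: "S \<in> ops H" "adj S S" "norm (S - T) \<le> \<delta> / 8"
  shows "finite_dim (spectral_space H S (- (\<delta> / 2)) (\<delta> / 2))"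
proof -
  let ?P = "spectral_proj H (- (\<delta> / 2)) (\<delta> / 2) S" and ?V = "spectral_space H S (- (\<delta> / 2)) (\<delta> / 2)"
  have P: "is_proj ?P" using \<delta> by (intro is_proj_spectral_proj[OF Hs S(1,2)]) auto
  have Po: "?P \<in> ops H" by (rule spectral_proj_ops[OF Hs S(1,2)])
  have V: "subspace ?V" unfolding spectral_space_def by (rule subspace_range[OF Hs(1)])
  have fixV: "?P u = u" "u \<in> H" if "u \<in> ?V" for u
    using that is_projD(2)[OF P] opsD(3)[OF Hs Po] by (auto simp: spectral_space_def)
  show ?thesis
  proof (rule finite_dim_inj[OF linear_blinfun V])
    show "inj_on (proj kern) ?V"
    proof (rule inj_onI)
      fix x y assume xy: "x \<in> ?V" "y \<in> ?V" "proj kern x = proj kern y"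
      let ?u = "x - y"
      have u: "?u \<in> ?V" using xy V by (simp add: subspace_diff)
      have "proj kern ?u = 0" using xy by (simp add: bl)
      then have "\<delta> * norm ?u \<le> norm (T ?u)" using fixV(2)[OF u] by (intro below')
      also have "\<dots> \<le> norm (S ?u) + norm (S ?u - T ?u)"
        using norm_triangle_ineq4[of "S ?u" "S ?u - T ?u"] by simp
      also have "\<dots> \<le> \<delta> / 4 * norm ?u + \<delta> / 8 * norm ?u"
        by (intro add_mono gap_range[OF S] fixV(1)[OF u] perturbed_bound S(3))
      finally have "5 * \<delta> / 8 * norm ?u \<le> 0" by (simp add: field_simps)
      then show "x = y" using \<delta> by (simp add: mult_le_0_iff)
    qed
    have "finite_dim kern" using FS_D(3)[OF H T] by (simp add: kern_def)
    then show "finite_dim (proj kern ` ?V)"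
      by (rule finite_dim_subset) (use proj_in[OF kern] in auto)
  qed
qed

text \<open>Let \<open>P\<close>, \<open>Q\<close> be the projections of \<open>S\<close>,
  \<open>R\<close> and \<open>Z = (1 - P) Q\<close>. As \<open>S\<close> is at least
  \<open>3 * \<delta> / 4\<close> on the range of \<open>1 - P\<close> and \<open>R\<close> at most
  \<open>\<delta> / 4\<close> on that of \<open>Q\<close>, the identity
  \<open>S Z = (1 - P) (S - R) Q + Z R Q\<close> gives
  \<open>norm Z \<le> 2 / \<delta> * norm (S - R)\<close>. The difference \<open>P - Q\<close>
  consists of two such terms.\<close>

lemma gap_lipschitz:
  assumes S: "S \<in> ops H" "adj S S" "norm (S - T) \<le> \<delta> / 8"
    and R: "R \<in> ops H" "adj R R" "norm (R - T) \<le> \<delta> / 8"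
  shows "norm (spectral_proj H (- (\<delta> / 2)) (\<delta> / 2) S - spectral_proj H (- (\<delta> / 2)) (\<delta> / 2) R)
    \<le> 4 / \<delta> * norm (S - R)"
proof -
  have half: "norm ((proj H - spectral_proj H (- (\<delta> / 2)) (\<delta> / 2) S) o\<^sub>L spectral_proj H (- (\<delta> / 2)) (\<delta> / 2) R)
     \<le> 2 / \<delta> * norm (S - R)"
    if S: "S \<in> ops H" "adj S S" "norm (S - T) \<le> \<delta> / 8"
      and R: "R \<in> ops H" "adj R R" "norm (R - T) \<le> \<delta> / 8" for S R
  proof -
    let ?P = "spectral_proj H (- (\<delta> / 2)) (\<delta> / 2) S" and ?Q = "spectral_proj H (- (\<delta> / 2)) (\<delta> / 2) R"
    define Z where "Z = (proj H - ?P) o\<^sub>L ?Q"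
    have P: "is_proj ?P" and Q: "is_proj ?Q" using \<delta> by (auto intro!: is_proj_spectral_proj[OF Hs] S R)
    have Po: "?P \<in> ops H" and Qo: "?Q \<in> ops H" by (auto intro!: spectral_proj_ops[OF Hs] S R)
    have PS: "?P (S v) = S (?P v)" for v by (rule commD[OF spectral_proj_comm_self[OF Hs S(1,2)]])
    have QR: "?Q (R v) = R (?Q v)" for v by (rule commD[OF spectral_proj_comm_self[OF Hs R(1,2)]])
    have Zu: "Z u = ?Q u - ?P (?Q u)" for u by (simp add: Z_def bl opsD(2)[OF Hs Qo])
    have *: "3 * \<delta> / 4 * norm (Z u) \<le> (norm (S - R) + \<delta> / 4 * norm Z) * norm u" for u
    proof -
      have "?P (Z u) = 0" by (simp add: Zu bl is_projD(2)[OF P])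
      moreover have "Z u \<in> H" using opsD(3)[OF Hs Po] opsD(3)[OF Hs Qo] Hs(1) by (simp add: Zu subspace_diff)
      ultimately have "3 * \<delta> / 4 * norm (Z u) \<le> norm (S (Z u))" by (rule gap_kernel[OF S])
      also have "S (Z u) = (proj H - ?P) ((S - R) (?Q u)) + Z (R (?Q u))"
        by (simp add: Zu bl PS QR is_projD(2)[OF Q] opsD[OF Hs S(1)] opsD[OF Hs R(1)])
      also have "norm \<dots> \<le> norm (S - R) * norm u + norm Z * (\<delta> / 4 * norm u)"
      proof (rule norm_triangle_mono)
        have "comm (proj H) ?P" by (rule ops_comm[OF Hs Po])
        then have "is_proj (proj H - ?P)"
          using is_proj_compose[OF is_proj_proj[OF Hs] is_proj_compl[OF P]]
          by (rule_tac back_subst[of is_proj, OF _ blinfun_eqI[of "proj H o\<^sub>L (id_blinfun - ?P)"]])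
            (auto simp: bl opsD(2)[OF Hs Po] intro: comm_intros)
        then have "norm ((proj H - ?P) ((S - R) (?Q u))) \<le> norm ((S - R) (?Q u))" by (rule is_proj_le)
        also have "\<dots> \<le> norm (S - R) * norm (?Q u)" by (rule norm_blinfun)
        also have "\<dots> \<le> norm (S - R) * norm u" by (intro mult_left_mono is_proj_le Q) simp
        finally show "norm ((proj H - ?P) ((S - R) (?Q u))) \<le> norm (S - R) * norm u" .
        have "norm (Z (R (?Q u))) \<le> norm Z * norm (R (?Q u))" by (rule norm_blinfun)
        also have "\<dots> \<le> norm Z * (\<delta> / 4 * norm (?Q u))"
          by (intro mult_left_mono gap_range[OF R] is_projD(2)[OF Q]) simp
        also have "\<dots> \<le> norm Z * (\<delta> / 4 * norm u)"
          using \<delta> is_proj_le[OF Q] by (intro mult_left_mono) auto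
        finally show "norm (Z (R (?Q u))) \<le> norm Z * (\<delta> / 4 * norm u)" .
      qed
      finally show ?thesis by (simp add: algebra_simps)
    qed
    have c0: "0 < 3 * \<delta> / 4" using \<delta> by simp
    have "norm (Z u) \<le> (norm (S - R) + \<delta> / 4 * norm Z) / (3 * \<delta> / 4) * norm u" for u
    proof -
      have "norm (Z u) * (3 * \<delta> / 4) \<le> (norm (S - R) + \<delta> / 4 * norm Z) * norm u"
        using *[of u] by (simp only: mult.commute[of "norm (Z u)"])
      then show ?thesis by (simp only: times_divide_eq_left pos_le_divide_eq[OF c0])
    qed
    then have "norm Z \<le> (norm (S - R) + \<delta> / 4 * norm Z) / (3 * \<delta> / 4)"
      using \<delta> by (intro norm_blinfun_bound) auto
    then have "3 * \<delta> / 4 * norm Z \<le> norm (S - R) + \<delta> / 4 * norm Z"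
      using \<delta> by (simp add: field_simps)
    then show ?thesis using \<delta> by (simp add: Z_def[symmetric] field_simps)
  qed
  let ?P = "spectral_proj H (- (\<delta> / 2)) (\<delta> / 2) S" and ?Q = "spectral_proj H (- (\<delta> / 2)) (\<delta> / 2) R"
  have P: "is_proj ?P" and Q: "is_proj ?Q" using \<delta> by (auto intro!: is_proj_spectral_proj[OF Hs] S R)
  have Po: "?P \<in> ops H" and Qo: "?Q \<in> ops H" by (auto intro!: spectral_proj_ops[OF Hs] S R)
  \<comment> \<open>Only products of the form \<open>(1 - P) Q\<close> have been estimated; the
    first term is brought to that form by taking the adjoint.\<close>
  have "?P - ?Q = (?P o\<^sub>L (proj H - ?Q)) - ((proj H - ?P) o\<^sub>L ?Q)"
    by (rule blinfun_eqI) (simp add: bl opsD[OF Hs Po] opsD[OF Hs Qo])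
  also have "norm \<dots> \<le> norm (?P o\<^sub>L (proj H - ?Q)) + norm ((proj H - ?P) o\<^sub>L ?Q)" by (rule norm_triangle_ineq4)
  also have "norm (?P o\<^sub>L (proj H - ?Q)) \<le> norm ((proj H - ?Q) o\<^sub>L ?P)"
    by (intro adj_norm_le adj_compose adj_diff is_projD(1)[OF is_proj_proj[OF Hs]] is_projD(1) P Q)
  also have "\<dots> \<le> 2 / \<delta> * norm (S - R)" using half[OF R S] by (simp add: norm_minus_commute)
  also note half[OF S R]
  finally show ?thesis by simp
qed

end

definition sf_piece :: "'h::{real_inner, complete_space} set \<Rightarrow> (real \<Rightarrow> 'h \<Rightarrow>\<^sub>L 'h) \<Rightarrow> real \<Rightarrow> real \<Rightarrow> real \<Rightarrow> bool" where
  "sf_piece H L x y a \<longleftrightarrow> a > 0 \<and> continuous_on {x..y} (\<lambda>s. spectral_proj H (- a) a (L s)) \<and>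
     (\<forall>s\<in>{x..y}. finite_dim (spectral_space H (L s) (- a) a))"

text \<open>Having an admissible partition is a property of intervals that survives concatenation
  and, by the gap estimates, holds on all short intervals around each point; the bisection principle
  \<open>Bolzano\<close> then gives it on \<open>{0..1}\<close>.\<close>

lemma sf_data_exists:
  assumes H: "hilbert H" and L: "\<And>s. s \<in> {0..1} \<Longrightarrow> L s \<in> FS H" "continuous_on {0..1} L"
  shows "\<exists>N l a. sf_data H L N l a"
proof -
  define Q where "Q x y \<longleftrightarrow> (0 \<le> x \<and> x \<le> y \<and> y \<le> 1 \<longrightarrow> (\<exists>N l a. l 0 = x \<and> l N = y \<and> (\<forall>i<N. l i < l (Suc i)) \<and>
    (\<forall>i\<in>{1..N}. sf_piece H L (l (i - 1)) (l i) (a i))))" for x y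
  have "Q 0 1"
  proof (rule Bolzano[of 0 1 Q])
    show "(0::real) \<le> 1" by simp
  next
    fix x y z assume Q: "Q x y" "Q y z" "x \<le> y" "y \<le> z"
    show "Q x z" unfolding Q_def
    proof
      assume xz: "0 \<le> x \<and> x \<le> z \<and> z \<le> 1"
      obtain N l a where 1: "l 0 = x" "l N = y" "\<forall>i<N. l i < l (Suc i)"
        "\<forall>i\<in>{1..N}. sf_piece H L (l (i - 1)) (l i) (a i)" using Q(1,3,4) xz by (auto simp: Q_def)
      obtain N' l' a' where 2: "l' 0 = y" "l' N' = z" "\<forall>i<N'. l' i < l' (Suc i)"
        "\<forall>i\<in>{1..N'}. sf_piece H L (l' (i - 1)) (l' i) (a' i)" using Q(2,3,4) xz by (auto simp: Q_def)
      define m where "m i = (if i \<le> N then l i else l' (i - N))" for i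
      define b where "b i = (if i \<le> N then a i else a' (i - N))" for i
      have m': "m i = l' (i - N)" if "i \<ge> N" for i using that 1(2) 2(1) by (auto simp: m_def)
      have "m i < m (Suc i)" if "i < N + N'" for i
      proof (cases "i < N")
        case False
        then show ?thesis using m'[of i] m'[of "Suc i"] 2(3) that by (simp add: Suc_diff_le)
      qed (use 1 in \<open>simp add: m_def\<close>)
      moreover have "sf_piece H L (m (i - 1)) (m i) (b i)" if "i \<in> {1..N + N'}" for i
      proof (cases "i \<le> N")
        case False
        then have "i - N \<in> {1..N'}" using that by auto
        then have "sf_piece H L (l' (i - N - 1)) (l' (i - N)) (a' (i - N))" using 2(4) by blast
        then show ?thesis using False m'[of i] m'[of "i - 1"] by (simp add: b_def diff_commute)
      qed (use 1 that in \<open>auto simp: m_def b_def\<close>)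
      moreover have "m 0 = x" "m (N + N') = z" using 1 2 m'[of "N + N'"] by (auto simp: m_def)
      ultimately show "\<exists>N l a. l 0 = x \<and> l N = z \<and> (\<forall>i<N. l i < l (Suc i)) \<and>
        (\<forall>i\<in>{1..N}. sf_piece H L (l (i - 1)) (l i) (a i))" by blast
    qed
  next
    fix x :: real assume x: "0 \<le> x" "x \<le> 1"
    then have xL: "L x \<in> FS H" using L by auto
    obtain \<delta> where \<delta>: "\<delta> > 0" "\<And>u. u \<in> H \<Longrightarrow> (\<And>v. v \<in> H \<Longrightarrow> L x v = 0 \<Longrightarrow> u \<bullet> v = 0) \<Longrightarrow> \<delta> * norm u \<le> norm (L x u)"
      using fredholm_bounded_below[OF H xL] by metis
    obtain d where d: "d > 0" "\<And>s. s \<in> {0..1} \<Longrightarrow> dist s x < d \<Longrightarrow> dist (L s) (L x) < \<delta> / 8"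
      using L(2) x \<delta>(1) unfolding continuous_on_iff by (metis atLeastAtMost_iff divide_pos_pos zero_less_numeral)
    have "Q y z" if yz: "y \<le> x" "x \<le> z" "z - y < d" for y z
      unfolding Q_def
    proof
      assume *: "0 \<le> y \<and> y \<le> z \<and> z \<le> 1"
      have near: "L s \<in> ops H" "adj (L s) (L s)" "norm (L s - L x) \<le> \<delta> / 8" if "s \<in> {y..z}" for s
      proof -
        have s: "s \<in> {0..1}" "dist s x < d" using that * yz by (auto simp: dist_real_def)
        show "L s \<in> ops H" "adj (L s) (L s)" using FS_D[OF H L(1)[OF s(1)]] by auto
        show "norm (L s - L x) \<le> \<delta> / 8" using d(2)[OF s] by (simp add: dist_norm)
      qed
      have "sf_piece H L y z (\<delta> / 2)"
        unfolding sf_piece_def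
      proof (intro conjI ballI)
        show "finite_dim (spectral_space H (L s) (- (\<delta> / 2)) (\<delta> / 2))" if "s \<in> {y..z}" for s
          by (rule gap_finite_dim[OF H xL \<delta> near[OF that]])
        show "continuous_on {y..z} (\<lambda>s. spectral_proj H (- (\<delta> / 2)) (\<delta> / 2) (L s))"
        proof (rule continuous_on_compose2[of "L ` {y..z}" _ "{y..z}" L])
          show "continuous_on (L ` {y..z}) (spectral_proj H (- (\<delta> / 2)) (\<delta> / 2))"
          proof (rule lipschitz_on_continuous_on)
            show "(4 / \<delta>)-lipschitz_on (L ` {y..z}) (spectral_proj H (- (\<delta> / 2)) (\<delta> / 2))"
            proof (rule lipschitz_onI)
              fix A B assume "A \<in> L ` {y..z}" "B \<in> L ` {y..z}"
              then show "dist (spectral_proj H (- (\<delta> / 2)) (\<delta> / 2) A) (spectral_proj H (- (\<delta> / 2)) (\<delta> / 2) B)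
                \<le> 4 / \<delta> * dist A B"
                unfolding dist_norm using gap_lipschitz[OF H xL \<delta> near near] by blast
            qed (use \<delta>(1) in simp)
          qed
          show "continuous_on {y..z} L" using L(2) * by (auto intro: continuous_on_subset)
        qed auto
      qed (use \<delta> in simp)
      then show "\<exists>N l a. l 0 = y \<and> l N = z \<and> (\<forall>i<N. l i < l (Suc i)) \<and>
        (\<forall>i\<in>{1..N}. sf_piece H L (l (i - 1)) (l i) (a i))"
      \<comment> \<open>Partition points increase strictly, so a degenerate interval gets the empty
        partition \<open>N = 0\<close>.\<close>
      proof (cases "y = z")
        case True
        then show ?thesis by (intro exI[of _ 0] exI[of _ "\<lambda>_. y"]) auto
      next
        case False
        then show ?thesis using * \<open>sf_piece H L y z (\<delta> / 2)\<close>
          by (intro exI[of _ 1] exI[of _ "\<lambda>i. if i = 0 then y else z"] exI[of _ "\<lambda>_. \<delta> / 2"]) auto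
      qed
    qed
    then show "\<exists>d>0. \<forall>y z. y \<le> x \<and> x \<le> z \<and> z - y < d \<longrightarrow> Q y z" using d(1) by blast
  qed
  then show ?thesis by (auto simp: Q_def sf_data_def sf_piece_def)
qed

section \<open>The representation ring\<close>

declare RO_eq.trans [trans]

definition class_diff :: "('g, 'm) monoid_scheme \<Rightarrow> 'g topology \<Rightarrow> 'g rep \<Rightarrow> 'g rep \<Rightarrow> ('g rep \<times> 'g rep) set" where
  "class_diff G X U V = RO_rel G X `` {(U, V)}"

lemma rep_isoI:
  assumes "is_rep G X n U" "is_rep G X n V" "P \<in> carrier_mat n n" "Q \<in> carrier_mat n n"
    "P * Q = 1\<^sub>m n" "Q * P = 1\<^sub>m n" "\<And>g. g \<in> carrier G \<Longrightarrow> P * U g = V g * P"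
  shows "rep_iso G X U V"
  unfolding rep_iso_def invertible_mat_def inverts_mat_def using assms
  by (intro exI[of _ n] exI[of _ P]) (auto intro!: exI[of _ Q])

lemma rep_isoE:
  assumes "rep_iso G X U V"
  obtains n P Q where "is_rep G X n U" "is_rep G X n V" "P \<in> carrier_mat n n" "Q \<in> carrier_mat n n"
    "P * Q = 1\<^sub>m n" "Q * P = 1\<^sub>m n" "\<And>g. g \<in> carrier G \<Longrightarrow> P * U g = V g * P"
proof -
  obtain n P where 1: "is_rep G X n U" "is_rep G X n V" "P \<in> carrier_mat n n"
    "\<And>g. g \<in> carrier G \<Longrightarrow> P * U g = V g * P" and i: "invertible_mat P"
    using assms by (auto simp: rep_iso_def)
  obtain Q where Q: "P * Q = 1\<^sub>m (dim_row P)" "Q * P = 1\<^sub>m (dim_row Q)"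
    using i by (auto simp: invertible_mat_def inverts_mat_def)
  have "dim_col Q = n" using arg_cong[OF Q(1), of dim_col] 1(3) by auto
  moreover have "dim_row Q = n" using arg_cong[OF Q(2), of dim_col] 1(3) by auto
  ultimately have "Q \<in> carrier_mat n n" by auto
  then show ?thesis using that[OF 1(1,2,3) _ _ _ 1(4)] Q 1(3) by auto
qed

lemma is_rep_dim: "is_rep G X n U \<Longrightarrow> g \<in> carrier G \<Longrightarrow> U g \<in> carrier_mat n n"
  by (auto simp: is_rep_def)

lemma rep_iso_refl: "is_rep G X n U \<Longrightarrow> rep_iso G X U U"
  by (rule rep_isoI[of _ _ n _ _ "1\<^sub>m n" "1\<^sub>m n"]) (auto dest: is_rep_dim)

lemma rep_iso_sym:
  assumes "rep_iso G X U V" shows "rep_iso G X V U"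
proof -
  obtain n P Q where *: "is_rep G X n U" "is_rep G X n V" "P \<in> carrier_mat n n" "Q \<in> carrier_mat n n"
    "P * Q = 1\<^sub>m n" "Q * P = 1\<^sub>m n" "\<And>g. g \<in> carrier G \<Longrightarrow> P * U g = V g * P"
    using rep_isoE[OF assms] by metis
  show ?thesis
  proof (rule rep_isoI[OF *(2,1,4,3,6,5)])
    fix g assume g: "g \<in> carrier G"
    note c = is_rep_dim[OF *(1) g] is_rep_dim[OF *(2) g] *(3,4)
    have "Q * V g = Q * (V g * (P * Q))" using c by (simp add: *(5))
    also have "\<dots> = Q * ((V g * P) * Q)" using c by (simp add: assoc_mult_mat[of _ n n _ n _ n])
    also have "\<dots> = Q * ((P * U g) * Q)" by (simp add: *(7)[OF g])
    also have "\<dots> = (Q * P) * (U g * Q)" using c by (simp add: assoc_mult_mat[of _ n n _ n _ n])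
    also have "\<dots> = U g * Q" using c by (simp add: *(6))
    finally show "Q * V g = U g * Q" .
  qed
qed

lemma rep_iso_trans:
  assumes "rep_iso G X U V" "rep_iso G X V W" shows "rep_iso G X U W"
proof -
  obtain n P Q where 1: "is_rep G X n U" "is_rep G X n V" "P \<in> carrier_mat n n" "Q \<in> carrier_mat n n"
    "P * Q = 1\<^sub>m n" "Q * P = 1\<^sub>m n" "\<And>g. g \<in> carrier G \<Longrightarrow> P * U g = V g * P"
    using rep_isoE[OF assms(1)] by metis
  obtain m P' Q' where 2: "is_rep G X m V" "is_rep G X m W" "P' \<in> carrier_mat m m" "Q' \<in> carrier_mat m m"
    "P' * Q' = 1\<^sub>m m" "Q' * P' = 1\<^sub>m m" "\<And>g. g \<in> carrier G \<Longrightarrow> P' * V g = W g * P'"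
    using rep_isoE[OF assms(2)] by metis
  \<comment> \<open>The size is not a component of a representation but can be read off from its
    value at the identity.\<close>
  have "V \<one>\<^bsub>G\<^esub> = 1\<^sub>m n" "V \<one>\<^bsub>G\<^esub> = 1\<^sub>m m" using 1(2) 2(1) by (auto simp: is_rep_def)
  then have mn: "m = n" by (metis index_one_mat(2))
  note ass = assoc_mult_mat[of _ n n _ n _ n]
  show ?thesis
  proof (rule rep_isoI[OF 1(1) 2(2)[unfolded mn], of "P' * P" "Q * Q'"])
    note c = 1(3,4) 2(3,4)[unfolded mn]
    show "P' * P \<in> carrier_mat n n" "Q * Q' \<in> carrier_mat n n" using c by auto
    have "(P' * P) * (Q * Q') = P' * ((P * Q) * Q')" using c by (simp add: ass)
    then show "(P' * P) * (Q * Q') = 1\<^sub>m n" using c 1(5) 2(5) mn by simp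
    have "(Q * Q') * (P' * P) = Q * ((Q' * P') * P)" using c by (simp add: ass)
    then show "(Q * Q') * (P' * P) = 1\<^sub>m n" using c 1(6) 2(6) mn by simp
    fix g assume g: "g \<in> carrier G"
    note d = c is_rep_dim[OF 1(1) g] is_rep_dim[OF 1(2) g] is_rep_dim[OF 2(2) g, unfolded mn]
    have "(P' * P) * U g = P' * (P * U g)" using d by (simp add: ass)
    also have "\<dots> = (P' * V g) * P" using d by (simp add: 1(7)[OF g] ass)
    also have "\<dots> = W g * (P' * P)" using d by (simp add: 2(7)[OF g] ass)
    finally show "(P' * P) * U g = W g * (P' * P)" .
  qed
qed

lemma rep_iso_reps: "rep_iso G X U V \<Longrightarrow> U \<in> reps G X \<and> V \<in> reps G X"
  by (auto simp: rep_iso_def reps_def)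

lemma mat_sum_carrier: "A \<in> carrier_mat n n \<Longrightarrow> B \<in> carrier_mat m m \<Longrightarrow> mat_sum A B \<in> carrier_mat (n + m) (n + m)"
  by (auto simp: mat_sum_def)

lemma mat_sum_mult:
  assumes "A \<in> carrier_mat n n" "B \<in> carrier_mat m m" "A' \<in> carrier_mat n n" "B' \<in> carrier_mat m m"
  shows "mat_sum A B * mat_sum A' B' = mat_sum (A * A') (B * B')"
proof -
  have "mat_sum A B * mat_sum A' B' = four_block_mat (A * A' + 0\<^sub>m n m * 0\<^sub>m m n) (A * 0\<^sub>m n m + 0\<^sub>m n m * B')
      (0\<^sub>m m n * A' + B * 0\<^sub>m m n) (0\<^sub>m m n * 0\<^sub>m n m + B * B')"
    unfolding mat_sum_def using assms
    by (subst mult_four_block_mat[of _ n n _ m _ m _ _ n _ m]) auto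
  then show ?thesis using assms by (simp add: mat_sum_def)
qed

lemma mat_sum_one: "mat_sum (1\<^sub>m n) (1\<^sub>m m) = 1\<^sub>m (n + m)"
  by (simp add: mat_sum_def)

lemma mat_sum_assoc: "mat_sum A (mat_sum B C) = mat_sum (mat_sum A B) C"
  unfolding mat_sum_def by (rule assoc_four_block_mat)

lemma mat_sum_index:
  assumes "A \<in> carrier_mat n n" "B \<in> carrier_mat m m" "i < n + m" "j < n + m"
  shows "mat_sum A B $$ (i, j) =
    (if i < n then if j < n then A $$ (i, j) else 0 else if j < n then 0 else B $$ (i - n, j - n))"
  using assms by (auto simp: mat_sum_def)

context
  fixes G :: "('g, 'm) monoid_scheme" and X :: "'g topology"
  assumes G: "group G" and top: "topspace X = carrier G"
begin

lemma is_rep_sum: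
  assumes U: "is_rep G X n U" and V: "is_rep G X m V"
  shows "is_rep G X (n + m) (rep_sum U V)"
  unfolding is_rep_def
proof (intro conjI ballI allI impI)
  note Uc = is_rep_dim[OF U] and Vc = is_rep_dim[OF V]
  show "rep_sum U V g \<in> carrier_mat (n + m) (n + m)" if "g \<in> carrier G" for g
    unfolding rep_sum_def using that by (intro mat_sum_carrier Uc Vc)
  show "rep_sum U V \<one>\<^bsub>G\<^esub> = 1\<^sub>m (n + m)"
    using U V by (simp add: is_rep_def rep_sum_def mat_sum_one)
  show "rep_sum U V (g \<otimes>\<^bsub>G\<^esub> h) = rep_sum U V g * rep_sum U V h" if "g \<in> carrier G" "h \<in> carrier G" for g h
    using U V that mat_sum_mult[OF Uc[OF that(1)] Vc[OF that(1)] Uc[OF that(2)] Vc[OF that(2)]]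
    by (simp add: is_rep_def rep_sum_def)
  fix i j assume ij: "i < n + m" "j < n + m"
  have "continuous_map X euclideanreal (\<lambda>g. if i < n then if j < n then U g $$ (i, j) else 0
     else if j < n then 0 else V g $$ (i - n, j - n))"
    using U V ij by (auto simp: is_rep_def)
  then show "continuous_map X euclideanreal (\<lambda>g. rep_sum U V g $$ (i, j))"
  proof (rule continuous_map_eq)
    fix g assume "g \<in> topspace X"
    then have g: "g \<in> carrier G" using top by simp
    show "(if i < n then if j < n then U g $$ (i, j) else 0
     else if j < n then 0 else V g $$ (i - n, j - n)) = rep_sum U V g $$ (i, j)"
      using mat_sum_index[OF Uc[OF g] Vc[OF g] ij] by (simp add: rep_sum_def)
  qed
qed

lemma reps_sum: "U \<in> reps G X \<Longrightarrow> V \<in> reps G X \<Longrightarrow> rep_sum U V \<in> reps G X"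
  unfolding reps_def using is_rep_sum by blast

lemma is_rep_trivial: "is_rep G X n (trivial_rep n)"
  by (auto simp: is_rep_def trivial_rep_def)

lemma reps_trivial: "trivial_rep n \<in> reps G X"
  using is_rep_trivial by (auto simp: reps_def)

lemma rep_iso_sum:
  assumes "rep_iso G X U U'" "rep_iso G X V V'" shows "rep_iso G X (rep_sum U V) (rep_sum U' V')"
proof -
  obtain n P Q where 1: "is_rep G X n U" "is_rep G X n U'" "P \<in> carrier_mat n n" "Q \<in> carrier_mat n n"
    "P * Q = 1\<^sub>m n" "Q * P = 1\<^sub>m n" "\<And>g. g \<in> carrier G \<Longrightarrow> P * U g = U' g * P"
    using rep_isoE[OF assms(1)] by metis
  obtain m P' Q' where 2: "is_rep G X m V" "is_rep G X m V'" "P' \<in> carrier_mat m m" "Q' \<in> carrier_mat m m"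
    "P' * Q' = 1\<^sub>m m" "Q' * P' = 1\<^sub>m m" "\<And>g. g \<in> carrier G \<Longrightarrow> P' * V g = V' g * P'"
    using rep_isoE[OF assms(2)] by metis
  show ?thesis
  proof (rule rep_isoI[OF is_rep_sum[OF 1(1) 2(1)] is_rep_sum[OF 1(2) 2(2)]
        mat_sum_carrier[OF 1(3) 2(3)] mat_sum_carrier[OF 1(4) 2(4)]])
    show "mat_sum P P' * mat_sum Q Q' = 1\<^sub>m (n + m)" "mat_sum Q Q' * mat_sum P P' = 1\<^sub>m (n + m)"
      using 1 2 by (simp_all add: mat_sum_mult[of _ n _ m] mat_sum_one)
    fix g assume g: "g \<in> carrier G"
    show "mat_sum P P' * rep_sum U V g = rep_sum U' V' g * mat_sum P P'"
      using g 1 2 is_rep_dim[OF 1(1) g] is_rep_dim[OF 1(2) g] is_rep_dim[OF 2(1) g] is_rep_dim[OF 2(2) g]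
      by (simp add: rep_sum_def mat_sum_mult[of _ n _ m])
  qed
qed

text \<open>Conjugation by the block permutation matrix \<open>S n m\<close>, whose inverse is
  \<open>S m n\<close>.\<close>

lemma rep_sum_comm:
  assumes "U \<in> reps G X" "V \<in> reps G X" shows "rep_iso G X (rep_sum U V) (rep_sum V U)"
proof -
  obtain n m where U: "is_rep G X n U" and V: "is_rep G X m V" using assms by (auto simp: reps_def)
  define S where "S a b = four_block_mat (0\<^sub>m b a) (1\<^sub>m b) (1\<^sub>m a) (0\<^sub>m a b :: real mat)" for a b
  have Sc: "S a b \<in> carrier_mat (a + b) (a + b)" for a b by (auto simp: S_def)
  have SS: "S a b * S b a = 1\<^sub>m (a + b)" for a b
    unfolding S_def
    by (subst mult_four_block_mat[of _ b a _ b _ a _ _ b _ a]) (auto simp: add.commute)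
  have nm: "m + n = n + m" by simp
  show ?thesis
  proof (rule rep_isoI[OF is_rep_sum[OF U V] is_rep_sum[OF V U, unfolded nm] Sc Sc[of m n, unfolded nm] SS])
    show "S m n * S n m = 1\<^sub>m (n + m)" using SS[of m n] by (simp add: add.commute)
    fix g assume g: "g \<in> carrier G"
    note c = is_rep_dim[OF U g] is_rep_dim[OF V g]
    have "S n m * rep_sum U V g = four_block_mat (0\<^sub>m m n) (V g) (U g) (0\<^sub>m n m)"
      unfolding S_def rep_sum_def mat_sum_def using c
      by (subst mult_four_block_mat[of _ m n _ m _ n _ _ n _ m]) auto
    also have "\<dots> = rep_sum V U g * S n m"
      unfolding S_def rep_sum_def mat_sum_def using c
      by (subst mult_four_block_mat[of _ m m _ n _ n _ _ n _ m]) auto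
    finally show "S n m * rep_sum U V g = rep_sum V U g * S n m" .
  qed
qed

text \<open>An equality of block matrices, so sums may be rebracketed by rewriting; exchanging
  summands, in contrast, costs an isomorphism.\<close>

lemma rep_sum_assoc: "rep_sum U (rep_sum V W) = rep_sum (rep_sum U V) W"
  by (auto simp: rep_sum_def mat_sum_assoc)

lemma rep_sum_trivial:
  assumes "U \<in> reps G X" shows "rep_iso G X (rep_sum (trivial_rep 0) U) U"
proof -
  obtain n where U: "is_rep G X n U" using assms by (auto simp: reps_def)
  have 0: "is_rep G X n (rep_sum (trivial_rep 0) U)" using is_rep_sum[OF is_rep_trivial[of 0] U] by simp
  show ?thesis
  proof (rule rep_isoI[OF 0 U, of "1\<^sub>m n" "1\<^sub>m n"])
    fix g assume g: "g \<in> carrier G"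
    have "mat_sum (1\<^sub>m 0) (U g) = U g"
      using is_rep_dim[OF U g] by (intro eq_matI) (auto simp: mat_sum_def)
    then show "1\<^sub>m n * rep_sum (trivial_rep 0) U g = U g * 1\<^sub>m n"
      using is_rep_dim[OF U g] by (simp add: rep_sum_def trivial_rep_def)
  qed auto
qed

lemma rep_sum_right_comm:
  assumes "A \<in> reps G X" "B \<in> reps G X" "C \<in> reps G X"
  shows "rep_iso G X (rep_sum (rep_sum A B) C) (rep_sum (rep_sum A C) B)"
proof -
  obtain n where A: "is_rep G X n A" using assms by (auto simp: reps_def)
  show ?thesis
    unfolding rep_sum_assoc[symmetric] by (intro rep_iso_sum rep_iso_refl[OF A] rep_sum_comm assms)
qed

lemma reps_refl: "U \<in> reps G X \<Longrightarrow> rep_iso G X U U"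
  using rep_iso_refl by (auto simp: reps_def)

lemma RO_eq_reps:
  "RO_eq G X p q \<Longrightarrow> p \<in> reps G X \<times> reps G X \<and> q \<in> reps G X \<times> reps G X"
  by (induction rule: RO_eq.induct) (auto dest: rep_iso_reps intro: reps_sum)

lemma equiv_RO_rel: "equiv (reps G X \<times> reps G X) (RO_rel G X)"
proof (rule equivI)
  show "RO_rel G X \<subseteq> (reps G X \<times> reps G X) \<times> (reps G X \<times> reps G X)"
    using RO_eq_reps by (auto simp: RO_rel_def)
  show "refl_on (reps G X \<times> reps G X) (RO_rel G X)"
    using reps_refl by (auto simp: refl_on_def RO_rel_def intro: RO_eq.iso)
  show "sym_on UNIV (RO_rel G X)" by (auto simp: sym_on_def RO_rel_def intro: RO_eq.sym)
  show "trans_on UNIV (RO_rel G X)" by (auto simp: trans_on_def RO_rel_def intro: RO_eq.trans)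
qed

lemma class_diff_eq_iff:
  assumes "U \<in> reps G X" "V \<in> reps G X" "U' \<in> reps G X" "V' \<in> reps G X"
  shows "class_diff G X U V = class_diff G X U' V' \<longleftrightarrow> RO_eq G X (U, V) (U', V')"
  unfolding class_diff_def using eq_equiv_class_iff[OF equiv_RO_rel, of "(U, V)" "(U', V')"] assms
  by (auto simp: RO_rel_def)

lemma class_diff_in: "U \<in> reps G X \<Longrightarrow> V \<in> reps G X \<Longrightarrow> class_diff G X U V \<in> carrier (RO G X)"
  by (auto simp: class_diff_def RO_def intro!: quotientI)

lemma RO_carrierE:
  assumes "x \<in> carrier (RO G X)"
  obtains U V where "U \<in> reps G X" "V \<in> reps G X" "x = class_diff G X U V"
  using assms by (auto simp: class_diff_def RO_def quotient_def)

text \<open>Adding a fixed pair respects each generating rule of \<open>RO_eq\<close>; in the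
  stabilisation rule the new summand has to be moved past the old one.\<close>

lemma RO_eq_sum:
  assumes "RO_eq G X p q" "A \<in> reps G X" "B \<in> reps G X"
  shows "RO_eq G X (rep_sum (fst p) A, rep_sum (snd p) B) (rep_sum (fst q) A, rep_sum (snd q) B)"
  using assms(1)
proof (induction rule: RO_eq.induct)
  case (iso U U' V V')
  then show ?case using assms(2,3) by (auto intro!: RO_eq.iso rep_iso_sum reps_refl)
next
  case (stab U V W)
  have "RO_eq G X (rep_sum U A, rep_sum V B) (rep_sum (rep_sum U A) W, rep_sum (rep_sum V B) W)"
    using stab assms by (intro RO_eq.stab reps_sum)
  moreover have "RO_eq G X (rep_sum (rep_sum U A) W, rep_sum (rep_sum V B) W)
      (rep_sum (rep_sum U W) A, rep_sum (rep_sum V W) B)"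
    using stab assms by (intro RO_eq.iso rep_sum_right_comm)
  ultimately show ?case by (simp, rule RO_eq.trans)
qed (auto intro: RO_eq.sym RO_eq.trans)

lemma RO_eq_comm:
  assumes "U \<in> reps G X" "V \<in> reps G X" "A \<in> reps G X" "B \<in> reps G X"
  shows "RO_eq G X (rep_sum U A, rep_sum V B) (rep_sum A U, rep_sum B V)"
  using assms by (intro RO_eq.iso rep_sum_comm)

lemma RO_rel_Image:
  assumes "\<And>q. q \<in> S \<Longrightarrow> RO_eq G X p q" "p \<in> S" shows "RO_rel G X `` S = RO_rel G X `` {p}"
  unfolding RO_rel_def using assms by (blast intro: RO_eq.trans)

text \<open>The sum in \<open>RO\<close> is formed from all representatives, so these sums must be
  shown to be related. The representatives are replaced one argument at a time, with an exchange of
  summands in between.\<close>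

lemma RO_add:
  assumes "U \<in> reps G X" "V \<in> reps G X" "U' \<in> reps G X" "V' \<in> reps G X"
  shows "class_diff G X U V \<oplus>\<^bsub>RO G X\<^esub> class_diff G X U' V' = class_diff G X (rep_sum U U') (rep_sum V V')"
proof -
  let ?S = "{(rep_sum A A', rep_sum B B') | A B A' B'. (A, B) \<in> class_diff G X U V \<and> (A', B') \<in> class_diff G X U' V'}"
  have "RO_eq G X (rep_sum U U', rep_sum V V') q" if q: "q \<in> ?S" for q
  proof -
    obtain A B A' B' where *: "q = (rep_sum A A', rep_sum B B')" "RO_eq G X (U, V) (A, B)" "RO_eq G X (U', V') (A', B')"
      using q by (auto simp: class_diff_def RO_rel_def)
    have r: "A \<in> reps G X" "B \<in> reps G X" "A' \<in> reps G X" "B' \<in> reps G X"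
      using RO_eq_reps *(2,3) by auto
    have "RO_eq G X (rep_sum U U', rep_sum V V') (rep_sum A U', rep_sum B V')"
      using RO_eq_sum[OF *(2) assms(3,4)] by simp
    also have "RO_eq G X (rep_sum A U', rep_sum B V') (rep_sum U' A, rep_sum V' B)"
      using r assms by (intro RO_eq_comm)
    also have "RO_eq G X (rep_sum U' A, rep_sum V' B) (rep_sum A' A, rep_sum B' B)"
      using RO_eq_sum[OF *(3) r(1,2)] by simp
    also have "RO_eq G X (rep_sum A' A, rep_sum B' B) (rep_sum A A', rep_sum B B')"
      using r by (intro RO_eq_comm)
    finally show ?thesis using * by simp
  qed
  moreover have "(rep_sum U U', rep_sum V V') \<in> ?S"
    using equiv_class_self[OF equiv_RO_rel, of "(U, V)"] equiv_class_self[OF equiv_RO_rel, of "(U', V')"] assms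
    unfolding class_diff_def by blast
  ultimately have "RO_rel G X `` ?S = RO_rel G X `` {(rep_sum U U', rep_sum V V')}"
    by (rule RO_rel_Image)
  then show ?thesis by (simp add: RO_def class_diff_def)
qed

lemma RO_zero: "\<zero>\<^bsub>RO G X\<^esub> = class_diff G X (trivial_rep 0) (trivial_rep 0)"
  by (simp add: RO_def class_diff_def)

lemma abelian_monoid_RO: "abelian_monoid (RO G X)"
proof (rule abelian_monoidI)
  fix x y z assume "x \<in> carrier (RO G X)" "y \<in> carrier (RO G X)" "z \<in> carrier (RO G X)"
  then obtain U V U' V' U'' V'' where r: "U \<in> reps G X" "V \<in> reps G X" "U' \<in> reps G X" "V' \<in> reps G X"
    "U'' \<in> reps G X" "V'' \<in> reps G X"
    and e: "x = class_diff G X U V" "y = class_diff G X U' V'" "z = class_diff G X U'' V''"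
    by (metis RO_carrierE)
  show "(x \<oplus>\<^bsub>RO G X\<^esub> y) \<oplus>\<^bsub>RO G X\<^esub> z = x \<oplus>\<^bsub>RO G X\<^esub> (y \<oplus>\<^bsub>RO G X\<^esub> z)"
    using r by (simp add: e RO_add reps_sum rep_sum_assoc)
next
  fix x y assume "x \<in> carrier (RO G X)" "y \<in> carrier (RO G X)"
  then obtain U V U' V' where r: "U \<in> reps G X" "V \<in> reps G X" "U' \<in> reps G X" "V' \<in> reps G X"
    and e: "x = class_diff G X U V" "y = class_diff G X U' V'"
    by (metis RO_carrierE)
  show "x \<oplus>\<^bsub>RO G X\<^esub> y \<in> carrier (RO G X)"
    using r by (simp add: e RO_add class_diff_in reps_sum)
  show "x \<oplus>\<^bsub>RO G X\<^esub> y = y \<oplus>\<^bsub>RO G X\<^esub> x"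
    using r by (simp add: e RO_add class_diff_eq_iff reps_sum RO_eq_comm)
next
  show "\<zero>\<^bsub>RO G X\<^esub> \<in> carrier (RO G X)" by (simp add: RO_zero class_diff_in reps_trivial)
  fix x assume "x \<in> carrier (RO G X)"
  then obtain U V where r: "U \<in> reps G X" "V \<in> reps G X" and e: "x = class_diff G X U V"
    by (metis RO_carrierE)
  show "\<zero>\<^bsub>RO G X\<^esub> \<oplus>\<^bsub>RO G X\<^esub> x = x"
    using r by (simp add: e RO_zero RO_add reps_trivial class_diff_eq_iff reps_sum)
      (intro RO_eq.iso rep_sum_trivial)
qed

text \<open>Stabilise the first pair by \<open>V'\<close> and the second by \<open>V\<close>: the
  given isomorphism matches the positive parts, an exchange of summands the negative ones.\<close>

lemma class_diff_eqI:
  assumes r: "U \<in> reps G X" "V \<in> reps G X" "U' \<in> reps G X" "V' \<in> reps G X"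
    and iso: "rep_iso G X (rep_sum U V') (rep_sum U' V)"
  shows "class_diff G X U V = class_diff G X U' V'"
proof -
  have "RO_eq G X (U, V) (rep_sum U V', rep_sum V V')" using r by (intro RO_eq.stab)
  also have "RO_eq G X (rep_sum U V', rep_sum V V') (rep_sum U' V, rep_sum V' V)"
    using r by (intro RO_eq.iso iso rep_sum_comm)
  also have "RO_eq G X (rep_sum U' V, rep_sum V' V) (U', V')" using r by (intro RO_eq.sym[OF RO_eq.stab])
  finally show ?thesis using r by (simp add: class_diff_eq_iff)
qed

lemma class_diff_self: "U \<in> reps G X \<Longrightarrow> class_diff G X U U = \<zero>\<^bsub>RO G X\<^esub>"
  unfolding RO_zero
  by (intro class_diff_eqI reps_trivial rep_sum_comm)

lemma class_diff_telescope:
  fixes N :: nat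
  assumes "\<And>i. i \<le> N \<Longrightarrow> U i \<in> reps G X"
  shows "(\<Oplus>\<^bsub>RO G X\<^esub>i\<in>{1..N}. class_diff G X (U (i - 1)) (U i)) = class_diff G X (U 0) (U N)"
  using assms
proof (induction N)
  case 0
  then show ?case
    using abelian_monoid.finsum_empty[OF abelian_monoid_RO] by (simp add: class_diff_self)
next
  case (Suc N)
  interpret abelian_monoid "RO G X" by (rule abelian_monoid_RO)
  have r: "U i \<in> reps G X" if "i \<le> Suc N" for i using Suc that by simp
  have "(\<Oplus>\<^bsub>RO G X\<^esub>i\<in>{1..Suc N}. class_diff G X (U (i - 1)) (U i)) =
      class_diff G X (U N) (U (Suc N)) \<oplus>\<^bsub>RO G X\<^esub> (\<Oplus>\<^bsub>RO G X\<^esub>i\<in>{1..N}. class_diff G X (U (i - 1)) (U i))"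
  proof -
    have "{1..Suc N} = insert (Suc N) {1..N}" by auto
    then show ?thesis by (simp only:) (subst finsum_insert, auto intro!: class_diff_in r)
  qed
  also have "\<dots> = class_diff G X (rep_sum (U N) (U 0)) (rep_sum (U (Suc N)) (U N))"
    using Suc by (simp add: RO_add)
  also have "\<dots> = class_diff G X (U 0) (U (Suc N))"
  proof (rule class_diff_eqI)
    show "rep_iso G X (rep_sum (rep_sum (U N) (U 0)) (U (Suc N))) (rep_sum (U 0) (rep_sum (U (Suc N)) (U N)))"
      unfolding rep_sum_assoc
      by (rule rep_iso_trans[OF rep_iso_sum[OF rep_sum_comm reps_refl] rep_sum_right_comm]) (auto intro: r)
  qed (auto intro!: reps_sum r)
  finally show ?case .
qed

end

section \<open>Matrix forms\<close>

lemma coefficients_unique: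
  fixes b :: "nat \<Rightarrow> 'h::real_vector"
  assumes "inj_on b {..<n}" "independent (b ` {..<n})" "(\<Sum>i<n. x i *\<^sub>R b i) = (\<Sum>i<n. y i *\<^sub>R b i)" "i < n"
  shows "x i = y i"
proof -
  define u where "u v = x (inv_into {..<n} b v) - y (inv_into {..<n} b v)" for v
  have "(\<Sum>v\<in>b ` {..<n}. u v *\<^sub>R v) = (\<Sum>i<n. (x i - y i) *\<^sub>R b i)"
    using assms(1) by (simp add: sum.reindex u_def)
  also have "\<dots> = 0" using assms(3) by (simp add: scaleR_diff_left sum_subtractf)
  finally have "u (b i) = 0"
    using assms(2,4) independentD[of "b ` {..<n}" "b ` {..<n}" u "b i"] by auto
  then show ?thesis using assms(1,4) by (simp add: u_def)
qed

lemma span_indexed: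
  fixes b :: "nat \<Rightarrow> 'h::real_vector"
  assumes "v \<in> span (b ` {..<n})"
  obtains x where "v = (\<Sum>i<n. x i *\<^sub>R b i)"
proof -
  have "\<exists>x. v = (\<Sum>i<n. x i *\<^sub>R b i)" using assms
  proof (induction rule: span_induct_alt)
    case base then show ?case by (intro exI[of _ "\<lambda>_. 0"]) simp
  next
    case (step c w y)
    then obtain x j where x: "y = (\<Sum>i<n. x i *\<^sub>R b i)" "j < n" "w = b j" by auto
    have "c *\<^sub>R w + y = (\<Sum>i<n. ((if i = j then c else 0) + x i) *\<^sub>R b i)"
      using x by (simp add: scaleR_add_left sum.distrib if_distrib[of "\<lambda>z. z *\<^sub>R _"] cong: if_cong)
    then show ?case by (intro exI[of _ "\<lambda>i. (if i = j then c else 0) + x i"])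
  qed
  then show ?thesis using that by blast
qed

lemma matrix_form_rep: "matrix_form G X \<rho> V R \<Longrightarrow> R \<in> reps G X"
  by (auto simp: matrix_form_def reps_def)

definition rep_basis ::
  "('g, 'm) monoid_scheme \<Rightarrow> 'g topology \<Rightarrow> ('g \<Rightarrow> 'h::{real_inner, complete_space} \<Rightarrow>\<^sub>L 'h) \<Rightarrow>
     'h set \<Rightarrow> 'g rep \<Rightarrow> nat \<Rightarrow> (nat \<Rightarrow> 'h) \<Rightarrow> bool" where
  "rep_basis G X \<rho> V R n b \<longleftrightarrow> is_rep G X n R \<and> inj_on b {..<n} \<and> independent (b ` {..<n}) \<and>
     span (b ` {..<n}) = V \<and> (\<forall>g\<in>carrier G. \<forall>j<n. \<rho> g (b j) = (\<Sum>i<n. R g $$ (i, j) *\<^sub>R b i))"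

lemma matrix_form_iff: "matrix_form G X \<rho> V R \<longleftrightarrow> (\<exists>n b. rep_basis G X \<rho> V R n b)"
  unfolding matrix_form_def rep_basis_def ..

lemma rep_basisD:
  assumes "rep_basis G X \<rho> V R n b"
  shows "is_rep G X n R" "inj_on b {..<n}" "independent (b ` {..<n})" "span (b ` {..<n}) = V"
    "\<And>g j. g \<in> carrier G \<Longrightarrow> j < n \<Longrightarrow> \<rho> g (b j) = (\<Sum>i<n. R g $$ (i, j) *\<^sub>R b i)"
  using assms by (simp_all add: rep_basis_def)

text \<open>\<open>P\<close> and \<open>Q\<close> express the two bases in each other. Expanding
  \<open>\<rho> g (c j)\<close> in the basis \<open>b\<close> in two ways gives
  \<open>P * S g = R g * P\<close>.\<close>

lemma matrix_form_unique:
  fixes \<rho> :: "'g \<Rightarrow> 'h::{real_inner, complete_space} \<Rightarrow>\<^sub>L 'h"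
  assumes R: "matrix_form G X \<rho> V R" and S: "matrix_form G X \<rho> V S"
  shows "rep_iso G X R S"
proof -
  obtain n b where "rep_basis G X \<rho> V R n b"
    using R by (auto simp: matrix_form_iff)
  note b = rep_basisD[OF this]
  obtain m c where "rep_basis G X \<rho> V S m c"
    using S by (auto simp: matrix_form_iff)
  note c = rep_basisD[OF this]
  have "card (b ` {..<n}) = card (c ` {..<m})"
    using b c dim_eq_card_independent[of "b ` {..<n}"] dim_eq_card_independent[of "c ` {..<m}"] by (metis dim_span)
  then have mn: "m = n" using b(2) c(2) by (simp add: card_image)
  note c = c[unfolded mn]
  have "\<exists>x. c j = (\<Sum>i<n. x i *\<^sub>R b i)" if "j < n" for j
    using that c(4) b(4) span_base[of "c j" "c ` {..<n}"] by (metis imageI lessThan_iff span_indexed)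
  then obtain p where p: "\<And>j. j < n \<Longrightarrow> c j = (\<Sum>i<n. p j i *\<^sub>R b i)" by metis
  have "\<exists>x. b j = (\<Sum>i<n. x i *\<^sub>R c i)" if "j < n" for j
    using that c(4) b(4) span_base[of "b j" "b ` {..<n}"] by (metis imageI lessThan_iff span_indexed)
  then obtain q where q: "\<And>j. j < n \<Longrightarrow> b j = (\<Sum>i<n. q j i *\<^sub>R c i)" by metis
  define P where "P = mat n n (\<lambda>(i, j). p j i)"
  define Q where "Q = mat n n (\<lambda>(i, j). q j i)"
  have PQc: "P \<in> carrier_mat n n" "Q \<in> carrier_mat n n" by (auto simp: P_def Q_def)
  have times: "(A * B) $$ (i, j) = (\<Sum>k<n. A $$ (i, k) * B $$ (k, j))"
    if "A \<in> carrier_mat n n" "B \<in> carrier_mat n n" "i < n" "j < n" for A B :: "real mat" and i j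
    using that by (auto simp: times_mat_def Matrix.scalar_prod_def lessThan_atLeast0 intro!: sum.cong)
  have change: "(\<Sum>k<n. y k *\<^sub>R (\<Sum>i<n. x k i *\<^sub>R v i)) = (\<Sum>i<n. (\<Sum>k<n. x k i * y k) *\<^sub>R v i)"
    for x :: "nat \<Rightarrow> nat \<Rightarrow> real" and y and v :: "nat \<Rightarrow> 'h"
  proof -
    have "(\<Sum>k<n. y k *\<^sub>R (\<Sum>i<n. x k i *\<^sub>R v i)) = (\<Sum>k<n. \<Sum>i<n. (x k i * y k) *\<^sub>R v i)"
      by (simp add: scaleR_sum_right mult.commute)
    also have "\<dots> = (\<Sum>i<n. \<Sum>k<n. (x k i * y k) *\<^sub>R v i)" by (rule sum.swap)
    finally show ?thesis by (simp add: scaleR_sum_left)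
  qed
  have unit: "v j = (\<Sum>i<n. (1\<^sub>m n $$ (i, j)) *\<^sub>R v i)" if "j < n" for v :: "nat \<Rightarrow> 'h" and j
  proof -
    have "(\<Sum>i<n. (1\<^sub>m n $$ (i, j)) *\<^sub>R v i) = (\<Sum>i<n. if i = j then v i else 0)"
      using that by (intro sum.cong) auto
    then show ?thesis using that by simp
  qed
  have PQ: "P * Q = 1\<^sub>m n"
  proof (rule eq_matI)
    fix i j assume "i < dim_row (1\<^sub>m n :: real mat)" "j < dim_col (1\<^sub>m n :: real mat)"
    then have ij: "i < n" "j < n" by auto
    have "b j = (\<Sum>k<n. q j k *\<^sub>R (\<Sum>i<n. p k i *\<^sub>R b i))" using q[OF ij(2)] p by simp
    then have "(\<Sum>i<n. (1\<^sub>m n $$ (i, j)) *\<^sub>R b i) = (\<Sum>i<n. (\<Sum>k<n. p k i * q j k) *\<^sub>R b i)"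
      unfolding change unit[OF ij(2), symmetric] .
    then have "1\<^sub>m n $$ (i, j) = (\<Sum>k<n. p k i * q j k)" using ij(1) by (rule coefficients_unique[OF b(2,3)])
    then show "(P * Q) $$ (i, j) = 1\<^sub>m n $$ (i, j)"
      using ij times[OF PQc ij] by (simp add: P_def Q_def)
  qed (use PQc in auto)
  have QP: "Q * P = 1\<^sub>m n"
  proof (rule eq_matI)
    fix i j assume "i < dim_row (1\<^sub>m n :: real mat)" "j < dim_col (1\<^sub>m n :: real mat)"
    then have ij: "i < n" "j < n" by auto
    have "c j = (\<Sum>k<n. p j k *\<^sub>R (\<Sum>i<n. q k i *\<^sub>R c i))" using p[OF ij(2)] q by simp
    then have "(\<Sum>i<n. (1\<^sub>m n $$ (i, j)) *\<^sub>R c i) = (\<Sum>i<n. (\<Sum>k<n. q k i * p j k) *\<^sub>R c i)"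
      unfolding change unit[OF ij(2), symmetric] .
    then have "1\<^sub>m n $$ (i, j) = (\<Sum>k<n. q k i * p j k)" using ij(1) by (rule coefficients_unique[OF c(2,3)])
    then show "(Q * P) $$ (i, j) = 1\<^sub>m n $$ (i, j)"
      using ij times[OF PQc(2,1) ij] by (simp add: P_def Q_def)
  qed (use PQc in auto)
  have "P * S g = R g * P" if g: "g \<in> carrier G" for g
  proof (rule eq_matI)
    note d = is_rep_dim[OF b(1) g] is_rep_dim[OF c(1) g] PQc
    fix i j assume "i < dim_row (R g * P)" "j < dim_col (R g * P)"
    then have ij: "i < n" "j < n" using d by auto
    have "\<rho> g (c j) = (\<Sum>k<n. S g $$ (k, j) *\<^sub>R (\<Sum>i<n. p k i *\<^sub>R b i))"
      using c(5)[OF g ij(2)] p by simp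
    then have 1: "\<rho> g (c j) = (\<Sum>i<n. (\<Sum>k<n. p k i * S g $$ (k, j)) *\<^sub>R b i)" unfolding change .
    have "\<rho> g (c j) = (\<Sum>k<n. p j k *\<^sub>R \<rho> g (b k))"
      using p[OF ij(2)] by (simp add: blinfun.sum_right blinfun.scaleR_right)
    also have "\<dots> = (\<Sum>k<n. p j k *\<^sub>R (\<Sum>i<n. R g $$ (i, k) *\<^sub>R b i))"
      using b(5)[OF g] by simp
    finally have "\<rho> g (c j) = (\<Sum>i<n. (\<Sum>k<n. R g $$ (i, k) * p j k) *\<^sub>R b i)" unfolding change .
    then have "(\<Sum>k<n. p k i * S g $$ (k, j)) = (\<Sum>k<n. R g $$ (i, k) * p j k)"
      using 1 by (intro coefficients_unique[OF b(2,3) _ ij(1)]) simp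
    then show "(P * S g) $$ (i, j) = (R g * P) $$ (i, j)"
      using ij times[OF d(3,2) ij] times[OF d(1,3) ij] by (simp add: P_def)
  qed (use is_rep_dim[OF b(1) g] is_rep_dim[OF c(1) g] PQc in auto)
  then have "rep_iso G X S R" by (intro rep_isoI[OF c(1) b(1) PQc PQ QP])
  then show ?thesis by (rule rep_iso_sym)
qed

text \<open>The image of a basis has the same matrices, so the very same \<open>R\<close> serves for
  the image. In this way isomorphisms of invariant subspaces are used as equalities of matrix
  forms.\<close>

lemma matrix_form_image:
  assumes R: "matrix_form G X \<rho> V R" and f: "linear f" "inj_on f V"
    and eq: "\<And>g u. g \<in> carrier G \<Longrightarrow> u \<in> V \<Longrightarrow> f (blinfun_apply (\<rho> g) u) = blinfun_apply (\<rho>' g) (f u)"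
  shows "matrix_form G X \<rho>' (f ` V) R"
proof -
  obtain n b where "rep_basis G X \<rho> V R n b"
    using R by (auto simp: matrix_form_iff)
  note b = rep_basisD[OF this]
  have bV: "b ` {..<n} \<subseteq> V" using span_superset[of "b ` {..<n}"] unfolding b(4) .
  have img: "(f \<circ> b) ` {..<n} = f ` (b ` {..<n})" by auto
  show ?thesis unfolding matrix_form_def
  proof (intro exI[of _ n] exI[of _ "f \<circ> b"] conjI ballI allI impI)
    show "inj_on (f \<circ> b) {..<n}" by (rule comp_inj_on[OF b(2) inj_on_subset[OF f(2) bV]])
    show "independent ((f \<circ> b) ` {..<n})"
      unfolding img using f(2) by (intro linear_independent_injective_image f(1) b(3)) (simp only: b(4))
    show "span ((f \<circ> b) ` {..<n}) = f ` V"
      unfolding img using linear_span_image[OF f(1)] b(4) by metis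
    fix g j assume "g \<in> carrier G" "j < n"
    then have "\<rho>' g (f (b j)) = f (\<Sum>i<n. R g $$ (i, j) *\<^sub>R b i)"
      using eq[of g "b j"] b(5)[of g j] bV by auto
    then show "\<rho>' g ((f \<circ> b) j) = (\<Sum>i<n. R g $$ (i, j) *\<^sub>R (f \<circ> b) i)"
      by (simp add: linear_sum[OF f(1)] linear_cmul[OF f(1)])
  qed (rule b(1))
qed

lemma matrix_form_cong:
  assumes "matrix_form G X \<rho> V R" "\<And>g u. g \<in> carrier G \<Longrightarrow> u \<in> V \<Longrightarrow> blinfun_apply (\<rho> g) u = blinfun_apply (\<rho>' g) u"
  shows "matrix_form G X \<rho>' V R"
  using matrix_form_image[OF assms(1) linear_ident, of \<rho>'] assms(2) by simp

text \<open>Concatenated bases give block diagonal matrices. The hypothesis on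
  \<open>V \<inter> W\<close> admits non-orthogonal sums, such as those that arise after a
  congruence.\<close>

lemma matrix_form_sum:
  fixes \<rho> :: "'g \<Rightarrow> 'h::{real_inner, complete_space} \<Rightarrow>\<^sub>L 'h"
  assumes G: "group G" "topspace X = carrier G"
    and R: "matrix_form G X \<rho> V R" and S: "matrix_form G X \<rho> W S" and VW: "V \<inter> W = {0}"
  shows "matrix_form G X \<rho> {v + w | v w. v \<in> V \<and> w \<in> W} (rep_sum R S)"
proof -
  obtain n b where "rep_basis G X \<rho> V R n b"
    using R by (auto simp: matrix_form_iff)
  note b = rep_basisD[OF this]
  obtain m c where "rep_basis G X \<rho> W S m c"
    using S by (auto simp: matrix_form_iff)
  note c = rep_basisD[OF this]
  define d where "d i = (if i < n then b i else c (i - n))" for i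
  have split_set: "{..<n + m} = {..<n} \<union> (\<lambda>i. i + n) ` {..<m}"
  proof
    show "{..<n + m} \<subseteq> {..<n} \<union> (\<lambda>i. i + n) ` {..<m}"
    proof
      fix i assume "i \<in> {..<n + m}"
      then show "i \<in> {..<n} \<union> (\<lambda>i. i + n) ` {..<m}"
        by (cases "i < n") (auto intro!: image_eqI[of _ _ "i - n"])
    qed
  qed auto
  have sum_split: "(\<Sum>i<n + m. f i) = (\<Sum>i<n. f i) + (\<Sum>i<m. f (i + n))" for f :: "nat \<Rightarrow> 'h"
    unfolding split_set by (subst sum.union_disjoint) (auto simp: sum.reindex)
  have img: "d ` {..<n + m} = b ` {..<n} \<union> c ` {..<m}"
    unfolding split_set image_Un image_image
    by (intro arg_cong2[where f="(\<union>)"] image_cong) (auto simp: d_def)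
  have bV: "b i \<in> V" if "i < n" for i using that span_base[of "b i" "b ` {..<n}"] unfolding b(4) by simp
  have cW: "c i \<in> W" if "i < m" for i using that span_base[of "c i" "c ` {..<m}"] unfolding c(4) by simp
  have b0: "b i \<noteq> 0" if "i < n" for i using b(3) that dependent_zero[of "b ` {..<n}"] by force
  have disj: "b i \<noteq> c j" if "i < n" "j < m" for i j
  proof
    assume "b i = c j"
    then have "b i \<in> V \<inter> W" using bV[OF that(1)] cW[OF that(2)] by simp
    then show False using b0[OF that(1)] unfolding VW by simp
  qed
  have inj: "inj_on d {..<n + m}"
  proof (rule inj_onI)
    fix i j assume ij: "i \<in> {..<n + m}" "j \<in> {..<n + m}" "d i = d j"
    consider "i < n" "j < n" | "i < n" "\<not> j < n" | "\<not> i < n" "j < n" | "\<not> i < n" "\<not> j < n" by blast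
    then show "i = j"
    proof cases
      case 1 then show ?thesis using ij b(2) by (auto simp: d_def inj_on_def)
    next
      case 2 then show ?thesis using ij disj[of i "j - n"] by (auto simp: d_def)
    next
      case 3
      then have "i - n < m" using ij by auto
      then show ?thesis using 3 ij disj[of j "i - n"] by (auto simp: d_def)
    next
      case 4
      then have "i - n = j - n" using ij inj_onD[OF c(2), of "i - n" "j - n"] by (auto simp: d_def)
      then show ?thesis using 4 by simp
    qed
  qed
  have ind: "independent (d ` {..<n + m})"
  proof (rule independent_if_scalars_zero)
    fix f x assume s: "(\<Sum>x\<in>d ` {..<n + m}. f x *\<^sub>R x) = 0" and x: "x \<in> d ` {..<n + m}"
    have "0 = (\<Sum>i<n. f (b i) *\<^sub>R b i) + (\<Sum>i<m. f (c i) *\<^sub>R c i)"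
    proof -
      have "0 = (\<Sum>i<n + m. f (d i) *\<^sub>R d i)" using s by (simp only: sum.reindex[OF inj] o_def)
      then show ?thesis by (simp add: sum_split d_def)
    qed
    moreover have 1: "(\<Sum>i<n. f (b i) *\<^sub>R b i) \<in> V" unfolding b(4)[symmetric]
      by (intro span_sum span_scale span_base) auto
    moreover have 2: "(\<Sum>i<m. f (c i) *\<^sub>R c i) \<in> W" unfolding c(4)[symmetric]
      by (intro span_sum span_scale span_base) auto
    ultimately have e: "(\<Sum>i<n. f (b i) *\<^sub>R b i) = - (\<Sum>i<m. f (c i) *\<^sub>R c i)"
      by (simp add: eq_neg_iff_add_eq_0)
    then have "(\<Sum>i<n. f (b i) *\<^sub>R b i) \<in> W"
      using span_neg[of "\<Sum>i<m. f (c i) *\<^sub>R c i" "c ` {..<m}"] 2 unfolding c(4) by simp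
    then have "(\<Sum>i<n. f (b i) *\<^sub>R b i) \<in> V \<inter> W" using 1 by simp
    then have z: "(\<Sum>i<n. f (b i) *\<^sub>R b i) = 0" unfolding VW by simp
    then have z': "(\<Sum>i<m. f (c i) *\<^sub>R c i) = 0" using e by simp
    have "f (b i) = 0" if "i < n" for i
      using coefficients_unique[OF b(2,3), of "\<lambda>i. f (b i)" "\<lambda>_. 0" i] z that by simp
    moreover have "f (c i) = 0" if "i < m" for i
      using coefficients_unique[OF c(2,3), of "\<lambda>i. f (c i)" "\<lambda>_. 0" i] z' that by simp
    ultimately show "f x = 0" using x unfolding img by auto
  qed simp
  show ?thesis unfolding matrix_form_def
  proof (intro exI[of _ "n + m"] exI[of _ d] conjI ballI allI impI)
    show "is_rep G X (n + m) (rep_sum R S)" by (rule is_rep_sum[OF G b(1) c(1)])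
    show "span (d ` {..<n + m}) = {v + w | v w. v \<in> V \<and> w \<in> W}"
      unfolding img span_Un b(4) c(4) by auto
    fix g j assume g: "g \<in> carrier G" and j: "j < n + m"
    note dm = is_rep_dim[OF b(1) g] is_rep_dim[OF c(1) g]
    have idx: "rep_sum R S g $$ (i, j) = (if i < n then if j < n then R g $$ (i, j) else 0 else if j < n then 0 else S g $$ (i - n, j - n))"
      if "i < n + m" for i
      unfolding rep_sum_def by (rule mat_sum_index[OF dm that j])
    show "\<rho> g (d j) = (\<Sum>i<n + m. rep_sum R S g $$ (i, j) *\<^sub>R d i)"
    proof (cases "j < n")
      case True
      then show ?thesis using b(5)[OF g True] by (simp add: sum_split idx d_def)
    next
      case False
      then have "j - n < m" using j by simp
      from c(5)[OF g this] show ?thesis using False by (simp add: sum_split idx d_def)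
    qed
  qed (rule inj ind)+
qed

lemma orthonormal_expansion:
  assumes b: "\<And>i j. i < n \<Longrightarrow> j < n \<Longrightarrow> b i \<bullet> b j = (if i = j then 1 else (0::real))"
    and v: "v \<in> span (b ` {..<n::nat})"
  shows "v = (\<Sum>i<n. (b i \<bullet> v) *\<^sub>R b i)"
proof -
  obtain x where x: "v = (\<Sum>i<n. x i *\<^sub>R b i)" using span_indexed[OF v] by metis
  have "b j \<bullet> v = x j" if "j < n" for j
  proof -
    have "b j \<bullet> v = (\<Sum>i<n. if i = j then x i else 0)"
      unfolding x inner_sum_right using b that by (intro sum.cong) auto
    then show ?thesis using that by simp
  qed
  then show ?thesis using x by simp
qed

text \<open>In an orthonormal basis the entries are the inner products
  \<open>b i \<bullet> \<rho> g (b j)\<close>, whose continuity in \<open>g\<close> is inherited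
  from the action.\<close>

lemma matrix_form_exists:
  assumes \<rho>: "orthogonal_action G X H \<rho>" and G: "group G" "topspace X = carrier G"
    and V: "subspace V" "finite_dim V" "V \<subseteq> H" "invariant G \<rho> V"
  obtains R where "matrix_form G X \<rho> V R"
proof -
  obtain b n where b: "inj_on b {..<n::nat}" "independent (b ` {..<n})" "span (b ` {..<n}) = V"
    "\<And>i j. i < n \<Longrightarrow> j < n \<Longrightarrow> b i \<bullet> b j = (if i = j then 1 else 0)"
    using finite_dim_orthonormal_basis[OF V(1,2)] by metis
  have bV: "b i \<in> V" if "i < n" for i using that span_base[of "b i" "b ` {..<n}"] unfolding b(3) by simp
  have inv: "\<rho> g (b j) \<in> V" if "g \<in> carrier G" "j < n" for g j
    using V(4) bV that by (auto simp: invariant_def)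
  define R where "R g = mat n n (\<lambda>(i, j). b i \<bullet> \<rho> g (b j))" for g
  have Rb: "\<rho> g (b j) = (\<Sum>i<n. R g $$ (i, j) *\<^sub>R b i)" if "g \<in> carrier G" "j < n" for g j
    using orthonormal_expansion[OF b(4), of n "\<rho> g (b j)"] inv[OF that] that b(3) by (simp add: R_def)
  have "is_rep G X n R"
    unfolding is_rep_def
  proof (intro conjI ballI allI impI)
    show "R g \<in> carrier_mat n n" for g by (simp add: R_def)
    show "R \<one>\<^bsub>G\<^esub> = 1\<^sub>m n"
    proof (rule eq_matI)
      fix i j assume "i < dim_row (1\<^sub>m n :: real mat)" "j < dim_col (1\<^sub>m n :: real mat)"
      then have ij: "i < n" "j < n" by auto
      then have "\<rho> \<one>\<^bsub>G\<^esub> (b j) = b j" using \<rho> bV V(3) by (auto simp: orthogonal_action_def)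
      then show "R \<one>\<^bsub>G\<^esub> $$ (i, j) = 1\<^sub>m n $$ (i, j)" using ij b(4) by (simp add: R_def)
    qed (auto simp: R_def)
    show "R (g \<otimes>\<^bsub>G\<^esub> h) = R g * R h" if gh: "g \<in> carrier G" "h \<in> carrier G" for g h
    proof (rule eq_matI)
      fix i j assume "i < dim_row (R g * R h)" "j < dim_col (R g * R h)"
      then have ij: "i < n" "j < n" by (auto simp: R_def)
      have "\<rho> (g \<otimes>\<^bsub>G\<^esub> h) (b j) = \<rho> g (\<rho> h (b j))"
        using \<rho> gh bV[OF ij(2)] V(3) by (auto simp: orthogonal_action_def)
      also have "\<dots> = (\<Sum>k<n. R h $$ (k, j) *\<^sub>R \<rho> g (b k))"
        using Rb[OF gh(2) ij(2)] by (simp add: blinfun.sum_right blinfun.scaleR_right)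
      finally have "b i \<bullet> \<rho> (g \<otimes>\<^bsub>G\<^esub> h) (b j) = (\<Sum>k<n. R h $$ (k, j) * (b i \<bullet> \<rho> g (b k)))"
        by (simp add: inner_sum_right)
      also have "\<dots> = (\<Sum>k<n. R g $$ (i, k) * R h $$ (k, j))"
        using ij by (intro sum.cong) (auto simp: R_def)
      finally show "R (g \<otimes>\<^bsub>G\<^esub> h) $$ (i, j) = (R g * R h) $$ (i, j)"
        using ij by (simp add: R_def times_mat_def Matrix.scalar_prod_def lessThan_atLeast0)
    qed (auto simp: R_def)
    fix i j assume ij: "i < n" "j < n"
    have "continuous_map X (prod_topology X (top_of_set H)) (\<lambda>g. (g, b j))"
      using bV[OF ij(2)] V(3) by (intro continuous_map_pairedI) auto
    moreover have "continuous_map (prod_topology X (top_of_set H)) euclidean (\<lambda>(g, u). \<rho> g u)"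
      using \<rho> by (simp add: orthogonal_action_def)
    ultimately have "continuous_map X euclidean ((\<lambda>(g, u). \<rho> g u) \<circ> (\<lambda>g. (g, b j)))"
      by (rule continuous_map_compose)
    moreover have "continuous_map euclidean euclideanreal (\<lambda>u. b i \<bullet> u)"
      by (simp add: continuous_intros)
    ultimately have "continuous_map X euclideanreal ((\<lambda>u. b i \<bullet> u) \<circ> ((\<lambda>(g, u). \<rho> g u) \<circ> (\<lambda>g. (g, b j))))"
      by (rule continuous_map_compose)
    then show "continuous_map X euclideanreal (\<lambda>g. R g $$ (i, j))"
      using ij by (simp add: R_def o_def)
  qed
  then have "matrix_form G X \<rho> V R"
    unfolding matrix_form_def using b Rb by blast
  then show ?thesis by (rule that)
qed

text \<open>All matrix forms of one subspace are isomorphic, so the pairs in \<open>RO_diff\<close>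
  lie in a single class.\<close>

lemma RO_diff_eq:
  assumes G: "group G" "topspace X = carrier G"
    and R: "matrix_form G X \<rho> V R" and S: "matrix_form G X \<rho> W S"
  shows "RO_diff G X \<rho> V W = class_diff G X R S"
proof -
  have "RO_eq G X (R, S) (R', S')" if "matrix_form G X \<rho> V R'" "matrix_form G X \<rho> W S'" for R' S'
    using that R S by (intro RO_eq.iso matrix_form_unique)
  then show ?thesis
    unfolding RO_diff_def class_diff_def RO_rel_def using R S by (auto intro: RO_eq.trans)
qed

section \<open>Congruence of paths of invertible operators\<close>

definition inv_pair :: "('h::real_normed_vector \<Rightarrow>\<^sub>L 'h) \<Rightarrow> ('h \<Rightarrow>\<^sub>L 'h) \<Rightarrow> bool" where
  "inv_pair S R \<longleftrightarrow> S o\<^sub>L R = id_blinfun \<and> R o\<^sub>L S = id_blinfun"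

text \<open>\<open>M\<close> stands for a set of symmetries; the congruences below are built inside
  its commutant.\<close>

definition commutes :: "('h::real_normed_vector \<Rightarrow>\<^sub>L 'h) set \<Rightarrow> ('h \<Rightarrow>\<^sub>L 'h) \<Rightarrow> bool" where
  "commutes M T \<longleftrightarrow> (\<forall>C\<in>M. comm C T)"

lemma inv_pairD:
  assumes "inv_pair S R" shows "S (R u) = u" "R (S u) = u"
  using assms unfolding inv_pair_def by (metis blinfun_apply_blinfun_compose blinfun_apply_id_blinfun)+

lemma inv_pairI:
  assumes "\<And>u. blinfun_apply S (blinfun_apply R u) = u" "\<And>u. blinfun_apply R (blinfun_apply S u) = u"
  shows "inv_pair S R"
  unfolding inv_pair_def using assms by (auto intro!: blinfun_eqI)

lemma commutesI: "(\<And>C. C \<in> M \<Longrightarrow> comm C T) \<Longrightarrow> commutes M T"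
  by (simp add: commutes_def)

lemma commutesD: "commutes M T \<Longrightarrow> C \<in> M \<Longrightarrow> comm C T"
  by (simp add: commutes_def)

lemma commutes_intros:
  "commutes M A \<Longrightarrow> commutes M B \<Longrightarrow> commutes M (A + B)"
  "commutes M A \<Longrightarrow> commutes M B \<Longrightarrow> commutes M (A - B)"
  "commutes M A \<Longrightarrow> commutes M (c *\<^sub>R A)"
  "commutes M A \<Longrightarrow> commutes M B \<Longrightarrow> commutes M (A o\<^sub>L B)"
  "commutes M id_blinfun" "commutes M 0"
  by (auto simp: commutes_def intro: comm_intros)

lemma comm_inverse:
  assumes "comm C S" "inv_pair S R" shows "comm C R"
proof (rule commI)
  fix u
  have "C (R u) = R (S (C (R u)))" by (simp add: inv_pairD[OF assms(2)])
  also have "S (C (R u)) = C (S (R u))" using commD[OF assms(1), of "R u"] by simp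
  also have "\<dots> = C u" by (simp add: inv_pairD[OF assms(2)])
  finally show "C (R u) = R (C u)" .
qed

lemma sa_inverse:
  assumes "adj S S" "inv_pair S R" shows "adj R R"
  unfolding adj_def
proof (intro allI)
  fix u v
  have "R u \<bullet> v = R u \<bullet> S (R v)" by (simp add: inv_pairD[OF assms(2)])
  also have "\<dots> = S (R u) \<bullet> R v" by (rule adjD[OF assms(1), symmetric])
  also have "\<dots> = u \<bullet> R v" by (simp add: inv_pairD[OF assms(2)])
  finally show "R u \<bullet> v = u \<bullet> R v" .
qed

text \<open>Test \<open>S (R v) = v\<close> against \<open>v\<close> and move \<open>S\<close> to
  the other side.\<close>

lemma adj_invertible_bounded_below:
  assumes "adj S S'" "inv_pair S R" shows "norm v \<le> norm R * norm (S' v)"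
proof -
  have "norm v * norm v = S (R v) \<bullet> v"
    by (simp add: inv_pairD[OF assms(2)] power2_norm_eq_inner[symmetric] power2_eq_square)
  also have "\<dots> = R v \<bullet> S' v" by (rule adjD[OF assms(1)])
  also have "\<dots> \<le> norm (R v) * norm (S' v)" by (rule norm_cauchy_schwarz)
  also have "\<dots> \<le> norm R * norm v * norm (S' v)" by (intro mult_right_mono norm_blinfun) simp
  finally have "norm v * norm v \<le> norm v * (norm R * norm (S' v))" by (simp add: mult_ac)
  then show ?thesis by (cases "v = 0") auto
qed

lemma closed_range_bounded_below:
  fixes T :: "'h::{real_inner, complete_space} \<Rightarrow>\<^sub>L 'h"
  assumes "c > 0" "\<And>u. u \<in> V \<Longrightarrow> c * norm u \<le> norm (T u)" "subspace V" "closed V"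
  shows "closed (blinfun_apply T ` V)"
proof -
  have "complete (blinfun_apply T ` V)"
    using assms by (intro complete_isometric_image[of c]) (auto simp: complete_eq_closed blinfun.bounded_linear_right)
  then show ?thesis by (rule complete_imp_closed)
qed

text \<open>The lower bound makes \<open>T\<close> injective with closed range, and selfadjointness
  identifies the orthogonal complement of the range with the kernel, which is 0.\<close>

lemma sa_bounded_below_invertible:
  fixes T :: "'h::{real_inner, complete_space} \<Rightarrow>\<^sub>L 'h"
  assumes T: "adj T T" and c: "c > 0" "\<And>u. c * norm u \<le> norm (T u)"
  obtains R where "inv_pair T R"
proof -
  let ?V = "range (blinfun_apply T)"
  have V: "subspace ?V" "closed ?V"
    using closed_range_bounded_below[OF c, of UNIV] by (auto intro: subspace_range)
  have zero: "u = 0" if "T u = 0" for u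
    using c(2)[of u] that c(1) by (simp add: mult_le_0_iff)
  have inj: "inj (blinfun_apply T)"
  proof (rule injI)
    fix x y assume "T x = T y"
    then have "T (x - y) = 0" by (simp add: bl)
    then show "x = y" using zero by fastforce
  qed
  have surj: "\<exists>x. T x = y" for y
  proof -
    let ?z = "y - proj ?V y"
    have "T ?z \<bullet> T ?z = ?z \<bullet> T (T ?z)" by (rule adjD[OF T])
    also have "\<dots> = 0" by (intro proj_orth[OF V]) auto
    finally have "T ?z = 0" by simp
    then have "?z = 0" by (rule zero)
    then show ?thesis using proj_in[OF V, of y] by (auto simp: image_iff)
  qed
  then obtain r where r: "\<And>y. T (r y) = y" by metis
  have rT: "r (T x) = x" for x by (rule injD[OF inj]) (rule r)
  have "bounded_linear r"
  proof (rule bounded_linear_intro[where K="1 / c"])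
    show "r (x + y) = r x + r y" for x y
      by (rule injD[OF inj]) (simp add: bl r)
    show "r (s *\<^sub>R x) = s *\<^sub>R r x" for s x
      by (rule injD[OF inj]) (simp add: bl r)
    show "norm (r x) \<le> norm x * (1 / c)" for x
      using c(2)[of "r x"] c(1) unfolding r by (simp add: field_simps)
  qed
  then have "inv_pair T (Blinfun r)"
    by (intro inv_pairI) (simp_all add: bounded_linear_Blinfun_apply r rT)
  then show ?thesis by (rule that)
qed

lemma continuous_on_adj:
  fixes S S' :: "'a::metric_space \<Rightarrow> 'h::real_inner \<Rightarrow>\<^sub>L 'h"
  assumes "continuous_on A S" "\<And>x. x \<in> A \<Longrightarrow> adj (S x) (S' x)" shows "continuous_on A S'"
  unfolding continuous_on_iff
proof (intro ballI allI impI)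
  fix x and e :: real assume x: "x \<in> A" and "e > 0"
  then obtain d where d: "d > 0" "\<And>y. y \<in> A \<Longrightarrow> dist y x < d \<Longrightarrow> dist (S y) (S x) < e"
    using assms(1) unfolding continuous_on_iff by metis
  have "dist (S' y) (S' x) < e" if "y \<in> A" "dist y x < d" for y
    using adj_norm_le[OF adj_diff[OF assms(2)[OF that(1)] assms(2)[OF x]]] d(2)[OF that]
    by (simp add: dist_norm)
  then show "\<exists>d>0. \<forall>y\<in>A. dist y x < d \<longrightarrow> dist (S' y) (S' x) < e" using d(1) by blast
qed

text \<open>Take norms in \<open>Q = R - Q (C - B) R\<close>: the correction term is at most half of
  \<open>norm Q\<close>.\<close>

lemma inverse_norm_bound:
  assumes B: "inv_pair B R" and C: "inv_pair C Q" and near: "norm (C - B) * norm R \<le> 1 / 2"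
  shows "norm Q \<le> 2 * norm R"
proof -
  have "Q = R - (Q o\<^sub>L (C - B) o\<^sub>L R)"
    by (rule blinfun_eqI) (simp add: bl inv_pairD[OF B] inv_pairD[OF C])
  then have "norm Q \<le> norm R + norm (Q o\<^sub>L (C - B) o\<^sub>L R)" by (metis norm_triangle_ineq4)
  also have "norm (Q o\<^sub>L (C - B) o\<^sub>L R) \<le> norm Q * norm (C - B) * norm R"
    by (meson mult_right_mono norm_blinfun_compose norm_ge_zero order_trans)
  also have "\<dots> \<le> norm Q * (1 / 2)"
    unfolding mult.assoc by (intro mult_left_mono near) simp
  finally show ?thesis by simp
qed

lemma continuous_on_inverse_op:
  fixes B R :: "'a::metric_space \<Rightarrow> 'h::real_normed_vector \<Rightarrow>\<^sub>L 'h"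
  assumes B: "continuous_on A B" and R: "\<And>x. x \<in> A \<Longrightarrow> inv_pair (B x) (R x)"
  shows "continuous_on A R"
  unfolding continuous_on_iff
proof (intro ballI allI impI)
  fix x and e :: real assume x: "x \<in> A" and e: "e > 0"
  define m where "m = norm (R x) + 1"
  have m: "m > 0" "norm (R x) \<le> m" by (auto simp: m_def add_nonneg_pos)
  define \<epsilon> where "\<epsilon> = min (1 / (2 * m)) (e / (4 * m * m))"
  have "\<epsilon> > 0" using m e by (simp add: \<epsilon>_def)
  then obtain d where d: "d > 0" "\<And>y. y \<in> A \<Longrightarrow> dist y x < d \<Longrightarrow> dist (B y) (B x) < \<epsilon>"
    using B x unfolding continuous_on_iff by metis
  have "dist (R y) (R x) < e" if y: "y \<in> A" "dist y x < d" for y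
  proof -
    have n: "norm (B y - B x) \<le> \<epsilon>" using d(2)[OF y] by (simp add: dist_norm)
    have "norm (B y - B x) * norm (R x) \<le> \<epsilon> * m" using n m \<open>\<epsilon> > 0\<close> by (intro mult_mono) auto
    also have "\<dots> \<le> (1 / (2 * m)) * m" using m by (intro mult_right_mono) (auto simp: \<epsilon>_def)
    also have "\<dots> = 1 / 2" using m by simp
    finally have b: "norm (R y) \<le> 2 * norm (R x)" by (rule inverse_norm_bound[OF R[OF x] R[OF y(1)]])
    have "R y - R x = - (R y o\<^sub>L (B y - B x) o\<^sub>L R x)"
      by (rule blinfun_eqI) (simp add: bl inv_pairD[OF R[OF x]] inv_pairD[OF R[OF y(1)]])
    then have "norm (R y - R x) = norm (R y o\<^sub>L (B y - B x) o\<^sub>L R x)" by (simp only: norm_minus_cancel)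
    also have "\<dots> \<le> norm (R y) * norm (B y - B x) * norm (R x)"
      by (meson mult_right_mono norm_blinfun_compose norm_ge_zero order_trans)
    also have "\<dots> \<le> (2 * m) * \<epsilon> * m" using b m n \<open>\<epsilon> > 0\<close> by (intro mult_mono) auto
    also have "\<dots> \<le> (2 * m) * (e / (4 * m * m)) * m"
      using m by (intro mult_right_mono mult_left_mono) (auto simp: \<epsilon>_def)
    also have "\<dots> = e / 2" using m by (simp add: field_simps)
    finally show ?thesis using e by (simp add: dist_norm)
  qed
  then show "\<exists>d>0. \<forall>y\<in>A. dist y x < d \<longrightarrow> dist (R y) (R x) < e" using d(1) by blast
qed

lemma continuous_on_glue:
  fixes f g :: "real \<Rightarrow> 'a::topological_space"
  assumes "continuous_on {a..b} f" "continuous_on {b..c} g" "f b = g b" "a \<le> b" "b \<le> c"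
  shows "continuous_on {a..c} (\<lambda>x. if x \<le> b then f x else g x)"
proof -
  have "continuous_on ({a..b} \<union> {b..c}) (\<lambda>x. if x \<le> b then f x else g x)"
    using assms by (intro continuous_on_cases) auto
  moreover have "{a..b} \<union> {b..c} = {a..c}" using assms by auto
  ultimately show ?thesis by simp
qed

text \<open>A change of variables along which a selfadjoint \<open>T\<close> is pulled back to
  \<open>S' o\<^sub>L T o\<^sub>L S\<close>. The adjoint is carried as an argument since
  \<open>adj\<close> is a relation.\<close>

definition transporter :: "('h::{real_inner, complete_space} \<Rightarrow>\<^sub>L 'h) set \<Rightarrow> ('h \<Rightarrow>\<^sub>L 'h) \<Rightarrow> ('h \<Rightarrow>\<^sub>L 'h) \<Rightarrow> bool" where
  "transporter M S S' \<longleftrightarrow> adj S S' \<and> commutes M S \<and> commutes M S' \<and> (\<exists>R. inv_pair S R)"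

lemma inv_pair_compose: "inv_pair S R \<Longrightarrow> inv_pair T Q \<Longrightarrow> inv_pair (S o\<^sub>L T) (Q o\<^sub>L R)"
  by (rule inv_pairI) (simp_all add: inv_pairD)

lemma transporter_compose:
  assumes "transporter M S S'" "transporter M T T'" shows "transporter M (S o\<^sub>L T) (T' o\<^sub>L S')"
  using assms unfolding transporter_def
  by (auto intro: adj_compose commutes_intros inv_pair_compose)

lemma sqrt_lim_zero: "sqrt_lim (0 :: 'h::{real_inner, complete_space} \<Rightarrow>\<^sub>L 'h) = 0"
proof -
  have "sqrt_iter (0 :: 'h \<Rightarrow>\<^sub>L 'h) n = 0" for n
    by (induction n) auto
  then have "sqrt_iter (0 :: 'h \<Rightarrow>\<^sub>L 'h) = (\<lambda>n. 0)" by auto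
  then show ?thesis unfolding sqrt_lim_def by (intro limI) simp
qed

text \<open>\<open>Y = (C\<^sup>-\<^sup>1 B)\<^sup>1\<^sup>/\<^sup>2\<close> satisfies \<open>Y\<^sup>* C = C Y\<close>, hence \<open>Y\<^sup>* C Y = C Y\<^sup>2 = B\<close>.\<close>

lemma local_congruence:
  fixes B :: "'h::{real_inner, complete_space} \<Rightarrow>\<^sub>L 'h"
  assumes B: "adj B B" "commutes M B" "inv_pair B R" and C: "adj C C" "commutes M C" "inv_pair C Q"
    and near: "norm (id_blinfun - (Q o\<^sub>L B)) \<le> 1"
  defines "Y \<equiv> id_blinfun - sqrt_lim (id_blinfun - (Q o\<^sub>L B))"
    and "Y' \<equiv> id_blinfun - sqrt_lim (id_blinfun - (B o\<^sub>L Q))"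
  shows "transporter M Y Y'" "Y' o\<^sub>L C o\<^sub>L Y = B"
proof -
  let ?X = "id_blinfun - (Q o\<^sub>L B)" and ?X' = "id_blinfun - (B o\<^sub>L Q)"
  have QQ: "adj Q Q" by (rule sa_inverse[OF C(1,3)])
  have XX: "adj ?X ?X'" by (intro adj_intros QQ B)
  have near': "norm ?X' \<le> 1" using adj_norm_le[OF XX] near by simp
  have YY: "adj Y Y'" unfolding Y_def Y'_def by (intro adj_intros adj_sqrt_lim near XX)
  have MQ: "commutes M Q" using C by (auto simp: commutes_def intro: comm_inverse)
  have MX: "commutes M ?X" "commutes M ?X'" by (intro commutes_intros MQ B)+
  have "commutes M (sqrt_lim ?X)"
    by (rule commutesI, rule comm_sqrt_lim[OF near], rule commutesD[OF MX(1)])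
  moreover have "commutes M (sqrt_lim ?X')"
    by (rule commutesI, rule comm_sqrt_lim[OF near'], rule commutesD[OF MX(2)])
  ultimately have MY: "commutes M Y" "commutes M Y'"
    unfolding Y_def Y'_def by (auto intro: commutes_intros(2,5))
  have Y2: "Y o\<^sub>L Y = Q o\<^sub>L B" unfolding Y_def sqrt_lim_square[OF near] by simp
  then have Y2': "Y (Y u) = Q (B u)" for u by (metis blinfun_apply_blinfun_compose)
  have "C o\<^sub>L ?X = ?X' o\<^sub>L C" by (rule blinfun_eqI) (simp add: bl inv_pairD[OF C(3)])
  then have "C o\<^sub>L sqrt_lim ?X = sqrt_lim ?X' o\<^sub>L C" by (rule sqrt_lim_intertwine[OF _ near near'])
  then have "C (sqrt_lim ?X u) = sqrt_lim ?X' (C u)" for u by (metis blinfun_apply_blinfun_compose)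
  then have CY: "C (Y u) = Y' (C u)" for u by (simp add: Y_def Y'_def bl)
  show "Y' o\<^sub>L C o\<^sub>L Y = B"
    by (rule blinfun_eqI) (simp add: CY[symmetric] Y2' inv_pairD[OF C(3)])
  \<comment> \<open>The inverse of the square of \<open>Y\<close>. It commutes with
    \<open>Y\<close>, so \<open>Y o\<^sub>L D\<close> is a two-sided inverse of
    \<open>Y\<close>.\<close>
  define D where "D = R o\<^sub>L C"
  have YYD: "Y (Y (D u)) = u" and DYY: "D (Y (Y u)) = u" for u
    by (simp_all add: D_def Y2' inv_pairD[OF C(3)] inv_pairD[OF B(3)])
  have "inv_pair Y (Y o\<^sub>L D)"
  proof (rule inv_pairI)
    show "Y ((Y o\<^sub>L D) u) = u" for u by (simp add: YYD)
    have "D (Y v) = Y (D v)" for v using DYY[of "Y (D v)"] YYD[of v] by simp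
    then show "(Y o\<^sub>L D) (Y u) = u" for u using YYD[of u] by simp
  qed
  then show "transporter M Y Y'" unfolding transporter_def using YY MY by blast
qed

text \<open>Near each point \<open>local_congruence\<close> carries \<open>B s\<close> to the
  operator at the left end of a short interval, continuously in \<open>s\<close> and starting from
  the identity. Two such paths are joined by composing the second with the end value of the first,
  and \<open>Bolzano\<close> extends this to the whole interval.\<close>

lemma congruence_path:
  fixes B :: "real \<Rightarrow> 'h::{real_inner, complete_space} \<Rightarrow>\<^sub>L 'h"
  assumes le: "a \<le> b" and cont: "continuous_on {a..b} B"
    and B: "\<And>s. s \<in> {a..b} \<Longrightarrow> adj (B s) (B s)" "\<And>s. s \<in> {a..b} \<Longrightarrow> commutes M (B s)"
      "\<And>s. s \<in> {a..b} \<Longrightarrow> \<exists>R. inv_pair (B s) R"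
  obtains S S' where "continuous_on {a..b} S" "S a = id_blinfun" "S' a = id_blinfun"
    "\<And>s. s \<in> {a..b} \<Longrightarrow> transporter M (S s) (S' s)"
    "\<And>s. s \<in> {a..b} \<Longrightarrow> S' s o\<^sub>L B s o\<^sub>L S s = B a"
proof -
  define P where "P x y \<longleftrightarrow> (a \<le> x \<and> x \<le> y \<and> y \<le> b \<longrightarrow> (\<exists>S S'. continuous_on {x..y} S \<and>
    S x = id_blinfun \<and> S' x = id_blinfun \<and>
    (\<forall>s\<in>{x..y}. transporter M (S s) (S' s) \<and> S' s o\<^sub>L B s o\<^sub>L S s = B x)))" for x y
  obtain R where R: "\<And>s. s \<in> {a..b} \<Longrightarrow> inv_pair (B s) (R s)" using B(3) by metis
  have contR: "continuous_on {a..b} R" by (rule continuous_on_inverse_op[OF cont R])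
  have "P a b"
  proof (rule Bolzano[OF le, of P])
    fix x y z assume P: "P x y" "P y z" "x \<le> y" "y \<le> z"
    show "P x z" unfolding P_def
    proof
      assume xz: "a \<le> x \<and> x \<le> z \<and> z \<le> b"
      obtain S S' where S: "continuous_on {x..y} S" "S x = id_blinfun" "S' x = id_blinfun"
        "\<And>s. s \<in> {x..y} \<Longrightarrow> transporter M (S s) (S' s)" "\<And>s. s \<in> {x..y} \<Longrightarrow> S' s o\<^sub>L B s o\<^sub>L S s = B x"
        using P(1,3,4) xz unfolding P_def by auto
      obtain T T' where T: "continuous_on {y..z} T" "T y = id_blinfun" "T' y = id_blinfun"
        "\<And>s. s \<in> {y..z} \<Longrightarrow> transporter M (T s) (T' s)" "\<And>s. s \<in> {y..z} \<Longrightarrow> T' s o\<^sub>L B s o\<^sub>L T s = B y"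
        using P(2,3,4) xz unfolding P_def by auto
      define U where "U s = (if s \<le> y then S s else T s o\<^sub>L S y)" for s
      define U' where "U' s = (if s \<le> y then S' s else S' y o\<^sub>L T' s)" for s
      have "continuous_on {x..z} U"
        unfolding U_def using P(3,4) T(2)
        by (intro continuous_on_glue S continuous_on_blinfun_compose T continuous_on_const)
          (auto intro: blinfun_eqI)
      moreover have "U x = id_blinfun" "U' x = id_blinfun" using S P(3) by (auto simp: U_def U'_def)
      moreover have "transporter M (U s) (U' s) \<and> U' s o\<^sub>L B s o\<^sub>L U s = B x" if s: "s \<in> {x..z}" for s
      proof (cases "s \<le> y")
        case True
        then show ?thesis using S s by (auto simp: U_def U'_def)
      next
        case False
        then have s': "s \<in> {y..z}" "y \<in> {x..y}" using s P by auto
        have "U' s o\<^sub>L B s o\<^sub>L U s = S' y o\<^sub>L (T' s o\<^sub>L B s o\<^sub>L T s) o\<^sub>L S y"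
          using False by (intro blinfun_eqI) (simp add: U_def U'_def)
        also have "\<dots> = B x" unfolding T(5)[OF s'(1)] by (rule S(5)[OF s'(2)])
        finally show ?thesis
          using False transporter_compose[OF T(4)[OF s'(1)] S(4)[OF s'(2)]] by (simp add: U_def U'_def)
      qed
      ultimately show "\<exists>S S'. continuous_on {x..z} S \<and> S x = id_blinfun \<and> S' x = id_blinfun \<and>
        (\<forall>s\<in>{x..z}. transporter M (S s) (S' s) \<and> S' s o\<^sub>L B s o\<^sub>L S s = B x)" by blast
    qed
  next
    fix x assume x: "a \<le> x" "x \<le> b"
    \<comment> \<open>With \<open>m\<close> above \<open>norm (R x)\<close>, perturbations of size
      \<open>1 / (4 * m)\<close> keep the inverses below \<open>2 * m\<close>, and two operators of
      the neighbourhood differ by at most \<open>1 / (2 * m)\<close>. So \<open>1 - R s B y\<close>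
      has norm at most 1, as the square root requires.\<close>
    define m where "m = norm (R x) + 1"
    have m: "m > 0" "norm (R x) \<le> m" by (auto simp: m_def add_nonneg_pos)
    have "1 / (4 * m) > 0" using m by simp
    moreover have "x \<in> {a..b}" using x by simp
    ultimately obtain d where d: "d > 0" "\<And>y. y \<in> {a..b} \<Longrightarrow> dist y x < d \<Longrightarrow> dist (B y) (B x) < 1 / (4 * m)"
      using cont unfolding continuous_on_iff by metis
    have "P y z" if yz: "y \<le> x" "x \<le> z" "z - y < d" for y z
      unfolding P_def
    proof
      assume *: "a \<le> y \<and> y \<le> z \<and> z \<le> b"
      have in_ab: "s \<in> {a..b}" "dist s x < d" if "s \<in> {y..z}" for s
        using that * yz by (auto simp: dist_real_def)
      have nB: "norm (B s - B x) \<le> 1 / (4 * m)" if "s \<in> {y..z}" for s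
        using d(2)[OF in_ab[OF that]] by (simp add: dist_norm)
      have nR: "norm (R s) \<le> 2 * m" if "s \<in> {y..z}" for s
      proof -
        have "norm (B s - B x) * norm (R x) \<le> 1 / (4 * m) * m"
          using nB[OF that] m by (intro mult_mono) auto
        also have "\<dots> \<le> 1 / 2" using m by simp
        finally have "norm (R s) \<le> 2 * norm (R x)"
          using x by (intro inverse_norm_bound[OF R R]) (use in_ab[OF that] in auto)
        then show ?thesis using m by simp
      qed
      have y: "y \<in> {y..z}" using * by simp
      have near: "norm (id_blinfun - (R s o\<^sub>L B y)) \<le> 1" if "s \<in> {y..z}" for s
      proof -
        have "id_blinfun - (R s o\<^sub>L B y) = R s o\<^sub>L (B s - B y)"
          by (rule blinfun_eqI) (simp add: bl inv_pairD[OF R[OF in_ab(1)[OF that]]])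
        then have "norm (id_blinfun - (R s o\<^sub>L B y)) \<le> norm (R s) * norm (B s - B y)"
          by (simp add: norm_blinfun_compose)
        also have "\<dots> \<le> (2 * m) * (1 / (4 * m) + 1 / (4 * m))"
          using nR[OF that] m norm_triangle_ineq4[of "B s - B x" "B y - B x"] nB[OF that] nB[OF y]
          by (intro mult_mono) auto
        also have "\<dots> = 1" using m by (simp add: field_simps)
        finally show ?thesis .
      qed
      define S where "S s = id_blinfun - sqrt_lim (id_blinfun - (R s o\<^sub>L B y))" for s
      define S' where "S' s = id_blinfun - sqrt_lim (id_blinfun - (B y o\<^sub>L R s))" for s
      have contS: "continuous_on {y..z} S"
        unfolding S_def
      proof (intro continuous_on_diff continuous_on_const continuous_on_compose2[OF continuous_on_sqrt_lim])
        show "continuous_on {y..z} (\<lambda>s. R s o\<^sub>L B y)"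
          using * by (intro continuous_on_blinfun_compose continuous_on_const continuous_on_subset[OF contR]) auto
        show "(\<lambda>s. id_blinfun - (R s o\<^sub>L B y)) ` {y..z} \<subseteq> cball 0 1"
          using near by (auto simp: dist_norm norm_minus_commute)
      qed
      have Sy: "S y = id_blinfun" "S' y = id_blinfun"
        using R[OF in_ab(1)[OF y]] unfolding inv_pair_def S_def S'_def by (simp_all add: sqrt_lim_zero)
      have "transporter M (S s) (S' s) \<and> S' s o\<^sub>L B s o\<^sub>L S s = B y" if s: "s \<in> {y..z}" for s
        unfolding S_def S'_def
        using local_congruence[OF B(1,2)[OF in_ab(1)[OF y]] R[OF in_ab(1)[OF y]]
            B(1,2)[OF in_ab(1)[OF s]] R[OF in_ab(1)[OF s]] near[OF s]]
          B(2)[OF in_ab(1)[OF y]] B(2)[OF in_ab(1)[OF s]] by blast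
      then show "\<exists>S S'. continuous_on {y..z} S \<and> S y = id_blinfun \<and> S' y = id_blinfun \<and>
        (\<forall>s\<in>{y..z}. transporter M (S s) (S' s) \<and> S' s o\<^sub>L B s o\<^sub>L S s = B y)"
        using contS Sy by blast
    qed
    then show "\<exists>d>0. \<forall>y z. y \<le> x \<and> x \<le> z \<and> z - y < d \<longrightarrow> P y z" using d(1) by blast
  qed
  then show ?thesis using that le unfolding P_def by auto
qed

section \<open>Negative eigenspaces in finite dimensions\<close>

text \<open>A cube of coordinates has compact image, by induction on the number of basis vectors,
  and the unit sphere of \<open>V\<close> is a closed part of the cube with coefficients of modulus
  at most 1.\<close>

lemma compact_unit_sphere:
  fixes V :: "'h::real_inner set"
  assumes V: "subspace V" "finite_dim V" shows "compact (V \<inter> sphere 0 1)"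
proof -
  obtain b n where b: "span (b ` {..<n::nat}) = V"
    "\<And>i j. i < n \<Longrightarrow> j < n \<Longrightarrow> b i \<bullet> b j = (if i = j then 1 else 0)"
    using finite_dim_orthonormal_basis[OF V] by metis
  define K where "K k = {\<Sum>i<k. x i *\<^sub>R b i | x. \<forall>i<k. \<bar>x i\<bar> \<le> (1::real)}" for k
  have KC: "compact (K k)" for k
  proof (induction k)
    case 0 then show ?case by (simp add: K_def)
  next
    case (Suc k)
    have "K (Suc k) = (\<lambda>(v, t). v + t *\<^sub>R b k) ` (K k \<times> {-1..1})"
    proof (intro equalityI subsetI)
      fix v assume "v \<in> K (Suc k)"
      then obtain x where x: "v = (\<Sum>i<Suc k. x i *\<^sub>R b i)" "\<forall>i<Suc k. \<bar>x i\<bar> \<le> 1" by (auto simp: K_def)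
      then have "(\<Sum>i<k. x i *\<^sub>R b i) \<in> K k" "x k \<in> {-1..1}" by (auto simp: K_def abs_le_iff)
      then show "v \<in> (\<lambda>(v, t). v + t *\<^sub>R b k) ` (K k \<times> {-1..1})"
        using x by (intro image_eqI[of _ _ "(\<Sum>i<k. x i *\<^sub>R b i, x k)"]) auto
    next
      fix v assume "v \<in> (\<lambda>(v, t). v + t *\<^sub>R b k) ` (K k \<times> {-1..1})"
      then obtain x t where x: "v = (\<Sum>i<k. x i *\<^sub>R b i) + t *\<^sub>R b k" "\<forall>i<k. \<bar>x i\<bar> \<le> 1" "\<bar>t\<bar> \<le> 1"
        by (auto simp: K_def abs_le_iff)
      then show "v \<in> K (Suc k)"
        unfolding K_def by (intro CollectI exI[of _ "x(k := t)"]) (auto simp: less_Suc_eq)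
    qed
    then show ?case
      using Suc by (auto intro!: compact_continuous_image compact_Times continuous_intros simp: case_prod_unfold)
  qed
  have eq: "V \<inter> sphere 0 1 = K n \<inter> sphere 0 1"
  proof (intro equalityI subsetI)
    fix v assume v: "v \<in> V \<inter> sphere 0 1"
    have 1: "\<bar>b i \<bullet> v\<bar> \<le> 1" if "i < n" for i
      using Cauchy_Schwarz_ineq2[of "b i" v] v b(2)[OF that that] by (simp add: norm_eq_sqrt_inner)
    have 2: "v = (\<Sum>i<n. (b i \<bullet> v) *\<^sub>R b i)"
      using v by (intro orthonormal_expansion[OF b(2)]) (simp_all add: b(1))
    have "v \<in> K n"
      unfolding K_def using 1 by (intro CollectI exI[of _ "\<lambda>i. b i \<bullet> v"] conjI allI impI 2)
    then show "v \<in> K n \<inter> sphere 0 1" using v by simp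
  next
    fix v assume v: "v \<in> K n \<inter> sphere 0 1"
    then obtain x where "v = (\<Sum>i<n. x i *\<^sub>R b i)" by (auto simp: K_def)
    then have "v \<in> V" unfolding b(1)[symmetric] by (auto intro!: span_sum span_scale intro: span_base)
    then show "v \<in> V \<inter> sphere 0 1" using v by simp
  qed
  show ?thesis unfolding eq unfolding sphere_def
    by (intro compact_Int_closed KC closed_Collect_eq continuous_intros)
qed

text \<open>Minimise the form on the unit sphere. If the minimum \<open>c\<close> is attained at
  \<open>w\<close>, the compression of \<open>T - c\<close> to \<open>V\<close> is positive with
  null vector \<open>w\<close>, so it kills \<open>w\<close> by \<open>pos_null\<close>.\<close>

lemma rayleigh_eigenvector:
  fixes T :: "'h::{real_inner, complete_space} \<Rightarrow>\<^sub>L 'h"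
  assumes V: "subspace V" "finite_dim V" and TV: "\<And>u. u \<in> V \<Longrightarrow> T u \<in> V" and T: "adj T T"
    and neg: "u \<in> V" "T u \<bullet> u < 0"
  obtains c w where "c < 0" "w \<in> V" "w \<noteq> 0" "T w = c *\<^sub>R w"
proof -
  have u0: "u \<noteq> 0" using neg by auto
  let ?S = "V \<inter> sphere 0 1"
  have Vc: "closed V" using V by (rule finite_dim_closed)
  have scaled: "v /\<^sub>R norm v \<in> ?S" if "v \<in> V" "v \<noteq> 0" for v
    using that V(1) by (simp add: subspace_scale)
  have ne: "?S \<noteq> {}" using scaled[OF neg(1) u0] by blast
  have "continuous_on ?S (\<lambda>v. T v \<bullet> v)" by (intro continuous_intros)
  then obtain w where w: "w \<in> ?S" "\<And>v. v \<in> ?S \<Longrightarrow> T w \<bullet> w \<le> T v \<bullet> v"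
    using continuous_attains_inf[OF compact_unit_sphere[OF V] ne] by blast
  define c where "c = T w \<bullet> w"
  have min: "c * (v \<bullet> v) \<le> T v \<bullet> v" if "v \<in> V" for v
  proof (cases "v = 0")
    case False
    have "c \<le> T (v /\<^sub>R norm v) \<bullet> (v /\<^sub>R norm v)" unfolding c_def using scaled[OF that False] by (rule w(2))
    also have "\<dots> = (T v \<bullet> v) / (v \<bullet> v)"
      by (simp add: bl power2_norm_eq_inner[symmetric] power2_eq_square divide_inverse)
    finally show ?thesis using False by (simp add: pos_le_divide_eq)
  qed simp
  have "c * (u \<bullet> u) < 0" using min[OF neg(1)] neg(2) by linarith
  moreover have "0 < u \<bullet> u" using u0 by simp
  ultimately have c: "c < 0" by (simp add: mult_less_0_iff)
  let ?P = "proj V"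
  have P: "is_proj ?P" by (rule is_proj_proj[OF V(1) Vc])
  define A where "A = ?P o\<^sub>L (T - c *\<^sub>R id_blinfun) o\<^sub>L ?P"
  have A: "A v \<bullet> v = T (?P v) \<bullet> ?P v - c * (?P v \<bullet> ?P v)" for v
  proof -
    have "A v \<bullet> v = (T - c *\<^sub>R id_blinfun) (?P v) \<bullet> ?P v"
      unfolding A_def by (simp only: blinfun_apply_blinfun_compose is_projD(3)[OF P])
    then show ?thesis by (simp add: bl inner_diff_left)
  qed
  have "adj A (?P o\<^sub>L ((T - c *\<^sub>R id_blinfun) o\<^sub>L ?P))"
    unfolding A_def by (intro adj_intros T is_projD(1)[OF P])
  moreover have "?P o\<^sub>L ((T - c *\<^sub>R id_blinfun) o\<^sub>L ?P) = A"
    unfolding A_def by (rule blinfun_eqI) simp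
  ultimately have "adj A A" by simp
  moreover have "0 \<le> A v \<bullet> v" for v using min[OF proj_in[OF V(1) Vc], of v] A[of v] by simp
  moreover have Pw: "?P w = w" using w(1) proj_ident[OF V(1) Vc] by simp
  moreover have "A w \<bullet> w = 0" using A[of w] Pw w(1) by (simp add: c_def norm_eq_1)
  ultimately have "A w = 0" by (intro pos_null)
  then have "?P (T w - c *\<^sub>R w) = 0" by (simp add: A_def Pw blinfun.diff_left blinfun.scaleR_left)
  moreover have "T w - c *\<^sub>R w \<in> V" using w(1) TV V(1) by (simp add: subspace_diff subspace_scale)
  ultimately have "T w = c *\<^sub>R w" using proj_ident[OF V(1) Vc] by simp
  moreover have "w \<noteq> 0" using w(1) by auto
  ultimately show ?thesis using that[OF c, of w] w(1) by blast
qed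

text \<open>A dimension count by independent sets: \<open>f\<close> embeds \<open>N\<close> in
  \<open>E\<close>, while \<open>g\<close> embeds \<open>E\<close> in the image of \<open>N\<close>
  under \<open>h\<close>. Were \<open>f\<close> not onto, the image of a basis of \<open>N\<close>
  and one further vector would be independent in \<open>E\<close>, yet go injectively into a span of
  at most \<open>card B\<close> vectors.\<close>

lemma dim_squeeze:
  fixes N E :: "'h::real_vector set"
  assumes N: "subspace N" "finite_dim N" and E: "subspace E"
    and f: "linear f" "inj_on f N" "f ` N \<subseteq> E" and g: "linear g" "inj_on g E" and h: "linear h" "g ` E \<subseteq> h ` N"
  shows "f ` N = E"
proof (rule ccontr)
  assume "f ` N \<noteq> E"
  then obtain y where y: "y \<in> E" "y \<notin> f ` N" using f(3) by blast
  obtain B where B: "finite B" "independent B" "span B = N" "B \<subseteq> N" using finite_dim_basis[OF N] by metis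
  have sf: "span (f ` B) = f ` N" using linear_span_image[OF f(1), of B] B(3) by simp
  have "independent (f ` B)"
    using f(2) B by (intro linear_independent_injective_image f(1)) auto
  then have ind: "independent (insert y (f ` B))"
    using y(2) unfolding sf[symmetric] by (simp add: independent_insert)
  have sub: "insert y (f ` B) \<subseteq> E" using y(1) f(3) B(4) by auto
  then have sE: "span (insert y (f ` B)) \<subseteq> E" using E by (rule span_minimal)
  have "independent (g ` insert y (f ` B))"
    using inj_on_subset[OF g(2) sE] by (intro linear_independent_injective_image g(1) ind)
  moreover have "g ` insert y (f ` B) \<subseteq> span (h ` B)"
    using h(2) sub linear_span_image[OF h(1), of B] B(3) by blast
  ultimately have "card (g ` insert y (f ` B)) \<le> card (h ` B)"
    using independent_span_bound[of "h ` B"] B(1) by blast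
  also have "\<dots> \<le> card B" by (rule card_image_le[OF B(1)])
  also have "card (g ` insert y (f ` B)) = card (insert y (f ` B))"
    by (intro card_image inj_on_subset[OF g(2) sub])
  also have "\<dots> = Suc (card B)"
    using B y(2) f(2) by (subst card_insert_disjoint) (auto simp: card_image inj_on_subset)
  finally show False by simp
qed

context
  fixes F :: "'h::{real_inner, complete_space} set" and T :: "'h \<Rightarrow>\<^sub>L 'h"
  assumes F: "subspace F" "finite_dim F" and T: "adj T T" and TF: "\<And>u. u \<in> F \<Longrightarrow> T u \<in> F"
begin

lemma E_neg_subset: "subspace (E_neg F T)" "E_neg F T \<subseteq> F" "finite_dim (E_neg F T)" "closed (E_neg F T)"
proof -
  show 1: "subspace (E_neg F T)" by (simp add: E_neg_def)
  show 2: "E_neg F T \<subseteq> F" unfolding E_neg_def using F(1) by (intro span_minimal) auto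
  show 3: "finite_dim (E_neg F T)" using finite_dim_subset[OF F(2) 2] .
  show "closed (E_neg F T)" using 1 3 by (rule finite_dim_closed)
qed

text \<open>Eigenvectors for negative eigenvalues are fixed by \<open>slt T 0\<close>, hence so is
  their span, and there the form is negative by \<open>slt_range\<close>.\<close>

lemma E_neg_negative:
  assumes u: "u \<in> E_neg F T" "u \<noteq> 0" shows "T u \<bullet> u < 0"
proof -
  have "slt T 0 v = v" if v: "T v = c *\<^sub>R v" "c < 0" for v c
  proof -
    define w where "w = v - slt T 0 v"
    have "T w = c *\<^sub>R w"
      using commD[OF comm_slt_self[OF T], of 0 v] v(1) by (simp add: w_def bl algebra_simps)
    moreover have "slt T 0 w = 0" by (simp add: w_def bl is_projD(2)[OF is_proj_slt])
    ultimately have "0 \<le> c * (w \<bullet> w)" using slt_kernel[OF T, of 0 w] by simp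
    then have "w \<bullet> w \<le> 0" using v(2) by (auto simp: zero_le_mult_iff)
    then have "w = 0" by (metis inner_eq_zero_iff inner_ge_zero order_antisym)
    then show ?thesis by (simp add: w_def)
  qed
  then have "(\<Union>c\<in>{..<0}. {u \<in> F. T u = c *\<^sub>R u}) \<subseteq> {u. (slt T 0 - id_blinfun) u = 0}"
    by (auto simp: bl)
  then have "E_neg F T \<subseteq> {u. (slt T 0 - id_blinfun) u = 0}"
    unfolding E_neg_def by (rule span_minimal[OF _ subspace_kernel])
  then have "slt T 0 u = u" using u(1) by (auto simp: bl)
  then show ?thesis using slt_range[OF T _ u(2), of 0] by simp
qed

lemma E_neg_invariant:
  assumes C: "\<And>u. u \<in> F \<Longrightarrow> blinfun_apply C u \<in> F" "comm C T" and u: "u \<in> E_neg F T"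
  shows "C u \<in> E_neg F T"
proof -
  have "C ` (\<Union>c\<in>{..<0}. {u \<in> F. T u = c *\<^sub>R u}) \<subseteq> (\<Union>c\<in>{..<0}. {u \<in> F. T u = c *\<^sub>R u})"
  proof
    fix y assume "y \<in> C ` (\<Union>c\<in>{..<0}. {u \<in> F. T u = c *\<^sub>R u})"
    then obtain c v where v: "y = C v" "v \<in> F" "c < 0" "T v = c *\<^sub>R v" by auto
    have "T (C v) = c *\<^sub>R C v" using commD[OF C(2), of v] v(4) by (simp add: bl)
    then show "y \<in> (\<Union>c\<in>{..<0}. {u \<in> F. T u = c *\<^sub>R u})" using C(1)[OF v(2)] v(1,3) by blast
  qed
  then have "span (C ` (\<Union>c\<in>{..<0}. {u \<in> F. T u = c *\<^sub>R u})) \<subseteq> E_neg F T"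
    unfolding E_neg_def by (rule span_mono)
  then show ?thesis
    using u linear_span_image[of "blinfun_apply C" "\<Union>c\<in>{..<0}. {u \<in> F. T u = c *\<^sub>R u}"]
    unfolding E_neg_def by auto
qed

text \<open>The orthogonal complement of \<open>E_neg F T\<close> in \<open>F\<close> is invariant
  under \<open>T\<close>; a negative value of the form on it would produce, by
  \<open>rayleigh_eigenvector\<close>, a negative eigenvector inside it.\<close>

lemma E_neg_complement:
  assumes u: "u \<in> F" "\<And>v. v \<in> E_neg F T \<Longrightarrow> u \<bullet> v = 0" shows "0 \<le> T u \<bullet> u"
proof (rule ccontr)
  assume n: "\<not> 0 \<le> T u \<bullet> u"
  define V where "V = {w \<in> F. proj (E_neg F T) w = 0}"
  note E = E_neg_subset
  have V: "subspace V" "finite_dim V"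
    using F subspace_inter[OF F(1) subspace_kernel, of "proj (E_neg F T)"]
    by (auto simp: V_def Int_def intro: finite_dim_subset[OF F(2)])
  have "comm T (proj (E_neg F T))"
    using E_neg_invariant[OF TF comm_refl] by (intro proj_comm[OF E(1,4) T])
  then have "T w \<in> V" if "w \<in> V" for w
    using that TF commD[of T "proj (E_neg F T)" w] by (auto simp: V_def)
  moreover have "u \<in> V" using u proj_0_iff[OF E(1,4)] by (simp add: V_def)
  ultimately obtain c w where w: "c < 0" "w \<in> V" "w \<noteq> 0" "T w = c *\<^sub>R w"
    using rayleigh_eigenvector[OF V _ T, of u] n by (metis not_le)
  then have "w \<in> E_neg F T" unfolding E_neg_def by (intro span_base) (auto simp: V_def)
  then have "proj (E_neg F T) w = w" by (rule proj_ident[OF E(1,4)])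
  then show False using w by (simp add: V_def)
qed

text \<open>The law of inertia in equivariant form. Projecting \<open>N\<close> to the negative
  eigenspace is injective, because the form is nonnegative on the orthogonal complement of that
  space. Projecting off \<open>M\<close> is injective on the eigenspace and maps it into the image
  of \<open>N\<close>. So the first projection is also onto, and being equivariant it transports
  \<open>R\<close>.\<close>

lemma matrix_form_E_neg:
  assumes N: "subspace N" "N \<subseteq> F" "\<And>u. u \<in> N \<Longrightarrow> u \<noteq> 0 \<Longrightarrow> T u \<bullet> u < 0"
    and M: "subspace M" "M \<subseteq> F" "\<And>u. u \<in> M \<Longrightarrow> 0 \<le> T u \<bullet> u"
    and NM: "\<And>u. u \<in> F \<Longrightarrow> \<exists>v\<in>N. \<exists>w\<in>M. u = v + w"
    and \<rho>: "\<And>g. g \<in> carrier G \<Longrightarrow> comm (\<rho> g) (proj (E_neg F T))"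
    and R: "matrix_form G X \<rho> N R"
  shows "matrix_form G X \<rho> (E_neg F T) R"
proof -
  let ?E = "E_neg F T"
  note E = E_neg_subset
  have Nf: "finite_dim N" using finite_dim_subset[OF F(2) N(2)] .
  have Mc: "closed M" using finite_dim_closed[OF M(1) finite_dim_subset[OF F(2) M(2)]] .
  have inj: "inj_on (proj ?E) N"
  proof (rule inj_onI)
    fix x y assume xy: "x \<in> N" "y \<in> N" "proj ?E x = proj ?E y"
    then have d: "x - y \<in> N" using N(1) by (simp add: subspace_diff)
    have "proj ?E (x - y) = 0" using xy by (simp add: bl)
    then have "0 \<le> T (x - y) \<bullet> (x - y)"
      using d N(2) proj_0_iff[OF E(1,4)] by (intro E_neg_complement) auto
    then show "x = y" using N(3)[OF d] by fastforce
  qed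
  have inj': "inj_on (blinfun_apply (id_blinfun - proj M)) ?E"
  proof (rule inj_onI)
    fix x y assume xy: "x \<in> ?E" "y \<in> ?E" "(id_blinfun - proj M) x = (id_blinfun - proj M) y"
    then have d: "x - y \<in> ?E" using E(1) by (simp add: subspace_diff)
    have "proj M (x - y) = x - y" using xy by (simp add: bl algebra_simps)
    then have "x - y \<in> M" using proj_in[OF M(1) Mc] by metis
    then show "x = y" using M(3) E_neg_negative[OF d] by fastforce
  qed
  have "blinfun_apply (id_blinfun - proj M) ` ?E \<subseteq> blinfun_apply (id_blinfun - proj M) ` N"
  proof
    fix z assume "z \<in> blinfun_apply (id_blinfun - proj M) ` ?E"
    then obtain u where u: "u \<in> F" "z = (id_blinfun - proj M) u" using E(2) by blast
    obtain v w where "v \<in> N" "w \<in> M" "u = v + w" using NM[OF u(1)] by blast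
    then show "z \<in> blinfun_apply (id_blinfun - proj M) ` N"
      using u(2) proj_ident[OF M(1) Mc, of w] by (intro image_eqI[of _ _ v]) (auto simp: bl)
  qed
  then have "proj ?E ` N = ?E"
    using proj_in[OF E(1,4)] inj inj'
    by (intro dim_squeeze[OF N(1) Nf E(1)]) (auto intro: linear_blinfun)
  moreover have "matrix_form G X \<rho> (proj ?E ` N) R"
    using commD[OF \<rho>] by (intro matrix_form_image[OF R _ inj]) auto
  ultimately show ?thesis by simp
qed

end

text \<open>If \<open>P u = u\<close> and \<open>Q u = 0\<close>, then \<open>u = (P - Q) u\<close>
  forces \<open>u = 0\<close>. So each projection is injective on the range of the other, and
  \<open>Q\<close> is an equivariant isomorphism of the ranges.\<close>

lemma matrix_form_near_projection:
  fixes P Q :: "'h::{real_inner, complete_space} \<Rightarrow>\<^sub>L 'h"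
  assumes P: "is_proj P" "finite_dim (range P)" and Q: "is_proj Q" and near: "norm (P - Q) < 1"
    and \<rho>: "\<And>g. g \<in> carrier G \<Longrightarrow> comm (\<rho> g) Q"
    and R: "matrix_form G X \<rho> (range P) R"
  shows "matrix_form G X \<rho> (range Q) R"
proof -
  have inj: "inj_on (blinfun_apply B) (range A)" if A: "is_proj A" and near: "norm (A - B) < 1" for A B :: "'h \<Rightarrow>\<^sub>L 'h"
  proof (rule inj_onI)
    fix x y assume xy: "x \<in> range A" "y \<in> range A" "B x = B y"
    let ?u = "x - y"
    have "A ?u = ?u" using xy is_proj_range(1)[OF A] by (auto simp: bl)
    then have "?u = (A - B) ?u" using xy by (simp add: bl)
    then have "norm ?u \<le> norm (A - B) * norm ?u" using norm_blinfun[of "A - B" ?u] by simp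
    then have "(1 - norm (A - B)) * norm ?u \<le> 0" by (simp add: algebra_simps)
    then have "norm ?u = 0" using near by (simp add: mult_le_0_iff)
    then show "x = y" by simp
  qed
  have near': "norm (Q - P) < 1" using near by (simp add: norm_minus_commute)
  have "blinfun_apply Q ` range P = range Q"
    using inj[OF P(1) near] inj[OF Q near']
    by (intro dim_squeeze[OF is_proj_range(3)[OF P(1)] P(2) is_proj_range(3)[OF Q], of _ P id])
      (auto intro: linear_blinfun linear_id)
  moreover have "matrix_form G X \<rho> (blinfun_apply Q ` range P) R"
    using commD[OF \<rho>] by (intro matrix_form_image[OF R _ inj[OF P(1) near]]) auto
  ultimately show ?thesis by simp
qed

text \<open>Projections at nearby parameters are at distance below 1, so the isomorphism class of
  the range is locally constant; \<open>Bolzano\<close> propagates it along the interval.\<close>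

lemma matrix_form_projection_path:
  fixes P :: "real \<Rightarrow> 'h::{real_inner, complete_space} \<Rightarrow>\<^sub>L 'h"
  assumes le: "a \<le> b" and cont: "continuous_on {a..b} P"
    and P: "\<And>s. s \<in> {a..b} \<Longrightarrow> is_proj (P s)" "\<And>s. s \<in> {a..b} \<Longrightarrow> finite_dim (range (P s))"
      "\<And>s g. s \<in> {a..b} \<Longrightarrow> g \<in> carrier G \<Longrightarrow> comm (\<rho> g) (P s)"
    and R: "matrix_form G X \<rho> (range (P a)) R"
  shows "matrix_form G X \<rho> (range (P b)) R"
proof -
  define Q where "Q x y \<longleftrightarrow> (a \<le> x \<and> x \<le> y \<and> y \<le> b \<longrightarrow>
    (matrix_form G X \<rho> (range (P x)) R \<longrightarrow> matrix_form G X \<rho> (range (P y)) R))" for x y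
  have "Q a b"
  proof (rule Bolzano[OF le, of Q])
    fix x assume x: "a \<le> x" "x \<le> b"
    have "x \<in> {a..b}" "(0::real) < 1 / 2" using x by auto
    then obtain d where d: "d > 0" "\<And>y. y \<in> {a..b} \<Longrightarrow> dist y x < d \<Longrightarrow> dist (P y) (P x) < 1 / 2"
      using cont unfolding continuous_on_iff by metis
    have "Q y z" if yz: "y \<le> x" "x \<le> z" "z - y < d" for y z
      unfolding Q_def
    proof (intro impI)
      assume *: "a \<le> y \<and> y \<le> z \<and> z \<le> b" and R: "matrix_form G X \<rho> (range (P y)) R"
      have yz': "y \<in> {a..b}" "z \<in> {a..b}" using * by auto
      have "dist (P y) (P z) < 1"
        using d(2)[OF yz'(1)] d(2)[OF yz'(2)] yz dist_triangle2[of "P y" "P z" "P x"]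
        by (auto simp: dist_real_def)
      then show "matrix_form G X \<rho> (range (P z)) R"
        using P yz' by (intro matrix_form_near_projection[OF _ _ _ _ _ R]) (auto simp: dist_norm)
    qed
    then show "\<exists>d>0. \<forall>y z. y \<le> x \<and> x \<le> z \<and> z - y < d \<longrightarrow> Q y z" using d(1) by blast
  qed (auto simp: Q_def)
  then show ?thesis using R le by (auto simp: Q_def)
qed

section \<open>Operators on a Hilbert representation\<close>

lemma restr_op_eq:
  fixes T :: "'h::{real_inner, complete_space} \<Rightarrow>\<^sub>L 'h"
  assumes K: "subspace K" "closed K" and T: "\<And>u. u \<in> K \<Longrightarrow> T u \<in> K"
  shows "restr_op K T = T o\<^sub>L proj K"
  unfolding restr_op_def
proof (rule the_equality)
  have P: "is_proj (proj K)" by (rule is_proj_proj[OF K])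
  have o: "T o\<^sub>L proj K \<in> ops K"
    using T proj_in[OF K] by (intro opsI[OF K]) (auto simp: is_projD(2)[OF P])
  then show "T o\<^sub>L proj K \<in> ops K \<and> (\<forall>u\<in>K. (T o\<^sub>L proj K) u = T u)"
    by (simp add: proj_ident[OF K])
  fix R assume "R \<in> ops K \<and> (\<forall>u\<in>K. blinfun_apply R u = T u)"
  then show "R = T o\<^sub>L proj K"
    by (intro ops_eqI[OF K _ o]) (auto simp: proj_ident[OF K])
qed

lemma restr_op_apply:
  fixes T :: "'h::{real_inner, complete_space} \<Rightarrow>\<^sub>L 'h"
  assumes "subspace K" "closed K" "\<And>u. u \<in> K \<Longrightarrow> T u \<in> K" "u \<in> K"
  shows "restr_op K T u = T u"
  using assms by (simp add: restr_op_eq[OF assms(1,2)] proj_ident)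

lemma restr_op_ops:
  fixes T :: "'h::{real_inner, complete_space} \<Rightarrow>\<^sub>L 'h"
  assumes "subspace K" "closed K" "\<And>u. u \<in> K \<Longrightarrow> T u \<in> K"
  shows "restr_op K T \<in> ops K"
proof -
  have "T o\<^sub>L proj K \<in> ops K"
    using assms(3) proj_in[OF assms(1,2)]
    by (intro opsI[OF assms(1,2)]) (auto simp: is_projD(2)[OF is_proj_proj[OF assms(1,2)]])
  then show ?thesis by (simp add: restr_op_eq[OF assms])
qed

lemma FS_I:
  assumes "subspace H" "closed H" "T \<in> ops H" "adj T T" "finite_dim {u \<in> H. T u = 0}" "closed (blinfun_apply T ` H)"
  shows "T \<in> FS H"
  using assms selfadjoint_adj by (auto simp: FS_def)

text \<open>Adding the identity on the orthogonal complement of \<open>H\<close> makes an operator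
  of \<open>ops H\<close> invertible on the whole type, where the congruence results live. The
  complement contributes the bound 1, hence \<open>min c 1\<close>.\<close>

lemma extension_invertible:
  fixes T :: "'h::{real_inner, complete_space} \<Rightarrow>\<^sub>L 'h"
  assumes H: "subspace H" "closed H" and T: "T \<in> ops H" "adj T T"
    and c: "c > 0" "\<And>u. u \<in> H \<Longrightarrow> c * norm u \<le> norm (T u)"
  obtains R where "inv_pair (T + (id_blinfun - proj H)) R"
proof -
  let ?B = "T + (id_blinfun - proj H)"
  have P: "is_proj (proj H)" by (rule is_proj_proj[OF H])
  have a: "adj ?B ?B" by (intro adj_intros T is_projD(1)[OF P])
  have m: "min c 1 > 0" using c by simp
  have "min c 1 * norm u \<le> norm (?B u)" for u
  proof -
    have e: "proj H (?B u) = T u" by (simp add: bl opsD[OF H T(1)] is_projD(2)[OF P])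
    have "?B u - T u = u - proj H u" by (simp add: bl)
    then have n: "(norm (?B u))\<^sup>2 = (norm (T u))\<^sup>2 + (norm (u - proj H u))\<^sup>2"
      using is_proj_pyth[OF P, of "?B u"] unfolding e by simp
    have "min c 1 * norm (proj H u) \<le> c * norm (proj H u)" by (intro mult_right_mono) auto
    also have "\<dots> \<le> norm (T u)" using c(2)[OF proj_in[OF H]] opsD(1)[OF H T(1)] by simp
    finally have "(min c 1 * norm (proj H u))\<^sup>2 \<le> (norm (T u))\<^sup>2"
      using m by (intro power_mono) auto
    moreover have "min c 1 * norm (u - proj H u) \<le> 1 * norm (u - proj H u)" by (intro mult_right_mono) auto
    then have "(min c 1 * norm (u - proj H u))\<^sup>2 \<le> (norm (u - proj H u))\<^sup>2"
      using m by (intro power_mono) auto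
    moreover have "(min c 1 * norm u)\<^sup>2 = (min c 1 * norm (proj H u))\<^sup>2 + (min c 1 * norm (u - proj H u))\<^sup>2"
      using is_proj_pyth[OF P, of u] by (simp only: power_mult_distrib distrib_left[symmetric])
    ultimately have "(min c 1 * norm u)\<^sup>2 \<le> (norm (?B u))\<^sup>2" using n by linarith
    then show ?thesis by (rule power2_le_imp_le) simp
  qed
  then show ?thesis using sa_bounded_below_invertible[OF a m] that by blast
qed

text \<open>The inverse of the extension commutes with \<open>proj H\<close>, so it preserves
  \<open>H\<close>; composed with \<open>proj H\<close> it is an inverse in
  \<open>ops H\<close>.\<close>

lemma GL_I:
  assumes H: "subspace H" "closed H" and T: "T \<in> ops H" "adj T T"
    and c: "c > 0" "\<And>u. u \<in> H \<Longrightarrow> c * norm u \<le> norm (T u)"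
  shows "T \<in> GL H"
proof -
  obtain R where R: "inv_pair (T + (id_blinfun - proj H)) R" using extension_invertible[OF H T c] by metis
  have P: "is_proj (proj H)" by (rule is_proj_proj[OF H])
  have "comm (proj H) (T + (id_blinfun - proj H))"
    by (intro comm_intros ops_comm[OF H T(1)] comm_refl)
  then have cR: "comm (proj H) R" using R by (rule comm_inverse)
  then have RH: "R u \<in> H" if "u \<in> H" for u
    using commD[OF cR, of u] proj_ident[OF H that] proj_in[OF H, of "R u"] by simp
  have o: "R o\<^sub>L proj H \<in> ops H"
    using RH proj_in[OF H] by (intro opsI[OF H]) (auto simp: is_projD(2)[OF P])
  have B: "(T + (id_blinfun - proj H)) u = T u" if "u \<in> H" for u
    using proj_ident[OF H that] by (simp add: bl)
  have "(R o\<^sub>L proj H) (T u) = u \<and> T ((R o\<^sub>L proj H) u) = u" if u: "u \<in> H" for u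
    using inv_pairD(2)[OF R, of u] inv_pairD(1)[OF R, of u] B[OF u] B[OF RH[OF u]]
    by (simp add: opsD[OF H T(1)] proj_ident[OF H u])
  then show ?thesis unfolding GL_def using T(1) o by blast
qed

lemma GL_bounded_below:
  fixes T :: "'h::{real_inner, complete_space} \<Rightarrow>\<^sub>L 'h"
  assumes "T \<in> GL H" obtains c where "c > 0" "\<And>u. u \<in> H \<Longrightarrow> c * norm u \<le> norm (T u)"
proof -
  obtain R :: "'h \<Rightarrow>\<^sub>L 'h" where R: "\<And>u. u \<in> H \<Longrightarrow> R (T u) = u" using assms by (auto simp: GL_def)
  define m where "m = norm R + 1"
  have m: "m > 0" by (simp add: m_def add_nonneg_pos)
  have *: "1 / m * norm u \<le> norm (T u)" if "u \<in> H" for u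
  proof -
    have "norm u \<le> norm R * norm (T u)" using norm_blinfun[of R "T u"] R[OF that] by simp
    also have "\<dots> \<le> m * norm (T u)" by (simp add: m_def algebra_simps)
    finally show ?thesis using m by (simp add: field_simps)
  qed
  show ?thesis by (rule that[of "1 / m"]) (use m * in auto)
qed

lemma FS_bounded_below:
  assumes H: "subspace H" "closed H" and T: "T \<in> ops H" "adj T T"
    and c: "c > 0" "\<And>u. u \<in> H \<Longrightarrow> c * norm u \<le> norm (T u)"
  shows "T \<in> FS H"
proof (rule FS_I[OF H T])
  have "u = 0" if "u \<in> H" "T u = 0" for u
    using c(2)[OF that(1)] that(2) c(1) by (simp add: mult_le_0_iff)
  then have "{u \<in> H. T u = 0} \<subseteq> span {}" by auto
  then show "finite_dim {u \<in> H. T u = 0}" unfolding finite_dim_def by blast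
  show "closed (blinfun_apply T ` H)" by (rule closed_range_bounded_below[OF c H])
qed

lemma finite_dim_Un:
  assumes "finite_dim V" "finite_dim W" shows "finite_dim (V \<union> W)"
proof -
  obtain B C where B: "finite B" "V \<subseteq> span B" and C: "finite C" "W \<subseteq> span C"
    using assms by (auto simp: finite_dim_def)
  have "V \<subseteq> span (B \<union> C)" "W \<subseteq> span (B \<union> C)"
    by (rule order_trans[OF B(2) span_mono], simp) (rule order_trans[OF C(2) span_mono], simp)
  then show ?thesis using B(1) C(1) unfolding finite_dim_def by (intro exI[of _ "B \<union> C"]) auto
qed

lemma finite_dim_Union:
  assumes "finite I" "\<And>i. i \<in> I \<Longrightarrow> finite_dim (V i)" shows "finite_dim (span (\<Union>i\<in>I. V i))"
proof -
  obtain B where B: "\<And>i. i \<in> I \<Longrightarrow> finite (B i) \<and> V i \<subseteq> span (B i)"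
    using assms(2) unfolding finite_dim_def by metis
  have "span (B i) \<subseteq> span (\<Union>i\<in>I. B i)" if "i \<in> I" for i using that by (intro span_mono) auto
  then have "span (\<Union>i\<in>I. V i) \<subseteq> span (\<Union>i\<in>I. B i)" using B by (intro span_minimal subspace_span) blast
  then show ?thesis using B assms(1) unfolding finite_dim_def by (intro exI[of _ "\<Union>i\<in>I. B i"]) auto
qed

section \<open>Equivariance as commutation, and congruence on a Hilbert representation\<close>

context
  fixes G :: "('g, 'm) monoid_scheme" and X :: "'g topology"
    and H :: "'h::{real_inner, complete_space} set" and \<rho> :: "'g \<Rightarrow> 'h \<Rightarrow>\<^sub>L 'h"
  assumes G: "group G" and top: "topspace X = carrier G" and HR: "hilbert_rep G X H \<rho>"
begin

text \<open>Commuting with \<open>proj H\<close> means respecting \<open>H\<close> and its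
  complement, so one set encodes both equivariance and living on \<open>H\<close>. It contains the
  adjoints of its elements, by \<open>symm_adj\<close>.\<close>

definition symm :: "('h \<Rightarrow>\<^sub>L 'h) set" where "symm = insert (proj H) (\<rho> ` carrier G)"

lemma HS: "subspace H" "closed H"
  using HR hilbertD by (auto simp: hilbert_rep_def)

lemma HH: "hilbert H"
  using HR by (simp add: hilbert_rep_def)

lemma PH: "is_proj (proj H)"
  by (rule is_proj_proj[OF HS])

lemma action: "orthogonal_action G X H \<rho>"
  using HR by (simp add: hilbert_rep_def)

lemma rho_ops: "g \<in> carrier G \<Longrightarrow> \<rho> g \<in> ops H"
  using action by (auto simp: orthogonal_action_def)

lemma rho_in: "g \<in> carrier G \<Longrightarrow> \<rho> g u \<in> H"
  using opsD(3)[OF HS rho_ops] .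

text \<open>On \<open>H\<close> the action is orthogonal, so the inverse group element gives the
  adjoint; off \<open>H\<close> both operators vanish. This keeps adjoints inside
  \<open>symm\<close>.\<close>

lemma rho_adj:
  assumes g: "g \<in> carrier G" shows "adj (\<rho> g) (\<rho> (inv\<^bsub>G\<^esub> g))"
  unfolding adj_def
proof (intro allI)
  fix u v
  have i: "inv\<^bsub>G\<^esub> g \<in> carrier G" using G g by (simp add: group.inv_closed)
  have on_H: "\<rho> g u \<bullet> v = u \<bullet> \<rho> (inv\<^bsub>G\<^esub> g) v" if "u \<in> H" "v \<in> H" for u v
  proof -
    have "\<rho> g (\<rho> (inv\<^bsub>G\<^esub> g) v) = \<rho> (g \<otimes>\<^bsub>G\<^esub> inv\<^bsub>G\<^esub> g) v"
      using action g i that by (auto simp: orthogonal_action_def)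
    also have "\<dots> = v" using action that G g by (simp add: group.r_inv orthogonal_action_def)
    finally show ?thesis
      using action g that rho_in[OF i, of v] unfolding orthogonal_action_def by metis
  qed
  have "\<rho> g u \<bullet> v = \<rho> g (proj H u) \<bullet> proj H v"
    using is_projD(3)[OF PH, of "\<rho> g u" v] opsD[OF HS rho_ops[OF g]] by simp
  also have "\<dots> = proj H u \<bullet> \<rho> (inv\<^bsub>G\<^esub> g) (proj H v)" by (intro on_H proj_in[OF HS])
  also have "\<dots> = u \<bullet> \<rho> (inv\<^bsub>G\<^esub> g) v"
    using is_projD(3)[OF PH, of u "\<rho> (inv\<^bsub>G\<^esub> g) v"] opsD[OF HS rho_ops[OF i]] by simp
  finally show "\<rho> g u \<bullet> v = u \<bullet> \<rho> (inv\<^bsub>G\<^esub> g) v" .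
qed

lemma symm_adj: "C \<in> symm \<Longrightarrow> \<exists>C'\<in>symm. adj C C'"
proof -
  assume "C \<in> symm"
  then consider "C = proj H" | g where "g \<in> carrier G" "C = \<rho> g" by (auto simp: symm_def)
  then show ?thesis
  proof cases
    case 1
    then show ?thesis using is_projD(1)[OF PH] by (auto simp: symm_def)
  next
    case 2
    then have "\<rho> (inv\<^bsub>G\<^esub> g) \<in> symm" using G by (simp add: symm_def group.inv_closed)
    then show ?thesis using rho_adj 2 by blast
  qed
qed

lemma symm_ops: "C \<in> symm \<Longrightarrow> C \<in> ops H"
  using rho_ops opsI[OF HS, of "proj H"] proj_in[OF HS] is_projD(2)[OF PH] by (auto simp: symm_def)

lemma commutes_rho: "commutes symm T \<Longrightarrow> g \<in> carrier G \<Longrightarrow> comm (\<rho> g) T"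
  by (simp add: commutes_def symm_def)

lemma commutes_proj_H: "commutes symm T \<Longrightarrow> comm (proj H) T"
  by (simp add: commutes_def symm_def)

lemma commutes_in: "commutes symm T \<Longrightarrow> u \<in> H \<Longrightarrow> T u \<in> H"
  using commD[OF commutes_proj_H, of T u] proj_in[OF HS, of "T u"] proj_ident[OF HS, of u] by simp

lemma symm_invariant: "C \<in> symm \<Longrightarrow> invariant G \<rho> V \<Longrightarrow> V \<subseteq> H \<Longrightarrow> u \<in> V \<Longrightarrow> C u \<in> V"
  using proj_ident[OF HS] by (auto simp: symm_def invariant_def)

lemma commutes_proj:
  assumes V: "subspace V" "closed V" "V \<subseteq> H" "invariant G \<rho> V" shows "commutes symm (proj V)"
proof (rule commutesI)
  fix C assume C: "C \<in> symm"
  obtain C' where C': "C' \<in> symm" "adj C C'" using symm_adj[OF C] by blast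
  show "comm C (proj V)"
    by (rule proj_comm[OF V(1,2) C'(2)]) (use symm_invariant C C' V in auto)
qed

lemma commutes_spectral_proj:
  assumes T: "T \<in> ops H" "adj T T" "commutes symm T" shows "commutes symm (spectral_proj H a b T)"
proof (rule commutesI)
  fix C assume C: "C \<in> symm"
  obtain C' where C': "C' \<in> symm" "adj C C'" using symm_adj[OF C] by blast
  show "comm C (spectral_proj H a b T)"
    using T C C' ops_comm[OF HS symm_ops[OF C]]
    by (intro spectral_proj_comm[OF HS T(1,2) C'(2)]) (auto intro: commutesD comm_sym)
qed

lemma invariant_range:
  assumes "commutes symm T" "invariant G \<rho> V" shows "invariant G \<rho> (blinfun_apply T ` V)"
  unfolding invariant_def
proof (intro ballI)
  fix g u assume g: "g \<in> carrier G" and "u \<in> blinfun_apply T ` V"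
  then obtain v where "v \<in> V" "u = T v" by blast
  then show "\<rho> g u \<in> blinfun_apply T ` V"
    using commD[OF commutes_rho[OF assms(1) g], of v] assms(2) g by (auto simp: invariant_def)
qed

lemma invariant_kernel:
  assumes "commutes symm T" "invariant G \<rho> V" shows "invariant G \<rho> {u \<in> V. T u = 0}"
  unfolding invariant_def
proof (intro ballI CollectI conjI)
  fix g u assume g: "g \<in> carrier G" and u: "u \<in> {u \<in> V. T u = 0}"
  then show "\<rho> g u \<in> V" using assms(2) by (auto simp: invariant_def)
  show "T (\<rho> g u) = 0" using commD[OF commutes_rho[OF assms(1) g], of u] u by (simp add: bl)
qed

lemma invariant_H: "invariant G \<rho> H"
  using rho_in by (auto simp: invariant_def)

lemma FS_G_iff: "T \<in> FS_G G H \<rho> \<longleftrightarrow> T \<in> FS H \<and> commutes symm T"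
proof
  assume T: "T \<in> FS_G G H \<rho>"
  then have To: "T \<in> ops H" using FS_D[OF HH] by (auto simp: FS_G_def)
  have "comm C T" if C: "C \<in> symm" for C
  proof (cases "C = proj H")
    case True then show ?thesis using ops_comm[OF HS To] by simp
  next
    case False
    then obtain g where g: "g \<in> carrier G" "C = \<rho> g" using C by (auto simp: symm_def)
    have e: "T (\<rho> g u) = \<rho> g (T u)" if "u \<in> H" for u using T g that by (simp add: FS_G_def)
    have "C (T u) = T (C u)" for u
      using e[OF proj_in[OF HS, of u]] opsD[OF HS To] opsD[OF HS rho_ops[OF g(1)]] g by simp
    then show ?thesis by (rule commI)
  qed
  then show "T \<in> FS H \<and> commutes symm T" using T by (auto simp: FS_G_def commutes_def)
next
  assume "T \<in> FS H \<and> commutes symm T"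
  then show "T \<in> FS_G G H \<rho>"
    unfolding FS_G_def using commD[OF commutes_rho] by auto
qed

lemma FS_G_D:
  assumes "T \<in> FS_G G H \<rho>" shows "T \<in> ops H" "adj T T" "commutes symm T" "T \<in> FS H"
  using assms FS_D[OF HH] by (auto simp: FS_G_iff)

lemma transporter_in: "transporter symm S S' \<Longrightarrow> u \<in> H \<Longrightarrow> S u \<in> H"
  using commutes_in by (auto simp: transporter_def)

lemma transporter_congruence_ops:
  assumes T: "T \<in> ops H" "adj T T" "commutes symm T" and S: "transporter symm S S'"
  shows "S' o\<^sub>L T o\<^sub>L S \<in> ops H" "adj (S' o\<^sub>L T o\<^sub>L S) (S' o\<^sub>L T o\<^sub>L S)" "commutes symm (S' o\<^sub>L T o\<^sub>L S)"
proof -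
  have aS: "adj S S'" and cS: "commutes symm S" "commutes symm S'" using S by (auto simp: transporter_def)
  have "S (proj H u) = proj H (S u)" for u using commD[OF commutes_proj_H[OF cS(1)], of u] by simp
  then show "S' o\<^sub>L T o\<^sub>L S \<in> ops H"
    using commutes_in[OF cS(2)] opsD[OF HS T(1)] by (intro opsI[OF HS]) auto
  have "adj (S' o\<^sub>L T o\<^sub>L S) (S' o\<^sub>L (T o\<^sub>L S))" by (intro adj_intros aS adj_sym[OF aS] T)
  moreover have "S' o\<^sub>L (T o\<^sub>L S) = S' o\<^sub>L T o\<^sub>L S" by (rule blinfun_eqI) simp
  ultimately show "adj (S' o\<^sub>L T o\<^sub>L S) (S' o\<^sub>L T o\<^sub>L S)" by simp
  show "commutes symm (S' o\<^sub>L T o\<^sub>L S)" by (intro commutes_intros cS T)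
qed

text \<open>Undoes the extension by the identity of the complement: a transporter commutes with
  \<open>proj H\<close>, so the added summand is cancelled by the final projection.\<close>

lemma transporter_extension:
  assumes T: "T \<in> ops H" and S: "transporter symm S S'"
  shows "(S' o\<^sub>L (T + (id_blinfun - proj H)) o\<^sub>L S) o\<^sub>L proj H = S' o\<^sub>L T o\<^sub>L S"
proof (rule blinfun_eqI)
  fix u
  have "S (proj H u) = proj H (S u)"
    using S commD[OF commutes_proj_H, of S u] by (auto simp: transporter_def)
  then show "((S' o\<^sub>L (T + (id_blinfun - proj H)) o\<^sub>L S) o\<^sub>L proj H) u = (S' o\<^sub>L T o\<^sub>L S) u"
    by (simp add: bl opsD[OF HS T] is_projD(2)[OF PH])
qed

lemma transporter_bounded_below:
  assumes S: "transporter symm S S'"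
  obtains c where "c > 0" "\<And>v. c * norm v \<le> norm (S v)" "\<And>v. c * norm v \<le> norm (S' v)"
proof -
  obtain R where R: "inv_pair S R" and aS: "adj S S'" using S by (auto simp: transporter_def)
  define m where "m = norm R + 1"
  have m: "m > 0" "norm R \<le> m" by (auto simp: m_def add_nonneg_pos)
  have 1: "norm v \<le> m * norm (S v)" for v
  proof -
    have "norm v \<le> norm R * norm (S v)" using norm_blinfun[of R "S v"] inv_pairD(2)[OF R] by simp
    also have "\<dots> \<le> m * norm (S v)" using m by (intro mult_right_mono) auto
    finally show ?thesis .
  qed
  have 2: "norm v \<le> m * norm (S' v)" for v
  proof -
    have "norm v \<le> norm R * norm (S' v)" by (rule adj_invertible_bounded_below[OF aS R])
    also have "\<dots> \<le> m * norm (S' v)" using m by (intro mult_right_mono) auto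
    finally show ?thesis .
  qed
  show ?thesis
    by (rule that[of "1 / m"]) (use m 1 2 in \<open>auto simp: field_simps\<close>)
qed

lemma transporter_image_H:
  assumes S: "transporter symm S S'" shows "blinfun_apply S ` H = H"
proof -
  obtain R where R: "inv_pair S R" and cS: "commutes symm S" using S by (auto simp: transporter_def)
  have "commutes symm R" using cS R by (auto simp: commutes_def intro: comm_inverse)
  then have "u \<in> blinfun_apply S ` H" if "u \<in> H" for u
    using commutes_in[of R u] that inv_pairD(1)[OF R, of u] by (metis imageI)
  then show ?thesis using transporter_in[OF S] by blast
qed

text \<open>\<open>S\<close> maps the kernel of the congruence injectively into that of
  \<open>T\<close>. It also maps \<open>H\<close> onto \<open>H\<close>, so the range is the image
  of the closed range of \<open>T\<close> under \<open>S'\<close>, which is bounded below.\<close>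

lemma FS_G_congruence:
  assumes T: "T \<in> FS_G G H \<rho>" and S: "transporter symm S S'"
  shows "S' o\<^sub>L T o\<^sub>L S \<in> FS_G G H \<rho>"
proof -
  note Td = FS_G_D[OF T] and C = transporter_congruence_ops[OF FS_G_D(1-3)[OF T] S]
  obtain c where c: "c > 0" "\<And>v. c * norm v \<le> norm (S v)" "\<And>v. c * norm v \<le> norm (S' v)"
    using transporter_bounded_below[OF S] by metis
  have S0: "v = 0" if "S v = 0" for v using c(2)[of v] c(1) that by (simp add: mult_le_0_iff)
  have S'0: "v = 0" if "S' v = 0" for v using c(3)[of v] c(1) that by (simp add: mult_le_0_iff)
  have "S' o\<^sub>L T o\<^sub>L S \<in> FS H"
  proof (rule FS_I[OF HS C(1,2)])
    let ?K = "{u \<in> H. (S' o\<^sub>L T o\<^sub>L S) u = 0}"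
    have "?K = H \<inter> {u. (S' o\<^sub>L T o\<^sub>L S) u = 0}" by auto
    then have K: "subspace ?K" using subspace_inter[OF HS(1) subspace_kernel] by metis
    have "inj_on (blinfun_apply S) ?K"
    proof (rule inj_onI)
      fix x y assume "S x = S y"
      then have "S (x - y) = 0" by (simp add: bl)
      then show "x = y" using S0 by fastforce
    qed
    moreover have "blinfun_apply S ` ?K \<subseteq> {u \<in> H. T u = 0}"
      using transporter_in[OF S] S'0 by auto
    then have "finite_dim (blinfun_apply S ` ?K)" using FS_D(3)[OF HH Td(4)] by (rule finite_dim_subset[rotated])
    ultimately show "finite_dim ?K" by (intro finite_dim_inj[OF linear_blinfun K])
    have "blinfun_apply (S' o\<^sub>L T o\<^sub>L S) ` H = blinfun_apply S' ` (blinfun_apply T ` (blinfun_apply S ` H))"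
      by (simp add: image_image)
    also have "\<dots> = blinfun_apply S' ` (blinfun_apply T ` H)" unfolding transporter_image_H[OF S] ..
    also have "closed \<dots>"
      by (rule closed_range_bounded_below[OF c(1) c(3) subspace_range[OF HS(1)] FS_D(4)[OF HH Td(4)]])
    finally show "closed (blinfun_apply (S' o\<^sub>L T o\<^sub>L S) ` H)" .
  qed
  then show ?thesis using C(3) by (simp add: FS_G_iff)
qed

lemma GL_congruence:
  assumes T: "T \<in> FS_G G H \<rho>" "T \<in> GL H" and S: "transporter symm S S'"
  shows "S' o\<^sub>L T o\<^sub>L S \<in> GL H"
proof -
  obtain c where c: "c > 0" "\<And>v. c * norm v \<le> norm (S v)" "\<And>v. c * norm v \<le> norm (S' v)"
    using transporter_bounded_below[OF S] by metis
  obtain d where d: "d > 0" "\<And>u. u \<in> H \<Longrightarrow> d * norm u \<le> norm (T u)" using GL_bounded_below[OF T(2)] by metis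
  show ?thesis
  proof (rule GL_I[OF HS transporter_congruence_ops(1,2)[OF FS_G_D(1-3)[OF T(1)] S]])
    show "c * d * c > 0" using c d by simp
    fix u assume u: "u \<in> H"
    have "c * d * c * norm u = c * (d * (c * norm u))" by simp
    also have "\<dots> \<le> c * (d * norm (S u))" using c d by (intro mult_left_mono) auto
    also have "\<dots> \<le> c * norm (T (S u))" using c d transporter_in[OF S u] by (intro mult_left_mono) auto
    also have "\<dots> \<le> norm (S' (T (S u)))" by (rule c(3))
    finally show "c * d * c * norm u \<le> norm ((S' o\<^sub>L T o\<^sub>L S) u)" by simp
  qed
qed

text \<open>Both parts of \<open>u\<close> obey the same bound: on the range of the projection the
  shift leaves at least \<open>2 * a - a\<close>, and on its kernel \<open>T\<close> itself gives at
  least \<open>a\<close>. The two parts and their images are orthogonal.\<close>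

lemma spectral_shift_bounded_below:
  assumes T: "T \<in> ops H" "adj T T" and a: "a > 0" and u: "u \<in> H"
  shows "a * norm u \<le> norm ((T + (2 * a) *\<^sub>R spectral_proj H (- a) a T) u)"
proof -
  let ?P = "spectral_proj H (- a) a T" and ?B = "T + (2 * a) *\<^sub>R spectral_proj H (- a) a T"
  have P: "is_proj ?P" using a by (intro is_proj_spectral_proj[OF HS T]) auto
  have PT: "?P (T v) = T (?P v)" for v by (rule commD[OF spectral_proj_comm_self[OF HS T]])
  have PuH: "?P u \<in> H" using opsD(3)[OF HS spectral_proj_ops[OF HS T]] .
  define v where "v = u - ?P u"
  have v: "?P v = 0" "v \<in> H" using u PuH HS(1) by (auto simp: v_def bl is_projD(2)[OF P] subspace_diff)
  have e: "?P (?B u) = T (?P u) + (2 * a) *\<^sub>R ?P u" by (simp add: bl PT is_projD(2)[OF P])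
  have e': "?B u - ?P (?B u) = T v" unfolding e by (simp add: v_def bl)
  have "norm ((2 * a) *\<^sub>R ?P u) \<le> norm (T (?P u) + (2 * a) *\<^sub>R ?P u) + norm (T (?P u))"
    using norm_triangle_ineq4[of "T (?P u) + (2 * a) *\<^sub>R ?P u" "T (?P u)"] by simp
  moreover have "norm (T (?P u)) \<le> a * norm (?P u)"
    using a by (intro spectral_proj_norm_range[OF HS T] is_projD(2)[OF P]) auto
  ultimately have "a * norm (?P u) \<le> norm (?P (?B u))" unfolding e using a by simp
  then have "(a * norm (?P u))\<^sup>2 \<le> (norm (?P (?B u)))\<^sup>2" using a by (intro power_mono) auto
  moreover have "a * norm v \<le> norm (T v)" using a v by (intro spectral_proj_norm_kernel[OF HS T]) auto
  then have "(a * norm v)\<^sup>2 \<le> (norm (T v))\<^sup>2" using a by (intro power_mono) auto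
  moreover have "(norm (?B u))\<^sup>2 = (norm (?P (?B u)))\<^sup>2 + (norm (T v))\<^sup>2"
    using is_proj_pyth[OF P, of "?B u"] unfolding e' .
  moreover have "(a * norm u)\<^sup>2 = (a * norm (?P u))\<^sup>2 + (a * norm v)\<^sup>2"
    using is_proj_pyth[OF P, of u] by (simp only: power_mult_distrib distrib_left[symmetric] v_def)
  ultimately have "(a * norm u)\<^sup>2 \<le> (norm (?B u))\<^sup>2" by linarith
  then show ?thesis by (rule power2_le_imp_le) simp
qed

text \<open>The path joins \<open>J = sgn T\<close> to \<open>T\<close>; pairing with \<open>J u\<close> bounds its operators from below.\<close>

lemma sign_transporter:
  assumes T: "T \<in> FS_G G H \<rho>" "T \<in> GL H"
  obtains J S S' where "J \<in> ops H" "adj J J" "commutes symm J" "J o\<^sub>L J = proj H"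
    "continuous_on {0..1::real} S" "S 0 = id_blinfun" "S' 0 = id_blinfun"
    "\<And>s. s \<in> {0..1} \<Longrightarrow> transporter symm (S s) (S' s)" "S' 1 o\<^sub>L T o\<^sub>L S 1 = J"
proof -
  note Td = FS_G_D[OF T(1)]
  let ?E = "sle T 0"
  have cE: "commutes symm ?E"
  proof (rule commutesI)
    fix C assume C: "C \<in> symm"
    obtain C' where C': "C' \<in> symm" "adj C C'" using symm_adj[OF C] by blast
    show "comm C ?E" by (rule comm_sle[OF Td(2) C'(2)]) (use Td C C' in \<open>auto intro: commutesD\<close>)
  qed
  have E: "is_proj ?E" by (rule is_proj_sle)
  have cP: "commutes symm (proj H)"
    using commutes_proj[OF HS order_refl invariant_H] .
  \<comment> \<open>The sign of \<open>T\<close> on \<open>H\<close>: \<open>-1\<close> on the range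
    of the spectral projection for the levels at most 0 and \<open>1\<close> on its complement in
    \<open>H\<close>.\<close>
  define J where "J = proj H - 2 *\<^sub>R (?E o\<^sub>L proj H)"
  have EP: "?E (proj H u) = proj H (?E u)" for u using commD[OF commutes_proj_H[OF cE], of u] by simp
  have Jo: "J \<in> ops H"
    using proj_in[OF HS] HS(1)
    by (intro opsI[OF HS]) (auto simp: J_def bl is_projD(2)[OF PH] EP intro!: subspace_diff subspace_scale)
  have "adj (?E o\<^sub>L proj H) (proj H o\<^sub>L ?E)" by (intro adj_intros is_projD(1) E PH)
  moreover have "proj H o\<^sub>L ?E = ?E o\<^sub>L proj H" by (rule blinfun_eqI) (simp add: EP)
  ultimately have "adj (?E o\<^sub>L proj H) (?E o\<^sub>L proj H)" by simp
  then have Ja: "adj J J" unfolding J_def by (intro adj_diff adj_scaleR is_projD(1)[OF PH])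
  have Jc: "commutes symm J" unfolding J_def by (intro commutes_intros cE cP)
  have JJ: "J o\<^sub>L J = proj H"
    by (rule blinfun_eqI) (simp add: J_def bl EP is_projD(2)[OF PH] is_projD(2)[OF E] scaleR_2)
  define B where "B s = ((1 - s) *\<^sub>R J + s *\<^sub>R T) + (id_blinfun - proj H)" for s
  have Bo: "(1 - s) *\<^sub>R J + s *\<^sub>R T \<in> ops H" for s
    using opsD[OF HS Jo] opsD[OF HS Td(1)] HS(1)
    by (intro opsI[OF HS]) (auto simp: bl intro!: subspace_add subspace_scale)
  have Ba: "adj ((1 - s) *\<^sub>R J + s *\<^sub>R T) ((1 - s) *\<^sub>R J + s *\<^sub>R T)" for s by (intro adj_intros Ja Td)
  have inv: "\<exists>R. inv_pair (B s) R" if s: "s \<in> {0..1}" for s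
  \<comment> \<open>Pairing with \<open>J u\<close> yields the lower bound \<open>1 - s\<close>,
    which is lost at \<open>s = 1\<close>; there the invertibility of \<open>T\<close> is
    used.\<close>
  proof (cases "s = 1")
    case True
    obtain c where "c > 0" "\<And>u. u \<in> H \<Longrightarrow> c * norm u \<le> norm (T u)" using GL_bounded_below[OF T(2)] by metis
    then show ?thesis using extension_invertible[OF HS Td(1,2)] True unfolding B_def by fastforce
  next
    case False
    have c: "1 - s > 0" using False s by simp
    have "(1 - s) * norm u \<le> norm (((1 - s) *\<^sub>R J + s *\<^sub>R T) u)" if u: "u \<in> H" for u
    proof -
      define e where "e = ?E u"
      define f where "f = u - e"
      have Ju: "J u = f - e"
        using u by (simp add: J_def bl proj_ident[OF HS] e_def f_def scaleR_2)
      have ef: "?E e = e" "?E f = 0" by (simp_all add: e_def f_def bl is_projD(2)[OF E])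
      have "T e \<bullet> f = ?E (T e) \<bullet> f" using commD[OF comm_sle_self[OF Td(2)], of 0 e] ef by simp
      also have "\<dots> = 0" using ef by (simp add: is_projD(3)[OF E])
      finally have Tef: "T e \<bullet> f = 0" .
      then have Tfe: "T f \<bullet> e = 0" using adjD[OF Td(2), of f e] by (simp add: inner_commute)
      \<comment> \<open>The signs of \<open>J\<close> let both spectral halves contribute
        nonnegatively.\<close>
      have "T u \<bullet> J u = T f \<bullet> f - T e \<bullet> e"
        using Tef Tfe unfolding Ju by (simp add: f_def bl inner_simps)
      then have pos: "T u \<bullet> J u \<ge> 0" using sle_range[OF Td(2) ef(1)] sle_kernel_le[OF Td(2) ef(2)] by simp
      have "J u \<bullet> J u = u \<bullet> J (J u)" by (rule adjD[OF Ja])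
      also have "J (J u) = proj H u" using JJ by (metis blinfun_apply_blinfun_compose)
      finally have nJ: "J u \<bullet> J u = u \<bullet> u" using u by (simp add: proj_ident[OF HS])
      then have nJ': "norm (J u) = norm u" by (simp add: norm_eq_sqrt_inner)
      have "(1 - s) * (u \<bullet> u) \<le> ((1 - s) *\<^sub>R J + s *\<^sub>R T) u \<bullet> J u"
        using pos s by (simp add: bl inner_simps nJ)
      also have "\<dots> \<le> norm (((1 - s) *\<^sub>R J + s *\<^sub>R T) u) * norm u"
        using norm_cauchy_schwarz[of "((1 - s) *\<^sub>R J + s *\<^sub>R T) u" "J u"] unfolding nJ' .
      finally have "norm u * ((1 - s) * norm u) \<le> norm u * norm (((1 - s) *\<^sub>R J + s *\<^sub>R T) u)"
        by (simp add: power2_norm_eq_inner[symmetric] power2_eq_square mult_ac)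
      then show ?thesis by (cases "u = 0") auto
    qed
    then show ?thesis unfolding B_def using extension_invertible[OF HS Bo Ba c] by metis
  qed
  have contB: "continuous_on {0..1} B" unfolding B_def by (intro continuous_intros)
  have "adj (B s) (B s)" "commutes symm (B s)" for s
    unfolding B_def by (intro adj_intros Ba is_projD(1)[OF PH], intro commutes_intros Jc Td cP)
  then obtain S S' where S: "continuous_on {0..1} S" "S 0 = id_blinfun" "S' 0 = id_blinfun"
    "\<And>s. s \<in> {0..1} \<Longrightarrow> transporter symm (S s) (S' s)" "\<And>s. s \<in> {0..1} \<Longrightarrow> S' s o\<^sub>L B s o\<^sub>L S s = B 0"
    using congruence_path[OF zero_le_one contB] inv by metis
  have "S' 1 o\<^sub>L T o\<^sub>L S 1 = (S' 1 o\<^sub>L B 1 o\<^sub>L S 1) o\<^sub>L proj H"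
    using transporter_extension[OF Td(1) S(4)[of 1]] by (simp add: B_def)
  also have "\<dots> = B 0 o\<^sub>L proj H" using S(5)[of 1] by simp
  also have "\<dots> = J" by (rule blinfun_eqI) (simp add: B_def bl opsD[OF HS Jo] is_projD(2)[OF PH])
  finally show ?thesis using that[OF Jo Ja Jc JJ S(1-4)] by blast
qed

text \<open>The span of the ranges of all \<open>A\<close> and \<open>J o\<^sub>L A\<close>:
  commutation makes it invariant under the group, and \<open>J (J u) = u\<close> on \<open>H\<close>
  makes it stable under \<open>J\<close>.\<close>

lemma invariant_hull:
  assumes "finite \<A>" and \<A>: "\<And>A. A \<in> \<A> \<Longrightarrow> A \<in> ops H \<and> commutes symm A \<and> finite_dim (range (blinfun_apply A))"
    and J: "J \<in> ops H" "commutes symm J" "J o\<^sub>L J = proj H"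
  obtains F where "subspace F" "finite_dim F" "F \<subseteq> H" "invariant G \<rho> F" "\<And>u. u \<in> F \<Longrightarrow> J u \<in> F"
    "\<And>A u. A \<in> \<A> \<Longrightarrow> A u \<in> F"
proof -
  define V where "V A = range (blinfun_apply A) \<union> range (blinfun_apply (J o\<^sub>L A))" for A :: "'h \<Rightarrow>\<^sub>L 'h"
  define U where "U = (\<Union>A\<in>\<A>. V A)"
  have AH: "A u \<in> H" if "A \<in> \<A>" for A u using \<A>[OF that] opsD(3)[OF HS] by blast
  have JJ: "J (J u) = proj H u" for u using J(3) by (metis blinfun_apply_blinfun_compose)
  have "finite_dim (V A)" if A: "A \<in> \<A>" for A
  proof -
    have "range (blinfun_apply (J o\<^sub>L A)) = J ` range (blinfun_apply A)" by (simp add: image_image)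
    then show ?thesis using \<A>[OF A] unfolding V_def by (intro finite_dim_Un) (auto intro: finite_dim_image)
  qed
  then have fin: "finite_dim (span U)" unfolding U_def by (intro finite_dim_Union assms(1))
  have stable: "C u \<in> span U" if C: "\<And>v. v \<in> U \<Longrightarrow> C v \<in> U" and u: "u \<in> span U" for C :: "'h \<Rightarrow>\<^sub>L 'h" and u
  proof -
    have "C ` span U = span (C ` U)" using linear_span_image[OF linear_blinfun, of C U] by simp
    also have "\<dots> \<subseteq> span U" using C by (intro span_mono) auto
    finally show ?thesis using u by blast
  qed
  show ?thesis
  proof (rule that[of "span U"])
    show "span U \<subseteq> H"
      using AH opsD(3)[OF HS J(1)] HS(1) by (intro span_minimal) (auto simp: U_def V_def)
    show "invariant G \<rho> (span U)"
      unfolding invariant_def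
    proof (intro ballI)
      fix g u assume g: "g \<in> carrier G" and u: "u \<in> span U"
      show "\<rho> g u \<in> span U"
      proof (rule stable[OF _ u])
        fix v assume "v \<in> U"
        then obtain A w where A: "A \<in> \<A>" "v = A w \<or> v = J (A w)" by (auto simp: U_def V_def)
        have "\<rho> g (A w) = A (\<rho> g w)" using \<A>[OF A(1)] g by (intro commD commutes_rho) auto
        moreover have "\<rho> g (J (A w)) = J (\<rho> g (A w))" using g J by (intro commD commutes_rho) auto
        ultimately have "\<rho> g v = A (\<rho> g w) \<or> \<rho> g v = (J o\<^sub>L A) (\<rho> g w)" using A(2) by auto
        then show "\<rho> g v \<in> U" using A(1) by (auto simp: U_def V_def)
      qed
    qed
    show "J u \<in> span U" if "u \<in> span U" for u
    proof (rule stable[OF _ that])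
      fix v assume "v \<in> U"
      then obtain A w where A: "A \<in> \<A>" "v = A w \<or> v = J (A w)" by (auto simp: U_def V_def)
      have "J (J (A w)) = A w" using JJ proj_ident[OF HS AH[OF A(1)]] by simp
      then have "J v = (J o\<^sub>L A) w \<or> J v = A w" using A(2) by auto
      then show "J v \<in> U" using A(1) by (auto simp: U_def V_def)
    qed
    show "A u \<in> span U" if "A \<in> \<A>" for A u using that by (intro span_base) (auto simp: U_def V_def)
  qed (use fin in auto)
qed

text \<open>Choose \<open>F\<close> stable under \<open>J\<close> and containing the range of
  \<open>K\<close>. On the complement of \<open>F\<close> in \<open>H\<close> the operator is
  \<open>J\<close>, its own inverse there. So the kernel lies in \<open>F\<close>, and a vector of
  \<open>H\<close> is in the range exactly when its projection to \<open>F\<close> lies in the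
  finite-dimensional image of \<open>F\<close>.\<close>

lemma finite_rank_FS_G:
  assumes J: "J \<in> ops H" "adj J J" "commutes symm J" "J o\<^sub>L J = proj H"
    and K: "K \<in> ops H" "adj K K" "commutes symm K" "finite_dim (range (blinfun_apply K))"
  shows "J + K \<in> FS_G G H \<rho>"
proof -
  obtain F where F: "subspace F" "finite_dim F" "F \<subseteq> H" "\<And>u. u \<in> F \<Longrightarrow> J u \<in> F" "\<And>u. K u \<in> F"
    using invariant_hull[of "{K}" J] J K by (metis finite.intros singletonD singletonI)
  have Fc: "closed F" by (rule finite_dim_closed[OF F(1,2)])
  let ?Q = "proj F"
  have Q: "is_proj ?Q" by (rule is_proj_proj[OF F(1) Fc])
  have JJ: "J (J u) = proj H u" for u using J(4) by (metis blinfun_apply_blinfun_compose)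
  have JQ: "J (?Q u) = ?Q (J u)" for u
    using F(4) by (intro commD proj_comm[OF F(1) Fc J(2)])
  have QK: "?Q (K u) = K u" for u by (rule proj_ident[OF F(1) Fc F(5)])
  then have "?Q o\<^sub>L K = K" by (auto intro: blinfun_eqI)
  moreover have "adj (?Q o\<^sub>L K) (K o\<^sub>L ?Q)" by (intro adj_intros K is_projD(1)[OF Q])
  ultimately have "K o\<^sub>L ?Q = K" using K(2) adj_unique by metis
  then have KQ: "K (?Q u) = K u" for u by (metis blinfun_apply_blinfun_compose)
  let ?T = "J + K"
  have To: "?T \<in> ops H"
    using opsD[OF HS J(1)] opsD[OF HS K(1)] HS(1) by (intro opsI[OF HS]) (auto simp: bl subspace_add)
  have Ta: "adj ?T ?T" by (intro adj_intros J K)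
  have "?T \<in> FS H"
  proof (rule FS_I[OF HS To Ta])
    have "u \<in> F" if "u \<in> H" "?T u = 0" for u
    proof -
      have "J u = - K u" using that(2) by (simp add: bl eq_neg_iff_add_eq_0)
      then have "J u \<in> F" using F(1,5) by (simp add: subspace_neg)
      then have "J (J u) \<in> F" by (rule F(4))
      then show ?thesis using JJ proj_ident[OF HS that(1)] by simp
    qed
    then show "finite_dim {u \<in> H. ?T u = 0}" by (intro finite_dim_subset[OF F(2)]) auto
    have TF: "blinfun_apply ?T ` F \<subseteq> F" using F(1,4,5) by (auto simp: bl subspace_add)
    have TFc: "closed (blinfun_apply ?T ` F)"
      by (rule finite_dim_closed[OF subspace_range[OF F(1)] finite_dim_image[OF linear_blinfun F(2)]])
    have "blinfun_apply ?T ` H = {y \<in> H. ?Q y \<in> blinfun_apply ?T ` F}"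
    proof (intro equalityI subsetI)
      fix y assume "y \<in> blinfun_apply ?T ` H"
      then obtain u where u: "u \<in> H" "y = ?T u" by blast
      have "?Q y = ?T (?Q u)" by (simp add: u(2) bl JQ QK KQ)
      then show "y \<in> {y \<in> H. ?Q y \<in> blinfun_apply ?T ` F}"
        using u opsD(3)[OF HS To] proj_in[OF F(1) Fc] by blast
    next
      fix y assume y: "y \<in> {y \<in> H. ?Q y \<in> blinfun_apply ?T ` F}"
      then obtain f where f: "f \<in> F" "?Q y = ?T f" by blast
      \<comment> \<open>\<open>J\<close> inverts itself on the complement, and \<open>K\<close> does
        not see this vector because its projection to \<open>F\<close> is 0.\<close>
      let ?w = "J (y - ?Q y)"
      have "K ?w = K (?Q ?w)" by (simp add: KQ)
      also have "?Q ?w = 0" by (simp add: JQ[symmetric] bl is_projD(2)[OF Q])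
      finally have Kw: "K ?w = 0" by (simp add: bl)
      have "y - ?Q y \<in> H" using y F(3) proj_in[OF F(1) Fc, of y] HS(1) by (auto intro: subspace_diff)
      then have Jw: "J ?w = y - ?Q y" using JJ proj_ident[OF HS] by simp
      have "?T (f + ?w) = ?T f + (J ?w + K ?w)" by (simp only: blinfun.add_right blinfun.add_left)
      also have "\<dots> = y" using f(2) Kw Jw by simp
      finally have "?T (f + ?w) = y" .
      moreover have "f + ?w \<in> H" using f(1) F(3) opsD(3)[OF HS J(1)] HS(1) by (auto intro: subspace_add)
      ultimately show "y \<in> blinfun_apply ?T ` H" by (metis imageI)
    qed
    also have "\<dots> = H \<inter> blinfun_apply ?Q -` (blinfun_apply ?T ` F)" by auto
    also have "closed \<dots>"
      using HS(2) TFc by (intro closed_Int continuous_closed_vimage) (auto intro: continuous_intros)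
    finally show "closed (blinfun_apply ?T ` H)" .
  qed
  then show ?thesis using commutes_intros(1)[OF J(3) K(3)] by (simp add: FS_G_iff)
qed

section \<open>Inertia under congruence and the class of one piece\<close>

lemma spectral_space_range:
  assumes "T \<in> ops H" "adj T T"
  shows "spectral_space H T a b = range (blinfun_apply (spectral_proj H a b T))"
proof -
  have "spectral_proj H a b T u \<in> blinfun_apply (spectral_proj H a b T) ` H" for u
    using opsD(1)[OF HS spectral_proj_ops[OF HS assms], of a b u] proj_in[OF HS, of u] by (metis imageI)
  then show ?thesis unfolding spectral_space_def by auto
qed

lemma range_spectral_proj:
  assumes "T \<in> ops H" "adj T T" "commutes symm T" "a \<le> b"
  shows "subspace (range (blinfun_apply (spectral_proj H a b T)))"
    "range (blinfun_apply (spectral_proj H a b T)) \<subseteq> H"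
    "invariant G \<rho> (range (blinfun_apply (spectral_proj H a b T)))"
proof -
  show "subspace (range (blinfun_apply (spectral_proj H a b T)))"
    by (rule is_proj_range(3)[OF is_proj_spectral_proj[OF HS assms(1,2,4)]])
  show "range (blinfun_apply (spectral_proj H a b T)) \<subseteq> H"
    using opsD(3)[OF HS spectral_proj_ops[OF HS assms(1,2)]] by auto
  show "invariant G \<rho> (range (blinfun_apply (spectral_proj H a b T)))"
    using invariant_range[OF commutes_spectral_proj[OF assms(1-3)] invariant_H]
    unfolding spectral_space_range[OF assms(1,2), unfolded spectral_space_def] .
qed

lemma comm_proj_E_neg:
  assumes F: "subspace F" "finite_dim F" "F \<subseteq> H" "invariant G \<rho> F"
    and A: "adj A A" "commutes symm A" "\<And>u. u \<in> F \<Longrightarrow> A u \<in> F"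
  shows "invariant G \<rho> (E_neg F A)" "g \<in> carrier G \<Longrightarrow> comm (\<rho> g) (proj (E_neg F A))"
proof -
  note E = E_neg_subset[OF F(1,2) A(1,3)]
  show i: "invariant G \<rho> (E_neg F A)"
    unfolding invariant_def
  proof (intro ballI)
    fix g u assume g: "g \<in> carrier G" and u: "u \<in> E_neg F A"
    show "\<rho> g u \<in> E_neg F A"
      by (rule E_neg_invariant[OF F(1,2) A(1,3) _ commutes_rho[OF A(2) g] u])
        (use F(4) g in \<open>auto simp: invariant_def\<close>)
  qed
  show "comm (\<rho> g) (proj (E_neg F A))" if "g \<in> carrier G"
    by (intro commutes_rho[OF commutes_proj[OF E(1,4) order_trans[OF E(2) F(3)] i] that])
qed

text \<open>Pulled back along \<open>S\<close>, the space \<open>F\<close> is the sum of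
  \<open>W\<close>, the preimage of the spectral space, and \<open>D\<close>, the vectors of
  \<open>F\<close> whose image is killed by the projection; \<open>W\<close> and \<open>D\<close>
  are orthogonal for both forms. On \<open>D\<close> the forms agree. On \<open>W\<close> the
  shifted form is nonnegative, while the unshifted one is negative on \<open>Wm\<close> and
  nonnegative on \<open>W0\<close>. So the negative spaces have matrix forms \<open>d\<close> and
  \<open>rep_sum n d\<close>.\<close>

lemma inertia:
  assumes T: "T \<in> ops H" "adj T T" "commutes symm T" and a: "a > 0"
    and fin: "finite_dim (range (blinfun_apply (spectral_proj H (- a) a T)))"
    and S: "transporter symm S S'"
    and F: "subspace F" "finite_dim F" "F \<subseteq> H" "invariant G \<rho> F"
    and CF: "\<And>u. u \<in> F \<Longrightarrow> (S' o\<^sub>L (T + (2 * a) *\<^sub>R spectral_proj H (- a) a T) o\<^sub>L S) u \<in> F"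
    and PF: "\<And>u. (S' o\<^sub>L spectral_proj H (- a) a T o\<^sub>L S) u \<in> F"
  obtains n d where
    "matrix_form G X \<rho> {u \<in> range (blinfun_apply (spectral_proj H (- a) a T)). spectral_proj H 0 a T u = 0} n"
    "matrix_form G X \<rho> (E_neg F (S' o\<^sub>L (T + (2 * a) *\<^sub>R spectral_proj H (- a) a T) o\<^sub>L S)) d"
    "matrix_form G X \<rho> (E_neg F (S' o\<^sub>L T o\<^sub>L S)) (rep_sum n d)"
proof -
  define P where "P = spectral_proj H (- a) a T"
  define P0 where "P0 = spectral_proj H 0 a T"
  define B where "B = T + (2 * a) *\<^sub>R P"
  define C where "C = S' o\<^sub>L B o\<^sub>L S"
  define A where "A = S' o\<^sub>L T o\<^sub>L S"
  have le: "- a \<le> a" "0 \<le> a" using a by auto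
  have P: "is_proj P" unfolding P_def by (rule is_proj_spectral_proj[OF HS T(1,2) le(1)])
  have P0: "is_proj P0" unfolding P0_def by (rule is_proj_spectral_proj[OF HS T(1,2) le(2)])
  have Po: "P \<in> ops H" unfolding P_def by (rule spectral_proj_ops[OF HS T(1,2)])
  have Pc: "commutes symm P" unfolding P_def by (rule commutes_spectral_proj[OF T])
  have P0c: "commutes symm P0" unfolding P0_def by (rule commutes_spectral_proj[OF T])
  have PT: "P (T u) = T (P u)" for u unfolding P_def by (rule commD[OF spectral_proj_comm_self[OF HS T(1,2)]])
  have P0T: "P0 (T u) = T (P0 u)" for u unfolding P0_def by (rule commD[OF spectral_proj_comm_self[OF HS T(1,2)]])
  have PP0: "P (P0 u) = P0 u" for u
    unfolding P_def P0_def
    by (rule spectral_proj_nonneg_part(1)[OF HS T(1,2) le(2)]) (rule is_projD(2)[OF P0, unfolded P0_def])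
  have nonneg: "0 \<le> T u \<bullet> u" if "P0 u = u" for u
    using spectral_proj_nonneg_part(2)[OF HS T(1,2) le(2)] that by (simp add: P0_def)
  have neg: "T u \<bullet> u < 0" if "P u = u" "P0 u = 0" "u \<noteq> 0" for u
    using spectral_proj_neg_part[OF HS T(1,2) le(2)] that by (simp add: P0_def P_def)
  have Bo: "B \<in> ops H"
    unfolding B_def using opsD[OF HS T(1)] opsD[OF HS Po] HS(1)
    by (intro opsI[OF HS]) (auto simp: bl intro!: subspace_add subspace_scale)
  have Ba: "adj B B" unfolding B_def by (intro adj_intros T is_projD(1)[OF P])
  have Bc: "commutes symm B" unfolding B_def by (intro commutes_intros T Pc)
  note Cd = transporter_congruence_ops[OF Bo Ba Bc S, folded C_def]
  note Ad = transporter_congruence_ops[OF T S, folded A_def]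
  have aS: "adj S S'" and cS: "commutes symm S" using S by (auto simp: transporter_def)
  obtain R where R: "inv_pair S R" using S by (auto simp: transporter_def)
  have cR: "commutes symm R" using cS R by (auto simp: commutes_def intro: comm_inverse)
  have A_form: "A u \<bullet> v = T (S u) \<bullet> S v" and C_form: "C u \<bullet> v = B (S u) \<bullet> S v" for u v
    by (simp_all add: A_def C_def adjD[OF adj_sym[OF aS]])
  have CF': "C u \<in> F" if "u \<in> F" for u using CF[OF that] by (simp add: C_def B_def P_def)
  have PF': "S' (P (S u)) \<in> F" for u using PF[of u] by (simp add: P_def)
  have AF: "A u \<in> F" if "u \<in> F" for u
  proof -
    have "A u = C u - (2 * a) *\<^sub>R S' (P (S u))" by (simp add: A_def C_def B_def bl)
    then show ?thesis using CF'[OF that] PF' F(1) by (simp add: subspace_diff subspace_scale)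
  qed
  have C_inj: "u = 0" if u: "u \<in> H" "C u = 0" for u
  proof -
    obtain c where c: "c > 0" "\<And>v. c * norm v \<le> norm (S' v)" "\<And>v. c * norm v \<le> norm (S v)"
      using transporter_bounded_below[OF S] by metis
    have "B (S u) = 0" using c(2)[of "B (S u)"] c(1) u(2) by (simp add: C_def mult_le_0_iff)
    then have "S u = 0"
      using spectral_shift_bounded_below[OF T(1,2) a transporter_in[OF S u(1)]] a
      by (simp add: B_def P_def mult_le_0_iff)
    then show ?thesis using c(3)[of u] c(1) by (simp add: mult_le_0_iff)
  qed
  have C_inj_on: "inj_on (blinfun_apply C) F"
  proof (rule inj_onI)
    fix x y assume "x \<in> F" "y \<in> F" "C x = C y"
    then have "x - y \<in> H" "C (x - y) = 0" using F(1,3) by (auto simp: bl intro: subspace_diff)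
    then show "x = y" using C_inj by fastforce
  qed
  have C_surj: "blinfun_apply C ` F = F"
    using CF' by (intro dim_squeeze[OF F(1,2,1) _ C_inj_on, of id id]) (auto intro: linear_id)
  \<comment> \<open>The shifted operator is injective on \<open>H\<close> and, by dimension, maps
    \<open>F\<close> onto \<open>F\<close>. As \<open>T p + (2 * a) *\<^sub>R p\<close> stays in the
    range of \<open>P\<close>, the image of \<open>R p\<close> lies in \<open>F\<close>, and
    injectivity brings \<open>R p\<close> itself back to \<open>F\<close>.\<close>
  have W_in_F: "R p \<in> F" if p: "P p = p" for p
  proof -
    have pH: "p \<in> H" using opsD(3)[OF HS Po, of p] p by simp
    have "C (R p) = S' (P (S (R (T p + (2 * a) *\<^sub>R p))))"
      using p PT[of p] by (simp add: C_def B_def bl inv_pairD[OF R])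
    then have "C (R p) \<in> blinfun_apply C ` F" using PF' C_surj by simp
    then obtain f where f: "f \<in> F" "C f = C (R p)" by force
    then have 0: "C (R p - f) = 0" by (simp add: bl)
    have "R p - f \<in> H" using f(1) F(3) commutes_in[OF cR pH] HS(1) by (auto intro: subspace_diff)
    then have "R p - f = 0" using 0 by (rule C_inj)
    then show ?thesis using f(1) by simp
  qed
  let ?N = "{u \<in> range (blinfun_apply P). P0 u = 0}"
  define Wm where "Wm = blinfun_apply R ` ?N"
  define W0 where "W0 = blinfun_apply R ` range (blinfun_apply P0)"
  define W where "W = blinfun_apply R ` range (blinfun_apply P)"
  define D where "D = {u \<in> F. (P o\<^sub>L S) u = 0}"
  note rP = is_proj_range[OF P] and rP0 = is_proj_range[OF P0]
  have N: "subspace ?N" "finite_dim ?N" "?N \<subseteq> H" "invariant G \<rho> ?N"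
  proof -
    have "?N = range (blinfun_apply P) \<inter> {u. P0 u = 0}" by auto
    then show "subspace ?N" using subspace_inter[OF rP(3) subspace_kernel] by metis
    show "finite_dim ?N" using fin by (rule finite_dim_subset) (auto simp: P_def)
    show "?N \<subseteq> H" using opsD(3)[OF HS Po] by auto
    show "invariant G \<rho> ?N"
      using invariant_kernel[OF P0c range_spectral_proj(3)[OF T le(1), folded P_def]] .
  qed
  obtain n where n: "matrix_form G X \<rho> ?N n" using matrix_form_exists[OF action G top N] by metis
  have R_inj: "inj_on (blinfun_apply R) V" for V
    by (rule inj_onI) (metis inv_pairD(1)[OF R])
  have nW: "matrix_form G X \<rho> Wm n"
    unfolding Wm_def using commD[OF commutes_rho[OF cR]]
    by (intro matrix_form_image[OF n linear_blinfun R_inj]) auto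
  have Wsub: "subspace Wm" "subspace W0" "subspace W"
    unfolding Wm_def W0_def W_def using N(1) rP(3) rP0(3) by (auto intro: subspace_range)
  have WmF: "Wm \<subseteq> F" "W0 \<subseteq> F" "W \<subseteq> F"
    unfolding Wm_def W0_def W_def using W_in_F is_projD(2)[OF P] PP0 by auto
  have Pc_S: "commutes symm (P o\<^sub>L S)" by (intro commutes_intros Pc cS)
  have D: "subspace D" "finite_dim D" "D \<subseteq> F" "D \<subseteq> H" "invariant G \<rho> D"
  proof -
    have "D = F \<inter> {u. (P o\<^sub>L S) u = 0}" by (auto simp: D_def)
    then show "subspace D" using subspace_inter[OF F(1) subspace_kernel] by metis
    show "D \<subseteq> F" by (auto simp: D_def)
    then show "finite_dim D" "D \<subseteq> H" using finite_dim_subset[OF F(2)] F(3) by auto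
    show "invariant G \<rho> D" unfolding D_def by (rule invariant_kernel[OF Pc_S F(4)])
  qed
  have Dc: "closed D" by (rule finite_dim_closed[OF D(1,2)])
  have pD: "is_proj (proj D)" by (rule is_proj_proj[OF D(1) Dc])
  \<comment> \<open>\<open>D\<close> need not be invariant under \<open>C\<close>, whereas the
    results on \<open>E_neg\<close> ask for invariance; the compression has the same quadratic form
    on \<open>D\<close>.\<close>
  define CD where "CD = proj D o\<^sub>L C o\<^sub>L proj D"
  have "adj CD (proj D o\<^sub>L (C o\<^sub>L proj D))" unfolding CD_def by (intro adj_intros is_projD(1)[OF pD] Cd)
  moreover have "proj D o\<^sub>L (C o\<^sub>L proj D) = CD" unfolding CD_def by (rule blinfun_eqI) simp
  ultimately have CDa: "adj CD CD" by simp
  have CDD: "CD u \<in> D" for u by (simp add: CD_def proj_in[OF D(1) Dc])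
  have CDc: "commutes symm CD"
    unfolding CD_def by (intro commutes_intros Cd commutes_proj[OF D(1) Dc D(4,5)])
  have CD_form: "CD u \<bullet> u = C u \<bullet> u" if "u \<in> D" for u
    using that by (simp add: CD_def is_projD(3)[OF pD] proj_ident[OF D(1) Dc])
  define Dm where "Dm = E_neg D CD"
  define Dp where "Dp = {u \<in> D. proj Dm u = 0}"
  note E = E_neg_subset[OF D(1,2) CDa CDD, folded Dm_def]
  have DmF: "Dm \<subseteq> F" using E(2) D(3) by blast
  have Dm_inv: "invariant G \<rho> Dm"
    unfolding Dm_def by (rule comm_proj_E_neg(1)[OF D(1,2,4,5) CDa CDc CDD])
  obtain d where d: "matrix_form G X \<rho> Dm d"
    using matrix_form_exists[OF action G top E(1,3) order_trans[OF DmF F(3)] Dm_inv] by metis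
  have Dp: "subspace Dp" "Dp \<subseteq> D"
  proof -
    have "Dp = D \<inter> {u. proj Dm u = 0}" by (auto simp: Dp_def)
    then show "subspace Dp" using subspace_inter[OF D(1) subspace_kernel] by metis
  qed (auto simp: Dp_def)
  have Dm_neg: "C u \<bullet> u < 0" if "u \<in> Dm" "u \<noteq> 0" for u
    using E_neg_negative[OF D(1,2) CDa CDD that[unfolded Dm_def]] CD_form[of u] E(2) that by auto
  have Dp_pos: "0 \<le> C u \<bullet> u" if "u \<in> Dp" for u
  proof -
    have "0 \<le> CD u \<bullet> u"
      using that proj_0_iff[OF E(1,4)] unfolding Dp_def Dm_def
      by (intro E_neg_complement[OF D(1,2) CDa CDD]) auto
    then show ?thesis using CD_form[of u] that Dp(2) by auto
  qed
  have D_split: "\<exists>v\<in>Dm. \<exists>w\<in>Dp. u = v + w" if u: "u \<in> D" for u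
  proof (intro bexI)
    show "u = proj Dm u + (u - proj Dm u)" by simp
    show "proj Dm u \<in> Dm" by (rule proj_in[OF E(1,4)])
    then show "u - proj Dm u \<in> Dp"
      using u E(2) D(1) by (auto simp: Dp_def bl is_projD(2)[OF is_proj_proj[OF E(1,4)]] intro: subspace_diff)
  qed
  have F_split: "\<exists>v\<in>W. \<exists>w\<in>D. u = v + w" if u: "u \<in> F" for u
  proof (intro bexI)
    let ?v = "R (P (S u))"
    show v: "?v \<in> W" by (auto simp: W_def)
    show "u = ?v + (u - ?v)" by simp
    have "(P o\<^sub>L S) (u - ?v) = 0" by (simp add: bl inv_pairD[OF R] is_projD(2)[OF P])
    moreover have "u - ?v \<in> F" using u v WmF(3) F(1) by (auto intro: subspace_diff)
    ultimately show "u - ?v \<in> D" by (simp add: D_def)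
  qed
  have W_split: "\<exists>v\<in>Wm. \<exists>w\<in>W0. u = v + w" if u: "u \<in> W" for u
  proof -
    obtain p where p: "u = R p" "P p = p" using u rP(1) by (auto simp: W_def)
    show ?thesis
    proof (intro bexI)
      show "u = R (p - P0 p) + R (P0 p)" using p(1) by (simp add: bl)
      have "P (p - P0 p) = p - P0 p" "P0 (p - P0 p) = 0" by (simp_all add: bl p(2) PP0 is_projD(2)[OF P0])
      then have "p - P0 p \<in> ?N" unfolding rP(1) by simp
      then show "R (p - P0 p) \<in> Wm" unfolding Wm_def by blast
    qed (auto simp: W0_def)
  qed
  have S_W: "P (S w) = S w" if "w \<in> W" for w
    using that by (auto simp: W_def inv_pairD[OF R] is_projD(2)[OF P])
  have S_D: "P (S w) = 0" if "w \<in> D" for w using that by (simp add: D_def)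
  have A_WD: "A w \<bullet> u = 0" and C_WD: "C w \<bullet> u = 0" if "w \<in> W" "u \<in> D" for w u
  proof -
    have "T (S w) \<bullet> S u = P (T (S w)) \<bullet> S u" using S_W[OF that(1)] PT[of "S w"] by simp
    also have "\<dots> = 0" using S_D[OF that(2)] by (simp add: is_projD(3)[OF P])
    finally have 1: "T (S w) \<bullet> S u = 0" .
    have "P (S w) \<bullet> S u = 0" using S_D[OF that(2)] by (simp add: is_projD(3)[OF P])
    then show "A w \<bullet> u = 0" "C w \<bullet> u = 0" using 1 by (simp_all add: A_form C_form B_def bl inner_simps)
  qed
  have A_D: "A u = C u" if "u \<in> D" for u using S_D[OF that] by (simp add: A_def C_def B_def bl)
  have A_sum: "A (w + u) \<bullet> (w + u) = A w \<bullet> w + C u \<bullet> u"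
    and C_sum: "C (w + u) \<bullet> (w + u) = C w \<bullet> w + C u \<bullet> u" if "w \<in> W" "u \<in> D" for w u
    using A_WD[OF that] C_WD[OF that] A_D[OF that(2)] adjD[OF Ad(2), of u w] adjD[OF Cd(2), of u w]
    by (simp_all add: bl inner_simps inner_commute)
  have WmW: "Wm \<subseteq> W" "W0 \<subseteq> W"
  proof -
    show "Wm \<subseteq> W" unfolding Wm_def W_def by auto
    show "W0 \<subseteq> W" unfolding W0_def W_def using PP0 by (auto simp: image_iff) metis
  qed
  have A_Wm: "A w \<bullet> w < 0" if w: "w \<in> Wm" "w \<noteq> 0" for w
  proof -
    obtain p where p: "w = R p" "P p = p" "P0 p = 0" using w(1) unfolding Wm_def rP(1) by auto
    then have "p \<noteq> 0" using w(2) by auto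
    then show ?thesis using neg[OF p(2,3)] p(1) by (simp add: A_form inv_pairD[OF R])
  qed
  have A_W0: "0 \<le> A w \<bullet> w" if w: "w \<in> W0" for w
    using w nonneg[OF is_projD(2)[OF P0]] by (auto simp: W0_def A_form inv_pairD[OF R])
  have C_W: "0 \<le> C w \<bullet> w" if w: "w \<in> W" for w
  proof -
    have p: "P (S w) = S w" using S_W[OF w] .
    \<comment> \<open>On the spectral range the form of \<open>T\<close> is at least
      \<open>- a\<close>, so the shift by \<open>2 * a\<close> leaves at least
      \<open>a\<close>.\<close>
    have "- a * (S w \<bullet> S w) \<le> T (S w) \<bullet> S w"
      using spectral_proj_range_ge[OF HS T(1,2) le(1)] p by (simp add: P_def)
    moreover have "C w \<bullet> w = T (S w) \<bullet> S w + (2 * a) * (S w \<bullet> S w)"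
      by (simp add: C_form B_def bl p inner_simps)
    moreover have "0 \<le> a * (S w \<bullet> S w)" using a by simp
    ultimately show ?thesis by simp
  qed
  have WD0: "Wm \<inter> Dm = {0}"
  proof -
    have "x = 0" if "x \<in> Wm" "x \<in> Dm" for x
    proof -
      have "P (S x) = S x" "P (S x) = 0" using S_W S_D that WmW(1) E(2) by blast+
      then have "S x = 0" by simp
      then show ?thesis using inv_pairD(2)[OF R, of x] by simp
    qed
    then show ?thesis using subspace_0[OF Wsub(1)] subspace_0[OF E(1)] by auto
  qed
  let ?N1 = "{v + w | v w. v \<in> Wm \<and> w \<in> Dm}"
  let ?M1 = "{v + w | v w. v \<in> W0 \<and> w \<in> Dp}"
  let ?M2 = "{v + w | v w. v \<in> W \<and> w \<in> Dp}"
  have nd: "matrix_form G X \<rho> ?N1 (rep_sum n d)" by (rule matrix_form_sum[OF G top nW d WD0])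
  have DpF: "Dp \<subseteq> F" using Dp(2) D(3) by blast
  have "matrix_form G X \<rho> (E_neg F A) (rep_sum n d)"
  proof (rule matrix_form_E_neg[OF F(1,2) Ad(2) AF _ _ _ _ _ _ _ _ nd])
    show "subspace ?N1" by (rule subspace_sums[OF Wsub(1) E(1)])
    show "?N1 \<subseteq> F" using WmF(1) DmF F(1) by (auto intro: subspace_add)
    show "subspace ?M1" by (rule subspace_sums[OF Wsub(2) Dp(1)])
    show "?M1 \<subseteq> F" using WmF(2) DpF F(1) by (auto intro: subspace_add)
    show "A u \<bullet> u < 0" if u: "u \<in> ?N1" "u \<noteq> 0" for u
    proof -
      obtain v w where vw: "u = v + w" "v \<in> Wm" "w \<in> Dm" using u(1) by blast
      then have e: "A u \<bullet> u = A v \<bullet> v + C w \<bullet> w" using A_sum[of v w] WmW E(2) by auto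
      have "A v \<bullet> v \<le> 0" using A_Wm[OF vw(2)] by (cases "v = 0") auto
      moreover have "C w \<bullet> w \<le> 0" using Dm_neg[OF vw(3)] by (cases "w = 0") auto
      moreover have "A v \<bullet> v < 0 \<or> C w \<bullet> w < 0" using A_Wm[OF vw(2)] Dm_neg[OF vw(3)] u(2) vw(1) by (cases "w = 0") auto
      ultimately show ?thesis unfolding e by linarith
    qed
    show "0 \<le> A u \<bullet> u" if u: "u \<in> ?M1" for u
    proof -
      obtain v w where vw: "u = v + w" "v \<in> W0" "w \<in> Dp" using u(1) by blast
      then have "A u \<bullet> u = A v \<bullet> v + C w \<bullet> w" using A_sum[of v w] WmW Dp(2) by auto
      then show ?thesis using A_W0[OF vw(2)] Dp_pos[OF vw(3)] by linarith
    qed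
    show "\<exists>v\<in>?N1. \<exists>w\<in>?M1. u = v + w" if u: "u \<in> F" for u
    proof -
      obtain x y where xy: "x \<in> W" "y \<in> D" "u = x + y" using F_split[OF u] by blast
      obtain x1 x2 where x: "x1 \<in> Wm" "x2 \<in> W0" "x = x1 + x2" using W_split[OF xy(1)] by blast
      obtain y1 y2 where y: "y1 \<in> Dm" "y2 \<in> Dp" "y = y1 + y2" using D_split[OF xy(2)] by blast
      have "u = (x1 + y1) + (x2 + y2)" using xy(3) x(3) y(3) by simp
      then show ?thesis using x y by blast
    qed
    show "comm (\<rho> g) (proj (E_neg F A))" if "g \<in> carrier G" for g
      by (rule comm_proj_E_neg(2)[OF F Ad(2,3) AF that])
  qed
  moreover have "matrix_form G X \<rho> (E_neg F C) d"
  proof (rule matrix_form_E_neg[OF F(1,2) Cd(2) CF' E(1) DmF Dm_neg _ _ _ _ _ d])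
    show "subspace ?M2" by (rule subspace_sums[OF Wsub(3) Dp(1)])
    show "?M2 \<subseteq> F" using WmF(3) DpF F(1) by (auto intro: subspace_add)
    show "0 \<le> C u \<bullet> u" if u: "u \<in> ?M2" for u
    proof -
      obtain v w where vw: "u = v + w" "v \<in> W" "w \<in> Dp" using u(1) by blast
      then have "C u \<bullet> u = C v \<bullet> v + C w \<bullet> w" using C_sum[of v w] Dp(2) by auto
      then show ?thesis using C_W[OF vw(2)] Dp_pos[OF vw(3)] by linarith
    qed
    show "\<exists>v\<in>Dm. \<exists>w\<in>?M2. u = v + w" if u: "u \<in> F" for u
    proof -
      obtain x y where xy: "x \<in> W" "y \<in> D" "u = x + y" using F_split[OF u] by blast
      obtain y1 y2 where y: "y1 \<in> Dm" "y2 \<in> Dp" "y = y1 + y2" using D_split[OF xy(2)] by blast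
      have "u = y1 + (x + y2)" using xy(3) y(3) by simp
      then show ?thesis using xy y by blast
    qed
    show "comm (\<rho> g) (proj (E_neg F C))" if "g \<in> carrier G" for g
      by (rule comm_proj_E_neg(2)[OF F Cd(2,3) CF' that])
  qed auto
  ultimately show ?thesis
    using n that[of n d] unfolding A_def C_def B_def P_def P0_def by blast
qed

lemma spectral_range_split:
  assumes T: "T \<in> ops H" "adj T T" "commutes symm T" and a: "a > 0"
    and p: "matrix_form G X \<rho> (range (blinfun_apply (spectral_proj H 0 a T))) p"
    and n: "matrix_form G X \<rho> {u \<in> range (blinfun_apply (spectral_proj H (- a) a T)). spectral_proj H 0 a T u = 0} n"
  shows "matrix_form G X \<rho> (range (blinfun_apply (spectral_proj H (- a) a T))) (rep_sum p n)"
proof -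
  define P where "P = spectral_proj H (- a) a T"
  define P0 where "P0 = spectral_proj H 0 a T"
  let ?N = "{u \<in> range (blinfun_apply P). P0 u = 0}"
  have le: "- a \<le> a" "0 \<le> a" using a by auto
  have P: "is_proj P" unfolding P_def by (rule is_proj_spectral_proj[OF HS T(1,2) le(1)])
  have P0: "is_proj P0" unfolding P0_def by (rule is_proj_spectral_proj[OF HS T(1,2) le(2)])
  have PP0: "P (P0 u) = P0 u" for u
    unfolding P_def P0_def
    by (rule spectral_proj_nonneg_part(1)[OF HS T(1,2) le(2)]) (rule is_projD(2)[OF P0, unfolded P0_def])
  note rP = is_proj_range[OF P] and rP0 = is_proj_range[OF P0]
  have "range (blinfun_apply P0) \<inter> ?N = {0}"
    unfolding rP0(1) rP(1) by (auto simp: bl)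
  then have "matrix_form G X \<rho> {v + w | v w. v \<in> range (blinfun_apply P0) \<and> w \<in> ?N} (rep_sum p n)"
    using p n unfolding P_def[symmetric] P0_def[symmetric] by (intro matrix_form_sum[OF G top])
  moreover have "{v + w | v w. v \<in> range (blinfun_apply P0) \<and> w \<in> ?N} = range (blinfun_apply P)"
  proof (intro equalityI subsetI)
    fix u assume "u \<in> {v + w | v w. v \<in> range (blinfun_apply P0) \<and> w \<in> ?N}"
    then show "u \<in> range (blinfun_apply P)" unfolding rP0(1) rP(1) using PP0 by (auto simp: bl) metis
  next
    fix u assume "u \<in> range (blinfun_apply P)"
    then have "P u = u" using rP(1) by blast
    then have "u - P0 u \<in> ?N" unfolding rP(1) by (simp add: bl PP0 is_projD(2)[OF P0])
    moreover have "u = P0 u + (u - P0 u)" by simp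
    ultimately show "u \<in> {v + w | v w. v \<in> range (blinfun_apply P0) \<and> w \<in> ?N}" by blast
  qed
  ultimately show ?thesis by (simp add: P_def)
qed

text \<open>By \<open>inertia\<close> the negative spaces have classes \<open>nx + dx\<close> and
  \<open>ny + dy\<close>, where \<open>dx\<close> and \<open>dy\<close> agree because the shifted
  operators coincide. The spectral space for \<open>[- a, a]\<close> has constant class along the
  piece, so \<open>px + nx = py + ny\<close>. Adding \<open>px\<close> at one end and
  \<open>py\<close> at the other turns \<open>ex - ey\<close> into \<open>py - px\<close>: the
  decrease of the negative part is the increase of the nonnegative one.\<close>

lemma piece_class:
  fixes x y :: real
  assumes xy: "x \<le> y" and L: "\<And>s. s \<in> {x..y} \<Longrightarrow> L s \<in> FS_G G H \<rho>"
    and a: "a > 0" "continuous_on {x..y} (\<lambda>s. spectral_proj H (- a) a (L s))"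
      "\<And>s. s \<in> {x..y} \<Longrightarrow> finite_dim (spectral_space H (L s) (- a) a)"
    and S: "transporter symm (S x) (S' x)" "transporter symm (S y) (S' y)"
    and C: "S' y o\<^sub>L (L y + (2 * a) *\<^sub>R spectral_proj H (- a) a (L y)) o\<^sub>L S y =
      S' x o\<^sub>L (L x + (2 * a) *\<^sub>R spectral_proj H (- a) a (L x)) o\<^sub>L S x"
    and F: "subspace F" "finite_dim F" "F \<subseteq> H" "invariant G \<rho> F"
    and CF: "\<And>u. u \<in> F \<Longrightarrow> (S' x o\<^sub>L (L x + (2 * a) *\<^sub>R spectral_proj H (- a) a (L x)) o\<^sub>L S x) u \<in> F"
    and PF: "\<And>u. (S' x o\<^sub>L spectral_proj H (- a) a (L x) o\<^sub>L S x) u \<in> F"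
      "\<And>u. (S' y o\<^sub>L spectral_proj H (- a) a (L y) o\<^sub>L S y) u \<in> F"
    and e: "matrix_form G X \<rho> (E_neg F (S' x o\<^sub>L L x o\<^sub>L S x)) ex"
      "matrix_form G X \<rho> (E_neg F (S' y o\<^sub>L L y o\<^sub>L S y)) ey"
  shows "class_diff G X ex ey =
    RO_diff G X \<rho> (spectral_space H (L y) 0 a) (spectral_space H (L x) 0 a)"
proof -
  have mem: "x \<in> {x..y}" "y \<in> {x..y}" using xy by auto
  note Ld = FS_G_D[OF L]
  have rs: "spectral_space H (L s) u v = range (blinfun_apply (spectral_proj H u v (L s)))" if "s \<in> {x..y}" for s u v
    by (rule spectral_space_range[OF Ld(1,2)[OF that]])
  have fin: "finite_dim (range (blinfun_apply (spectral_proj H (- a) a (L s))))" if "s \<in> {x..y}" for s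
    using a(3)[OF that] rs[OF that] by simp
  obtain nx dx where nx: "matrix_form G X \<rho> {u \<in> range (blinfun_apply (spectral_proj H (- a) a (L x))). spectral_proj H 0 a (L x) u = 0} nx"
    "matrix_form G X \<rho> (E_neg F (S' x o\<^sub>L (L x + (2 * a) *\<^sub>R spectral_proj H (- a) a (L x)) o\<^sub>L S x)) dx"
    "matrix_form G X \<rho> (E_neg F (S' x o\<^sub>L L x o\<^sub>L S x)) (rep_sum nx dx)"
    by (rule inertia[OF Ld(1-3)[OF mem(1)] a(1) fin[OF mem(1)] S(1) F CF PF(1)])
  obtain ny dy where ny: "matrix_form G X \<rho> {u \<in> range (blinfun_apply (spectral_proj H (- a) a (L y))). spectral_proj H 0 a (L y) u = 0} ny"
    "matrix_form G X \<rho> (E_neg F (S' x o\<^sub>L (L x + (2 * a) *\<^sub>R spectral_proj H (- a) a (L x)) o\<^sub>L S x)) dy"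
    "matrix_form G X \<rho> (E_neg F (S' y o\<^sub>L L y o\<^sub>L S y)) (rep_sum ny dy)"
    by (rule inertia[OF Ld(1-3)[OF mem(2)] a(1) fin[OF mem(2)] S(2) F CF[folded C] PF(2), unfolded C])
  have ex_p: "\<exists>p. matrix_form G X \<rho> (range (blinfun_apply (spectral_proj H 0 a (L s)))) p" if s: "s \<in> {x..y}" for s
  proof -
    have a0: "0 \<le> a" "- a \<le> a" using a by auto
    note T = Ld(1-3)[OF s]
    have "range (blinfun_apply (spectral_proj H 0 a (L s))) \<subseteq> range (blinfun_apply (spectral_proj H (- a) a (L s)))"
      using spectral_proj_nonneg_part(1)[OF HS T(1,2) a0(1)]
        is_projD(2)[OF is_proj_spectral_proj[OF HS T(1,2) a0(1)]] by (metis image_subsetI rangeI)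
    then have "finite_dim (range (blinfun_apply (spectral_proj H 0 a (L s))))"
      using fin[OF s] by (rule finite_dim_subset[rotated])
    then show ?thesis
      using range_spectral_proj[OF T a0(1)] by (meson matrix_form_exists[OF action G top])
  qed
  obtain px where px: "matrix_form G X \<rho> (range (blinfun_apply (spectral_proj H 0 a (L x)))) px" using ex_p[OF mem(1)] ..
  obtain py where py: "matrix_form G X \<rho> (range (blinfun_apply (spectral_proj H 0 a (L y)))) py" using ex_p[OF mem(2)] ..
  have "matrix_form G X \<rho> (range (blinfun_apply (spectral_proj H (- a) a (L x)))) (rep_sum px nx)"
    by (rule spectral_range_split[OF Ld(1-3)[OF mem(1)] a(1) px nx(1)])
  then have "matrix_form G X \<rho> (range (blinfun_apply (spectral_proj H (- a) a (L y)))) (rep_sum px nx)"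
  proof (rule matrix_form_projection_path[OF xy a(2), rotated -1])
    fix s assume s: "s \<in> {x..y}"
    show "is_proj (spectral_proj H (- a) a (L s))" using a by (intro is_proj_spectral_proj[OF HS Ld(1,2)[OF s]]) auto
    show "finite_dim (range (blinfun_apply (spectral_proj H (- a) a (L s))))" by (rule fin[OF s])
    show "comm (\<rho> g) (spectral_proj H (- a) a (L s))" if "g \<in> carrier G" for g
      by (rule commutes_rho[OF commutes_spectral_proj[OF Ld(1-3)[OF s]] that])
  qed
  moreover have "matrix_form G X \<rho> (range (blinfun_apply (spectral_proj H (- a) a (L y)))) (rep_sum py ny)"
    by (rule spectral_range_split[OF Ld(1-3)[OF mem(2)] a(1) py ny(1)])
  ultimately have iso_p: "rep_iso G X (rep_sum px nx) (rep_sum py ny)" by (rule matrix_form_unique)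
  have iso_d: "rep_iso G X dx dy" by (rule matrix_form_unique[OF nx(2) ny(2)])
  have iso_x: "rep_iso G X ex (rep_sum nx dx)" by (rule matrix_form_unique[OF e(1) nx(3)])
  have iso_y: "rep_iso G X ey (rep_sum ny dy)" by (rule matrix_form_unique[OF e(2) ny(3)])
  note r = matrix_form_rep[OF e(1)] matrix_form_rep[OF e(2)] matrix_form_rep[OF px] matrix_form_rep[OF py]
    matrix_form_rep[OF nx(1)] matrix_form_rep[OF nx(2)] matrix_form_rep[OF ny(1)] matrix_form_rep[OF ny(2)]
  note rs' = reps_sum[OF G top] and refl' = reps_refl[OF G top] and comm' = rep_sum_comm[OF G top]
    and sum' = rep_iso_sum[OF G top]
  have "rep_iso G X (rep_sum ex px) (rep_sum (rep_sum nx dx) px)" by (intro sum' iso_x refl' r)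
  also have rep_trans: "rep_iso G X (rep_sum (rep_sum nx dx) px) (rep_sum px (rep_sum nx dx))" by (intro comm' rs' r)
  finally (rep_iso_trans) have 1: "rep_iso G X (rep_sum ex px) (rep_sum (rep_sum px nx) dx)"
    by (simp add: rep_sum_assoc[OF G top])
  have 2: "rep_iso G X (rep_sum (rep_sum px nx) dx) (rep_sum (rep_sum py ny) dy)" by (intro sum' iso_p iso_d)
  have "rep_iso G X (rep_sum py ey) (rep_sum py (rep_sum ny dy))" by (intro sum' iso_y refl' r)
  then have 3: "rep_iso G X (rep_sum (rep_sum py ny) dy) (rep_sum py ey)"
    by (simp add: rep_sum_assoc[OF G top] rep_iso_sym)
  have "class_diff G X ex ey = class_diff G X py px"
    using r by (intro class_diff_eqI[OF G top] rep_iso_trans[OF rep_iso_trans[OF 1 2] 3])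
  also have "\<dots> = RO_diff G X \<rho> (spectral_space H (L y) 0 a) (spectral_space H (L x) 0 a)"
    unfolding rs[OF mem(1)] rs[OF mem(2)] by (rule RO_diff_eq[OF G top py px, symmetric])
  finally show ?thesis .
qed

lemma partition_mono:
  fixes l :: "nat \<Rightarrow> real"
  assumes "\<And>i. i < N \<Longrightarrow> l i < l (Suc i)" "i \<le> j" "j \<le> N" shows "l i \<le> l j"
  using assms(2,3)
proof (induction j)
  case (Suc j)
  show ?case
  proof (cases "i = Suc j")
    case False
    then have "l i \<le> l j" using Suc by simp
    also have "l j < l (Suc j)" using Suc by (intro assms(1)) simp
    finally show ?thesis by simp
  qed simp
qed simp

text \<open>Inside a piece the shifted operators are invertible, so \<open>congruence_path\<close>
  applies to their extensions, and the result is composed with the transporter already reached. At a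
  partition point \<open>a i\<close> and with it the shifted operator may jump; hence constancy is
  claimed piece by piece, while the transporter stays continuous. The start \<open>S0\<close> is
  left free so that it can be the transporter taking \<open>L 0\<close> to \<open>J\<close>.\<close>

lemma partition_transporter:
  fixes l a :: "nat \<Rightarrow> real"
  assumes L: "\<And>s. s \<in> {0..1} \<Longrightarrow> L s \<in> FS_G G H \<rho>" "continuous_on {0..1} L"
    and sf: "sf_data H L N l a" and S0: "transporter symm S0 S0'" and k: "k \<le> N"
  shows "\<exists>S S'. continuous_on {0..l k} S \<and> S 0 = S0 \<and> S' 0 = S0' \<and>
    (\<forall>s\<in>{0..l k}. transporter symm (S s) (S' s)) \<and>
    (\<forall>i\<in>{1..k}. \<forall>s\<in>{l (i - 1)..l i}.
      S' s o\<^sub>L (L s + (2 * a i) *\<^sub>R spectral_proj H (- a i) (a i) (L s)) o\<^sub>L S s =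
      S' (l (i - 1)) o\<^sub>L (L (l (i - 1)) + (2 * a i) *\<^sub>R spectral_proj H (- a i) (a i) (L (l (i - 1)))) o\<^sub>L S (l (i - 1)))"
  using k
proof (induction k)
  case 0
  have "l 0 = 0" using sf by (simp add: sf_data_def)
  then show ?case using S0 by (intro exI[of _ "\<lambda>_. S0"] exI[of _ "\<lambda>_. S0'"]) auto
next
  case (Suc k)
  define x where "x = l k"
  define y where "y = l (Suc k)"
  define c where "c = a (Suc k)"
  have sfl: "l 0 = 0" "l N = 1" "\<And>i. i < N \<Longrightarrow> l i < l (Suc i)" using sf by (auto simp: sf_data_def)
  have mono: "l i \<le> l j" if "i \<le> j" "j \<le> N" for i j using partition_mono[of N l] sfl(3) that by blast
  have xy: "0 \<le> x" "x < y" "y \<le> 1"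
    using mono[of 0 k] mono[of "Suc k" N] sfl Suc.prems by (auto simp: x_def y_def)
  have "Suc k \<in> {1..N}" using Suc.prems by auto
  then have c: "c > 0" "continuous_on {x..y} (\<lambda>s. spectral_proj H (- c) c (L s))"
    using sf unfolding sf_data_def x_def y_def c_def by force+
  let ?T = "\<lambda>s. L s + (2 * c) *\<^sub>R spectral_proj H (- c) c (L s)"
  obtain S S' where S: "continuous_on {0..x} S" "S 0 = S0" "S' 0 = S0'"
    "\<And>s. s \<in> {0..x} \<Longrightarrow> transporter symm (S s) (S' s)"
    "\<And>i s. i \<in> {1..k} \<Longrightarrow> s \<in> {l (i - 1)..l i} \<Longrightarrow>
      S' s o\<^sub>L (L s + (2 * a i) *\<^sub>R spectral_proj H (- a i) (a i) (L s)) o\<^sub>L S s =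
      S' (l (i - 1)) o\<^sub>L (L (l (i - 1)) + (2 * a i) *\<^sub>R spectral_proj H (- a i) (a i) (L (l (i - 1)))) o\<^sub>L S (l (i - 1))"
  proof -
    have "k \<le> N" using Suc.prems by simp
    from Suc.IH[OF this] show ?thesis
      unfolding x_def[symmetric] by (elim exE conjE) (rule that, (assumption | erule (1) bspec | (drule (1) bspec)+)+)
  qed
  have Ld: "L s \<in> ops H" "adj (L s) (L s)" "commutes symm (L s)" if "s \<in> {x..y}" for s
    using FS_G_D[OF L(1)] that xy by auto
  have To: "?T s \<in> ops H" and Ta: "adj (?T s) (?T s)" and Tc: "commutes symm (?T s)" if s: "s \<in> {x..y}" for s
  proof -
    note P = is_proj_spectral_proj[OF HS Ld(1,2)[OF s]]
    show "?T s \<in> ops H"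
      using opsD[OF HS Ld(1)[OF s]] opsD[OF HS spectral_proj_ops[OF HS Ld(1,2)[OF s]]] HS(1)
      by (intro opsI[OF HS]) (auto simp: bl intro!: subspace_add subspace_scale)
    show "adj (?T s) (?T s)" using c by (intro adj_intros Ld[OF s] is_projD(1)[OF P]) auto
    show "commutes symm (?T s)" by (intro commutes_intros Ld[OF s] commutes_spectral_proj)
  qed
  define B where "B s = ?T s + (id_blinfun - proj H)" for s
  have cP: "commutes symm (proj H)" using commutes_proj[OF HS order_refl invariant_H] .
  have Bc: "continuous_on {x..y} B"
    unfolding B_def using xy by (intro continuous_intros c(2) continuous_on_subset[OF L(2)]) auto
  have Ba: "adj (B s) (B s)" and Bs: "commutes symm (B s)" and Bi: "\<exists>R. inv_pair (B s) R" if s: "s \<in> {x..y}" for s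
  proof -
    show "adj (B s) (B s)" unfolding B_def by (intro adj_intros Ta[OF s] is_projD(1)[OF PH])
    show "commutes symm (B s)" unfolding B_def by (intro commutes_intros(1)[OF Tc[OF s]] commutes_intros cP)
    show "\<exists>R. inv_pair (B s) R"
      unfolding B_def
      using extension_invertible[OF HS To[OF s] Ta[OF s] c(1) spectral_shift_bounded_below[OF Ld(1,2)[OF s] c(1)]] by metis
  qed
  obtain V V' where V: "continuous_on {x..y} V" "V x = id_blinfun" "V' x = id_blinfun"
    "\<And>s. s \<in> {x..y} \<Longrightarrow> transporter symm (V s) (V' s)" "\<And>s. s \<in> {x..y} \<Longrightarrow> V' s o\<^sub>L B s o\<^sub>L V s = B x"
    by (rule congruence_path[OF less_imp_le[OF xy(2)] Bc Ba Bs Bi]) (assumption | rule that)+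
  define U where "U s = (if s \<le> x then S s else V s o\<^sub>L S x)" for s
  define U' where "U' s = (if s \<le> x then S' s else S' x o\<^sub>L V' s)" for s
  have U2: "U s = V s o\<^sub>L S x" "U' s = S' x o\<^sub>L V' s" if "s \<in> {x..y}" for s
    using that V(2,3) by (auto simp: U_def U'_def intro!: blinfun_eqI)
  have "continuous_on {0..y} U"
    unfolding U_def using xy V(2)
    by (intro continuous_on_glue S(1) continuous_on_blinfun_compose V(1) continuous_on_const)
      (auto intro: blinfun_eqI)
  moreover have "U 0 = S0" "U' 0 = S0'" using S(2,3) xy(1) by (auto simp: U_def U'_def)
  moreover have "transporter symm (U s) (U' s)" if s: "s \<in> {0..y}" for s
  proof (cases "s \<le> x")
    case True
    then show ?thesis using S(4)[of s] s by (simp add: U_def U'_def)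
  next
    case False
    then show ?thesis using transporter_compose[OF V(4)[of s] S(4)[of x]] s xy by (simp add: U_def U'_def)
  qed
  moreover have "U' s o\<^sub>L (L s + (2 * a i) *\<^sub>R spectral_proj H (- a i) (a i) (L s)) o\<^sub>L U s =
      U' (l (i - 1)) o\<^sub>L (L (l (i - 1)) + (2 * a i) *\<^sub>R spectral_proj H (- a i) (a i) (L (l (i - 1)))) o\<^sub>L U (l (i - 1))"
    if i: "i \<in> {1..Suc k}" and s: "s \<in> {l (i - 1)..l i}" for i s
  proof (cases "i = Suc k")
    case False
    then have i': "i \<in> {1..k}" using i by auto
    then have "l i \<le> x" using mono[of i k] Suc.prems by (simp add: x_def)
    then have "s \<le> x" "l (i - 1) \<le> x" using s by auto
    then show ?thesis using S(5)[OF i' s] by (simp add: U_def U'_def)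
  next
    case True
    then have s': "s \<in> {x..y}" "x \<in> {x..y}" "l (i - 1) = x" "a i = c" using s xy by (auto simp: x_def y_def c_def)
    \<comment> \<open>Composition with \<open>proj H\<close> removes the identity summand of
      \<open>B\<close> again.\<close>
    have ext: "V' t o\<^sub>L ?T t o\<^sub>L V t = ?T x" if t: "t \<in> {x..y}" for t
    proof -
      have "V' t o\<^sub>L ?T t o\<^sub>L V t = (V' t o\<^sub>L B t o\<^sub>L V t) o\<^sub>L proj H"
        unfolding B_def by (rule transporter_extension[OF To[OF t] V(4)[OF t], symmetric])
      also have "\<dots> = B x o\<^sub>L proj H" by (simp only: V(5)[OF t])
      also have "\<dots> = ?T x"
        by (rule blinfun_eqI) (simp only: B_def blinfun_apply_blinfun_compose blinfun.add_left blinfun.diff_left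
            blinfun_apply_id_blinfun is_projD(2)[OF PH] opsD(1)[OF HS To[OF s'(2)], unfolded blinfun.add_left] diff_self add_0_right)
      finally show ?thesis .
    qed
    have "U' t o\<^sub>L ?T t o\<^sub>L U t = S' x o\<^sub>L (V' t o\<^sub>L ?T t o\<^sub>L V t) o\<^sub>L S x" if t: "t \<in> {x..y}" for t
      by (rule blinfun_eqI) (simp add: U2[OF t])
    then have "U' t o\<^sub>L ?T t o\<^sub>L U t = S' x o\<^sub>L ?T x o\<^sub>L S x" if t: "t \<in> {x..y}" for t
      using ext[OF t] t by simp
    then show ?thesis unfolding s'(3,4) using s'(1,2) by metis
  qed
  ultimately show ?case unfolding y_def by blast
qed

section \<open>Restriction to invariant subspaces\<close>

lemma hilbert_rep_restr:
  assumes K: "subspace K" "closed K" "K \<subseteq> H" "invariant G \<rho> K"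
  shows "hilbert_rep G X K (restr_action G K \<rho>)"
proof -
  let ?r = "restr_action G K \<rho>"
  have inv: "\<rho> g u \<in> K" if "g \<in> carrier G" "u \<in> K" for g u using K(4) that by (auto simp: invariant_def)
  have r: "?r g u = \<rho> g u" if "g \<in> carrier G" "u \<in> K" for g u
    using restr_op_apply[OF K(1,2) inv[OF that(1)] that(2)] that(1) by (simp add: restr_action_def)
  obtain D where D: "countable D" "D \<subseteq> H" "H \<subseteq> closure D" using HH by (auto simp: hilbert_def)
  \<comment> \<open>Separability passes to \<open>K\<close> by projecting a countable dense subset
    of \<open>H\<close>.\<close>
  have "proj K ` closure D \<subseteq> closure (proj K ` D)"
    by (rule image_closure_subset) (auto intro: continuous_intros closure_subset[THEN subsetD])
  moreover have "K \<subseteq> proj K ` closure D"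
  proof
    fix u assume u: "u \<in> K"
    then have "u \<in> closure D" "proj K u = u" using K(3) D(3) proj_ident[OF K(1,2) u] by auto
    then show "u \<in> proj K ` closure D" by (metis imageI)
  qed
  ultimately have "K \<subseteq> closure (proj K ` D)" by blast
  moreover have "countable (proj K ` D)" "proj K ` D \<subseteq> K" using D(1) proj_in[OF K(1,2)] by auto
  ultimately have hK: "hilbert K" unfolding hilbert_def using K(1,2) by blast
  have act: "\<rho> \<in> carrier G \<rightarrow>\<^sub>E ops H" "\<And>u. u \<in> H \<Longrightarrow> \<rho> \<one>\<^bsub>G\<^esub> u = u"
    "\<And>g h u. g \<in> carrier G \<Longrightarrow> h \<in> carrier G \<Longrightarrow> u \<in> H \<Longrightarrow> \<rho> (g \<otimes>\<^bsub>G\<^esub> h) u = \<rho> g (\<rho> h u)"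
    "\<And>g u v. g \<in> carrier G \<Longrightarrow> u \<in> H \<Longrightarrow> v \<in> H \<Longrightarrow> \<rho> g u \<bullet> \<rho> g v = u \<bullet> v"
    "continuous_map (prod_topology X (top_of_set H)) euclidean (\<lambda>(g, u). \<rho> g u)"
    using action by (auto simp: orthogonal_action_def)
  have one: "\<one>\<^bsub>G\<^esub> \<in> carrier G" using G by (simp add: group.is_monoid monoid.one_closed)
  have mult: "g \<otimes>\<^bsub>G\<^esub> h \<in> carrier G" if "g \<in> carrier G" "h \<in> carrier G" for g h
    using G that by (simp add: group.is_monoid monoid.m_closed)
  have "orthogonal_action G X K ?r"
    unfolding orthogonal_action_def
  proof (intro conjI ballI)
    show "?r \<in> carrier G \<rightarrow>\<^sub>E ops K"
      using restr_op_ops[OF K(1,2)] inv by (auto simp: restr_action_def)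
    show "?r \<one>\<^bsub>G\<^esub> u = u" if "u \<in> K" for u using r[OF one that] act(2) K(3) that by auto
    show "?r (g \<otimes>\<^bsub>G\<^esub> h) u = ?r g (?r h u)" if "g \<in> carrier G" "h \<in> carrier G" "u \<in> K" for g h u
      using that r[OF mult[OF that(1,2)] that(3)] r[OF that(2,3)] r[OF that(1) inv[OF that(2,3)]] act(3) K(3) by auto
    show "?r g u \<bullet> ?r g v = u \<bullet> v" if "g \<in> carrier G" "u \<in> K" "v \<in> K" for g u v
      using r[OF that(1,2)] r[OF that(1,3)] act(4)[OF that(1) subsetD[OF K(3) that(2)] subsetD[OF K(3) that(3)]] by simp
    have snd: "continuous_map (prod_topology X (top_of_set K)) (top_of_set H) snd"
    proof (rule continuous_map_into_subtopology)
      show "continuous_map (prod_topology X (top_of_set K)) euclidean snd"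
        by (rule continuous_map_into_fulltopology[OF continuous_map_snd])
    qed (use K(3) in auto)
    have "continuous_map (prod_topology X (top_of_set K)) (prod_topology X (top_of_set H)) (\<lambda>p. (fst p, snd p))"
      using snd by (intro continuous_map_pairedI continuous_map_fst) simp
    then have "continuous_map (prod_topology X (top_of_set K)) euclidean ((\<lambda>(g, u). \<rho> g u) \<circ> (\<lambda>p. (fst p, snd p)))"
      by (rule continuous_map_compose[OF _ act(5)])
    then show "continuous_map (prod_topology X (top_of_set K)) euclidean (\<lambda>(g, u). ?r g u)"
      by (rule continuous_map_eq) (auto simp: top r)
  qed
  then show ?thesis using hK by (simp add: hilbert_rep_def)
qed

lemma restr_action_apply:
  assumes K: "subspace K" "closed K" "invariant G \<rho> K" and g: "g \<in> carrier G" and u: "u \<in> K"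
  shows "restr_action G K \<rho> g u = \<rho> g u"
proof -
  have "restr_action G K \<rho> g = restr_op K (\<rho> g)" using g by (simp add: restr_action_def)
  then show ?thesis using restr_op_apply[OF K(1,2) _ u, of "\<rho> g"] K(3) g by (simp add: invariant_def)
qed

lemma RO_diff_restr:
  assumes K: "subspace K" "closed K" "invariant G \<rho> K" and VW: "V \<subseteq> K" "W \<subseteq> K"
  shows "RO_diff G X (restr_action G K \<rho>) V W = RO_diff G X \<rho> V W"
proof -
  have "matrix_form G X (restr_action G K \<rho>) U R \<longleftrightarrow> matrix_form G X \<rho> U R" if "U \<subseteq> K" for U R
    using matrix_form_cong[of G X _ U R] restr_action_apply[OF K] that by (metis subsetD)
  then show ?thesis using VW unfolding RO_diff_def by simp
qed

lemma E_neg_restr: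
  assumes K: "subspace K" "closed K" "\<And>u. u \<in> K \<Longrightarrow> blinfun_apply A u \<in> K"
  shows "E_neg K (restr_op K A) = E_neg K A"
proof -
  have "{u \<in> K. restr_op K A u = c *\<^sub>R u} = {u \<in> K. A u = c *\<^sub>R u}" for c
    using restr_op_apply[OF K] by auto
  then show ?thesis by (simp add: E_neg_def)
qed

lemma restr_op_commutes:
  assumes K: "subspace K" "closed K" "K \<subseteq> H" "invariant G \<rho> K"
    and A: "adj A A" "commutes symm A" "\<And>u. u \<in> K \<Longrightarrow> A u \<in> K"
  shows "restr_op K A \<in> ops K" "adj (restr_op K A) (restr_op K A)"
    "g \<in> carrier G \<Longrightarrow> u \<in> K \<Longrightarrow>
      restr_op K A (restr_action G K \<rho> g u) = restr_action G K \<rho> g (restr_op K A u)"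
proof -
  have P: "is_proj (proj K)" by (rule is_proj_proj[OF K(1,2)])
  show "restr_op K A \<in> ops K" by (rule restr_op_ops[OF K(1,2) A(3)])
  have "comm A (proj K)" by (rule proj_comm[OF K(1,2) A(1) A(3) A(3)])
  moreover have "adj (A o\<^sub>L proj K) (proj K o\<^sub>L A)" by (intro adj_intros A is_projD(1)[OF P])
  ultimately have "adj (A o\<^sub>L proj K) (A o\<^sub>L proj K)" by (simp add: comm_def)
  then show "adj (restr_op K A) (restr_op K A)" by (simp add: restr_op_eq[OF K(1,2) A(3)])
  assume g: "g \<in> carrier G" and u: "u \<in> K"
  have "\<rho> g u \<in> K" using K(4) g u by (auto simp: invariant_def)
  then show "restr_op K A (restr_action G K \<rho> g u) = restr_action G K \<rho> g (restr_op K A u)"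
    using restr_action_apply[OF K(1,2,4) g] u A(3)[OF u] commD[OF commutes_rho[OF A(2) g], of u]
    by (simp add: restr_op_apply[OF K(1,2) A(3)])
qed

section \<open>Consequences of the four axioms\<close>

context
  fixes \<mu> :: "'h set \<Rightarrow> ('g \<Rightarrow> 'h \<Rightarrow>\<^sub>L 'h) \<Rightarrow> (real \<Rightarrow> 'h \<Rightarrow>\<^sub>L 'h) \<Rightarrow> ('g rep \<times> 'g rep) set"
  assumes Z: "\<And>K \<sigma> L. hilbert_rep G X K \<sigma> \<Longrightarrow>
      L \<in> \<Omega> (FS_G G K \<sigma>) (GL K \<inter> FS_G G K \<sigma>) \<Longrightarrow>
      (\<forall>l\<in>{0..1}. L l \<in> GL K \<inter> FS_G G K \<sigma>) \<Longrightarrow> \<mu> K \<sigma> L = \<zero>\<^bsub>RO G X\<^esub>"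
    and A: "\<And>K \<sigma> H\<^sub>1 H\<^sub>2 L. hilbert_rep G X K \<sigma> \<Longrightarrow>
      subspace H\<^sub>1 \<Longrightarrow> closed H\<^sub>1 \<Longrightarrow> subspace H\<^sub>2 \<Longrightarrow> closed H\<^sub>2 \<Longrightarrow>
      (\<forall>u\<in>H\<^sub>1. \<forall>v\<in>H\<^sub>2. u \<bullet> v = 0) \<Longrightarrow> K = {u + v | u v. u \<in> H\<^sub>1 \<and> v \<in> H\<^sub>2} \<Longrightarrow>
      invariant G \<sigma> H\<^sub>1 \<Longrightarrow> invariant G \<sigma> H\<^sub>2 \<Longrightarrow>
      L \<in> \<Omega> (FS_G G K \<sigma>) (GL K \<inter> FS_G G K \<sigma>) \<Longrightarrow>
      (\<forall>l\<in>{0..1}. blinfun_apply (L l) ` H\<^sub>1 \<subseteq> H\<^sub>1 \<and> blinfun_apply (L l) ` H\<^sub>2 \<subseteq> H\<^sub>2) \<Longrightarrow>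
      \<mu> K \<sigma> L = \<mu> H\<^sub>1 (restr_action G H\<^sub>1 \<sigma>) (restr_path H\<^sub>1 L)
                 \<oplus>\<^bsub>RO G X\<^esub> \<mu> H\<^sub>2 (restr_action G H\<^sub>2 \<sigma>) (restr_path H\<^sub>2 L)"
    and Hom: "\<And>K \<sigma> (h :: real \<times> real \<Rightarrow> 'h \<Rightarrow>\<^sub>L 'h). hilbert_rep G X K \<sigma> \<Longrightarrow>
      h \<in> {0..1} \<times> {0..1} \<rightarrow> FS_G G K \<sigma> \<Longrightarrow> continuous_on ({0..1} \<times> {0..1}) h \<Longrightarrow>
      (\<forall>s\<in>{0..1}. h (s, 0) \<in> GL K \<and> h (s, 1) \<in> GL K) \<Longrightarrow>
      \<mu> K \<sigma> (\<lambda>l\<in>{0..1}. h (0, l)) = \<mu> K \<sigma> (\<lambda>l\<in>{0..1}. h (1, l))"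
    and M: "\<And>K \<sigma> L. hilbert_rep G X K \<sigma> \<Longrightarrow> finite_dim K \<Longrightarrow>
      L \<in> \<Omega> (FS_G G K \<sigma>) (GL K \<inter> FS_G G K \<sigma>) \<Longrightarrow>
      \<mu> K \<sigma> L = RO_diff G X \<sigma> (E_neg K (L 0)) (E_neg K (L 1))"
begin

text \<open>Congruence by a two-parameter family is itself an admissible homotopy: it preserves
  Fredholm operators everywhere and invertibility at the ends, and \<open>S'\<close> is continuous
  because adjoints depend continuously on the operator.\<close>

lemma mu_congruence:
  assumes L: "\<And>s. s \<in> {0..1} \<Longrightarrow> L s \<in> FS_G G H \<rho>" "continuous_on {0..1} L" "L 0 \<in> GL H" "L 1 \<in> GL H"
    and S: "continuous_on ({0..1::real} \<times> {0..1::real}) S"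
      "\<And>p. p \<in> {0..1} \<times> {0..1} \<Longrightarrow> transporter symm (S p) (S' p)"
  shows "\<mu> H \<rho> (\<lambda>l\<in>{0..1}. S' (0, l) o\<^sub>L L l o\<^sub>L S (0, l)) = \<mu> H \<rho> (\<lambda>l\<in>{0..1}. S' (1, l) o\<^sub>L L l o\<^sub>L S (1, l))"
proof -
  define h where "h p = S' p o\<^sub>L L (snd p) o\<^sub>L S p" for p
  have S': "continuous_on ({0..1} \<times> {0..1}) S'"
    using S(2) by (intro continuous_on_adj[OF S(1)]) (simp add: transporter_def)
  have "continuous_on ({0..1} \<times> {0..1}) (\<lambda>p. L (snd p))"
    by (intro continuous_on_compose2[OF L(2)] continuous_intros) auto
  then have "continuous_on ({0..1} \<times> {0..1}) h"
    unfolding h_def by (intro continuous_on_blinfun_compose S(1) S')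
  moreover have "h \<in> {0..1} \<times> {0..1} \<rightarrow> FS_G G H \<rho>"
    unfolding h_def using FS_G_congruence[OF L(1) S(2)] by auto
  moreover have "\<forall>s\<in>{0..1}. h (s, 0) \<in> GL H \<and> h (s, 1) \<in> GL H"
    unfolding h_def using GL_congruence[OF L(1) _ S(2)] L(3,4) by auto
  ultimately have "\<mu> H \<rho> (\<lambda>l\<in>{0..1}. h (0, l)) = \<mu> H \<rho> (\<lambda>l\<in>{0..1}. h (1, l))" by (intro Hom[OF HR])
  then show ?thesis by (simp add: h_def)
qed

text \<open>A selfadjoint \<open>K s\<close> with range in \<open>F\<close> vanishes on the
  complement \<open>F2\<close>, so the path there is the constant involution given by
  \<open>J\<close>, to which \<open>Z\<close> applies; \<open>M\<close> evaluates the part on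
  \<open>F\<close>.\<close>

lemma mu_finite_rank:
  assumes J: "J \<in> ops H" "adj J J" "commutes symm J" "J o\<^sub>L J = proj H"
    and F: "subspace F" "finite_dim F" "F \<subseteq> H" "invariant G \<rho> F" "\<And>u. u \<in> F \<Longrightarrow> J u \<in> F"
    and K: "continuous_on {0..1} K" "\<And>s. s \<in> {0..1} \<Longrightarrow> K s \<in> ops H" "\<And>s. s \<in> {0..1} \<Longrightarrow> adj (K s) (K s)"
      "\<And>s. s \<in> {0..1} \<Longrightarrow> commutes symm (K s)" "\<And>s u. s \<in> {0..1} \<Longrightarrow> K s u \<in> F"
    and ends: "J + K 0 \<in> GL H" "J + K 1 \<in> GL H"
  shows "\<mu> H \<rho> (\<lambda>s\<in>{0..1::real}. J + K s) = RO_diff G X \<rho> (E_neg F (J + K 0)) (E_neg F (J + K 1))"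
proof -
  define L where "L = (\<lambda>s\<in>{0..1::real}. J + K s)"
  have Ls: "L s = J + K s" if "s \<in> {0..1}" for s using that by (simp add: L_def)
  have fr: "finite_dim (range (blinfun_apply (K s)))" if "s \<in> {0..1}" for s
    by (rule finite_dim_subset[OF F(2)]) (use K(5)[OF that] in auto)
  have LFS: "J + K s \<in> FS_G G H \<rho>" if s: "s \<in> {0..1}" for s
    by (rule finite_rank_FS_G[OF J K(2-4)[OF s] fr[OF s]])
  note Ld = FS_G_D[OF LFS]
  have Lcont: "continuous_on {0..1} L"
    using K(1) by (subst continuous_on_cong[OF refl Ls]) (auto intro: continuous_intros)
  have L: "L \<in> \<Omega> (FS_G G H \<rho>) (GL H \<inter> FS_G G H \<rho>)"
    unfolding \<Omega>_def using Lcont LFS ends by (auto simp: L_def)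
  have Fc: "closed F" by (rule finite_dim_closed[OF F(1,2)])
  let ?Q = "proj F"
  have Q: "is_proj ?Q" by (rule is_proj_proj[OF F(1) Fc])
  define F2 where "F2 = {u \<in> H. ?Q u = 0}"
  have F2: "subspace F2" "closed F2" "F2 \<subseteq> H" "invariant G \<rho> F2"
  proof -
    have "F2 = H \<inter> {u. ?Q u = 0}" by (auto simp: F2_def)
    then show "subspace F2" "closed F2" "F2 \<subseteq> H"
      using HS subspace_kernel[of ?Q] closed_kernel[of ?Q] by (auto simp: subspace_inter closed_Int)
    show "invariant G \<rho> F2"
      unfolding F2_def by (rule invariant_kernel[OF commutes_proj[OF F(1) Fc F(3,4)] invariant_H])
  qed
  have JQ: "J (?Q u) = ?Q (J u)" for u using F(5) by (intro commD proj_comm[OF F(1) Fc J(2)])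
  have JJ: "J (J u) = proj H u" for u using J(4) by (metis blinfun_apply_blinfun_compose)
  have KF2: "K s u = 0" if "s \<in> {0..1}" "u \<in> F2" for s u
  proof -
    have "K s u \<bullet> K s u = u \<bullet> K s (K s u)" by (rule adjD[OF K(3)[OF that(1)]])
    also have "\<dots> = u \<bullet> ?Q (K s (K s u))" by (simp add: proj_ident[OF F(1) Fc K(5)[OF that(1)]])
    also have "\<dots> = ?Q u \<bullet> K s (K s u)" by (simp add: is_projD(3)[OF Q])
    also have "\<dots> = 0" using that(2) by (simp add: F2_def)
    finally show ?thesis by simp
  qed
  have LF: "(J + K s) u \<in> F" if "s \<in> {0..1}" "u \<in> F" for s u
    using K(5)[OF that(1)] F(5)[OF that(2)] F(1) by (simp add: bl subspace_add)
  have JF2: "J u \<in> F2" if "u \<in> F2" for u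
    using that JQ[of u] opsD(3)[OF HS J(1)] by (simp add: F2_def bl)
  have LF2: "(J + K s) u \<in> F2" if "s \<in> {0..1}" "u \<in> F2" for s u
    using JF2[OF that(2)] KF2[OF that] by (simp add: bl)
  have split: "\<mu> H \<rho> L = \<mu> F (restr_action G F \<rho>) (restr_path F L)
    \<oplus>\<^bsub>RO G X\<^esub> \<mu> F2 (restr_action G F2 \<rho>) (restr_path F2 L)"
  proof (rule A[OF HR F(1) Fc F2(1,2) _ _ F(4) F2(4) L])
    show "\<forall>u\<in>F. \<forall>v\<in>F2. u \<bullet> v = 0"
    proof (intro ballI)
      fix u v assume "u \<in> F" "v \<in> F2"
      then show "u \<bullet> v = 0" using is_projD(3)[OF Q, of u v] proj_ident[OF F(1) Fc] by (simp add: F2_def)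
    qed
    show "H = {u + v | u v. u \<in> F \<and> v \<in> F2}"
    proof (intro equalityI subsetI)
      fix u assume u: "u \<in> H"
      have "?Q u \<in> F" by (rule proj_in[OF F(1) Fc])
      moreover have "u - ?Q u \<in> F2"
        using u \<open>?Q u \<in> F\<close> F(3) HS(1) by (auto simp: F2_def bl is_projD(2)[OF Q] intro: subspace_diff)
      ultimately show "u \<in> {u + v | u v. u \<in> F \<and> v \<in> F2}"
        by (intro CollectI exI[of _ "?Q u"] exI[of _ "u - ?Q u"]) simp
    qed (use F(3) F2(3) HS(1) in \<open>auto intro: subspace_add\<close>)
    show "\<forall>l\<in>{0..1}. blinfun_apply (L l) ` F \<subseteq> F \<and> blinfun_apply (L l) ` F2 \<subseteq> F2"
      using LF LF2 by (auto simp: Ls)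
  qed
  have HF: "hilbert_rep G X F (restr_action G F \<rho>)" by (rule hilbert_rep_restr[OF F(1) Fc F(3,4)])
  have HF2: "hilbert_rep G X F2 (restr_action G F2 \<rho>)" by (rule hilbert_rep_restr[OF F2])
  have r1: "restr_path F L s = restr_op F (J + K s)" if "s \<in> {0..1}" for s
    using that by (simp add: restr_path_def Ls)
  have r2: "restr_path F2 L s = restr_op F2 J" if "s \<in> {0..1}" for s
    using that KF2 by (simp add: restr_path_def Ls restr_op_eq[OF F2(1,2) LF2] restr_op_eq[where T = J, OF F2(1,2) JF2])
      (intro blinfun_eqI, simp add: bl proj_in[OF F2(1,2)])
  have R2: "restr_op F2 J \<in> ops F2" "adj (restr_op F2 J) (restr_op F2 J)"
    "\<And>g u. g \<in> carrier G \<Longrightarrow> u \<in> F2 \<Longrightarrow>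
      restr_op F2 J (restr_action G F2 \<rho> g u) = restr_action G F2 \<rho> g (restr_op F2 J u)"
    using restr_op_commutes[where A = J, OF F2 J(2,3) JF2] by blast+
  have J2: "restr_op F2 J \<in> GL F2 \<inter> FS_G G F2 (restr_action G F2 \<rho>)"
  proof -
    have "1 * norm u \<le> norm (restr_op F2 J u)" if u: "u \<in> F2" for u
    proof -
      have "J u \<bullet> J u = u \<bullet> J (J u)" by (rule adjD[OF J(2)])
      also have "\<dots> = u \<bullet> u" using u F2(3) by (auto simp: JJ proj_ident[OF HS])
      finally show ?thesis using restr_op_apply[where T = J, OF F2(1,2) JF2 u] by (simp add: norm_eq_sqrt_inner)
    qed
    then have "restr_op F2 J \<in> GL F2" "restr_op F2 J \<in> FS F2"
      using GL_I[OF F2(1,2) R2(1,2), of 1] FS_bounded_below[OF F2(1,2) R2(1,2), of 1] by auto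
    then show ?thesis using R2(3) by (simp add: FS_G_def)
  qed
  have "restr_path F2 L \<in> \<Omega> (FS_G G F2 (restr_action G F2 \<rho>)) (GL F2 \<inter> FS_G G F2 (restr_action G F2 \<rho>))"
  proof -
    have "continuous_on {0..1} (restr_path F2 L)"
      by (subst continuous_on_cong[OF refl r2]) (auto intro: continuous_on_const)
    then show ?thesis using J2 r2 unfolding \<Omega>_def by (auto simp: restr_path_def PiE_def)
  qed
  then have 2: "\<mu> F2 (restr_action G F2 \<rho>) (restr_path F2 L) = \<zero>\<^bsub>RO G X\<^esub>"
    using J2 r2 by (intro Z[OF HF2]) auto
  have R1: "restr_op F (J + K s) \<in> ops F" "adj (restr_op F (J + K s)) (restr_op F (J + K s))"
    "restr_op F (J + K s) \<in> FS_G G F (restr_action G F \<rho>)" if s: "s \<in> {0..1}" for s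
  proof -
    have R: "restr_op F (J + K s) \<in> ops F" "adj (restr_op F (J + K s)) (restr_op F (J + K s))"
      "\<And>g u. g \<in> carrier G \<Longrightarrow> u \<in> F \<Longrightarrow> restr_op F (J + K s) (restr_action G F \<rho> g u) =
        restr_action G F \<rho> g (restr_op F (J + K s) u)"
      using restr_op_commutes[where A = "J + K s", OF F(1) Fc F(3,4) Ld(2,3)[OF s] LF[OF s]] by blast+
    show "restr_op F (J + K s) \<in> ops F" "adj (restr_op F (J + K s)) (restr_op F (J + K s))" by (fact R)+
    have "restr_op F (J + K s) \<in> FS F"
    proof (rule FS_I[OF F(1) Fc R(1,2)])
      show "finite_dim {u \<in> F. restr_op F (J + K s) u = 0}" by (rule finite_dim_subset[OF F(2)]) auto
      show "closed (blinfun_apply (restr_op F (J + K s)) ` F)"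
        by (intro finite_dim_closed subspace_range F finite_dim_image linear_blinfun)
    qed
    then show "restr_op F (J + K s) \<in> FS_G G F (restr_action G F \<rho>)" using R(3) by (simp add: FS_G_def)
  qed
  have GLF: "restr_op F (J + K s) \<in> GL F" if s: "s \<in> {0..1}" and inv: "J + K s \<in> GL H" for s
  proof -
    obtain c where c: "c > 0" "\<And>u. u \<in> H \<Longrightarrow> c * norm u \<le> norm ((J + K s) u)" using GL_bounded_below[OF inv] by metis
    show ?thesis
      by (rule GL_I[OF F(1) Fc R1(1,2)[OF s] c(1)])
        (use c(2) F(3) in \<open>auto simp: restr_op_apply[OF F(1) Fc LF[OF s]]\<close>)
  qed
  have Q1: "restr_path F L s = (J + K s) o\<^sub>L ?Q" if "s \<in> {0..1}" for s
    using r1[OF that] restr_op_eq[OF F(1) Fc LF[OF that]] by simp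
  have "continuous_on {0..1} (restr_path F L)"
    using K(1) by (subst continuous_on_cong[OF refl Q1])
      (auto intro!: continuous_on_blinfun_compose continuous_intros)
  then have "restr_path F L \<in> \<Omega> (FS_G G F (restr_action G F \<rho>)) (GL F \<inter> FS_G G F (restr_action G F \<rho>))"
    using R1(3) GLF[OF _ ends(1)] GLF[OF _ ends(2)] r1 unfolding \<Omega>_def by (auto simp: restr_path_def PiE_def)
  then have 1: "\<mu> F (restr_action G F \<rho>) (restr_path F L) =
      RO_diff G X (restr_action G F \<rho>) (E_neg F (J + K 0)) (E_neg F (J + K 1))"
    using M[OF HF F(2)] E_neg_restr[OF F(1) Fc LF[of 0]] E_neg_restr[OF F(1) Fc LF[of 1]] by (simp add: r1)
  have z: "(0::real) \<in> {0..1}" "(1::real) \<in> {0..1}" by auto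
  note E = E_neg_subset[OF F(1,2) Ld(2)[OF z(1)] LF[OF z(1)]] E_neg_subset[OF F(1,2) Ld(2)[OF z(2)] LF[OF z(2)]]
  have e: "RO_diff G X (restr_action G F \<rho>) (E_neg F (J + K 0)) (E_neg F (J + K 1)) =
      RO_diff G X \<rho> (E_neg F (J + K 0)) (E_neg F (J + K 1))"
    by (rule RO_diff_restr[OF F(1) Fc F(4) E(2,6)])
  have form: "\<exists>R. matrix_form G X \<rho> (E_neg F (J + K s)) R" if s: "s \<in> {0..1}" for s
    using E_neg_subset[OF F(1,2) Ld(2)[OF s] LF[OF s]] comm_proj_E_neg(1)[OF F(1-4) Ld(2,3)[OF s] LF[OF s]] F(3)
    by (meson matrix_form_exists[OF action G top] order_trans)
  obtain R R' where "matrix_form G X \<rho> (E_neg F (J + K 0)) R" "matrix_form G X \<rho> (E_neg F (J + K 1)) R'"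
    using form[OF z(1)] form[OF z(2)] by blast
  then have "RO_diff G X \<rho> (E_neg F (J + K 0)) (E_neg F (J + K 1)) \<in> carrier (RO G X)"
    by (simp add: RO_diff_eq[OF G top] class_diff_in[OF G top] matrix_form_rep)
  then have "\<mu> H \<rho> L = RO_diff G X \<rho> (E_neg F (J + K 0)) (E_neg F (J + K 1))"
    using split unfolding 1 2 e by (simp add: abelian_monoid.r_zero[OF abelian_monoid_RO[OF G top]])
  then show ?thesis by (simp add: L_def)
qed

lemma mu_eq_sum:
  assumes L: "L \<in> \<Omega> (FS_G G H \<rho>) (GL H \<inter> FS_G G H \<rho>)" and sf: "sf_data H L N l a"
  shows "\<mu> H \<rho> L = (\<Oplus>\<^bsub>RO G X\<^esub>i\<in>{1..N}. RO_diff G X \<rho> (spectral_space H (L (l i)) 0 (a i))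
                                        (spectral_space H (L (l (i - 1))) 0 (a i)))"
proof -
  have LFS: "L s \<in> FS_G G H \<rho>" if "s \<in> {0..1}" for s using L that by (auto simp: \<Omega>_def)
  have Lc: "continuous_on {0..1} L" and L0: "L 0 \<in> GL H" and L1: "L 1 \<in> GL H" and Le: "L = (\<lambda>l\<in>{0..1}. L l)"
    using L by (auto simp: \<Omega>_def PiE_def extensional_restrict)
  note Ld = FS_G_D[OF LFS]
  have z: "(0::real) \<in> {0..1}" "(1::real) \<in> {0..1}" by auto
  have sfl: "l 0 = 0" "l N = 1" "\<And>i. i < N \<Longrightarrow> l i < l (Suc i)" using sf by (auto simp: sf_data_def)
  have mono: "l i \<le> l j" if "i \<le> j" "j \<le> N" for i j using partition_mono[of N l] sfl(3) that by blast
  have l01: "l i \<in> {0..1}" if "i \<le> N" for i using mono[of 0 i] mono[of i N] sfl that by auto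
  have pa: "a i > 0" "continuous_on {l (i - 1)..l i} (\<lambda>s. spectral_proj H (- a i) (a i) (L s))"
    "\<And>s. s \<in> {l (i - 1)..l i} \<Longrightarrow> finite_dim (spectral_space H (L s) (- a i) (a i))" if "i \<in> {1..N}" for i
    using sf that by (auto simp: sf_data_def)
  have piece: "s \<in> {0..1}" if "i \<in> {1..N}" "s \<in> {l (i - 1)..l i}" for i s
  proof -
    have "i - 1 \<le> N" "i \<le> N" using that(1) by auto
    then show ?thesis using l01[of "i - 1"] l01[of i] that(2) by auto
  qed
  obtain J S S' where J: "J \<in> ops H" "adj J J" "commutes symm J" "J o\<^sub>L J = proj H"
    and S: "continuous_on {0..1::real} S" "S 0 = id_blinfun" "S' 0 = id_blinfun"
    "\<And>s. s \<in> {0..1} \<Longrightarrow> transporter symm (S s) (S' s)" "S' 1 o\<^sub>L L 0 o\<^sub>L S 1 = J"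
    by (rule sign_transporter[OF LFS[OF z(1)] L0]) (rule that)
  obtain V V' where V: "continuous_on {0..1} V" "V 0 = S 1" "V' 0 = S' 1"
    "\<And>s. s \<in> {0..1} \<Longrightarrow> transporter symm (V s) (V' s)"
    "\<And>i s. i \<in> {1..N} \<Longrightarrow> s \<in> {l (i - 1)..l i} \<Longrightarrow>
      V' s o\<^sub>L (L s + (2 * a i) *\<^sub>R spectral_proj H (- a i) (a i) (L s)) o\<^sub>L V s =
      V' (l (i - 1)) o\<^sub>L (L (l (i - 1)) + (2 * a i) *\<^sub>R spectral_proj H (- a i) (a i) (L (l (i - 1)))) o\<^sub>L V (l (i - 1))"
    using partition_transporter[OF LFS Lc sf S(4)[OF z(2)] order_refl] unfolding sfl(2) by blast
  have V': "continuous_on {0..1} V'" using V(4) by (intro continuous_on_adj[OF V(1)]) (simp add: transporter_def)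
  have "\<mu> H \<rho> (\<lambda>s\<in>{0..1}. S' 0 o\<^sub>L L s o\<^sub>L S 0) = \<mu> H \<rho> (\<lambda>s\<in>{0..1}. S' 1 o\<^sub>L L s o\<^sub>L S 1)"
  proof -
    have "continuous_on ({0..1} \<times> {0..1::real}) (\<lambda>p. S (fst p))"
      by (intro continuous_on_compose2[OF S(1)] continuous_intros) auto
    moreover have "transporter symm (S (fst p)) (S' (fst p))" if "p \<in> {0..1} \<times> {0..1::real}" for p
      using that by (intro S(4)) auto
    ultimately show ?thesis
      using mu_congruence[OF LFS Lc L0 L1, of "\<lambda>p. S (fst p)" "\<lambda>p. S' (fst p)"] by simp
  qed
  moreover have "(\<lambda>s\<in>{0..1}. S' 0 o\<^sub>L L s o\<^sub>L S 0) = L"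
    by (subst (2) Le) (auto simp: S(2,3) intro!: restrict_ext blinfun_eqI)
  moreover have "\<mu> H \<rho> (\<lambda>s\<in>{0..1}. V' 0 o\<^sub>L L s o\<^sub>L V 0) = \<mu> H \<rho> (\<lambda>s\<in>{0..1}. V' s o\<^sub>L L s o\<^sub>L V s)"
  proof -
    \<comment> \<open>Multiplying the path parameter by the homotopy parameter contracts the path of
      transporters to its initial value \<open>S 1\<close>.\<close>
    have m: "fst p * snd p \<in> {0..1}" if "p \<in> {0..1} \<times> {0..1::real}" for p
      using that by (auto simp: mult_le_one)
    have "continuous_on ({0..1} \<times> {0..1}) (\<lambda>p. V (fst p * snd p))"
      using m by (intro continuous_on_compose2[OF V(1)] continuous_intros) auto
    from mu_congruence[OF LFS Lc L0 L1 this V(4)[OF m]] show ?thesis by simp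
  qed
  ultimately have mu1: "\<mu> H \<rho> L = \<mu> H \<rho> (\<lambda>s\<in>{0..1}. V' s o\<^sub>L L s o\<^sub>L V s)" by (simp add: V(2,3))
  define T where "T s = V' s o\<^sub>L L s o\<^sub>L V s" for s
  define K where "K s = T s - J" for s
  have Td: "T s \<in> ops H" "adj (T s) (T s)" "commutes symm (T s)" if "s \<in> {0..1}" for s
    unfolding T_def using transporter_congruence_ops[OF Ld(1-3)[OF that] V(4)[OF that]] by auto
  have TGL: "T 0 \<in> GL H" "T 1 \<in> GL H"
    unfolding T_def using GL_congruence[OF LFS _ V(4)] L0 L1 z by auto
  have T0: "T 0 = J" unfolding T_def V(2,3) by (rule S(5))
  have Tc: "continuous_on {0..1} T"
    unfolding T_def by (intro continuous_on_blinfun_compose V(1) V' Lc)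
  have TK: "T s = J + K s" for s by (simp add: K_def)
  have Ko: "K s \<in> ops H" and Ka: "adj (K s) (K s)" and Kc: "commutes symm (K s)" if s: "s \<in> {0..1}" for s
  proof -
    show "K s \<in> ops H"
      unfolding K_def using opsD[OF HS Td(1)[OF s]] opsD[OF HS J(1)] HS(1)
      by (intro opsI[OF HS]) (auto simp: bl intro!: subspace_diff)
    show "adj (K s) (K s)" unfolding K_def by (intro adj_intros Td[OF s] J)
    show "commutes symm (K s)" unfolding K_def by (intro commutes_intros Td[OF s] J)
  qed
  define P where "P i s = V' s o\<^sub>L spectral_proj H (- a i) (a i) (L s) o\<^sub>L V s" for i s
  have P: "P i s \<in> ops H" "commutes symm (P i s)" "finite_dim (range (blinfun_apply (P i s)))"
    if i: "i \<in> {1..N}" and s: "s \<in> {l (i - 1)..l i}" for i s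
  proof -
    have s': "s \<in> {0..1}" by (rule piece[OF i s])
    note d = Ld(1-3)[OF s']
    have "adj (spectral_proj H (- a i) (a i) (L s)) (spectral_proj H (- a i) (a i) (L s))"
      using pa(1)[OF i] by (intro is_projD(1)[OF is_proj_spectral_proj[OF HS d(1,2)]]) auto
    note c = transporter_congruence_ops[OF spectral_proj_ops[OF HS d(1,2)] this commutes_spectral_proj[OF d] V(4)[OF s']]
    show "P i s \<in> ops H" "commutes symm (P i s)" unfolding P_def by (rule c)+
    have "finite_dim (blinfun_apply (V' s) ` range (blinfun_apply (spectral_proj H (- a i) (a i) (L s))))"
      by (rule finite_dim_image[OF linear_blinfun pa(3)[OF i s, unfolded spectral_space_range[OF d(1,2)]]])
    then show "finite_dim (range (blinfun_apply (P i s)))"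
      by (rule finite_dim_subset) (auto simp: P_def)
  qed
  have TC: "T s + (2 * a i) *\<^sub>R P i s = T (l (i - 1)) + (2 * a i) *\<^sub>R P i (l (i - 1))"
    if i: "i \<in> {1..N}" and s: "s \<in> {l (i - 1)..l i}" for i s
  proof -
    have "T s + (2 * a i) *\<^sub>R P i s = V' s o\<^sub>L (L s + (2 * a i) *\<^sub>R spectral_proj H (- a i) (a i) (L s)) o\<^sub>L V s" for s
      by (rule blinfun_eqI) (simp add: T_def P_def bl)
    then show ?thesis using V(5)[OF i s] by simp
  qed
  have li: "l (i - 1) \<in> {l (i - 1)..l i}" "l i \<in> {l (i - 1)..l i}" if "i \<in> {1..N}" for i
    using mono[of "i - 1" i] that by auto
  \<comment> \<open>By \<open>TC\<close>, on one piece the operators \<open>T s\<close> differ only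
    by multiples of the finite-rank \<open>P\<close>. Starting from \<open>K 0 = 0\<close>, finite
    rank passes from each partition point to the piece after it.\<close>
  have fr: "\<forall>s\<in>{0..l k}. finite_dim (range (blinfun_apply (K s)))" if "k \<le> N" for k
    using that
  proof (induction k)
    case 0
    have "K 0 = 0" by (simp add: K_def T0)
    moreover have "finite_dim {0::'h}" unfolding finite_dim_def by (intro exI[of _ "{}"]) simp
    ultimately show ?case using sfl(1) by (auto simp: image_constant_conv)
  next
    case (Suc k)
    show ?case
    proof
      fix s assume s: "s \<in> {0..l (Suc k)}"
      show "finite_dim (range (blinfun_apply (K s)))"
      proof (cases "s \<le> l k")
        case True
        then show ?thesis using Suc s by auto
      next
        case False
        have i: "Suc k \<in> {1..N}" using Suc.prems by auto
        have s': "s \<in> {l (Suc k - 1)..l (Suc k)}" "l k \<in> {l (Suc k - 1)..l (Suc k)}" using s False li[OF i] by auto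
        have k0: "l k \<in> {0..l k}" using l01[of k] Suc.prems by auto
        have "K s = K (l k) + (2 * a (Suc k)) *\<^sub>R P (Suc k) (l k) - (2 * a (Suc k)) *\<^sub>R P (Suc k) s"
          using TC[OF i s'(1)] by (simp add: K_def algebra_simps)
        then have "range (blinfun_apply (K s)) \<subseteq> {v + w | v w. v \<in> range (blinfun_apply (K (l k))) \<and>
            w \<in> {v + w | v w. v \<in> range (blinfun_apply (P (Suc k) (l k))) \<and> w \<in> range (blinfun_apply (P (Suc k) s))}}"
        proof (intro subsetI)
          fix y assume y: "y \<in> range (blinfun_apply (K s))" and e: "K s = K (l k) + (2 * a (Suc k)) *\<^sub>R P (Suc k) (l k) - (2 * a (Suc k)) *\<^sub>R P (Suc k) s"
          then obtain u where "y = K s u" by blast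
          then have "y = K (l k) u + (P (Suc k) (l k) ((2 * a (Suc k)) *\<^sub>R u) + P (Suc k) s (- ((2 * a (Suc k)) *\<^sub>R u)))"
            unfolding e by (simp add: bl)
          then show "y \<in> {v + w | v w. v \<in> range (blinfun_apply (K (l k))) \<and>
            w \<in> {v + w | v w. v \<in> range (blinfun_apply (P (Suc k) (l k))) \<and> w \<in> range (blinfun_apply (P (Suc k) s))}}" by blast
        qed
        moreover have "finite_dim (range (blinfun_apply (K (l k))))" using Suc k0 by simp
        ultimately show ?thesis
          by (rule finite_dim_subset[OF finite_dim_sum[OF _ finite_dim_sum[OF P(3)[OF i s'(2)] P(3)[OF i s'(1)]]], rotated])
      qed
    qed
  qed
  have Kf: "finite_dim (range (blinfun_apply (K s)))" if "s \<in> {0..1}" for s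
    using fr[OF order_refl] that sfl(2) by simp
  \<comment> \<open>Only partition points enter, which keeps the family finite. The transported
    projections are taken at both ends of each piece, as \<open>piece_class\<close> requires them to
    map into \<open>F\<close>.\<close>
  define \<A> where "\<A> = (\<lambda>i. K (l i)) ` {..N} \<union> (\<lambda>i. P i (l (i - 1))) ` {1..N} \<union> (\<lambda>i. P i (l i)) ` {1..N}"
  have \<A>fin: "finite \<A>" by (simp add: \<A>_def)
  have \<A>: "B \<in> ops H \<and> commutes symm B \<and> finite_dim (range (blinfun_apply B))" if B: "B \<in> \<A>" for B
  proof -
    consider i where "i \<le> N" "B = K (l i)" | i s where "i \<in> {1..N}" "s \<in> {l (i - 1)..l i}" "B = P i s"
      using B li unfolding \<A>_def by blast
    then show ?thesis
    proof cases
      case 1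
      show ?thesis unfolding 1(2) using Ko Kc Kf l01[OF 1(1)] by simp
    next
      case 2
      show ?thesis unfolding 2(3) using P[OF 2(1,2)] by simp
    qed
  qed
  obtain F where F: "subspace F" "finite_dim F" "F \<subseteq> H" "invariant G \<rho> F" "\<And>u. u \<in> F \<Longrightarrow> J u \<in> F"
    and \<A>F: "\<And>B u. B \<in> \<A> \<Longrightarrow> blinfun_apply B u \<in> F"
    by (rule invariant_hull[OF \<A>fin \<A> J(1,3,4)]) (assumption, rule that)
  have KF: "K (l i) u \<in> F" if "i \<le> N" for i u using that by (intro \<A>F) (auto simp: \<A>_def)
  have PF: "P i (l (i - 1)) u \<in> F" "P i (l i) u \<in> F" if "i \<in> {1..N}" for i u
    using that by (auto simp: \<A>_def intro!: \<A>F)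
  have TF: "T (l i) u \<in> F" if "i \<le> N" "u \<in> F" for i u
    unfolding TK using KF[OF that(1)] F(5)[OF that(2)] F(1) by (simp add: bl subspace_add)
  have Fc: "closed F" by (rule finite_dim_closed[OF F(1,2)])
  let ?Q = "proj F"
  have Q: "is_proj ?Q" by (rule is_proj_proj[OF F(1) Fc])
  have Qc: "commutes symm ?Q" by (rule commutes_proj[OF F(1) Fc F(3,4)])
  \<comment> \<open>At partition points this compression changes nothing, since
    \<open>K (l i)\<close> is selfadjoint with range in \<open>F\<close>.\<close>
  define KQ where "KQ s = ?Q o\<^sub>L K s o\<^sub>L ?Q" for s
  have KQo: "KQ s \<in> ops H" and KQa: "adj (KQ s) (KQ s)" and KQc: "commutes symm (KQ s)"
    and KQF: "KQ s u \<in> F" if s: "s \<in> {0..1}" for s u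
  proof -
    show F': "KQ s u \<in> F" for u by (simp add: KQ_def proj_in[OF F(1) Fc])
    have "?Q (proj H u) = proj H (?Q u)" for u using commD[OF commutes_proj_H[OF Qc], of u] by simp
    then have "?Q (proj H u) = ?Q u" for u using proj_ident[OF HS] F(3) proj_in[OF F(1) Fc] by (metis subsetD)
    then show "KQ s \<in> ops H" using F' F(3) by (intro opsI[OF HS]) (auto simp: KQ_def)
    have "adj (KQ s) (?Q o\<^sub>L (K s o\<^sub>L ?Q))" unfolding KQ_def by (intro adj_intros Ka[OF s] is_projD(1)[OF Q])
    moreover have "?Q o\<^sub>L (K s o\<^sub>L ?Q) = KQ s" unfolding KQ_def by (rule blinfun_eqI) simp
    ultimately show "adj (KQ s) (KQ s)" by simp
    show "commutes symm (KQ s)" unfolding KQ_def by (intro commutes_intros Qc Kc[OF s])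
  qed
  have KQ_eq: "KQ (l i) = K (l i)" if i: "i \<le> N" for i
  proof -
    have s: "l i \<in> {0..1}" by (rule l01[OF i])
    have QK: "?Q o\<^sub>L K (l i) = K (l i)" by (rule blinfun_eqI) (simp add: proj_ident[OF F(1) Fc KF[OF i]])
    moreover have "adj (?Q o\<^sub>L K (l i)) (K (l i) o\<^sub>L ?Q)" by (intro adj_intros Ka[OF s] is_projD(1)[OF Q])
    ultimately have "K (l i) o\<^sub>L ?Q = K (l i)" using Ka[OF s] adj_unique by metis
    then show ?thesis unfolding KQ_def QK .
  qed
  have KQ01: "KQ 0 = K 0" "KQ 1 = K 1" using KQ_eq[of 0] KQ_eq[of N] sfl by auto
  have KQf: "finite_dim (range (blinfun_apply (KQ s)))" if "s \<in> {0..1}" for s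
    by (rule finite_dim_subset[OF F(2)]) (use KQF[OF that] in auto)
  have Kcont: "continuous_on {0..1} K" unfolding K_def by (intro continuous_intros Tc)
  have KQcont: "continuous_on {0..1} KQ"
    unfolding KQ_def by (intro continuous_on_blinfun_compose continuous_on_const Kcont)
  \<comment> \<open>A linear deformation of \<open>K\<close> to its compression: the perturbation of
    \<open>J\<close> keeps finite rank, so the operators stay Fredholm, and both ends of the path
    remain fixed.\<close>
  define h where "h p = J + ((1 - fst p) *\<^sub>R K (snd p) + fst p *\<^sub>R KQ (snd p))" for p :: "real \<times> real"
  have "\<mu> H \<rho> (\<lambda>s\<in>{0..1}. h (0, s)) = \<mu> H \<rho> (\<lambda>s\<in>{0..1}. h (1, s))"
  proof (rule Hom[OF HR])
    show "h \<in> {0..1} \<times> {0..1} \<rightarrow> FS_G G H \<rho>"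
    proof
      fix p :: "real \<times> real" assume "p \<in> {0..1} \<times> {0..1}"
      then have s: "snd p \<in> {0..1}" by auto
      let ?R = "(1 - fst p) *\<^sub>R K (snd p) + fst p *\<^sub>R KQ (snd p)"
      have "?R \<in> ops H"
        using opsD[OF HS Ko[OF s]] opsD[OF HS KQo[OF s]] HS(1)
        by (intro opsI[OF HS]) (auto simp: bl intro!: subspace_add subspace_scale)
      moreover have "adj ?R ?R" by (intro adj_intros Ka[OF s] KQa[OF s])
      moreover have "commutes symm ?R" by (intro commutes_intros Kc[OF s] KQc[OF s])
      moreover have "finite_dim (range (blinfun_apply ?R))"
      proof (rule finite_dim_subset[OF finite_dim_sum[OF Kf[OF s] KQf[OF s]]], rule subsetI)
        fix y assume "y \<in> range (blinfun_apply ?R)"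
        then obtain u where "y = K (snd p) ((1 - fst p) *\<^sub>R u) + KQ (snd p) (fst p *\<^sub>R u)" by (auto simp: bl)
        then show "y \<in> {v + w | v w. v \<in> range (blinfun_apply (K (snd p))) \<and> w \<in> range (blinfun_apply (KQ (snd p)))}" by blast
      qed
      ultimately show "h p \<in> FS_G G H \<rho>" unfolding h_def by (intro finite_rank_FS_G J)
    qed
    have c: "continuous_on ({0..1} \<times> {0..1}) (\<lambda>p. f (snd p))" if "continuous_on {0..1} f" for f :: "real \<Rightarrow> 'h \<Rightarrow>\<^sub>L 'h"
      by (intro continuous_on_compose2[OF that] continuous_intros) auto
    show "continuous_on ({0..1} \<times> {0..1}) h"
      unfolding h_def by (intro continuous_intros c Kcont KQcont)
    have "h (s, 0) = T 0" "h (s, 1) = T 1" for s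
      unfolding h_def by (simp_all add: KQ01 TK scaleR_left_distrib[symmetric])
    then show "\<forall>s\<in>{0..1}. h (s, 0) \<in> GL H \<and> h (s, 1) \<in> GL H" using TGL by simp
  qed
  then have "\<mu> H \<rho> L = \<mu> H \<rho> (\<lambda>s\<in>{0..1}. J + KQ s)"
    using mu1 by (simp add: h_def T_def[symmetric] TK[symmetric])
  also have "\<dots> = RO_diff G X \<rho> (E_neg F (J + KQ 0)) (E_neg F (J + KQ 1))"
    using TGL KQ01 TK by (intro mu_finite_rank[OF J F KQcont KQo KQa KQc KQF]) auto
  also have "\<dots> = RO_diff G X \<rho> (E_neg F (T (l 0))) (E_neg F (T (l N)))"
    using KQ01 TK sfl by simp
  finally have mu2: "\<mu> H \<rho> L = RO_diff G X \<rho> (E_neg F (T (l 0))) (E_neg F (T (l N)))" .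
  have "\<exists>R. matrix_form G X \<rho> (E_neg F (T (l i))) R" if i: "i \<le> N" for i
    using E_neg_subset[OF F(1,2) Td(2)[OF l01[OF i]] TF[OF i]]
      comm_proj_E_neg(1)[OF F(1-4) Td(2,3)[OF l01[OF i]] TF[OF i]] F(3)
    by (meson matrix_form_exists[OF action G top] order_trans)
  then obtain e where e: "\<And>i. i \<le> N \<Longrightarrow> matrix_form G X \<rho> (E_neg F (T (l i))) (e i)" by metis
  have "\<mu> H \<rho> L = class_diff G X (e 0) (e N)"
    unfolding mu2 by (rule RO_diff_eq[OF G top e e]) auto
  also have "\<dots> = (\<Oplus>\<^bsub>RO G X\<^esub>i\<in>{1..N}. class_diff G X (e (i - 1)) (e i))"
    by (rule class_diff_telescope[OF G top, symmetric]) (rule matrix_form_rep[OF e])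
  also have "\<dots> = (\<Oplus>\<^bsub>RO G X\<^esub>i\<in>{1..N}. RO_diff G X \<rho> (spectral_space H (L (l i)) 0 (a i))
                                        (spectral_space H (L (l (i - 1))) 0 (a i)))"
  proof (rule abelian_monoid.finsum_cong'[OF abelian_monoid_RO[OF G top] refl])
    have step: "class_diff G X (e (i - 1)) (e i) = RO_diff G X \<rho> (spectral_space H (L (l i)) 0 (a i))
        (spectral_space H (L (l (i - 1))) 0 (a i))" if i: "i \<in> {1..N}" for i
    proof (rule piece_class[of "l (i - 1)" "l i" L "a i" V V' F])
      have iN: "i - 1 \<le> N" "i \<le> N" using i by auto
      show "l (i - 1) \<le> l i" using li[OF i] by simp
      show "L s \<in> FS_G G H \<rho>" if "s \<in> {l (i - 1)..l i}" for s using LFS piece[OF i that] by simp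
      show "transporter symm (V (l (i - 1))) (V' (l (i - 1)))" "transporter symm (V (l i)) (V' (l i))"
        using V(4) l01[OF iN(1)] l01[OF iN(2)] by auto
      show "V' (l i) o\<^sub>L (L (l i) + (2 * a i) *\<^sub>R spectral_proj H (- a i) (a i) (L (l i))) o\<^sub>L V (l i) =
        V' (l (i - 1)) o\<^sub>L (L (l (i - 1)) + (2 * a i) *\<^sub>R spectral_proj H (- a i) (a i) (L (l (i - 1)))) o\<^sub>L V (l (i - 1))"
        by (rule V(5)[OF i li(2)[OF i]])
      show "(V' (l (i - 1)) o\<^sub>L (L (l (i - 1)) + (2 * a i) *\<^sub>R spectral_proj H (- a i) (a i) (L (l (i - 1)))) o\<^sub>L V (l (i - 1))) u \<in> F"
        if u: "u \<in> F" for u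
      proof -
        have "(V' (l (i - 1)) o\<^sub>L (L (l (i - 1)) + (2 * a i) *\<^sub>R spectral_proj H (- a i) (a i) (L (l (i - 1)))) o\<^sub>L V (l (i - 1))) u
          = T (l (i - 1)) u + (2 * a i) *\<^sub>R P i (l (i - 1)) u" by (simp add: T_def P_def bl)
        then show ?thesis using TF[OF iN(1) u] PF(1)[OF i] F(1) by (simp add: subspace_add subspace_scale)
      qed
      show "(V' (l (i - 1)) o\<^sub>L spectral_proj H (- a i) (a i) (L (l (i - 1))) o\<^sub>L V (l (i - 1))) u \<in> F" for u
        using PF(1)[OF i] unfolding P_def .
      show "(V' (l i) o\<^sub>L spectral_proj H (- a i) (a i) (L (l i)) o\<^sub>L V (l i)) u \<in> F" for u
        using PF(2)[OF i] unfolding P_def .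
      show "matrix_form G X \<rho> (E_neg F (V' (l (i - 1)) o\<^sub>L L (l (i - 1)) o\<^sub>L V (l (i - 1)))) (e (i - 1))"
        using e[OF iN(1)] unfolding T_def .
      show "matrix_form G X \<rho> (E_neg F (V' (l i) o\<^sub>L L (l i) o\<^sub>L V (l i))) (e i)"
        using e[OF iN(2)] unfolding T_def .
    qed (use pa[OF i] F in auto)
    show "class_diff G X (e (i - 1)) (e i) = RO_diff G X \<rho> (spectral_space H (L (l i)) 0 (a i))
        (spectral_space H (L (l (i - 1))) 0 (a i))" if "i \<in> {1..N}" for i
      by (rule step[OF that])
    show "(\<lambda>i. RO_diff G X \<rho> (spectral_space H (L (l i)) 0 (a i)) (spectral_space H (L (l (i - 1))) 0 (a i)))
        \<in> {1..N} \<rightarrow> carrier (RO G X)"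
    proof
      fix i assume i: "i \<in> {1..N}"
      then have "i - 1 \<le> N" "i \<le> N" by auto
      then show "RO_diff G X \<rho> (spectral_space H (L (l i)) 0 (a i)) (spectral_space H (L (l (i - 1))) 0 (a i)) \<in> carrier (RO G X)"
        unfolding step[OF i, symmetric] by (intro class_diff_in[OF G top] matrix_form_rep[OF e])
    qed
  qed
  finally show ?thesis .
qed

text \<open>\<open>sf_data_exists\<close> supplies one admissible choice and
  \<open>mu_eq_sum\<close> gives the same value for every choice, which is what the definite
  description in \<open>sf\<close> asks for.\<close>

lemma mu_eq_sf:
  assumes L: "L \<in> \<Omega> (FS_G G H \<rho>) (GL H \<inter> FS_G G H \<rho>)"
  shows "\<mu> H \<rho> L = sf G X H \<rho> L"
proof -
  have "L s \<in> FS H" if "s \<in> {0..1}" for s using L that by (auto simp: \<Omega>_def FS_G_def)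
  moreover have "continuous_on {0..1} L" using L by (simp add: \<Omega>_def)
  ultimately obtain N l a where sf: "sf_data H L N l a" using sf_data_exists[OF HH] by metis
  show ?thesis
    unfolding sf_def
  proof (rule the_equality[symmetric])
    show "\<exists>N l a. sf_data H L N l a \<and> \<mu> H \<rho> L =
        (\<Oplus>\<^bsub>RO G X\<^esub>i\<in>{1..N}. RO_diff G X \<rho> (spectral_space H (L (l i)) 0 (a i))
                                        (spectral_space H (L (l (i - 1))) 0 (a i)))"
      by (intro exI conjI) (rule sf, rule mu_eq_sum[OF L sf])
  next
    fix x assume "\<exists>N l a. sf_data H L N l a \<and> x =
        (\<Oplus>\<^bsub>RO G X\<^esub>i\<in>{1..N}. RO_diff G X \<rho> (spectral_space H (L (l i)) 0 (a i))
                                        (spectral_space H (L (l (i - 1))) 0 (a i)))"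
    then show "x = \<mu> H \<rho> L" by (elim exE conjE) (simp only: mu_eq_sum[OF L])
  qed
qed

end

end

theorem theorem2p1:
  fixes G :: "('g, 'm) monoid_scheme"
    and X :: "'g topology"
    and n :: nat
    and \<A> :: "'g chart set"
    and \<mu> :: "'h::{real_inner, complete_space} set \<Rightarrow> ('g \<Rightarrow> 'h \<Rightarrow>\<^sub>L 'h) \<Rightarrow>
      (real \<Rightarrow> 'h \<Rightarrow>\<^sub>L 'h) \<Rightarrow> ('g rep \<times> 'g rep) set"
  assumes G: "compact_Lie_group G X n \<A>"
    and maps: "\<And>H \<rho>. hilbert_rep G X H \<rho> \<Longrightarrow>
      \<mu> H \<rho> \<in> \<Omega> (FS_G G H \<rho>) (GL H \<inter> FS_G G H \<rho>) \<rightarrow> carrier (RO G X)"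
    and Z: "\<And>H \<rho> L. hilbert_rep G X H \<rho> \<Longrightarrow>
      L \<in> \<Omega> (FS_G G H \<rho>) (GL H \<inter> FS_G G H \<rho>) \<Longrightarrow>
      (\<forall>l\<in>{0..1}. L l \<in> GL H \<inter> FS_G G H \<rho>) \<Longrightarrow>
      \<mu> H \<rho> L = \<zero>\<^bsub>RO G X\<^esub>"
    and A: "\<And>H \<rho> H\<^sub>1 H\<^sub>2 L. hilbert_rep G X H \<rho> \<Longrightarrow>
      subspace H\<^sub>1 \<Longrightarrow> closed H\<^sub>1 \<Longrightarrow> subspace H\<^sub>2 \<Longrightarrow> closed H\<^sub>2 \<Longrightarrow>
      (\<forall>u\<in>H\<^sub>1. \<forall>v\<in>H\<^sub>2. u \<bullet> v = 0) \<Longrightarrow> H = {u + v | u v. u \<in> H\<^sub>1 \<and> v \<in> H\<^sub>2} \<Longrightarrow>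
      invariant G \<rho> H\<^sub>1 \<Longrightarrow> invariant G \<rho> H\<^sub>2 \<Longrightarrow>
      L \<in> \<Omega> (FS_G G H \<rho>) (GL H \<inter> FS_G G H \<rho>) \<Longrightarrow>
      (\<forall>l\<in>{0..1}. blinfun_apply (L l) ` H\<^sub>1 \<subseteq> H\<^sub>1 \<and> blinfun_apply (L l) ` H\<^sub>2 \<subseteq> H\<^sub>2) \<Longrightarrow>
      \<mu> H \<rho> L = \<mu> H\<^sub>1 (restr_action G H\<^sub>1 \<rho>) (restr_path H\<^sub>1 L)
                 \<oplus>\<^bsub>RO G X\<^esub> \<mu> H\<^sub>2 (restr_action G H\<^sub>2 \<rho>) (restr_path H\<^sub>2 L)"
    and H: "\<And>H \<rho> (h :: real \<times> real \<Rightarrow> 'h \<Rightarrow>\<^sub>L 'h). hilbert_rep G X H \<rho> \<Longrightarrow>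
      h \<in> {0..1} \<times> {0..1} \<rightarrow> FS_G G H \<rho> \<Longrightarrow> continuous_on ({0..1} \<times> {0..1}) h \<Longrightarrow>
      (\<forall>s\<in>{0..1}. h (s, 0) \<in> GL H \<and> h (s, 1) \<in> GL H) \<Longrightarrow>
      \<mu> H \<rho> (\<lambda>l\<in>{0..1}. h (0, l)) = \<mu> H \<rho> (\<lambda>l\<in>{0..1}. h (1, l))"
    and M: "\<And>H \<rho> L. hilbert_rep G X H \<rho> \<Longrightarrow> finite_dim H \<Longrightarrow>
      L \<in> \<Omega> (FS_G G H \<rho>) (GL H \<inter> FS_G G H \<rho>) \<Longrightarrow>
      \<mu> H \<rho> L = RO_diff G X \<rho> (E_neg H (L 0)) (E_neg H (L 1))"
  shows "\<forall>H \<rho>. hilbert_rep G X H \<rho> \<longrightarrow>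
    (\<forall>L \<in> \<Omega> (FS_G G H \<rho>) (GL H \<inter> FS_G G H \<rho>). \<mu> H \<rho> L = sf G X H \<rho> L)"
proof (intro allI impI ballI)
  fix H :: "'h set" and \<rho> :: "'g \<Rightarrow> 'h \<Rightarrow>\<^sub>L 'h" and L :: "real \<Rightarrow> 'h \<Rightarrow>\<^sub>L 'h"
  assume "hilbert_rep G X H \<rho>" "L \<in> \<Omega> (FS_G G H \<rho>) (GL H \<inter> FS_G G H \<rho>)"
  moreover have "group G" "topspace X = carrier G"
    using G by (auto simp: compact_Lie_group_def Lie_group_def)
  ultimately show "\<mu> H \<rho> L = sf G X H \<rho> L" by (intro mu_eq_sf Z A H M)
qed

end
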